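(* Let $p$ and the IID matrices $X=X^{(N)}$ satisfy the noise assumptions listed in the context. Define $$F := \int_{-\infty}^{\infty} \frac{(p'(x))^2}{p(x)}\,dx,\qquad G := \int_{-\infty}^{\infty} \frac{(p''(x))^2}{p(x)}\,dx ,$$ let $\omega>0$ be a fixed constant with $2\omega F<1$, and let $$\rho^*:=-\frac14\left(\log(1-2\omega F)+\frac{\omega^2}{2}(2F^2-G)\right).$$ Then the error probability of the likelihood ratio test (which rejects $\boldsymbol H_0$ if and only if $\mathcal L(Y;\omega)>1$), $$\mathrm{err}(\omega):=\mathbb P(\text{reject }\boldsymbol H_0\mid\boldsymbol H_0)+\mathbb P(\text{do not reject }\boldsymbol H_0\mid\boldsymbol H_1),$$ converges, as $N\to\infty$, to $$\mathrm{erfc}\left(\frac{\sqrt{\rho^*}}{2}\right)=\frac{2}{\sqrt\pi}\int_{\sqrt{\rho^*}/2}^{\infty}e^{-x^2}\,dx .$$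
   Context: Noise. $X=(X_{ij})$ is an $N\times N$ real random matrix (an IID matrix, with no symmetry constraint) whose entries $X_{ij}$, $1\le i,j\le N$, are independent and identically distributed centered real random variables with $N\,\mathbb E[X_{ij}^2]=1$ and such that for every $D>0$ there is a constant $C_D$ independent of $N$ with $N^{D/2}\,\mathbb E[|X_{ij}|^D]\le C_D$. The normalized entries $\sqrt N X_{ij}$ have density $p$, where $p$ does not depend on $N$ and satisfies: (1) $p$ is smooth, positive everywhere, and symmetric about $0$; (2) $p$ and all its derivatives vanish at infinity; (3) for every positive integer $s$ there are constants $C_s,r_s>0$, independent of $N$, with $|p^{(s)}(x)/p(x)|\le C_s(1+|x|^{r_s})$ for all $x\in\mathbb R$, where $p^{(s)}$ is the $s$-th derivative. Spike and hypotheses. $\boldsymbol x=(x_1,\dots,x_N)$ is a random vector, independent of $X$, with $\sqrt N x_i$ i.i.d. Rademacher ($\pm1$ with probability $1/2$ each). The data matrix is $Y=X+\sqrt\lambda\,\boldsymbol x\boldsymbol x^T$; $\boldsymbol H_0:\lambda=0$ and $\boldsymbol H_1:\lambda=\omega>0$. $\mathbb P(\cdot\mid\boldsymbol H_i)$ denotes probability when $Y$ is generated under $\boldsymbol H_i$. Likelihood ratio (of the law of $Y$ under $\boldsymbol H_1$ with respect to its law under $\boldsymbol H_0$): $$\mathcal L(Y;\omega):=\frac1{2^N}\sum_{\boldsymbol x\in\{\pm1/\sqrt N\}^N}\ \prod_{i,j=1}^N\frac{p(\sqrt N Y_{ij}-\sqrt{\omega N}\,x_ix_j)}{p(\sqrt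 N Y_{ij})}.$$ *)

theory Defs
  imports "HOL-Probability.Probability"
begin

text \<open>The \<open>n\<close>-th derivative of
  \<open>p\<close> is \<open>(deriv ^^ n) p\<close>; as \<open>deriv\<close> is total, smoothness is stated as differentiability of
  every iterate.  On the real line \<open>at_infinity\<close> covers both ends.\<close>

definition admissible_density :: "(real \<Rightarrow> real) \<Rightarrow> bool" where
  "admissible_density p \<longleftrightarrow>
     (\<forall>n x. (deriv ^^ n) p field_differentiable at x) \<and>
     (\<forall>x. p x > 0) \<and>
     (\<forall>x. p (- x) = p x) \<and>
     (\<forall>n. ((deriv ^^ n) p \<longlongrightarrow> 0) at_infinity) \<and>
     (\<forall>s\<ge>1. \<exists>C>0. \<exists>r>0. \<forall>x. \<bar>(deriv ^^ s) p x / p x\<bar> \<le> C * (1 + \<bar>x\<bar> powr r))"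

text \<open>\<open>X N i j\<close> is the entry \<open>(i, j)\<close> of the \<open>N \<times> N\<close> matrix, a random variable on the probability
  space \<open>M N\<close>.  That the entries are identically distributed is contained in the requirement that
  all normalized entries have the same density \<open>p\<close>, which does not depend on \<open>N\<close>.  The moment
  constant \<open>C\<close> depends on \<open>D\<close> only; \<open>integrable\<close> is needed there because the integral of a
  non-integrable function is 0.\<close>

definition iid_matrices ::
  "(real \<Rightarrow> real) \<Rightarrow> (nat \<Rightarrow> 'a measure) \<Rightarrow> (nat \<Rightarrow> nat \<Rightarrow> nat \<Rightarrow> 'a \<Rightarrow> real) \<Rightarrow> bool" where
  "iid_matrices p M X \<longleftrightarrow>
     (\<forall>N\<ge>1.
        prob_space (M N) \<and>
        prob_space.indep_vars (M N) (\<lambda>_. borel) (\<lambda>(i, j). X N i j) ({1..N} \<times> {1..N}) \<and>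
        (\<forall>i\<in>{1..N}. \<forall>j\<in>{1..N}.
           distributed (M N) lborel (\<lambda>w. sqrt (real N) * X N i j w) (\<lambda>t. ennreal (p t)) \<and>
           integrable (M N) (X N i j) \<and>
           prob_space.expectation (M N) (X N i j) = 0 \<and>
           integrable (M N) (\<lambda>w. (X N i j w)\<^sup>2) \<and>
           real N * prob_space.expectation (M N) (\<lambda>w. (X N i j w)\<^sup>2) = 1)) \<and>
     (\<forall>D>0. \<exists>C. \<forall>N\<ge>1. \<forall>i\<in>{1..N}. \<forall>j\<in>{1..N}.
        integrable (M N) (\<lambda>w. \<bar>X N i j w\<bar> powr D) \<and>
        real N powr (D / 2) * prob_space.expectation (M N) (\<lambda>w. \<bar>X N i j w\<bar> powr D) \<le> C)"

definition rademacher_spikes ::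
  "(nat \<Rightarrow> 'a measure) \<Rightarrow> (nat \<Rightarrow> nat \<Rightarrow> 'a \<Rightarrow> real) \<Rightarrow> bool" where
  "rademacher_spikes M x \<longleftrightarrow>
     (\<forall>N\<ge>1.
        prob_space.indep_vars (M N) (\<lambda>_. borel) (x N) {1..N} \<and>
        (\<forall>i\<in>{1..N}.
           prob_space.prob (M N) {w \<in> space (M N). sqrt (real N) * x N i w = 1} = 1 / 2 \<and>
           prob_space.prob (M N) {w \<in> space (M N). sqrt (real N) * x N i w = - 1} = 1 / 2))"

text \<open>\<open>indep_var\<close> requires both random elements to have the same value type, so independence of the
  whole matrix and the whole vector is stated through the \<open>\<sigma>\<close>-algebras they generate.\<close>

definition spike_indep_noise ::
  "(nat \<Rightarrow> 'a measure) \<Rightarrow> (nat \<Rightarrow> nat \<Rightarrow> nat \<Rightarrow> 'a \<Rightarrow> real) \<Rightarrow> (nat \<Rightarrow> nat \<Rightarrow> 'a \<Rightarrow> real) \<Rightarrow> bool" where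
  "spike_indep_noise M X x \<longleftrightarrow>
     (\<forall>N\<ge>1. prob_space.indep_set (M N)
        (sets (vimage_algebra (space (M N))
           (\<lambda>w. \<lambda>(i, j)\<in>{1..N} \<times> {1..N}. X N i j w) (PiM ({1..N} \<times> {1..N}) (\<lambda>_. borel))))
        (sets (vimage_algebra (space (M N))
           (\<lambda>w. \<lambda>i\<in>{1..N}. x N i w) (PiM {1..N} (\<lambda>_. borel)))))"

definition data_matrix ::
  "real \<Rightarrow> (nat \<Rightarrow> nat \<Rightarrow> real) \<Rightarrow> (nat \<Rightarrow> real) \<Rightarrow> nat \<Rightarrow> nat \<Rightarrow> real" where
  "data_matrix l X x i j = X i j + sqrt l * (x i * x j)"

definition likelihood_ratio ::
  "(real \<Rightarrow> real) \<Rightarrow> nat \<Rightarrow> real \<Rightarrow> (nat \<Rightarrow> nat \<Rightarrow> real) \<Rightarrow> real" where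
  "likelihood_ratio p N \<omega> Y =
     1 / 2 ^ N * (\<Sum>x \<in> {1..N} \<rightarrow>\<^sub>E {1 / sqrt (real N), - 1 / sqrt (real N)}.
       \<Prod>i\<in>{1..N}. \<Prod>j\<in>{1..N}.
         p (sqrt (real N) * Y i j - sqrt (\<omega> * real N) * x i * x j) / p (sqrt (real N) * Y i j))"

text \<open>The law of the data under \<open>H\<^sub>0\<close> (resp. \<open>H\<^sub>1\<close>) is that of \<open>data_matrix 0\<close>
  (resp. \<open>data_matrix \<omega>\<close>) evaluated at the random noise and spike.\<close>

definition lr_test_error ::
  "(real \<Rightarrow> real) \<Rightarrow> (nat \<Rightarrow> 'a measure) \<Rightarrow> (nat \<Rightarrow> nat \<Rightarrow> nat \<Rightarrow> 'a \<Rightarrow> real) \<Rightarrow>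
   (nat \<Rightarrow> nat \<Rightarrow> 'a \<Rightarrow> real) \<Rightarrow> real \<Rightarrow> nat \<Rightarrow> real" where
  "lr_test_error p M X x \<omega> N =
     (let Y = (\<lambda>l w. data_matrix l (\<lambda>i j. X N i j w) (\<lambda>i. x N i w)) in
      prob_space.prob (M N) {w \<in> space (M N). likelihood_ratio p N \<omega> (Y 0 w) > 1} +
      prob_space.prob (M N) {w \<in> space (M N). \<not> likelihood_ratio p N \<omega> (Y \<omega> w) > 1})"

definition erfc :: "real \<Rightarrow> real" where
  "erfc z = 2 / sqrt pi * (LBINT t:{z..}. exp (- t\<^sup>2))"

end

theory Submission
 imports Defs
begin

text \<open>Write \<open>L\<close> for the likelihood ratio. Since \<open>L\<close> is the density of the data law under the alternative
with respect to the law under the null, the sum of the two error probabilities is the null expectation of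
\<open>min 1 L\<close> (lemma \<open>lr_test_error_eq\<close>). The map \<open>min 1\<close> is bounded and Lipschitz, so the limit only
needs \<open>L\<close> up to errors that are small in mean. The claim is that \<open>L\<close> converges in law to
\<open>exp (sqrt v * g - v / 2)\<close> with \<open>g\<close> standard normal and \<open>v = 2 * rho\<close>; the expectation of the minimum of 1 and
that log-normal variable is the error function value of the theorem (\<open>expectation_min_lognormal\<close>).

A single factor of \<open>L\<close> splits into a part that is even and a part that is odd in the sign of the spike product.
After truncating the entries at a small power of \<open>N\<close> both parts are uniformly close to 1 and 0. Grouping the
entries \<open>(i, j)\<close> and \<open>(j, i)\<close> makes \<open>L\<close> the average over spin vectors \<open>s\<close> of a product over the edges and loops of the
complete graph of factors \<open>1 + \<zeta> + s i * s j * \<beta>\<close>, in which the variables of distinct edges are independent.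
Expanding in \<open>\<beta>\<close>, only closed subgraphs survive the average over spins. To leading order they are disjoint unions of
cycles, which suggests that \<open>ln L\<close> is close to a constant plus
\<open>S\<close>, the sum of all \<open>\<zeta>\<close> and of the products of \<open>\<beta>\<close> along the cycles of length at least 3.

This is made rigorous by a second moment comparison instead of an expansion of the logarithm. Let \<open>S\<close> contain
the cycles up to length \<open>l\<close> and let \<open>v_l\<close> be its limiting variance. Under the null \<open>S\<close> tends to the normal law
with mean 0 and variance \<open>v_l\<close>; under the null tilted by \<open>L\<close> it tends to the one with mean and variance \<open>v_l\<close>
(\<open>char_close\<close>, \<open>LR_char_close\<close>). For \<open>Q = exp (S - v_l / 2)\<close>, suitably capped, this gives the limits of the
expectations of \<open>L * Q\<close> and of \<open>Q^2\<close>, both equal to \<open>exp v_l\<close> when the cap is removed. The second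
moment of \<open>L\<close> is computed directly: it is an average over pairs of spins of \<open>exp (b * (overlap)^2 / 2)\<close>, bounded by a Gaussian linearization, with limit at
most \<open>exp v\<close> (\<open>LR_second_moment\<close>). Hence the mean of \<open>(L - Q)^2\<close> is asymptotically at most \<open>exp v - exp v_l\<close>, which vanishes as \<open>l\<close> grows
because \<open>v_l\<close> sums the logarithmic series inside \<open>v\<close>.

The normal limits are proved by a Stein type differential equation. The derivative of the characteristic function
of \<open>S\<close> is the expectation of \<open>S * exp (i * th * S)\<close>; expanding each summand in one edge variable, of which \<open>S\<close> is an
affine function with slope a sum of simple paths joining the ends of the edge, produces
\<open>v * (kappa + i * th)\<close> times the characteristic function, with \<open>kappa\<close> equal to 0 under the null and to 1 under the
tilted law. The errors are moments of path sums; each is bounded by a sum over tuples of paths of \<open>q\<close> to the number of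
distinct edges, where \<open>q\<close> is of order \<open>1 / N\<close> (\<open>expect_paths\<close>).\<close>

section \<open>Weighted walks, simple paths and cycles\<close>

fun steps :: "'v list => 'v set list" where
 "steps (x # y # zs) = {x, y} # steps (y # zs)"
| "steps _ = []"

definition walks :: "'v set => nat => 'v list set" where
 "walks V k = {v. set v \<subseteq> V \<and> length v = k}"

text \<open>The factor that a new walk contributes when the expectation of a product of paths is bounded by \<open>q\<close> to
the number of distinct edges: an edge in \<open>F\<close>, the set of edges used before, costs nothing.\<close>
definition wt :: "real => 'v set set => 'v list => real" where
 "wt q F v = prod_list (map (%e. if e \<in> F then 1 else q) (steps v))"

lemma finite_walks: "finite V ==> finite (walks V k)"
 unfolding walks_def by (rule finite_lists_length_eq)

lemma sum_walks_Suc: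
 "(\<Sum>v\<in>walks V (Suc k). f v) = (\<Sum>u\<in>V. \<Sum>v\<in>walks V k. f (u # v))"
proof -
 have "walks V (Suc k) = (%(u, v). u # v) ` (V \<times> walks V k)"
  by (force simp: walks_def length_Suc_conv)
 then have "(\<Sum>v\<in>walks V (Suc k). f v) = (\<Sum>(u, v)\<in>V \<times> walks V k. f (u # v))"
  by (simp add: sum.reindex inj_on_def case_prod_unfold)
 then show ?thesis by (simp add: sum.cartesian_product)
qed

lemma walks_0 [simp]: "walks V 0 = {[]}"
 by (auto simp: walks_def)

lemma steps_edge: "e \<in> set (steps v) ==> e \<subseteq> set v"
 by (induction v rule: steps.induct) auto

lemma steps_append: "v \<noteq> [] ==> w \<noteq> [] ==> steps (v @ w) = steps v @ {last v, hd w} # steps w"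
 by (induction v rule: steps.induct) (auto simp: neq_Nil_conv)

lemma steps_card: "distinct v ==> e \<in> set (steps v) ==> card e = 2"
 by (induction v rule: steps.induct) auto

lemma length_steps: "length (steps v) = length v - 1"
 by (induction v rule: steps.induct) auto

lemma distinct_steps: "distinct v ==> distinct (steps v)"
proof (induction v rule: steps.induct)
 case (1 x y zs)
 then show ?case using steps_edge[of "{x, y}" "y # zs"] by auto
qed auto

lemma wt_eq_power:
 assumes "distinct v"
 shows "wt q F v = q ^ card (set (steps v) - F)"
proof -
 have "wt q F v = (\<Prod>e\<in>set (steps v). if e \<in> F then 1 else q)"
  unfolding wt_def by (simp add: prod.distinct_set_conv_list distinct_steps[OF assms])
 also have "... = (\<Prod>e\<in>set (steps v) - F. q)"
  by (rule prod.mono_neutral_cong_right) auto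
 finally show ?thesis by simp
qed

lemma wt_Cons_Cons: "wt q F (u # w # v) = (if {u, w} \<in> F then 1 else q) * wt q F (w # v)"
 by (simp add: wt_def)

lemma wt_single [simp]: "wt q F [u] = 1" "wt q F [] = 1"
 by (simp_all add: wt_def)

lemma wt_nonneg: "0 <= q ==> 0 <= wt q F v"
 unfolding wt_def by (rule prod_list_nonneg) auto

lemma card_neighbours:
 assumes "finite F" "finite V"
 shows "card {w \<in> V. {u, w} \<in> F} <= card F"
proof (rule card_inj_on_le[of "%w. {u, w}"])
 show "inj_on (%w. {u, w}) {w \<in> V. {u, w} \<in> F}"
  by (auto simp: inj_on_def doubleton_eq_iff)
qed (use assms in auto)

lemma card_ordered_edges:
 assumes "finite F" "finite V"
 shows "(\<Sum>u\<in>V. card {w \<in> V. {u, w} \<in> F}) <= 2 * card F"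
proof -
 define E where "E = {e \<in> F. finite e \<and> card e <= 2}"
 have fE: "finite E" using assms by (simp add: E_def)
 have "card {w \<in> V. {u, w} \<in> F} <= card {e \<in> E. u \<in> e}" for u
 proof (rule card_inj_on_le[of "%w. {u, w}"])
  show "inj_on (%w. {u, w}) {w \<in> V. {u, w} \<in> F}"
   by (auto simp: inj_on_def doubleton_eq_iff)
  show "(%w. {u, w}) ` {w \<in> V. {u, w} \<in> F} \<subseteq> {e \<in> E. u \<in> e}"
   by (auto simp: E_def card_insert_if)
 qed (use fE in simp)
 then have "(\<Sum>u\<in>V. card {w \<in> V. {u, w} \<in> F}) <= (\<Sum>u\<in>V. card {e \<in> E. u \<in> e})"
  by (rule sum_mono)
 also have "... = (\<Sum>u\<in>V. \<Sum>e\<in>E. if u \<in> e then 1 else 0)"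
  using fE by (simp add: sum.If_cases Int_def)
 also have "... = (\<Sum>e\<in>E. \<Sum>u\<in>V. if u \<in> e then 1 else 0)"
  by (rule sum.swap)
 also have "... <= (\<Sum>e\<in>E. 2)"
 proof (rule sum_mono)
  fix e assume "e \<in> E"
  then have "card {u \<in> V. u \<in> e} <= 2"
   using card_mono[of e "{u \<in> V. u \<in> e}"] unfolding E_def by fastforce
  then show "(\<Sum>u\<in>V. if u \<in> e then 1 else 0) <= (2::nat)"
   using assms by (simp add: sum.If_cases Int_def)
 qed
 also have "... = 2 * card E" by simp
 also have "... <= 2 * card F"
  using assms by (auto simp: E_def intro!: card_mono)
 finally show ?thesis .
qed

locale walk_weights =
 fixes V :: "'v set" and F :: "'v set set" and q :: real
 assumes fin: "finite V" "finite F" and q: "0 <= q" and qV: "real (card V) * q <= 2"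
begin

abbreviation "w \<equiv> real (card F) + 2"

lemma w_ge: "w >= 1" "w >= 0" by auto

lemma row_sum: "(\<Sum>x\<in>V. if {u, x} \<in> F then 1 else q) <= w"
proof -
 have "(\<Sum>x\<in>V. if {u, x} \<in> F then 1 else q) <= (\<Sum>x\<in>V. (if {u, x} \<in> F then 1 else 0) + q)"
  using q by (intro sum_mono) auto
 also have "... = real (card {x \<in> V. {u, x} \<in> F}) + card V * q"
  by (simp add: sum.distrib fin sum.If_cases Int_def)
 also have "... <= w"
  using card_neighbours[OF fin(2,1), of u] qV by linarith
 finally show ?thesis .
qed

lemma col_sum: "(\<Sum>x\<in>V. if {x, u} \<in> F then 1 else q) <= w"
 using row_sum[of u] by (simp add: insert_commute)

lemma sum_wt_from: "(\<Sum>v\<in>walks V k. wt q F (u # v)) <= w ^ k"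
proof (induction k arbitrary: u)
 case (Suc k)
 have "(\<Sum>v\<in>walks V (Suc k). wt q F (u # v)) =
    (\<Sum>x\<in>V. (if {u, x} \<in> F then 1 else q) * (\<Sum>v\<in>walks V k. wt q F (x # v)))"
  by (simp add: sum_walks_Suc wt_Cons_Cons sum_distrib_left)
 also have "... <= (\<Sum>x\<in>V. (if {u, x} \<in> F then 1 else q) * w ^ k)"
  using Suc q by (intro sum_mono mult_left_mono) auto
 also have "... = (\<Sum>x\<in>V. if {u, x} \<in> F then 1 else q) * w ^ k"
  by (simp add: sum_distrib_right)
 also have "... <= w * w ^ k"
  by (intro mult_right_mono row_sum) auto
 finally show ?case by simp
qed simp

lemma sum_wt_all: "(\<Sum>v\<in>walks V (Suc k). wt q F v) <= card V * w ^ k"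
proof -
 have "(\<Sum>v\<in>walks V (Suc k). wt q F v) <= (\<Sum>u\<in>V. w ^ k)"
  unfolding sum_walks_Suc by (intro sum_mono sum_wt_from)
 then show ?thesis by simp
qed

text \<open>Prescribing both ends of a walk removes one sum over vertices, so that compared with \<open>sum_wt_all\<close> no factor of the order of the
number of vertices is lost.\<close>
lemma sum_wt_to: "(\<Sum>u\<in>V. \<Sum>v | v \<in> walks V k \<and> last (u # v) = x. wt q F (u # v)) <= w ^ k"
proof (induction k)
 case 0
 have "(\<Sum>v | v \<in> walks V 0 \<and> last (u # v) = x. wt q F (u # v)) = (if u = x then 1 else 0)" for u
  by (auto simp: sum.If_cases intro!: sum.neutral)
 then show ?case using fin by (auto simp: sum.delta)
next
 case (Suc k)
 let ?T = "%y. \<Sum>v | v \<in> walks V k \<and> last (y # v) = x. wt q F (y # v)"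
 have eq: "(\<Sum>v | v \<in> walks V (Suc k) \<and> last (u # v) = x. wt q F (u # v)) =
   (\<Sum>y\<in>V. (if {u, y} \<in> F then 1 else q) * ?T y)" for u
 proof -
  have "(\<Sum>v | v \<in> walks V (Suc k) \<and> last (u # v) = x. wt q F (u # v)) =
   (\<Sum>v\<in>walks V (Suc k). if last (u # v) = x then wt q F (u # v) else 0)"
   by (rule sum.mono_neutral_cong_left) (auto simp: fin finite_walks)
  also have "... = (\<Sum>y\<in>V. \<Sum>v\<in>walks V k. if last (y # v) = x then wt q F (u # y # v) else 0)"
   by (simp add: sum_walks_Suc)
  also have "... = (\<Sum>y\<in>V. \<Sum>v | v \<in> walks V k \<and> last (y # v) = x. wt q F (u # y # v))"
   by (rule sum.cong[OF refl], rule sum.mono_neutral_cong_right) (auto simp: fin finite_walks)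
  finally show ?thesis by (simp add: wt_Cons_Cons sum_distrib_left)
 qed
 have Tn: "0 <= ?T y" for y by (intro sum_nonneg wt_nonneg q)
 have "(\<Sum>u\<in>V. \<Sum>v | v \<in> walks V (Suc k) \<and> last (u # v) = x. wt q F (u # v)) =
   (\<Sum>y\<in>V. (\<Sum>u\<in>V. if {u, y} \<in> F then 1 else q) * ?T y)"
  unfolding eq by (subst sum.swap) (simp add: sum_distrib_right)
 also have "... <= (\<Sum>y\<in>V. w * ?T y)"
  by (intro sum_mono mult_right_mono col_sum Tn)
 also have "... <= w * w ^ k"
  unfolding sum_distrib_left[symmetric] by (intro mult_left_mono Suc) auto
 finally show ?case by simp
qed

lemma sum_wt_to_le: "(\<Sum>v | v \<in> walks V k \<and> last (u # v) = x. wt q F (u # v)) <= w ^ k"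
proof -
 have "(\<Sum>v | v \<in> walks V k \<and> last (u # v) = x. wt q F (u # v)) <= (\<Sum>v\<in>walks V k. wt q F (u # v))"
  by (rule sum_mono2) (auto simp: finite_walks fin intro: wt_nonneg q)
 with sum_wt_from[of u k] show ?thesis by linarith
qed

text \<open>One of the at most \<open>k\<close> steps lies outside \<open>F\<close>. It carries an explicit factor \<open>q\<close>, and once it is
taken out the remaining two pieces of the walk have one prescribed end each.\<close>
lemma sum_wt_new:
 "(\<Sum>v | v \<in> walks V k \<and> last (u # v) = x \<and> \<not> set (steps (u # v)) \<subseteq> F. wt q F (u # v))
   <= k * q * w ^ k"
proof (induction k arbitrary: u)
 case 0
 have "{v \<in> walks V 0. last (u # v) = x \<and> \<not> set (steps (u # v)) \<subseteq> F} = {}" by auto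
 then show ?case by (simp only:) simp
next
 case (Suc k)
 let ?T = "%y. \<Sum>v | v \<in> walks V k \<and> last (y # v) = x. wt q F (y # v)"
 let ?N = "%y. \<Sum>v | v \<in> walks V k \<and> last (y # v) = x \<and> \<not> set (steps (y # v)) \<subseteq> F. wt q F (y # v)"
 have "(\<Sum>v | v \<in> walks V (Suc k) \<and> last (u # v) = x \<and> \<not> set (steps (u # v)) \<subseteq> F. wt q F (u # v)) =
   (\<Sum>v\<in>walks V (Suc k). if last (u # v) = x \<and> \<not> set (steps (u # v)) \<subseteq> F then wt q F (u # v) else 0)"
  by (rule sum.mono_neutral_cong_left) (auto simp: fin finite_walks)
 also have "... = (\<Sum>y\<in>V. \<Sum>v\<in>walks V k. if last (y # v) = x \<and> \<not> set (steps (u # y # v)) \<subseteq> F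
   then wt q F (u # y # v) else 0)"
  by (simp add: sum_walks_Suc)
 also have "... = (\<Sum>y\<in>V. if {u, y} \<in> F then ?N y else q * ?T y)"
 proof (rule sum.cong[OF refl])
  fix y
  show "(\<Sum>v\<in>walks V k. if last (y # v) = x \<and> \<not> set (steps (u # y # v)) \<subseteq> F
   then wt q F (u # y # v) else 0) = (if {u, y} \<in> F then ?N y else q * ?T y)"
  proof (cases "{u, y} \<in> F")
   case True
   then show ?thesis
    by simp (rule sum.mono_neutral_cong_right, auto simp: fin finite_walks wt_Cons_Cons)
  next
   case False
   then show ?thesis
    by (simp add: sum_distrib_left)
      (rule sum.mono_neutral_cong_right, auto simp: fin finite_walks wt_Cons_Cons)
  qed
 qed
 also have "... <= (\<Sum>y\<in>V. (if {u, y} \<in> F then 1 else 0) * (k * q * w ^ k) + q * ?T y)"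
 proof (rule sum_mono)
  fix y
  have "0 <= q * ?T y" by (intro mult_nonneg_nonneg sum_nonneg wt_nonneg q)
  then show "(if {u, y} \<in> F then ?N y else q * ?T y)
   <= (if {u, y} \<in> F then 1 else 0) * (k * q * w ^ k) + q * ?T y"
   using Suc[of y] by auto
 qed
 also have "... = card {y \<in> V. {u, y} \<in> F} * (k * q * w ^ k) + q * (\<Sum>y\<in>V. ?T y)"
  by (simp add: sum.distrib sum_distrib_left sum.If_cases fin Int_def if_distrib[of "%c. c * _"] cong: if_cong)
 also have "... <= w * (k * q * w ^ k) + q * w ^ k"
  using card_neighbours[OF fin(2,1), of u] q
  by (intro add_mono mult_right_mono mult_left_mono sum_wt_to) auto
 also have "... <= Suc k * q * w ^ Suc k"
  using mult_right_mono[OF w_ge(1), of "q * w ^ k"] q by (simp add: algebra_simps)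
 finally show ?case .
qed

text \<open>A walk meeting \<open>F\<close> has one of its steps among at most \<open>2 * card F\<close> oriented edges; fixing that step fixes a
vertex of the walk, hence there is no factor for the choice of a starting point.\<close>
lemma sum_wt_old:
 "(\<Sum>v | v \<in> walks V (Suc k) \<and> set (steps v) \<inter> F \<noteq> {}. wt q F v) <= k * (2 * card F) * w ^ k"
proof (induction k)
 case 0
 have "{v. v \<in> walks V (Suc 0) \<and> set (steps v) \<inter> F \<noteq> {}} = {}"
  by (auto simp: walks_def length_Suc_conv)
 then show ?case by (simp only:) simp
next
 case (Suc k)
 let ?P = "%v. set (steps v) \<inter> F \<noteq> {}"
 have e: "(\<Sum>v | v \<in> walks V (Suc m) \<and> ?P v. wt q F v) =
   (\<Sum>u\<in>V. \<Sum>v\<in>walks V m. if ?P (u # v) then wt q F (u # v) else 0)" for m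
 proof -
  have "(\<Sum>v | v \<in> walks V (Suc m) \<and> ?P v. wt q F v) =
    (\<Sum>v\<in>walks V (Suc m). if ?P v then wt q F v else 0)"
   by (rule sum.mono_neutral_cong_left) (auto simp: fin finite_walks)
  then show ?thesis by (simp only: sum_walks_Suc)
 qed
 have "(\<Sum>v | v \<in> walks V (Suc (Suc k)) \<and> ?P v. wt q F v) =
   (\<Sum>u\<in>V. \<Sum>y\<in>V. \<Sum>v\<in>walks V k. if ?P (u # y # v) then wt q F (u # y # v) else 0)"
  unfolding e by (simp add: sum_walks_Suc)
 also have "... <= (\<Sum>u\<in>V. \<Sum>y\<in>V. (if {u, y} \<in> F then 1 else q) * 
    (\<Sum>v\<in>walks V k. if ?P (y # v) then wt q F (y # v) else 0)
    + (if {u, y} \<in> F then 1 else 0) * (\<Sum>v\<in>walks V k. wt q F (y # v)))"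
  unfolding sum_distrib_left sum.distrib[symmetric]
  by (intro sum_mono) (auto simp: wt_Cons_Cons intro: wt_nonneg q)
 also have "... <= (\<Sum>u\<in>V. \<Sum>y\<in>V. (if {u, y} \<in> F then 1 else q) * 
    (\<Sum>v\<in>walks V k. if ?P (y # v) then wt q F (y # v) else 0)
    + (if {u, y} \<in> F then 1 else 0) * w ^ k)"
  by (intro sum_mono add_left_mono mult_left_mono sum_wt_from) auto
 also have "... = (\<Sum>y\<in>V. (\<Sum>u\<in>V. if {u, y} \<in> F then 1 else q) * 
    (\<Sum>v\<in>walks V k. if ?P (y # v) then wt q F (y # v) else 0))
    + (\<Sum>u\<in>V. card {y\<in>V. {u, y} \<in> F}) * w ^ k"
 proof -
  have "(\<Sum>u\<in>V. \<Sum>y\<in>V. (if {u, y} \<in> F then 1 else 0) * w ^ k) =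
    (\<Sum>u\<in>V. card {y\<in>V. {u, y} \<in> F}) * w ^ k"
   by (simp add: sum_distrib_right[symmetric] sum.If_cases fin Int_def)
  then show ?thesis
   unfolding sum.distrib by (subst sum.swap) (simp only: sum_distrib_right)
 qed
 also have "... <= (\<Sum>y\<in>V. w * (\<Sum>v\<in>walks V k. if ?P (y # v) then wt q F (y # v) else 0))
    + real (2 * card F) * w ^ k"
  by (intro add_mono sum_mono mult_right_mono col_sum of_nat_mono card_ordered_edges fin sum_nonneg)
    (auto intro: wt_nonneg q)
 also have "... = w * (\<Sum>v | v \<in> walks V (Suc k) \<and> ?P v. wt q F v) + real (2 * card F) * w ^ k"
  unfolding e by (simp add: sum_distrib_left)
 also have "... <= w * (k * (2 * card F) * w ^ k) + real (2 * card F) * w ^ k"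
  by (intro add_right_mono mult_left_mono Suc) auto
 also have "... <= Suc k * (2 * card F) * w ^ Suc k"
  using mult_right_mono[OF w_ge(1), of "real (2 * card F) * w ^ k"] by (simp add: algebra_simps)
 finally show ?case .
qed

end

text \<open>A simple path determines the order of its edges: starting at the common first vertex, each step of the second path can
only follow the unique unused edge of the first one. Consequently two different paths with the same ends have different edge sets.\<close>
lemma path_unique:
 assumes "distinct v" "distinct v'" "v \<noteq> []" "v' \<noteq> []" "hd v = hd v'" "last v = last v'"
  "set (steps v') \<subseteq> set (steps v)"
 shows "v' = v"
 using assms
proof (induction v arbitrary: v' rule: steps.induct)
 case (1 x y zs)
 then obtain ws where v': "v' = x # ws" by (cases v') auto
 show ?case
 proof (cases ws)
  case Nil
  then show ?thesis using 1 v' by (auto split: if_splits)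
 next
  case (Cons y' zs')
  have "{x, y'} \<in> set (steps (x # y # zs))" using "1.prems"(7) v' Cons by auto
  moreover have "{x, y'} \<notin> set (steps (y # zs))"
   using steps_edge[of "{x, y'}" "y # zs"] "1.prems"(1) by auto
  ultimately have y: "y' = y" by (auto simp: doubleton_eq_iff)
  have "set (steps (y # zs')) \<subseteq> set (steps (y # zs))"
  proof
   fix e assume e: "e \<in> set (steps (y # zs'))"
   then have "e \<in> set (steps (x # y # zs))" using "1.prems"(7) v' Cons y by auto
   moreover have "e \<noteq> {x, y}" using steps_edge[OF e] "1.prems"(2) v' Cons y by auto
   ultimately show "e \<in> set (steps (y # zs))" by auto
  qed
  then have "y # zs' = y # zs"
   using 1 v' Cons y by (intro "1.IH") auto
  then show ?thesis using v' Cons y by simp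
 qed
next
 case ("2_2" x)
 then show ?case by (cases v' rule: steps.cases) auto
qed auto

definition closing :: "'v list => 'v set" where "closing v = {last v, hd v}"

definition pprod :: "('v set => real) => 'v list => real" where
 "pprod f v = prod_list (map f (steps v))"

definition cprod :: "('v set => real) => 'v list => real" where
 "cprod f v = f (closing v) * pprod f v"

definition csteps :: "'v list => 'v set list" where "csteps v = closing v # steps v"

text \<open>Simple paths are lists of distinct vertices. The same lists represent cycles by adding the closing edge; each
cycle of length \<open>k\<close> is then counted \<open>2 * k\<close> times, by the choice of its start and of its orientation.\<close>
definition dpaths :: "'v set => nat => 'v list set" where
 "dpaths V k = {v. length v = k \<and> distinct v \<and> set v \<subseteq> V}"

lemma finite_dpaths: "finite V ==> finite (dpaths V k)"
 by (rule finite_subset[OF _ finite_walks[of V k]]) (auto simp: dpaths_def walks_def)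

lemma csteps_rotate1: "v \<noteq> [] ==> tl v \<noteq> [] ==> csteps (rotate1 v) = rotate1 (csteps v)"
 by (cases v) (auto simp: csteps_def closing_def steps_append neq_Nil_conv)

lemma csteps_rotate: "length v >= 2 ==> csteps (rotate i v) = rotate i (csteps v)"
proof (induction i)
 case (Suc i)
 have "length (rotate i v) >= 2" using Suc by simp
 then have "rotate i v \<noteq> []" "tl (rotate i v) \<noteq> []"
  by (metis length_0_conv not_numeral_le_zero, metis Suc_le_length_iff length_0_conv list.sel(3) not_less_eq_eq numeral_2_eq_2 le0)
 then show ?case using Suc csteps_rotate1[of "rotate i v"] by simp
qed simp

lemma distinct_csteps:
 assumes "distinct v" "length v >= 3"
 shows "distinct (csteps v)"
proof -
 obtain x y z zs where v: "v = x # y # z # zs"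
  using assms(2) by (auto simp: numeral_3_eq_3 Suc_le_length_iff)
 have "last v \<noteq> x" "last v \<noteq> y" using assms(1) v last_in_set[of "z # zs"] by auto
 then have "closing v \<noteq> {x, y}" by (auto simp: closing_def v doubleton_eq_iff)
 moreover have "closing v \<notin> set (steps (y # z # zs))"
  using steps_edge[of "closing v" "y # z # zs"] assms(1) v by (auto simp: closing_def)
 ultimately show ?thesis
  using distinct_steps[OF assms(1)] by (simp add: csteps_def v)
qed

lemma sum_rotations:
 assumes "distinct v" "length v >= 3"
 shows "(\<Sum>i<length v. if closing (rotate i v) = e then 1 else 0) =
  (if e \<in> set (csteps v) then 1 else (0::real))"
proof -
 have len: "length (csteps v) = length v" using assms by (simp add: csteps_def length_steps)
 have c: "closing (rotate i v) = csteps v ! i" if "i < length v" for i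
 proof -
  have "closing (rotate i v) = hd (csteps (rotate i v))" by (simp add: csteps_def)
  also have "... = hd (rotate i (csteps v))" using assms by (simp add: csteps_rotate)
  also have "... = csteps v ! i" using that len by (subst hd_rotate_conv_nth) auto
  finally show ?thesis .
 qed
 have "(\<Sum>i<length v. if closing (rotate i v) = e then 1 else 0) =
   (\<Sum>i<length v. if csteps v ! i = e then 1 else (0::real))"
  by (intro sum.cong) (auto simp: c)
 also have "... = real (card {i. i < length v \<and> csteps v ! i = e})"
  by (simp add: sum.If_cases Int_def)
 also have "card {i. i < length v \<and> csteps v ! i = e} = (if e \<in> set (csteps v) then 1 else 0)"
 proof (cases "e \<in> set (csteps v)")
  case True
  then obtain i where i: "i < length v" "csteps v ! i = e" using len by (auto simp: in_set_conv_nth)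
  have "j = i" if "j < length v" "csteps v ! j = e" for j
   using that i distinct_csteps[OF assms] len by (metis nth_eq_iff_index_eq)
  then have "{i. i < length v \<and> csteps v ! i = e} = {i}" using i by blast
  then show ?thesis using True by simp
 next
  case False
  then have "{i. i < length v \<and> csteps v ! i = e} = {}" using len by (auto simp: in_set_conv_nth)
  then show ?thesis using False by simp
 qed
 finally show ?thesis by (simp split: if_splits)
qed

lemma cprod_csteps: "cprod f v = prod_list (map f (csteps v))"
 by (simp add: cprod_def csteps_def pprod_def)

lemma cprod_rotate:
 assumes "length v >= 2"
 shows "cprod f (rotate i v) = cprod f v"
proof -
 have "prod_list (map f (rotate1 l)) = prod_list (map f l)" for l :: "'a set list"
  by (cases l) (auto simp: mult.commute)
 then have "prod_list (map f (rotate i l)) = prod_list (map f l)" for l :: "'a set list"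
  by (induction i) auto
 then show ?thesis unfolding cprod_csteps csteps_rotate[OF assms] by simp
qed

lemma steps_rev: "steps (rev v) = rev (steps v)"
proof (induction v rule: steps.induct)
 case (1 x y zs)
 have "steps (rev (x # y # zs)) = steps (rev (y # zs) @ [x])" by simp
 also have "... = steps (rev (y # zs)) @ [{y, x}]"
  by (subst steps_append) (auto simp: last_rev)
 finally show ?case using 1 by (simp add: insert_commute)
qed auto

lemma cprod_rev: "v \<noteq> [] ==> cprod f (rev v) = cprod f v"
 unfolding cprod_def closing_def pprod_def steps_rev
 by (simp add: last_rev hd_rev insert_commute rev_map[symmetric] prod_list.rev)

lemma bij_rotate_dpaths: "bij_betw (rotate i) (dpaths V k) (dpaths V k)"
proof (rule bij_betw_byWitness[where f' = "rotate (k - i mod k)"])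
 have *: "rotate (k - i mod k) (rotate i v) = v" if "length v = k" for v :: "'a list"
 proof (cases "k = 0")
  case False
  have "(k - i mod k + i) mod k = (k - i mod k + i mod k) mod k" by (simp add: mod_add_right_eq)
  also have "k - i mod k + i mod k = k" using False by (simp add: less_imp_le)
  finally have "(k - i mod k + i) mod k = 0" by simp
  then show ?thesis using that by (simp add: rotate_rotate rotate_id)
 qed (use that in auto)
 then show "\<forall>v\<in>dpaths V k. rotate (k - i mod k) (rotate i v) = v" by (auto simp: dpaths_def)
 have "rotate i (rotate (k - i mod k) v) = rotate (k - i mod k) (rotate i v)" for v :: "'a list"
  by (simp add: rotate_rotate add.commute)
 then show "\<forall>v\<in>dpaths V k. rotate i (rotate (k - i mod k) v) = v" using * by (auto simp: dpaths_def)
qed (auto simp: dpaths_def)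

text \<open>Rotating a cycle so that the given edge becomes its closing edge leaves a path joining the ends of
that edge. There are \<open>k\<close> rotations and two orientations, which is the origin of the factor.\<close>
lemma sum_cycles_through_edge:
 assumes "finite V" "k >= 3" "x \<noteq> y"
 shows "(\<Sum>v | v \<in> dpaths V k \<and> {x, y} \<in> set (csteps v). cprod f v) =
  2 * real k * (\<Sum>v | v \<in> dpaths V k \<and> hd v = y \<and> last v = x. cprod f v)"
proof -
 let ?e = "{x, y}"
 let ?I = "%v. if closing v = ?e then 1 else (0::real)"
 have "(\<Sum>v | v \<in> dpaths V k \<and> ?e \<in> set (csteps v). cprod f v) =
   (\<Sum>v\<in>dpaths V k. (if ?e \<in> set (csteps v) then 1 else 0) * cprod f v)"
  by (rule sum.mono_neutral_cong_left) (auto simp: assms finite_dpaths)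
 also have "... = (\<Sum>v\<in>dpaths V k. (\<Sum>i<k. ?I (rotate i v)) * cprod f v)"
  using assms(2) sum_rotations[where e = ?e] by (intro sum.cong refl) (auto simp: dpaths_def)
 also have "... = (\<Sum>v\<in>dpaths V k. \<Sum>i<k. ?I (rotate i v) * cprod f (rotate i v))"
  unfolding sum_distrib_right using assms(2)
  by (intro sum.cong refl) (auto simp: dpaths_def cprod_rotate)
 also have "... = (\<Sum>i<k. \<Sum>v\<in>dpaths V k. ?I (rotate i v) * cprod f (rotate i v))"
  by (rule sum.swap)
 also have "... = (\<Sum>i<k. \<Sum>v\<in>dpaths V k. ?I v * cprod f v)"
  by (intro sum.cong refl sum.reindex_bij_betw[OF bij_rotate_dpaths])
 also have "... = k * (\<Sum>v | v \<in> dpaths V k \<and> closing v = ?e. cprod f v)"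
 proof -
  have "(\<Sum>v\<in>dpaths V k. ?I v * cprod f v) = (\<Sum>v | v \<in> dpaths V k \<and> closing v = ?e. cprod f v)"
   by (rule sum.mono_neutral_cong_right) (auto simp: assms finite_dpaths)
  then show ?thesis by simp
 qed
 also have "{v. v \<in> dpaths V k \<and> closing v = ?e} =
   {v. v \<in> dpaths V k \<and> hd v = y \<and> last v = x} \<union> {v. v \<in> dpaths V k \<and> hd v = x \<and> last v = y}"
  by (auto simp: closing_def doubleton_eq_iff)
 also have "(\<Sum>v\<in>.... cprod f v) = (\<Sum>v | v \<in> dpaths V k \<and> hd v = y \<and> last v = x. cprod f v) +
   (\<Sum>v | v \<in> dpaths V k \<and> hd v = x \<and> last v = y. cprod f v)"
  using assms finite_dpaths[OF assms(1), of k] by (intro sum.union_disjoint) auto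
 also have "(\<Sum>v | v \<in> dpaths V k \<and> hd v = x \<and> last v = y. cprod f v) =
   (\<Sum>v | v \<in> dpaths V k \<and> hd v = y \<and> last v = x. cprod f v)"
  using assms(2)
  by (intro sum.reindex_bij_witness[of _ rev rev])
    (auto simp: dpaths_def hd_rev last_rev intro!: cprod_rev)
 finally show ?thesis by simp
qed

section \<open>Bounded random variables on product spaces\<close>

text \<open>All random variables before the limit are bounded everywhere, which settles every integrability question at once.\<close>
definition bdd_rv :: "'a measure => ('a => 'b::{second_countable_topology,real_normed_vector}) => bool" where
 "bdd_rv M f \<longleftrightarrow> f \<in> borel_measurable M \<and> (\<exists>B. \<forall>x. norm (f x) <= B)"

lemma bdd_rvI: "f \<in> borel_measurable M ==> (\<And>x. norm (f x) <= B) ==> bdd_rv M f"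
 unfolding bdd_rv_def by blast

lemma bdd_rv_measurable [measurable_dest]: "bdd_rv M f ==> f \<in> borel_measurable M"
 unfolding bdd_rv_def by blast

lemma (in prob_space) bdd_rv_integrable:
 fixes f :: "'a => 'b::{second_countable_topology,banach}"
 shows "bdd_rv M f ==> integrable M f"
 unfolding bdd_rv_def by (auto intro: integrable_const_bound)

lemma bdd_rv_const [intro]: "bdd_rv M (%x. c)"
 by (rule bdd_rvI[of _ _ "norm c"]) auto

lemma bdd_rv_add [intro]:
 assumes "bdd_rv M f" "bdd_rv M g"
 shows "bdd_rv M (%x. f x + g x)"
proof -
 from assms obtain B C where "\<And>x. norm (f x) <= B" "\<And>x. norm (g x) <= C" unfolding bdd_rv_def by metis
 then have "norm (f x + g x) <= B + C" for x by (meson norm_triangle_mono)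
 with assms show ?thesis by (intro bdd_rvI[of _ _ "B + C"]) (auto simp: bdd_rv_def)
qed

lemma bdd_rv_minus [intro]: "bdd_rv M f ==> bdd_rv M (%x. - f x)"
 by (auto simp: bdd_rv_def)

lemma bdd_rv_diff [intro]: "bdd_rv M f ==> bdd_rv M g ==> bdd_rv M (%x. f x - g x)"
 using bdd_rv_add[of M f "%x. - g x"] by auto

lemma bdd_rv_mult [intro]:
 fixes f g :: "'a => 'b::{second_countable_topology,real_normed_algebra}"
 assumes "bdd_rv M f" "bdd_rv M g"
 shows "bdd_rv M (%x. f x * g x)"
proof -
 from assms obtain B C where BC: "\<And>x. norm (f x) <= B" "\<And>x. norm (g x) <= C" unfolding bdd_rv_def by metis
 have "norm (f x * g x) <= B * C" for x
  by (rule order.trans[OF norm_mult_ineq]) (use BC order.trans[OF norm_ge_zero BC(1)] in \<open>auto intro!: mult_mono\<close>)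
 with assms show ?thesis by (intro bdd_rvI[of _ _ "B * C"]) (auto simp: bdd_rv_def)
qed

lemma bdd_rv_sum [intro]: "(\<And>i. i \<in> I ==> bdd_rv M (f i)) ==> bdd_rv M (%x. \<Sum>i\<in>I. f i x)"
 by (induction I rule: infinite_finite_induct) auto

lemma bdd_rv_prod [intro]:
 fixes f :: "'i => 'a => 'b::{second_countable_topology,real_normed_field}"
 shows "(\<And>i. i \<in> I ==> bdd_rv M (f i)) ==> bdd_rv M (%x. \<Prod>i\<in>I. f i x)"
 by (induction I rule: infinite_finite_induct) auto

lemma bdd_rv_power [intro]:
 fixes f :: "'a => 'b::{second_countable_topology,real_normed_field}"
 shows "bdd_rv M f ==> bdd_rv M (%x. f x ^ k)"
 by (induction k) auto

lemma bdd_rv_of_real [intro]: "bdd_rv M f ==> bdd_rv M (%x. complex_of_real (f x))"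
 by (auto simp: bdd_rv_def)

lemma bdd_rv_iexp [intro]: "bdd_rv M f ==> bdd_rv M (%x. iexp (t * f x))"
 by (rule bdd_rvI[of _ _ 1]) (auto simp: bdd_rv_def)

lemma bdd_rv_abs [intro]: "bdd_rv M f ==> bdd_rv M (%x. \<bar>f x :: real\<bar>)"
 by (auto simp: bdd_rv_def)

lemma bdd_rv_coord:
 assumes "e \<in> J" "bdd_rv (\<nu> e) \<phi>"
 shows "bdd_rv (PiM J \<nu>) (%x. \<phi> (x e))"
 using assms unfolding bdd_rv_def by auto

text \<open>Functions that do not change with coordinate \<open>e\<close>; on a product space they are independent of it.\<close>
definition free_of :: "'i => (('i => 't) => 'b) => bool" where
 "free_of e H \<longleftrightarrow> (\<forall>x t. H (x(e := t)) = H x)"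

lemma free_ofD: "free_of e H ==> H (x(e := t)) = H x"
 by (simp add: free_of_def)

lemma integral_split_coordinate:
 fixes \<phi> :: "'t => 'b::{real_normed_field,banach,second_countable_topology}" and H :: "('i => 't) => 'b"
 assumes "finite J" "e \<in> J" and prob: "\<And>i. prob_space (\<nu> i)"
  and \<phi>: "bdd_rv (\<nu> e) \<phi>" and H: "bdd_rv (PiM J \<nu>) H" and f: "free_of e H"
 shows "(LINT x|PiM J \<nu>. \<phi> (x e) * H x) = (LINT t|\<nu> e. \<phi> t) * (LINT x|PiM J \<nu>. H x)"
proof -
 interpret P: product_sigma_finite \<nu>
  using prob by (simp add: product_sigma_finite_def prob_space_imp_sigma_finite)
 interpret PJ: prob_space "PiM J \<nu>" by (intro prob_space_PiM prob)
 interpret Pe: prob_space "\<nu> e" by (rule prob)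
 define t0 :: 't where "t0 = undefined"
 obtain J' where J: "J = insert e J'" "e \<notin> J'" "finite J'"
  using assms by (metis Set.set_insert finite_insert)
 have Ht: "H (x(e := t)) = H (x(e := t0))" for x t
  using free_ofD[OF f] by metis
 have key: "(LINT x|PiM J \<nu>. \<psi> (x e) * H x) = (LINT t|\<nu> e. \<psi> t) * (LINT x|PiM J' \<nu>. H (x(e := t0)))"
  if \<psi>: "bdd_rv (\<nu> e) \<psi>" for \<psi> :: "'t => 'b"
 proof -
  have "integrable (PiM J \<nu>) (%x. \<psi> (x e) * H x)"
   using bdd_rv_mult[OF bdd_rv_coord[of e J \<nu> \<psi>] H] assms(2) \<psi> by (simp add: PJ.bdd_rv_integrable)
  then have "(LINT x|PiM J \<nu>. \<psi> (x e) * H x) =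
    (LINT x|PiM J' \<nu>. (LINT y|\<nu> e. \<psi> ((x(e := y)) e) * H (x(e := y))))"
   using P.product_integral_insert[OF J(3,2), of "%x. \<psi> (x e) * H x"] by (simp only: J(1))
  also have "... = (LINT x|PiM J' \<nu>. (LINT y|\<nu> e. \<psi> y * H (x(e := t0))))"
  proof -
   have "\<psi> ((x(e := y)) e) * H (x(e := y)) = \<psi> y * H (x(e := t0))" for x y
    using Ht[of x y] by simp
   then show ?thesis by (simp only:)
  qed
  finally show ?thesis by simp
 qed
 have "(LINT x|PiM J \<nu>. H x) = (LINT x|PiM J' \<nu>. H (x(e := t0)))"
  using key[of "%_. 1"] by (simp add: bdd_rv_const Pe.prob_space)
 with key[OF \<phi>] show ?thesis by simp
qed

text \<open>Collecting the factors of several path products edge by edge turns the expectation of the product into a product of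
moments of single edges.\<close>
lemma prod_list_pprod:
 fixes f :: "'v set => real"
 assumes "finite A" "\<And>r. r \<in> set \<Gamma> ==> distinct r \<and> set (steps r) \<subseteq> A"
 shows "prod_list (map (pprod f) \<Gamma>) = (\<Prod>e\<in>A. f e ^ length (filter (%r. e \<in> set (steps r)) \<Gamma>))"
 using assms(2)
proof (induction \<Gamma>)
 case (Cons r \<Gamma>)
 have "pprod f r = (\<Prod>e\<in>set (steps r). f e)"
  using Cons.prems by (simp add: pprod_def prod.distinct_set_conv_list distinct_steps)
 also have "... = (\<Prod>e\<in>A. if e \<in> set (steps r) then f e else 1)"
  using Cons.prems assms(1) by (intro prod.mono_neutral_cong_left) auto
 finally show ?case using Cons
  by (simp add: prod.distrib[symmetric] cong: if_cong) (intro prod.cong, auto)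
qed simp

lemma sq_sum_le_two: "(x + y)\<^sup>2 <= 2 * (x\<^sup>2 + y\<^sup>2)" for x y :: real
 using sum_squares_bound[of x y] by (simp add: power2_sum)

lemma (in prob_space) cauchy_schwarz_bdd:
 fixes f g :: "'a => real"
 assumes "bdd_rv M f" "bdd_rv M g"
 shows "(LINT x|M. \<bar>f x * g x\<bar>) <= sqrt (LINT x|M. (f x)\<^sup>2) * sqrt (LINT x|M. (g x)\<^sup>2)"
proof -
 have i: "integrable M (%x. (f x)\<^sup>2)" "integrable M (%x. (g x)\<^sup>2)" "integrable M (%x. \<bar>f x * g x\<bar>)"
  using assms by (auto intro!: bdd_rv_integrable)
 define F G where "F = (LINT x|M. (f x)\<^sup>2)" and "G = (LINT x|M. (g x)\<^sup>2)"
 define I where "I = (LINT x|M. \<bar>f x * g x\<bar>)"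
 have nn: "F >= 0" "G >= 0" "I >= 0" by (auto simp: F_def G_def I_def)
 have *: "2 * s * I <= s\<^sup>2 * F + G" for s
 proof -
  have "(LINT x|M. 2 * s * \<bar>f x * g x\<bar>) <= (LINT x|M. s\<^sup>2 * (f x)\<^sup>2 + (g x)\<^sup>2)"
  proof (rule integral_mono)
   fix x
   have "0 <= (s * \<bar>f x\<bar> - \<bar>g x\<bar>)\<^sup>2" by simp
   then show "2 * s * \<bar>f x * g x\<bar> <= s\<^sup>2 * (f x)\<^sup>2 + (g x)\<^sup>2"
    by (simp add: power2_diff power_mult_distrib abs_mult)
  qed (use i in auto)
  then show ?thesis using i by (simp add: F_def G_def I_def)
 qed
 have "I\<^sup>2 <= F * G"
 proof (cases "F = 0")
  case True
  have "I = 0"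
  proof (rule ccontr)
   assume "I \<noteq> 0"
   with nn have "I > 0" by simp
   with *[of "(G + 1) / (2 * I)"] True show False by (simp add: field_simps)
  qed
  then show ?thesis using True by simp
 next
  case False
  with nn have "F > 0" by simp
  with *[of "I / F"] show ?thesis by (simp add: field_simps power2_eq_square)
 qed
 then have "I <= sqrt (F * G)" using nn by (simp add: real_le_rsqrt)
 then show ?thesis by (simp add: I_def F_def G_def real_sqrt_mult)
qed

lemma (in prob_space) abs_le_sqrt_second_moment:
 assumes "bdd_rv M (f :: 'a => real)"
 shows "(LINT x|M. \<bar>f x\<bar>) <= sqrt (LINT x|M. (f x)\<^sup>2)"
 using cauchy_schwarz_bdd[OF assms bdd_rv_const[of _ 1]] by (simp add: prob_space)

text \<open>The expansion of \<open>exp (i * th * S)\<close> in the coordinate \<open>e\<close>, where \<open>S = S0 + z + u * g\<close> with \<open>S0\<close> and \<open>g\<close>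
independent of the coordinate. The main term consists
of the mean of \<open>Y\<close> and of its covariances with the increment \<open>z + u * g\<close>; replacing \<open>S0\<close> by \<open>S\<close> in the exponential afterwards
costs the second and third groups of the error, the quadratic Taylor remainder costs the first.\<close>
lemma stein_expansion:
 fixes Y z u :: "'t => real" and H g S S0 :: "('i => 't) => real" and th :: real
 assumes J: "finite J" "e \<in> J" and prob: "\<And>i. prob_space (\<nu> i)"
  and Y: "bdd_rv (\<nu> e) Y" and z: "bdd_rv (\<nu> e) z" and u: "bdd_rv (\<nu> e) u"
  and H: "bdd_rv (PiM J \<nu>) H" "free_of e H" and g: "bdd_rv (PiM J \<nu>) g" "free_of e g"
  and S0: "bdd_rv (PiM J \<nu>) S0" "free_of e S0"
  and S: "\<And>x. S x = S0 x + z (x e) + u (x e) * g x"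
 defines "E \<equiv> %f. (LINT t|\<nu> e. f t)" and "EE \<equiv> %f. (LINT x|PiM J \<nu>. f x)"
 shows "cmod ((LINT x|PiM J \<nu>. Y (x e) * H x * iexp (th * S x)) -
   (LINT x|PiM J \<nu>. iexp (th * S x) * (H x * (E Y + \<i> * th * (E (%t. Y t * z t) + E (%t. Y t * u t) * g x)))))
  <= th\<^sup>2 * (E (%t. \<bar>Y t\<bar> * (z t)\<^sup>2) * EE (%x. \<bar>H x\<bar>) + E (%t. \<bar>Y t\<bar> * (u t)\<^sup>2) * EE (%x. \<bar>H x\<bar> * (g x)\<^sup>2))
   + \<bar>th\<bar> * \<bar>E Y\<bar> * (E (%t. \<bar>z t\<bar>) * EE (%x. \<bar>H x\<bar>) + E (%t. \<bar>u t\<bar>) * EE (%x. \<bar>H x * g x\<bar>))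
   + th\<^sup>2 * (\<bar>E (%t. Y t * z t)\<bar> * (E (%t. \<bar>z t\<bar>) * EE (%x. \<bar>H x\<bar>) + E (%t. \<bar>u t\<bar>) * EE (%x. \<bar>H x * g x\<bar>))
      + \<bar>E (%t. Y t * u t)\<bar> * (E (%t. \<bar>z t\<bar>) * EE (%x. \<bar>H x * g x\<bar>) + E (%t. \<bar>u t\<bar>) * EE (%x. \<bar>H x\<bar> * (g x)\<^sup>2)))"
proof -
 let ?M = "PiM J \<nu>"
 interpret PJ: prob_space ?M by (intro prob_space_PiM prob)
 interpret Pe: prob_space "\<nu> e" by (rule prob)
 note split = integral_split_coordinate[OF J prob]
 note co = bdd_rv_coord[of e J \<nu>, OF J(2)]
 note bd = Y z u H(1) g(1) S0(1) co[OF Y] co[OF z] co[OF u]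
 have bS: "bdd_rv ?M S" unfolding S by (intro bdd_rv_add bdd_rv_mult bd)
 define w where "w x = z (x e) + u (x e) * g x" for x
 have bw: "bdd_rv ?M w" unfolding w_def by (intro bdd_rv_add bdd_rv_mult bd)
 define K where "K x = complex_of_real (H x) * (E Y + \<i> * th * (E (%t. Y t * z t) + E (%t. Y t * u t) * g x))" for x
 have bK: "bdd_rv ?M K" unfolding K_def by (intro bdd_rv_add bdd_rv_mult bdd_rv_of_real bd bdd_rv_const)
 have Sw: "iexp (th * S x) = iexp (th * S0 x) * iexp (th * w x)" for x
  by (simp add: S w_def exp_add[symmetric] algebra_simps)
 have fr: "free_of e (%x. iexp (th * S0 x) * complex_of_real (H x))" "free_of e (%x. iexp (th * S0 x) * complex_of_real (H x) * g x)"
  using H(2) g(2) S0(2) by (simp_all add: free_of_def)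
 \<comment> \<open>first order part\<close>
 have cint: "(LINT t|\<nu> e. complex_of_real (f t)) = complex_of_real (E f)" for f
  unfolding E_def by (rule integral_complex_of_real)
 have main: "(LINT x|?M. iexp (th * S0 x) * H x * (Y (x e) * (1 + \<i> * (th * w x)))) = (LINT x|?M. iexp (th * S0 x) * K x)"
 proof -
  let ?A = "%x. iexp (th * S0 x) * complex_of_real (H x)"
  have bA: "bdd_rv ?M ?A" "bdd_rv ?M (%x. ?A x * g x)" by (intro bdd_rv_mult bdd_rv_iexp bdd_rv_of_real bd)+
  have bY: "bdd_rv (\<nu> e) (%t. complex_of_real (Y t))" "bdd_rv (\<nu> e) (%t. complex_of_real (Y t * z t))"
    "bdd_rv (\<nu> e) (%t. complex_of_real (Y t * u t))"
   by (intro bdd_rv_of_real bdd_rv_mult bd)+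
  note bYx = bY[THEN co]
  have "(LINT x|?M. iexp (th * S0 x) * H x * (Y (x e) * (1 + \<i> * (th * w x)))) =
   (LINT x|?M. complex_of_real (Y (x e)) * ?A x + \<i> * th * (complex_of_real (Y (x e) * z (x e)) * ?A x
     + complex_of_real (Y (x e) * u (x e)) * (?A x * g x)))"
   by (intro Bochner_Integration.integral_cong refl) (simp add: w_def algebra_simps)
  also have "... = (LINT x|?M. complex_of_real (Y (x e)) * ?A x) + \<i> * th * ((LINT x|?M. complex_of_real (Y (x e) * z (x e)) * ?A x)
     + (LINT x|?M. complex_of_real (Y (x e) * u (x e)) * (?A x * g x)))"
   using PJ.bdd_rv_integrable[OF bdd_rv_mult[OF bYx(1) bA(1)]] PJ.bdd_rv_integrable[OF bdd_rv_mult[OF bYx(2) bA(1)]]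
     PJ.bdd_rv_integrable[OF bdd_rv_mult[OF bYx(3) bA(2)]]
   by (simp del: of_real_mult)
  also have "... = E Y * (LINT x|?M. ?A x) + \<i> * th * (E (%t. Y t * z t) * (LINT x|?M. ?A x)
     + E (%t. Y t * u t) * (LINT x|?M. ?A x * g x))"
   using split[OF bY(1) bA(1) fr(1)] split[OF bY(2) bA(1) fr(1)] split[OF bY(3) bA(2) fr(2)]
   by (simp only: cint)
  also have "... = (LINT x|?M. E Y * ?A x + \<i> * th * (E (%t. Y t * z t) * ?A x + E (%t. Y t * u t) * (?A x * g x)))"
   using PJ.bdd_rv_integrable[OF bA(1)] PJ.bdd_rv_integrable[OF bA(2)] by simp
  also have "... = (LINT x|?M. iexp (th * S0 x) * K x)"
   by (intro Bochner_Integration.integral_cong refl) (simp add: K_def algebra_simps)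
  finally show ?thesis .
 qed
 have i1: "bdd_rv ?M (%x. complex_of_real (Y (x e)) * H x * iexp (th * S x))"
  "bdd_rv ?M (%x. iexp (th * S0 x) * H x * (Y (x e) * (1 + \<i> * (th * w x))))"
  "bdd_rv ?M (%x. iexp (th * S x) * K x)" "bdd_rv ?M (%x. iexp (th * S0 x) * K x)"
  by (intro bdd_rv_mult bdd_rv_add bdd_rv_iexp bdd_rv_of_real bdd_rv_const bd bS bw bK)+
 note i1' = i1[THEN PJ.bdd_rv_integrable]
 have err1: "cmod ((LINT x|?M. Y (x e) * H x * iexp (th * S x)) - (LINT x|?M. iexp (th * S0 x) * H x * (Y (x e) * (1 + \<i> * (th * w x)))))
  <= th\<^sup>2 * (E (%t. \<bar>Y t\<bar> * (z t)\<^sup>2) * EE (%x. \<bar>H x\<bar>) + E (%t. \<bar>Y t\<bar> * (u t)\<^sup>2) * EE (%x. \<bar>H x\<bar> * (g x)\<^sup>2))"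
 proof -
  let ?f = "%x. th\<^sup>2 * (\<bar>Y (x e)\<bar> * (z (x e))\<^sup>2 * \<bar>H x\<bar> + \<bar>Y (x e)\<bar> * (u (x e))\<^sup>2 * (\<bar>H x\<bar> * (g x)\<^sup>2))"
  have bY: "bdd_rv (\<nu> e) (%t. \<bar>Y t\<bar> * (z t)\<^sup>2)" "bdd_rv (\<nu> e) (%t. \<bar>Y t\<bar> * (u t)\<^sup>2)"
   by (intro bdd_rv_mult bdd_rv_abs bdd_rv_power bd)+
  have bH: "bdd_rv ?M (%x. \<bar>H x\<bar>)" "bdd_rv ?M (%x. \<bar>H x\<bar> * (g x)\<^sup>2)"
   by (intro bdd_rv_mult bdd_rv_abs bdd_rv_power bd)+
  have bf: "bdd_rv ?M ?f"
   by (intro bdd_rv_add bdd_rv_mult bdd_rv_const bdd_rv_abs bdd_rv_power bd)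
  have "cmod ((LINT x|?M. Y (x e) * H x * iexp (th * S x)) - (LINT x|?M. iexp (th * S0 x) * H x * (Y (x e) * (1 + \<i> * (th * w x)))))
    = cmod (LINT x|?M. Y (x e) * H x * iexp (th * S x) - iexp (th * S0 x) * H x * (Y (x e) * (1 + \<i> * (th * w x))))"
   using i1'(1,2) by (subst Bochner_Integration.integral_diff) auto
  also have "... <= (LINT x|?M. cmod (Y (x e) * H x * iexp (th * S x) - iexp (th * S0 x) * H x * (Y (x e) * (1 + \<i> * (th * w x)))))"
   by (rule integral_norm_bound)
  also have "... <= (LINT x|?M. ?f x)"
  proof (rule integral_mono)
   fix x
   have "Y (x e) * H x * iexp (th * S x) - iexp (th * S0 x) * H x * (Y (x e) * (1 + \<i> * (th * w x))) =
     iexp (th * S0 x) * (complex_of_real (Y (x e) * H x) * (iexp (th * w x) - (1 + \<i> * (th * w x))))"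
    unfolding Sw by (simp add: algebra_simps)
   then have "cmod (Y (x e) * H x * iexp (th * S x) - iexp (th * S0 x) * H x * (Y (x e) * (1 + \<i> * (th * w x)))) =
     \<bar>Y (x e) * H x\<bar> * cmod (iexp (th * w x) - (1 + \<i> * (th * w x)))"
    by (simp only: norm_mult norm_exp_i_times norm_of_real mult_1)
   also have "... <= \<bar>Y (x e) * H x\<bar> * (th\<^sup>2 * ((z (x e))\<^sup>2 + (u (x e) * g x)\<^sup>2))"
   proof (rule mult_left_mono)
    have "cmod (iexp (th * w x) - (1 + \<i> * (th * w x))) <= (th * w x)\<^sup>2 / 2"
     using iexp_approx1[of "th * w x" 1] by (simp add: numeral_2_eq_2 power2_eq_square)
    also have "... = th\<^sup>2 * (w x)\<^sup>2 / 2" by (simp only: power_mult_distrib)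
    also have "... <= th\<^sup>2 * (2 * ((z (x e))\<^sup>2 + (u (x e) * g x)\<^sup>2)) / 2"
     unfolding w_def by (intro divide_right_mono mult_left_mono sq_sum_le_two) auto
    finally show "cmod (iexp (th * w x) - (1 + \<i> * (th * w x))) <= th\<^sup>2 * ((z (x e))\<^sup>2 + (u (x e) * g x)\<^sup>2)"
     unfolding mult.left_commute[of "th\<^sup>2" 2] by linarith
   qed simp
   also have "... = ?f x"
    by (simp add: abs_mult power_mult_distrib distrib_left distrib_right mult_ac)
   finally show "cmod (Y (x e) * H x * iexp (th * S x) - iexp (th * S0 x) * H x * (Y (x e) * (1 + \<i> * (th * w x)))) <= ?f x" .
  qed (use PJ.bdd_rv_integrable[OF bf] i1'(1,2) in auto)
  also have "... = th\<^sup>2 * ((LINT x|?M. \<bar>Y (x e)\<bar> * (z (x e))\<^sup>2 * \<bar>H x\<bar>) + (LINT x|?M. \<bar>Y (x e)\<bar> * (u (x e))\<^sup>2 * (\<bar>H x\<bar> * (g x)\<^sup>2)))"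
   using PJ.bdd_rv_integrable[OF bdd_rv_mult[OF co[OF bY(1)] bH(1)]] PJ.bdd_rv_integrable[OF bdd_rv_mult[OF co[OF bY(2)] bH(2)]]
   by simp
  also have "... = th\<^sup>2 * (E (%t. \<bar>Y t\<bar> * (z t)\<^sup>2) * EE (%x. \<bar>H x\<bar>) + E (%t. \<bar>Y t\<bar> * (u t)\<^sup>2) * EE (%x. \<bar>H x\<bar> * (g x)\<^sup>2))"
   using split[OF bY(1) bH(1)] split[OF bY(2) bH(2)] H(2) g(2) by (simp add: E_def EE_def free_of_def)
  finally show ?thesis .
 qed
 have err2: "cmod ((LINT x|?M. iexp (th * S0 x) * K x) - (LINT x|?M. iexp (th * S x) * K x)) \<le>
    \<bar>th\<bar> * \<bar>E Y\<bar> * (E (%t. \<bar>z t\<bar>) * EE (%x. \<bar>H x\<bar>) + E (%t. \<bar>u t\<bar>) * EE (%x. \<bar>H x * g x\<bar>))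
   + th\<^sup>2 * (\<bar>E (%t. Y t * z t)\<bar> * (E (%t. \<bar>z t\<bar>) * EE (%x. \<bar>H x\<bar>) + E (%t. \<bar>u t\<bar>) * EE (%x. \<bar>H x * g x\<bar>))
      + \<bar>E (%t. Y t * u t)\<bar> * (E (%t. \<bar>z t\<bar>) * EE (%x. \<bar>H x * g x\<bar>) + E (%t. \<bar>u t\<bar>) * EE (%x. \<bar>H x\<bar> * (g x)\<^sup>2)))"
 proof -
  define c0 c1 c2 where "c0 = \<bar>E Y\<bar>" and "c1 = \<bar>E (%t. Y t * z t)\<bar>" and "c2 = \<bar>E (%t. Y t * u t)\<bar>"
  let ?f = "%x. (\<bar>th\<bar> * c0 + th\<^sup>2 * c1) * (\<bar>z (x e)\<bar> * \<bar>H x\<bar> + \<bar>u (x e)\<bar> * \<bar>H x * g x\<bar>)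
    + th\<^sup>2 * c2 * (\<bar>z (x e)\<bar> * \<bar>H x * g x\<bar> + \<bar>u (x e)\<bar> * (\<bar>H x\<bar> * (g x)\<^sup>2))"
  have bY: "bdd_rv (\<nu> e) (%t. \<bar>z t\<bar>)" "bdd_rv (\<nu> e) (%t. \<bar>u t\<bar>)"
   by (intro bdd_rv_mult bdd_rv_abs bdd_rv_power bd)+
  have bH: "bdd_rv ?M (%x. \<bar>H x\<bar>)" "bdd_rv ?M (%x. \<bar>H x * g x\<bar>)" "bdd_rv ?M (%x. \<bar>H x\<bar> * (g x)\<^sup>2)"
   by (intro bdd_rv_mult bdd_rv_abs bdd_rv_power bd)+
  have fH: "free_of e (%x. \<bar>H x\<bar>)" "free_of e (%x. \<bar>H x * g x\<bar>)" "free_of e (%x. \<bar>H x\<bar> * (g x)\<^sup>2)"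
   using H(2) g(2) by (auto simp: free_of_def)
  have bf: "bdd_rv ?M ?f"
   by (intro bdd_rv_add bdd_rv_mult bdd_rv_const bdd_rv_abs bdd_rv_power bd)
  have "cmod ((LINT x|?M. iexp (th * S0 x) * K x) - (LINT x|?M. iexp (th * S x) * K x))
    = cmod (LINT x|?M. iexp (th * S0 x) * K x - iexp (th * S x) * K x)"
   using i1'(3,4) by (subst Bochner_Integration.integral_diff) auto
  also have "... <= (LINT x|?M. cmod (iexp (th * S0 x) * K x - iexp (th * S x) * K x))"
   by (rule integral_norm_bound)
  also have "... <= (LINT x|?M. ?f x)"
  proof (rule integral_mono)
   fix x
   have "iexp (th * S0 x) * K x - iexp (th * S x) * K x = iexp (th * S0 x) * K x * (1 - iexp (th * w x))"
    unfolding Sw by (simp add: algebra_simps)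
   then have "cmod (iexp (th * S0 x) * K x - iexp (th * S x) * K x) = cmod (K x) * cmod (iexp (th * w x) - 1)"
    by (simp only: norm_mult norm_exp_i_times norm_minus_commute mult_1)
   also have "... <= cmod (K x) * \<bar>th * w x\<bar>"
    using iexp_approx1[of "th * w x" 0] by (intro mult_left_mono) auto
   also have "... <= (\<bar>H x\<bar> * (c0 + \<bar>th\<bar> * (c1 + c2 * \<bar>g x\<bar>))) * (\<bar>th\<bar> * (\<bar>z (x e)\<bar> + \<bar>u (x e)\<bar> * \<bar>g x\<bar>))"
   proof (rule mult_mono)
    have "cmod (complex_of_real (E (%t. Y t * z t)) + complex_of_real (E (%t. Y t * u t)) * complex_of_real (g x)) <= c1 + c2 * \<bar>g x\<bar>"
     by (rule order.trans[OF norm_triangle_ineq]) (simp add: norm_mult c1_def c2_def)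
    then have "cmod (complex_of_real (E Y) + \<i> * th * (E (%t. Y t * z t) + E (%t. Y t * u t) * g x)) <= c0 + \<bar>th\<bar> * (c1 + c2 * \<bar>g x\<bar>)"
     by (intro order.trans[OF norm_triangle_ineq]) (auto simp: norm_mult c0_def intro!: mult_left_mono)
    then show "cmod (K x) <= \<bar>H x\<bar> * (c0 + \<bar>th\<bar> * (c1 + c2 * \<bar>g x\<bar>))"
     unfolding K_def by (simp add: norm_mult mult_left_mono)
    show "\<bar>th * w x\<bar> <= \<bar>th\<bar> * (\<bar>z (x e)\<bar> + \<bar>u (x e)\<bar> * \<bar>g x\<bar>)"
     unfolding w_def abs_mult by (intro mult_left_mono) (auto simp: abs_mult[symmetric])
   qed (auto simp: c0_def c1_def c2_def)
   also have "... = ?f x"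
   proof -
    have sq: "th\<^sup>2 = \<bar>th\<bar> * \<bar>th\<bar>" "(g x)\<^sup>2 = \<bar>g x\<bar> * \<bar>g x\<bar>" by (simp_all add: power2_eq_square)
    show ?thesis unfolding sq abs_mult by (simp only: algebra_simps)
   qed
   finally show "cmod (iexp (th * S0 x) * K x - iexp (th * S x) * K x) <= ?f x" .
  qed (use PJ.bdd_rv_integrable[OF bf] i1'(3,4) in auto)
  also have "... = (\<bar>th\<bar> * c0 + th\<^sup>2 * c1) * ((LINT x|?M. \<bar>z (x e)\<bar> * \<bar>H x\<bar>) + (LINT x|?M. \<bar>u (x e)\<bar> * \<bar>H x * g x\<bar>))
    + th\<^sup>2 * c2 * ((LINT x|?M. \<bar>z (x e)\<bar> * \<bar>H x * g x\<bar>) + (LINT x|?M. \<bar>u (x e)\<bar> * (\<bar>H x\<bar> * (g x)\<^sup>2)))"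
   using PJ.bdd_rv_integrable[OF bdd_rv_mult[OF co[OF bY(1)] bH(1)]] PJ.bdd_rv_integrable[OF bdd_rv_mult[OF co[OF bY(2)] bH(2)]]
    PJ.bdd_rv_integrable[OF bdd_rv_mult[OF co[OF bY(1)] bH(2)]] PJ.bdd_rv_integrable[OF bdd_rv_mult[OF co[OF bY(2)] bH(3)]]
   by simp
  also have "... = (\<bar>th\<bar> * c0 + th\<^sup>2 * c1) * (E (%t. \<bar>z t\<bar>) * EE (%x. \<bar>H x\<bar>) + E (%t. \<bar>u t\<bar>) * EE (%x. \<bar>H x * g x\<bar>))
    + th\<^sup>2 * c2 * (E (%t. \<bar>z t\<bar>) * EE (%x. \<bar>H x * g x\<bar>) + E (%t. \<bar>u t\<bar>) * EE (%x. \<bar>H x\<bar> * (g x)\<^sup>2))"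
   using split[OF bY(1) bH(1) fH(1)] split[OF bY(2) bH(2) fH(2)] split[OF bY(1) bH(2) fH(2)] split[OF bY(2) bH(3) fH(3)]
   by (simp add: E_def EE_def)
  finally show ?thesis by (simp add: c0_def c1_def c2_def algebra_simps)
 qed
 have "cmod ((LINT x|?M. Y (x e) * H x * iexp (th * S x)) - (LINT x|?M. iexp (th * S x) * K x)) \<le>
   cmod ((LINT x|?M. Y (x e) * H x * iexp (th * S x)) - (LINT x|?M. iexp (th * S0 x) * H x * (Y (x e) * (1 + \<i> * (th * w x)))))
   + cmod ((LINT x|?M. iexp (th * S0 x) * K x) - (LINT x|?M. iexp (th * S x) * K x))"
  unfolding main by (rule order.trans[OF _ norm_triangle_ineq]) simp
 with err1 err2 show ?thesis unfolding K_def by linarith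
qed

section \<open>Path products of independent edge variables\<close>

definition used_edges :: "'v list list => 'v set set" where
 "used_edges \<Gamma> = (\<Union>r\<in>set \<Gamma>. set (steps r))"

lemma finite_used_edges: "finite (used_edges \<Gamma>)"
 by (simp add: used_edges_def)

lemma card_used_edges: "card (used_edges \<Gamma>) <= sum_list (map length \<Gamma>)"
proof (induction \<Gamma>)
 case (Cons r \<Gamma>)
 have "card (used_edges (r # \<Gamma>)) <= card (set (steps r)) + card (used_edges \<Gamma>)"
  unfolding used_edges_def by (simp add: card_Un_le)
 also have "card (set (steps r)) <= length r"
  using card_length[of "steps r"] by (simp add: length_steps)
 finally show ?case using Cons by simp
qed (simp add: used_edges_def)

lemma power_card_used_edges_Cons:
 assumes "distinct r"
 shows "q ^ card (used_edges (r # \<Gamma>)) = q ^ card (used_edges \<Gamma>) * wt q (used_edges \<Gamma>) r"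
proof -
 have "used_edges (r # \<Gamma>) = used_edges \<Gamma> \<union> (set (steps r) - used_edges \<Gamma>)"
  by (auto simp: used_edges_def)
 then have "card (used_edges (r # \<Gamma>)) = card (used_edges \<Gamma>) + card (set (steps r) - used_edges \<Gamma>)"
  by (metis Diff_disjoint List.finite_set card_Un_disjoint finite_Diff finite_used_edges)
 then show ?thesis by (simp add: wt_eq_power[OF assms] power_add)
qed

lemma prod_near_power:
 fixes x :: "'i => real"
 assumes "finite A" "\<And>i. i \<in> A ==> \<bar>x i - b\<bar> <= \<eta> * b" "0 <= b" "0 <= \<eta>"
 shows "\<bar>(\<Prod>i\<in>A. x i) - b ^ card A\<bar> <= b ^ card A * ((1 + \<eta>) ^ card A - 1)"
 using assms(1,2)
proof (induction A)
 case (insert i A)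
 let ?X = "\<Prod>i\<in>A. x i" and ?B = "b ^ card A" and ?r = "(1 + \<eta>) ^ card A"
 have IH: "\<bar>?X - ?B\<bar> <= ?B * (?r - 1)" using insert by auto
 have "0 <= ?B" using assms(3) by simp
 with IH have "\<bar>?X\<bar> <= ?B * ?r" unfolding right_diff_distrib by linarith
 then have "\<bar>(x i - b) * ?X\<bar> <= (\<eta> * b) * (?B * ?r)"
  unfolding abs_mult using insert.prems assms by (intro mult_mono) auto
 moreover have "\<bar>b * (?X - ?B)\<bar> <= b * (?B * (?r - 1))"
  unfolding abs_mult using IH assms(3) by (simp add: mult_left_mono)
 moreover have "x i * ?X - b * ?B = (x i - b) * ?X + b * (?X - ?B)" by (simp add: algebra_simps)
 ultimately have "\<bar>x i * ?X - b * ?B\<bar> <= (\<eta> * b) * (?B * ?r) + b * (?B * (?r - 1))" by linarith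
 then show ?case using insert by (simp add: algebra_simps)
qed simp

lemma one_plus_power_le:
 fixes \<eta> :: real
 assumes "0 <= \<eta>" "\<eta> <= 1"
 shows "(1 + \<eta>) ^ j - 1 <= (2 ^ j - 1) * \<eta>"
proof (induction j)
 case (Suc j)
 have "(1 + \<eta>) ^ Suc j <= (1 + \<eta>) * (1 + (2 ^ j - 1) * \<eta>)"
  using Suc assms by (simp add: mult_left_mono)
 also have "... = 1 + 2 ^ j * \<eta> + (2 ^ j - 1) * (\<eta> * \<eta>)" by (simp add: algebra_simps)
 also have "... <= 1 + 2 ^ j * \<eta> + (2 ^ j - 1) * \<eta>"
  using assms by (intro add_left_mono mult_left_mono) (auto simp: mult_left_le)
 finally show ?case by (simp add: algebra_simps)
qed simp

text \<open>A system of independent variables on the edges (two-element sets) and loops (singletons) of the complete graph on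
\<open>V\<close>. With \<open>\<kappa> = 0\<close> it describes the null law and with \<open>\<kappa> = 1\<close> the law tilted by a fixed spin vector, after the
signs have been absorbed into \<open>\<beta>\<close>: tilting by \<open>1 + \<zeta> + \<beta>\<close> shifts the mean of \<open>\<beta>\<close> by its variance \<open>b\<close> and that of \<open>\<zeta>\<close> by
its variance. In the intended scaling \<open>b\<close> and \<open>d\<close> are of order \<open>1 / n\<close> and \<open>a\<close> of order \<open>1 / n^2\<close>. The cutoff \<open>L\<close> is the largest cycle length that is
taken into account.\<close>
locale edge_field =
 fixes V :: "'v set" and \<nu> :: "'v set => 't measure" and \<zeta> \<beta> :: "'v set => 't => real"
  and \<kappa> a b d \<epsilon> \<eta> \<Lambda> :: real and L :: nat
 assumes finV: "finite V" and V2: "card V >= 2"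
  and prob: "\<And>e. prob_space (\<nu> e)"
  and meas: "\<And>e. \<zeta> e \<in> borel_measurable (\<nu> e)" "\<And>e. \<beta> e \<in> borel_measurable (\<nu> e)"
  and zeta_le: "\<And>e t. \<bar>\<zeta> e t\<bar> <= \<epsilon>" "\<And>e t. card e = 2 ==> \<bar>\<zeta> e t\<bar> <= \<eta>"
  and beta_le: "\<And>e t. \<bar>\<beta> e t\<bar> <= \<epsilon>"
  and small: "0 <= \<eta>" "\<eta> <= \<epsilon>" "\<epsilon> <= 1"
  and kappa: "\<kappa> = 0 \<or> \<kappa> = 1"
  and scale: "0 <= a" "0 <= b" "0 <= d" "real (card V) * b <= 1" "real (card V) ^ 2 * a <= \<Lambda>"
   "real (card V) * d <= \<Lambda>" "1 <= \<Lambda>"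
  and edge_moments: "\<And>e. e \<subseteq> V ==> card e = 2 ==> (LINT t|\<nu> e. \<beta> e t) = \<kappa> * b"
   "\<And>e. e \<subseteq> V ==> card e = 2 ==> \<bar>(LINT t|\<nu> e. (\<beta> e t)\<^sup>2) - b\<bar> <= \<eta> * b"
   "\<And>e. e \<subseteq> V ==> card e = 2 ==> (LINT t|\<nu> e. \<zeta> e t) = \<kappa> * a"
   "\<And>e. e \<subseteq> V ==> card e = 2 ==> \<bar>(LINT t|\<nu> e. (\<zeta> e t)\<^sup>2) - a\<bar> <= \<eta> * a"
   "\<And>e. e \<subseteq> V ==> card e = 2 ==> \<bar>(LINT t|\<nu> e. \<zeta> e t * \<beta> e t)\<bar> <= \<eta> * b"
  and loop_moments: "\<And>e. e \<subseteq> V ==> card e = 1 ==> (LINT t|\<nu> e. \<zeta> e t) = \<kappa> * d"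
   "\<And>e. e \<subseteq> V ==> card e = 1 ==> \<bar>(LINT t|\<nu> e. (\<zeta> e t)\<^sup>2) - d\<bar> <= \<epsilon> * d"
begin

abbreviation "n \<equiv> real (card V)"
definition "q = 2 * b"
definition "J = {e. e \<subseteq> V \<and> (card e = 1 \<or> card e = 2)}"
definition "M = PiM J \<nu>"
definition P :: "'v list => ('v set => 't) => real" where "P r x = pprod (%e. \<beta> e (x e)) r"
definition "D = (\<Union>k\<in>{3..L}. dpaths V k)"
definition "Dxy x y = {r \<in> D. hd r = y \<and> last r = x}"
definition "K = real L * ((8 * (real L)\<^sup>2 + real L + 1) * (4 * real L + 2) ^ L)"

lemma finJ: "finite J"
 unfolding J_def by (rule finite_subset[of _ "Pow V"]) (auto simp: finV)

lemma path_in_J: "distinct r ==> set r \<subseteq> V ==> set (steps r) \<subseteq> J"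
 unfolding J_def using steps_edge[of _ r] steps_card[of r] by blast

sublocale PM: prob_space M
 unfolding M_def by (intro prob_space_PiM prob)

lemma bdd_beta: "bdd_rv (\<nu> e) (\<beta> e)" and bdd_zeta: "bdd_rv (\<nu> e) (\<zeta> e)"
 using meas beta_le[of e] zeta_le(1)[of e] by (auto intro!: bdd_rvI[of _ _ \<epsilon>])

lemma bdd_beta_coord: "e \<in> J ==> bdd_rv M (%x. \<beta> e (x e))"
 and bdd_zeta_coord: "e \<in> J ==> bdd_rv M (%x. \<zeta> e (x e))"
 unfolding M_def using bdd_rv_coord[of e J \<nu> "\<beta> e"] bdd_rv_coord[of e J \<nu> "\<zeta> e"] bdd_beta bdd_zeta by auto

lemma q_bounds: "0 <= q" "q <= 1" "n * q <= 2" "n >= 2" "b * n <= 1"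
proof -
 show n: "n >= 2" using V2 by simp
 have "2 * b <= n * b" using n scale(2) by (rule mult_right_mono)
 then show "q <= 1" using scale unfolding q_def by linarith
qed (use scale in \<open>auto simp: algebra_simps q_def\<close>)

text \<open>The mean of \<open>\<beta>\<close> is at most \<open>b\<close>, and every higher moment is dominated by the second one, which is at most
\<open>(1 + \<eta>) * b\<close>; both are at most \<open>q\<close>. Thus an edge costs one factor \<open>q\<close> irrespective of how often it is used.\<close>
lemma beta_moment_le:
 assumes "e \<subseteq> V" "card e = 2" "m >= 1"
 shows "\<bar>(LINT t|\<nu> e. \<beta> e t ^ m)\<bar> <= q"
proof (cases "m = 1")
 case True
 then show ?thesis using edge_moments(1)[OF assms(1,2)] kappa scale by (auto simp: q_def)
next
 case False
 interpret Pe: prob_space "\<nu> e" by (rule prob)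
 have "\<bar>(LINT t|\<nu> e. \<beta> e t ^ m)\<bar> <= (LINT t|\<nu> e. \<bar>\<beta> e t ^ m\<bar>)" by (rule integral_abs_bound)
 also have "... <= (LINT t|\<nu> e. (\<beta> e t)\<^sup>2)"
 proof (rule integral_mono)
  fix t
  have "\<bar>\<beta> e t\<bar> <= 1" using beta_le[of e t] small by linarith
  then have "\<bar>\<beta> e t\<bar> ^ m <= \<bar>\<beta> e t\<bar> ^ 2" using False assms(3) by (intro power_decreasing) auto
  then show "\<bar>\<beta> e t ^ m\<bar> <= (\<beta> e t)\<^sup>2" by (simp add: power_abs)
 qed (auto intro!: Pe.bdd_rv_integrable bdd_beta)
 also have "... <= b + \<eta> * b" using edge_moments(2)[OF assms(1,2)] by linarith
 also have "... <= q" using small scale mult_right_mono[of \<eta> 1 b] by (auto simp: q_def)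
 finally show ?thesis .
qed

lemma expect_prod:
 fixes f :: "'v set => 't => real"
 assumes "A \<subseteq> J" "\<And>e. e \<in> A ==> bdd_rv (\<nu> e) (f e)"
 shows "(LINT x|M. (\<Prod>e\<in>A. f e (x e))) = (\<Prod>e\<in>A. (LINT t|\<nu> e. f e t))"
proof -
 interpret P: product_sigma_finite \<nu>
  using prob by (simp add: product_sigma_finite_def prob_space_imp_sigma_finite)
 define g where "g e t = (if e \<in> A then f e t else 1)" for e t
 have "(LINT x|M. (\<Prod>e\<in>A. f e (x e))) = (LINT x|M. (\<Prod>e\<in>J. g e (x e)))"
  unfolding g_def using assms(1) finJ
  by (intro Bochner_Integration.integral_cong refl prod.mono_neutral_cong_left) auto
 also have "... = (\<Prod>e\<in>J. (LINT t|\<nu> e. g e t))"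
  unfolding M_def
 proof (rule P.product_integral_prod[OF finJ])
  fix e
  interpret Pe: prob_space "\<nu> e" by (rule prob)
  show "integrable (\<nu> e) (g e)"
   unfolding g_def using assms(2) by (cases "e \<in> A") (auto intro!: Pe.bdd_rv_integrable)
 qed
 also have "... = (\<Prod>e\<in>A. (LINT t|\<nu> e. f e t))"
  using assms(1) finJ prob
  by (intro prod.mono_neutral_cong_right) (auto simp: g_def prob_space.prob_space)
 finally show ?thesis .
qed

lemma P_eq_prod: "distinct r ==> P r x = (\<Prod>e\<in>set (steps r). \<beta> e (x e))"
 by (simp add: P_def pprod_def prod.distinct_set_conv_list distinct_steps)

lemma bdd_P: "distinct r ==> set r \<subseteq> V ==> bdd_rv M (P r)"
proof -
 assume a: "distinct r" "set r \<subseteq> V"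
 have "P r = (%x. \<Prod>e\<in>set (steps r). \<beta> e (x e))" using P_eq_prod[OF a(1)] by (intro ext)
 then show "bdd_rv M (P r)"
  using path_in_J[OF a] by (auto intro!: bdd_rv_prod bdd_beta_coord)
qed

lemma bdd_P_dpaths: "r \<in> dpaths V k ==> bdd_rv M (P r)" "r \<in> D ==> bdd_rv M (P r)" "r \<in> Dxy x y ==> bdd_rv M (P r)"
 by (auto simp: D_def Dxy_def dpaths_def intro!: bdd_P)

text \<open>The expectation of a product of path weights is small as soon as many different edges are used,
 however often each of them is used.\<close>

text \<open>The combinatorial core: by independence the expectation is a product over the edges that occur, and each of them
contributes at most \<open>q\<close>. Since \<open>n * q\<close> is bounded, every vertex that is not forced costs nothing, and what remains is to count the vertices that are not compensated by an edge.\<close>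
lemma expect_paths:
 assumes "\<And>r. r \<in> set \<Gamma> ==> distinct r \<and> set r \<subseteq> V"
 shows "\<bar>(LINT x|M. prod_list (map (%r. P r x) \<Gamma>))\<bar> <= q ^ card (used_edges \<Gamma>)"
proof -
 let ?m = "%e. length (filter (%r. e \<in> set (steps r)) \<Gamma>)"
 have sub: "used_edges \<Gamma> \<subseteq> J"
  unfolding used_edges_def using assms path_in_J by blast
 have "prod_list (map (%r. P r x) \<Gamma>) = (\<Prod>e\<in>used_edges \<Gamma>. \<beta> e (x e) ^ ?m e)" for x
  unfolding P_def[abs_def] using assms
  by (intro prod_list_pprod finite_used_edges) (auto simp: used_edges_def)
 then have "(LINT x|M. prod_list (map (%r. P r x) \<Gamma>)) = (\<Prod>e\<in>used_edges \<Gamma>. (LINT t|\<nu> e. \<beta> e t ^ ?m e))"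
  using expect_prod[OF sub, of "%e t. \<beta> e t ^ ?m e"] by (simp add: bdd_rv_power bdd_beta)
 also have "\<bar>...\<bar> <= (\<Prod>e\<in>used_edges \<Gamma>. q)"
  unfolding abs_prod
 proof (rule prod_mono, safe)
  fix e assume e: "e \<in> used_edges \<Gamma>"
  then have "filter (%r. e \<in> set (steps r)) \<Gamma> \<noteq> []" by (auto simp: used_edges_def filter_empty_conv)
  then have "?m e >= 1" by (simp add: Suc_le_eq)
  moreover have "e \<subseteq> V \<and> card e = 2" using e assms steps_edge steps_card
   unfolding used_edges_def by blast
  ultimately show "\<bar>(LINT t|\<nu> e. \<beta> e t ^ ?m e)\<bar> <= q" by (intro beta_moment_le) auto
 qed auto
 finally show ?thesis by simp
qed

lemma dpaths_subset_walks: "dpaths V k \<subseteq> walks V k"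
 by (auto simp: dpaths_def walks_def)

lemma sum_D: "(\<Sum>r\<in>D. f r) = (\<Sum>k\<in>{3..L}. \<Sum>r\<in>dpaths V k. f r)"
 unfolding D_def by (rule sum.UNION_disjoint) (simp_all add: finite_dpaths finV, auto simp: dpaths_def)

lemma sum_Dxy: "(\<Sum>r\<in>Dxy x y. f r) = (\<Sum>k\<in>{3..L}. \<Sum>r | r \<in> dpaths V k \<and> hd r = y \<and> last r = x. f r)"
proof -
 have "Dxy x y = (\<Union>k\<in>{3..L}. {r. r \<in> dpaths V k \<and> hd r = y \<and> last r = x})"
  by (auto simp: Dxy_def D_def)
 then show ?thesis
  by (simp only:) (rule sum.UNION_disjoint, simp_all add: finite_dpaths finV, auto simp: dpaths_def)
qed

lemma finite_D: "finite D" "finite (Dxy x y)"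
 by (auto simp: D_def Dxy_def finite_dpaths finV)

lemma K_nonneg: "0 <= K" by (auto simp: K_def)

lemma sum_over_lengths:
 assumes "\<And>k. 3 <= k ==> k <= L ==> f k <= c" "0 <= (c::real)"
 shows "(\<Sum>k\<in>{3..L}. f k) <= real L * c"
proof -
 have "(\<Sum>k\<in>{3..L}. f k) <= (\<Sum>k\<in>{3..L}. c)" using assms by (intro sum_mono) auto
 also have "... = real (card {3..L}) * c" by simp
 also have "... <= real L * c" using assms(2) by (intro mult_right_mono) auto
 finally show ?thesis .
qed

context
 fixes F :: "'v set set"
 assumes F: "finite F" "card F <= 4 * L"
begin

interpretation walk_weights V F q
 by unfold_locales (use F finV q_bounds in auto)

abbreviation (input) "B \<equiv> (4 * real L + 2) ^ L"

lemma w_power: "k <= L ==> w ^ (k - 1) <= B"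
proof -
 assume k: "k <= L"
 have "w <= 4 * real L + 2" using of_nat_mono[OF F(2), where 'a = real] by simp
 then have "w ^ (k - 1) <= (4 * real L + 2) ^ (k - 1)" by (intro power_mono) auto
 also have "... <= B" using k by (intro power_increasing) auto
 finally show ?thesis .
qed

lemma K_ge: "c <= 8 * (real L)\<^sup>2 + real L + 1 ==> real L * (c * B) <= K"
 unfolding K_def by (intro mult_left_mono mult_right_mono) auto

lemma sum_D_le: "(\<Sum>r\<in>D. wt q F r) <= K * n"
proof -
 have "(\<Sum>r\<in>D. wt q F r) <= real L * (n * B)"
  unfolding sum_D
 proof (rule sum_over_lengths)
  fix k assume k: "3 <= k" "k <= L"
  have "(\<Sum>r\<in>dpaths V k. wt q F r) <= (\<Sum>r\<in>walks V (Suc (k - 1)). wt q F r)"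
   using k dpaths_subset_walks[of k] finV q_bounds
   by (intro sum_mono2 finite_walks wt_nonneg) auto
  also have "... <= n * w ^ (k - 1)" by (rule sum_wt_all)
  also have "... <= n * B" using w_power k by (intro mult_left_mono) auto
  finally show "(\<Sum>r\<in>dpaths V k. wt q F r) <= n * B" .
 qed auto
 also have "... = real L * (1 * B) * n" by simp
 also have "... <= K * n" by (intro mult_right_mono K_ge) auto
 finally show ?thesis .
qed

lemma sum_fixed_ends:
 assumes "k >= 1"
 shows "(\<Sum>r | r \<in> dpaths V k \<and> hd r = y \<and> last r = x \<and> Q r. wt q F r) \<le>
  (\<Sum>v | v \<in> walks V (k - 1) \<and> last (y # v) = x \<and> Q (y # v). wt q F (y # v))"
proof -
 have "(\<Sum>r | r \<in> dpaths V k \<and> hd r = y \<and> last r = x \<and> Q r. wt q F r) \<le>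
  (\<Sum>r\<in>(#) y ` {v. v \<in> walks V (k - 1) \<and> last (y # v) = x \<and> Q (y # v)}. wt q F r)"
 proof (rule sum_mono2)
  show "{r. r \<in> dpaths V k \<and> hd r = y \<and> last r = x \<and> Q r} \<subseteq>
    (#) y ` {v. v \<in> walks V (k - 1) \<and> last (y # v) = x \<and> Q (y # v)}"
  proof
   fix r assume g: "r \<in> {r. r \<in> dpaths V k \<and> hd r = y \<and> last r = x \<and> Q r}"
   then obtain v where "r = y # v" using assms by (cases r) (auto simp: dpaths_def)
   with g show "r \<in> (#) y ` {v. v \<in> walks V (k - 1) \<and> last (y # v) = x \<and> Q (y # v)}"
    by (intro image_eqI[of _ _ v]) (auto simp: dpaths_def walks_def)
  qed
 qed (auto simp: finite_walks finV intro!: wt_nonneg q_bounds)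
 also have "... = (\<Sum>v | v \<in> walks V (k - 1) \<and> last (y # v) = x \<and> Q (y # v). wt q F (y # v))"
  by (subst sum.reindex) auto
 finally show ?thesis .
qed

lemma sum_Dxy_le: "(\<Sum>r\<in>Dxy x y. wt q F r) <= K"
proof -
 have "(\<Sum>r\<in>Dxy x y. wt q F r) <= real L * (1 * B)"
  unfolding sum_Dxy
 proof (rule sum_over_lengths)
  fix k assume k: "3 <= k" "k <= L"
  have "(\<Sum>r | r \<in> dpaths V k \<and> hd r = y \<and> last r = x. wt q F r) <= w ^ (k - 1)"
   using sum_fixed_ends[of k y x "%_. True"] sum_wt_to_le[of y "k - 1" x] k by simp
  also have "... <= B" using w_power k by auto
  finally show "(\<Sum>r | r \<in> dpaths V k \<and> hd r = y \<and> last r = x. wt q F r) <= 1 * B" by simp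
 qed auto
 also have "... <= K" by (rule K_ge) simp
 finally show ?thesis .
qed

lemma sum_Dxy_new_le: "(\<Sum>r | r \<in> Dxy x y \<and> \<not> set (steps r) \<subseteq> F. wt q F r) <= K * q"
proof -
 have "(\<Sum>r | r \<in> Dxy x y \<and> \<not> set (steps r) \<subseteq> F. wt q F r) =
   (\<Sum>r\<in>Dxy x y. if \<not> set (steps r) \<subseteq> F then wt q F r else 0)"
  by (rule sum.mono_neutral_cong_left) (auto simp: finite_D)
 also have "... = (\<Sum>k\<in>{3..L}. \<Sum>r | r \<in> dpaths V k \<and> hd r = y \<and> last r = x.
   if \<not> set (steps r) \<subseteq> F then wt q F r else 0)"
  by (rule sum_Dxy)
 also have "... <= real L * (real L * q * B)"
 proof (rule sum_over_lengths)
  fix k assume k: "3 <= k" "k <= L"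
  have "(\<Sum>r | r \<in> dpaths V k \<and> hd r = y \<and> last r = x. if \<not> set (steps r) \<subseteq> F then wt q F r else 0)
   = (\<Sum>r | r \<in> dpaths V k \<and> hd r = y \<and> last r = x \<and> \<not> set (steps r) \<subseteq> F. wt q F r)"
   by (rule sum.mono_neutral_cong_right) (auto simp: finite_dpaths finV)
  also have "... <= real (k - 1) * q * w ^ (k - 1)"
   using sum_fixed_ends[of k y x "%r. \<not> set (steps r) \<subseteq> F"] sum_wt_new[of y "k - 1" x] k by simp
  also have "... <= real L * q * B"
   using w_power[of k] k q_bounds by (intro mult_mono) auto
  finally show "(\<Sum>r | r \<in> dpaths V k \<and> hd r = y \<and> last r = x. if \<not> set (steps r) \<subseteq> F then wt q F r else 0)
   <= real L * q * B" .
 qed (use q_bounds in auto)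
 also have "... = real L * (real L * B) * q" by simp
 also have "... <= K * q" using q_bounds by (intro mult_right_mono K_ge) auto
 finally show ?thesis .
qed

lemma sum_D_old_le: "(\<Sum>r | r \<in> D \<and> set (steps r) \<inter> F \<noteq> {}. wt q F r) <= K"
proof -
 let ?Q = "%r. set (steps r) \<inter> F \<noteq> {}"
 have "(\<Sum>r | r \<in> D \<and> ?Q r. wt q F r) = (\<Sum>r\<in>D. if ?Q r then wt q F r else 0)"
  by (rule sum.mono_neutral_cong_left) (auto simp: finite_D)
 also have "... = (\<Sum>k\<in>{3..L}. \<Sum>r\<in>dpaths V k. if ?Q r then wt q F r else 0)"
  by (rule sum_D)
 also have "... <= real L * (real L * (2 * (4 * real L)) * B)"
 proof (rule sum_over_lengths)
  fix k assume k: "3 <= k" "k <= L"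
  have "(\<Sum>r\<in>dpaths V k. if ?Q r then wt q F r else 0) = (\<Sum>r | r \<in> dpaths V k \<and> ?Q r. wt q F r)"
   by (rule sum.mono_neutral_cong_right) (auto simp: finite_dpaths finV)
  also have "... <= (\<Sum>r | r \<in> walks V (Suc (k - 1)) \<and> ?Q r. wt q F r)"
   using k dpaths_subset_walks[of k] finV q_bounds finite_walks[OF finV]
   by (intro sum_mono2 wt_nonneg) auto
  also have "... <= real ((k - 1) * (2 * card F)) * w ^ (k - 1)" by (rule sum_wt_old)
  also have "... <= real L * (2 * (4 * real L)) * B"
  proof -
   have "(k - 1) * (2 * card F) <= L * (2 * (4 * L))" using k F by (intro mult_mono) auto
   then have "real ((k - 1) * (2 * card F)) <= real L * (2 * (4 * real L))"
    by (metis (mono_tags) of_nat_le_iff of_nat_mult of_nat_numeral)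
   then show ?thesis using w_power[of k] k by (intro mult_mono) auto
  qed
  finally show "(\<Sum>r\<in>dpaths V k. if ?Q r then wt q F r else 0) <= real L * (2 * (4 * real L)) * B" .
 qed auto
 also have "... <= K" by (rule K_ge) (simp add: power2_eq_square)
 finally show ?thesis .
qed

end

end

section \<open>Moments and concentration of path sums\<close>

context edge_field
begin

definition "Gk k x y om = (\<Sum>r | r \<in> dpaths V k \<and> hd r = y \<and> last r = x. P r om)"
definition "G x y om = (\<Sum>r\<in>Dxy x y. P r om)"
definition "pairs = {(x, y). x \<in> V \<and> y \<in> V \<and> x \<noteq> y}"
definition "U m k om = b * (\<Sum>r\<in>dpaths V k. P r om ^ m)"
definition "Off k om = b * (\<Sum>r\<in>dpaths V k. \<Sum>r'\<in>Dxy (last r) (hd r) - {r}. P r om * P r' om)"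
definition "vk k = real (card (dpaths V k)) * b ^ k"
definition "vc = (\<Sum>k\<in>{3..L}. 1 / (2 * real k) * vk k)"

lemma DD: "r \<in> D ==> distinct r \<and> set r \<subseteq> V \<and> length r <= L \<and> length r >= 3"
 by (auto simp: D_def dpaths_def)

lemma dpaths_D: "3 <= k ==> k <= L ==> dpaths V k \<subseteq> D"
 by (auto simp: D_def)

lemma Dxy_D: "r \<in> Dxy x y ==> r \<in> D"
 by (simp add: Dxy_def)

lemma D_steps: "r \<in> D ==> steps r \<noteq> []"
 using DD[of r] length_steps[of r] by auto

lemma card_used_le:
 assumes "set \<Gamma> \<subseteq> D" "length \<Gamma> <= 4"
 shows "card (used_edges \<Gamma>) <= 4 * L"
proof -
 have "sum_list (map length \<Gamma>) <= sum_list (map (%_. L) \<Gamma>)"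
  using assms DD by (intro sum_list_mono) auto
 also have "... <= 4 * L" using assms by (simp add: sum_list_triv)
 finally show ?thesis using card_used_edges[of \<Gamma>] by linarith
qed

lemma nested_ends:
 assumes "set \<Gamma> \<subseteq> D" "length \<Gamma> <= 4"
 shows "(\<Sum>r\<in>Dxy x y. q ^ card (used_edges (r # \<Gamma>))) <= q ^ card (used_edges \<Gamma>) * K"
proof -
 have "(\<Sum>r\<in>Dxy x y. q ^ card (used_edges (r # \<Gamma>))) = q ^ card (used_edges \<Gamma>) * (\<Sum>r\<in>Dxy x y. wt q (used_edges \<Gamma>) r)"
  unfolding sum_distrib_left using DD Dxy_D by (intro sum.cong refl power_card_used_edges_Cons) auto
 also have "... <= q ^ card (used_edges \<Gamma>) * K"
  using q_bounds(1) by (intro mult_left_mono sum_Dxy_le finite_used_edges card_used_le assms) auto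
 finally show ?thesis .
qed

lemma nested_free:
 assumes "set \<Gamma> \<subseteq> D" "length \<Gamma> <= 4"
 shows "(\<Sum>r\<in>D. q ^ card (used_edges (r # \<Gamma>))) <= q ^ card (used_edges \<Gamma>) * (K * n)"
proof -
 have "(\<Sum>r\<in>D. q ^ card (used_edges (r # \<Gamma>))) = q ^ card (used_edges \<Gamma>) * (\<Sum>r\<in>D. wt q (used_edges \<Gamma>) r)"
  unfolding sum_distrib_left using DD by (intro sum.cong refl power_card_used_edges_Cons) auto
 also have "... <= q ^ card (used_edges \<Gamma>) * (K * n)"
  using q_bounds(1) by (intro mult_left_mono sum_D_le finite_used_edges card_used_le assms) auto
 finally show ?thesis .
qed

lemma nested_meet:
 assumes "set \<Gamma> \<subseteq> D" "length \<Gamma> <= 4"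
 shows "(\<Sum>r | r \<in> D \<and> set (steps r) \<inter> used_edges \<Gamma> \<noteq> {}. q ^ card (used_edges (r # \<Gamma>)))
   <= q ^ card (used_edges \<Gamma>) * K"
proof -
 have "(\<Sum>r | r \<in> D \<and> set (steps r) \<inter> used_edges \<Gamma> \<noteq> {}. q ^ card (used_edges (r # \<Gamma>))) =
   q ^ card (used_edges \<Gamma>) * (\<Sum>r | r \<in> D \<and> set (steps r) \<inter> used_edges \<Gamma> \<noteq> {}. wt q (used_edges \<Gamma>) r)"
  unfolding sum_distrib_left using DD by (intro sum.cong refl power_card_used_edges_Cons) auto
 also have "... <= q ^ card (used_edges \<Gamma>) * K"
  using q_bounds(1) by (intro mult_left_mono sum_D_old_le finite_used_edges card_used_le assms) auto
 finally show ?thesis .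
qed

lemma nested_other:
 assumes "r1 \<in> D"
 shows "(\<Sum>r\<in>Dxy (last r1) (hd r1) - {r1}. q ^ card (used_edges [r, r1])) <= q ^ card (used_edges [r1]) * (K * q)"
proof -
 let ?F = "used_edges [r1]" and ?D = "Dxy (last r1) (hd r1)"
 have "\<not> set (steps r) \<subseteq> ?F" if "r \<in> ?D - {r1}" for r
 proof
  assume "set (steps r) \<subseteq> ?F"
  then have "r = r1"
   using that assms DD[of r] DD[of r1] by (intro path_unique) (auto simp: Dxy_def used_edges_def)
  with that show False by simp
 qed
 then have "(\<Sum>r\<in>?D - {r1}. q ^ card (used_edges [r, r1])) \<le>
   (\<Sum>r | r \<in> ?D \<and> \<not> set (steps r) \<subseteq> ?F. q ^ card (used_edges [r, r1]))"
  using q_bounds(1) by (intro sum_mono2) (auto simp: finite_D)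
 also have "... = q ^ card ?F * (\<Sum>r | r \<in> ?D \<and> \<not> set (steps r) \<subseteq> ?F. wt q ?F r)"
  unfolding sum_distrib_left using DD Dxy_D by (intro sum.cong refl power_card_used_edges_Cons) auto
 also have "... <= q ^ card ?F * (K * q)"
  using q_bounds(1) assms by (intro mult_left_mono sum_Dxy_new_le finite_used_edges card_used_le) auto
 finally show ?thesis .
qed

lemma single_ends: "(\<Sum>r\<in>Dxy x y. q ^ card (used_edges [r])) <= K * q"
proof -
 have "(\<Sum>r\<in>Dxy x y. q ^ card (used_edges [r])) = (\<Sum>r | r \<in> Dxy x y \<and> \<not> set (steps r) \<subseteq> {}. wt q {} r)"
 proof (rule sum.cong)
  show "Dxy x y = {r. r \<in> Dxy x y \<and> \<not> set (steps r) \<subseteq> {}}"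
   using Dxy_D D_steps by auto
  fix r assume "r \<in> {r. r \<in> Dxy x y \<and> \<not> set (steps r) \<subseteq> {}}"
  then have "distinct r" using DD Dxy_D by blast
  then show "q ^ card (used_edges [r]) = wt q {} r"
   using power_card_used_edges_Cons[of r q "[]"] by (simp add: used_edges_def)
 qed
 also have "... <= K * q" by (rule sum_Dxy_new_le) auto
 finally show ?thesis .
qed

lemma single_free: "(\<Sum>r\<in>D. q ^ card (used_edges [r])) <= K * n"
 using nested_free[of "[]"] by (simp add: used_edges_def)

lemma expect_two:
 assumes "r1 \<in> D" "r2 \<in> D"
 shows "(LINT x|M. P r2 x * P r1 x) <= q ^ card (used_edges [r2, r1])"
proof -
 have "\<bar>(LINT x|M. prod_list (map (%r. P r x) [r2, r1]))\<bar> <= q ^ card (used_edges [r2, r1])"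
  using assms DD by (intro expect_paths) auto
 then show ?thesis by simp
qed

lemma expect_four:
 assumes "r1 \<in> D" "r2 \<in> D" "r3 \<in> D" "r4 \<in> D"
 shows "(LINT x|M. P r4 x * (P r3 x * (P r2 x * P r1 x))) <= q ^ card (used_edges [r4, r3, r2, r1])"
proof -
 have "\<bar>(LINT x|M. prod_list (map (%r. P r x) [r4, r3, r2, r1]))\<bar> <= q ^ card (used_edges [r4, r3, r2, r1])"
  using assms DD by (intro expect_paths) auto
 then show ?thesis by simp
qed

lemma bdd_PP: "r \<in> D ==> bdd_rv M (%x. P r x)"
 using bdd_P_dpaths(2)[of r] by simp

lemma second_moment:
 assumes "A \<subseteq> Dxy x y"
 shows "(LINT om|M. (\<Sum>r\<in>A. P r om)\<^sup>2) <= K\<^sup>2 * q"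
proof -
 let ?X = "Dxy x y"
 have A: "A \<subseteq> D" using assms Dxy_D by auto
 have "(LINT om|M. (\<Sum>r\<in>A. P r om)\<^sup>2) = (LINT om|M. (\<Sum>(r2, r1)\<in>A \<times> A. P r2 om * P r1 om))"
  by (simp add: power2_eq_square sum_product sum.cartesian_product)
 also have "... = (\<Sum>(r2, r1)\<in>A \<times> A. (LINT om|M. P r2 om * P r1 om))"
  using A by (subst Bochner_Integration.integral_sum)
   (auto intro!: PM.bdd_rv_integrable bdd_rv_mult bdd_PP simp: case_prod_unfold)
 also have "... = (\<Sum>r2\<in>A. \<Sum>r1\<in>A. (LINT om|M. P r2 om * P r1 om))"
  by (simp add: sum.cartesian_product)
 also have "... = (\<Sum>r1\<in>A. \<Sum>r2\<in>A. (LINT om|M. P r2 om * P r1 om))" by (rule sum.swap)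
 also have "... <= (\<Sum>r1\<in>A. \<Sum>r2\<in>A. q ^ card (used_edges [r2, r1]))"
  using A by (intro sum_mono expect_two) auto
 also have "... <= (\<Sum>r1\<in>?X. \<Sum>r2\<in>?X. q ^ card (used_edges [r2, r1]))"
  using assms q_bounds(1) finite_D
  by (intro order.trans[OF sum_mono2[of ?X A]] sum_mono sum_mono2) (auto intro!: sum_nonneg)
 also have "... <= (\<Sum>r1\<in>?X. q ^ card (used_edges [r1]) * K)"
  using Dxy_D by (intro sum_mono nested_ends) auto
 also have "... <= K * q * K"
  unfolding sum_distrib_right[symmetric] by (intro mult_right_mono single_ends K_nonneg)
 finally show ?thesis by (simp add: power2_eq_square mult_ac)
qed

text \<open>Peeling off the four paths one after the other, each sum over a path with prescribed ends costs a
constant; the first path always consists of new edges and yields the factor \<open>q\<close>.\<close>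
lemma fourth_moment:
 assumes "A \<subseteq> Dxy x y"
 shows "(LINT om|M. (\<Sum>r\<in>A. P r om) ^ 4) <= K ^ 4 * q"
proof -
 let ?X = "Dxy x y"
 have A: "A \<subseteq> D" using assms Dxy_D by auto
 have fA: "finite A" using assms finite_D(2) by (rule finite_subset)
 have "(\<Sum>r\<in>A. P r om) ^ 4 = (\<Sum>r4\<in>A. \<Sum>r3\<in>A. \<Sum>r2\<in>A. \<Sum>r1\<in>A. P r4 om * (P r3 om * (P r2 om * P r1 om)))" for om
 proof -
  define h where "h = (\<Sum>r\<in>A. P r om)"
  have m: "h * X = (\<Sum>r\<in>A. P r om * X)" for X by (simp add: h_def sum_distrib_right)
  have "h ^ 4 = h * (h * (h * h))" by (simp add: power4_eq_xxxx)
  also have "h * h = (\<Sum>r2\<in>A. \<Sum>r1\<in>A. P r2 om * P r1 om)" by (simp add: h_def sum_product)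
  also have "h * ... = (\<Sum>r3\<in>A. \<Sum>r2\<in>A. \<Sum>r1\<in>A. P r3 om * (P r2 om * P r1 om))"
   unfolding m by (simp only: sum_distrib_left)
  also have "h * ... = (\<Sum>r4\<in>A. \<Sum>r3\<in>A. \<Sum>r2\<in>A. \<Sum>r1\<in>A. P r4 om * (P r3 om * (P r2 om * P r1 om)))"
   unfolding m by (simp only: sum_distrib_left)
  finally show ?thesis by (simp add: h_def)
 qed
 then have "(LINT om|M. (\<Sum>r\<in>A. P r om) ^ 4) =
  (LINT om|M. (\<Sum>r4\<in>A. \<Sum>r3\<in>A. \<Sum>r2\<in>A. \<Sum>r1\<in>A. P r4 om * (P r3 om * (P r2 om * P r1 om))))"
  by (simp only:)
 also have "... = (LINT om|M. (\<Sum>(r4, r3, r2, r1)\<in>A\<times>A\<times>A\<times>A. P r4 om * (P r3 om * (P r2 om * P r1 om))))"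
  by (simp add: sum.cartesian_product)
 also have "... = (\<Sum>(r4, r3, r2, r1)\<in>A\<times>A\<times>A\<times>A. (LINT om|M. P r4 om * (P r3 om * (P r2 om * P r1 om))))"
  using A by (subst Bochner_Integration.integral_sum)
   (auto intro!: PM.bdd_rv_integrable bdd_rv_mult bdd_PP simp: case_prod_unfold)
 also have "... <= (\<Sum>(r4, r3, r2, r1)\<in>A\<times>A\<times>A\<times>A. q ^ card (used_edges [r4, r3, r2, r1]))"
  using A by (intro sum_mono) (auto intro!: expect_four)
 also have "... <= (\<Sum>(r4, r3, r2, r1)\<in>?X\<times>?X\<times>?X\<times>?X. q ^ card (used_edges [r4, r3, r2, r1]))"
  using assms q_bounds(1) finite_D(2) by (intro sum_mono2) auto
 also have "... = (\<Sum>(r1, r2, r3, r4)\<in>?X\<times>?X\<times>?X\<times>?X. q ^ card (used_edges [r4, r3, r2, r1]))"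
  by (rule sum.reindex_bij_witness[of _ "%(a,b,c,d). (d,c,b,a)" "%(a,b,c,d). (d,c,b,a)"]) auto
 also have "... = (\<Sum>r1\<in>?X. \<Sum>r2\<in>?X. \<Sum>r3\<in>?X. \<Sum>r4\<in>?X. q ^ card (used_edges [r4, r3, r2, r1]))"
  by (simp add: sum.cartesian_product)
 also have "... <= (\<Sum>r1\<in>?X. \<Sum>r2\<in>?X. \<Sum>r3\<in>?X. q ^ card (used_edges [r3, r2, r1]) * K)"
  using Dxy_D by (intro sum_mono nested_ends) auto
 also have "... = (\<Sum>r1\<in>?X. \<Sum>r2\<in>?X. \<Sum>r3\<in>?X. q ^ card (used_edges [r3, r2, r1])) * K"
  by (simp only: sum_distrib_right)
 also have "... <= (\<Sum>r1\<in>?X. \<Sum>r2\<in>?X. q ^ card (used_edges [r2, r1]) * K) * K"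
  using Dxy_D K_nonneg by (intro sum_mono mult_right_mono nested_ends) auto
 also have "... = (\<Sum>r1\<in>?X. \<Sum>r2\<in>?X. q ^ card (used_edges [r2, r1])) * K * K"
  by (simp only: sum_distrib_right)
 also have "... <= (\<Sum>r1\<in>?X. q ^ card (used_edges [r1]) * K) * K * K"
  using Dxy_D K_nonneg by (intro sum_mono mult_right_mono nested_ends) auto
 also have "... = (\<Sum>r1\<in>?X. q ^ card (used_edges [r1])) * K * K * K"
  by (simp only: sum_distrib_right)
 also have "... <= K * q * K * K * K"
  using K_nonneg by (intro mult_right_mono single_ends) auto
 finally show ?thesis by (simp add: power4_eq_xxxx mult_ac)
qed

lemma bdd_U: "3 <= k ==> k <= L ==> bdd_rv M (%om. U m k om)"
 unfolding U_def by (intro bdd_rv_mult bdd_rv_const bdd_rv_sum bdd_rv_power bdd_P_dpaths)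

lemma bdd_Off: "3 <= k ==> k <= L ==> bdd_rv M (%om. Off k om)"
 unfolding Off_def using dpaths_D[of k] Dxy_D by (intro bdd_rv_mult bdd_rv_const bdd_rv_sum bdd_PP) auto

lemma bdd_G: "bdd_rv M (%om. G x y om)"
 unfolding G_def using Dxy_D by (intro bdd_rv_sum bdd_PP) auto

lemma bdd_Gk: "bdd_rv M (%om. Gk k x y om)"
 unfolding Gk_def by (intro bdd_rv_sum bdd_P_dpaths) auto

text \<open>For two different paths with the same ends the second one uses an edge outside the first, by
\<open>path_unique\<close>, and gains a factor \<open>q\<close> that pays for the sum over the ends.\<close>
lemma Off_second_moment:
 assumes k: "3 <= k" "k <= L"
 shows "(LINT om|M. (Off k om)\<^sup>2) <= K ^ 4 * q"
proof -
 let ?D = "dpaths V k" and ?O = "%r. Dxy (last r) (hd r) - {r}"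
 let ?S = "SIGMA r:?D. ?O r"
 have sub: "?D \<subseteq> D" using k by (rule dpaths_D)
 have fin: "finite ?D" "finite (?O r)" "finite ?S" for r by (auto simp: finite_D finite_dpaths finV)
 have S: "r1 \<in> D \<and> r2 \<in> D" if "(r1, r2) \<in> ?S" for r1 r2 using that sub Dxy_D by auto
 have e: "Off k om = b * (\<Sum>(r1, r2)\<in>?S. P r1 om * P r2 om)" for om
  unfolding Off_def by (subst sum.Sigma) (use fin in auto)
 have sq: "(LINT om|M. (Off k om)\<^sup>2) = b\<^sup>2 * (LINT om|M. (\<Sum>((r1, r2), (r3, r4))\<in>?S\<times>?S. P r4 om * (P r3 om * (P r2 om * P r1 om))))"
  unfolding e power_mult_distrib
  by (simp add: power2_eq_square sum_product sum.cartesian_product case_prod_unfold mult_ac)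
 have "(LINT om|M. (\<Sum>((r1, r2), (r3, r4))\<in>?S\<times>?S. P r4 om * (P r3 om * (P r2 om * P r1 om)))) =
  (\<Sum>((r1, r2), (r3, r4))\<in>?S\<times>?S. (LINT om|M. P r4 om * (P r3 om * (P r2 om * P r1 om))))"
  unfolding case_prod_unfold using S
  by (intro Bochner_Integration.integral_sum PM.bdd_rv_integrable bdd_rv_mult bdd_PP) (auto dest!: S)
 also have "... <= (\<Sum>((r1, r2), (r3, r4))\<in>?S\<times>?S. q ^ card (used_edges [r4, r3, r2, r1]))"
  unfolding case_prod_unfold
 proof (rule sum_mono)
  fix p assume p: "p \<in> ?S \<times> ?S"
  then have m: "(fst (fst p), snd (fst p)) \<in> ?S" "(fst (snd p), snd (snd p)) \<in> ?S"
   by (simp_all only: mem_Times_iff prod.collapse)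
  show "(LINT om|M. P (snd (snd p)) om * (P (fst (snd p)) om * (P (snd (fst p)) om * P (fst (fst p)) om)))
    <= q ^ card (used_edges [snd (snd p), fst (snd p), snd (fst p), fst (fst p)])"
   using S[OF m(1)] S[OF m(2)] by (intro expect_four) blast+
 qed
 also have "... = (\<Sum>r1\<in>?D. \<Sum>r2\<in>?O r1. \<Sum>r3\<in>?D. \<Sum>r4\<in>?O r3. q ^ card (used_edges [r4, r3, r2, r1]))"
 proof -
  have sS: "(\<Sum>x\<in>?D. \<Sum>y\<in>?O x. g x y) = (\<Sum>(x, y)\<in>?S. g x y)" for g :: "_ => _ => real"
   by (rule sum.Sigma) (use fin in auto)
  show ?thesis unfolding sS by (simp only: sum.cartesian_product case_prod_unfold)
 qed
 also have "... <= (\<Sum>r1\<in>?D. \<Sum>r2\<in>?O r1. \<Sum>r3\<in>D. q ^ card (used_edges [r3, r2, r1]) * K)"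
 proof (intro sum_mono)
  fix r1 r2 assume g: "r1 \<in> ?D" "r2 \<in> ?O r1"
  have "(\<Sum>r3\<in>?D. \<Sum>r4\<in>?O r3. q ^ card (used_edges [r4, r3, r2, r1])) \<le>
    (\<Sum>r3\<in>D. \<Sum>r4\<in>Dxy (last r3) (hd r3). q ^ card (used_edges [r4, r3, r2, r1]))"
   using sub finite_D q_bounds(1)
   by (intro order.trans[OF sum_mono2[of D ?D]] sum_mono sum_mono2) (auto intro!: sum_nonneg)
  also have "... <= (\<Sum>r3\<in>D. q ^ card (used_edges [r3, r2, r1]) * K)"
   using g sub Dxy_D by (intro sum_mono nested_ends) auto
  finally show "(\<Sum>r3\<in>?D. \<Sum>r4\<in>?O r3. q ^ card (used_edges [r4, r3, r2, r1])) \<le>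
    (\<Sum>r3\<in>D. q ^ card (used_edges [r3, r2, r1]) * K)" .
 qed
 also have "... = (\<Sum>r1\<in>?D. \<Sum>r2\<in>?O r1. \<Sum>r3\<in>D. q ^ card (used_edges [r3, r2, r1])) * K"
  by (simp only: sum_distrib_right)
 also have "... <= (\<Sum>r1\<in>?D. \<Sum>r2\<in>?O r1. q ^ card (used_edges [r2, r1]) * (K * n)) * K"
  using sub Dxy_D K_nonneg by (intro sum_mono mult_right_mono nested_free) auto
 also have "... = (\<Sum>r1\<in>?D. \<Sum>r2\<in>?O r1. q ^ card (used_edges [r2, r1])) * (K * n) * K"
  by (simp only: sum_distrib_right)
 also have "... <= (\<Sum>r1\<in>?D. q ^ card (used_edges [r1]) * (K * q)) * (K * n) * K"
  using sub K_nonneg by (intro sum_mono mult_right_mono nested_other) auto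
 also have "... <= (\<Sum>r1\<in>D. q ^ card (used_edges [r1]) * (K * q)) * (K * n) * K"
  using sub K_nonneg q_bounds(1) finite_D by (intro mult_right_mono sum_mono2) auto
 also have "... = (\<Sum>r1\<in>D. q ^ card (used_edges [r1])) * (K * q) * (K * n) * K"
  by (simp only: sum_distrib_right)
 also have "... <= (K * n) * (K * q) * (K * n) * K"
  using K_nonneg q_bounds(1) by (intro mult_right_mono single_free) auto
 finally have "(LINT om|M. (Off k om)\<^sup>2) <= b\<^sup>2 * ((K * n) * (K * q) * (K * n) * K)"
  unfolding sq by (rule mult_left_mono) simp
 also have "... = (b * n)\<^sup>2 * (K ^ 4 * q)" by (simp add: power2_eq_square power4_eq_xxxx mult_ac)
 also have "... <= 1 * (K ^ 4 * q)"
  using q_bounds scale K_nonneg by (intro mult_right_mono) (auto intro: power_le_one)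
 finally show ?thesis by simp
qed

text \<open>Path products without a common edge are independent, so only pairs that share an edge contribute to the variance.\<close>
lemma covariance_le:
 assumes "r \<in> D" "r' \<in> D" "m >= 1"
 shows "(LINT om|M. P r' om ^ m * P r om ^ m) - (LINT om|M. P r' om ^ m) * (LINT om|M. P r om ^ m) \<le>
  (if set (steps r') \<inter> used_edges [r] \<noteq> {} then 2 * q ^ card (used_edges [r', r]) else 0)"
proof (cases "set (steps r') \<inter> used_edges [r] = {}")
 case True
 define A B where "A = set (steps r')" and "B = set (steps r)"
 have d: "distinct r" "distinct r'" using DD assms by auto
 have AJ: "A \<subseteq> J" "B \<subseteq> J" using path_in_J DD assms unfolding A_def B_def by blast+
 have dis: "A \<inter> B = {}" "finite A" "finite B" using True by (auto simp: A_def B_def used_edges_def)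
 note ex = expect_prod[of _ "%e t. \<beta> e t ^ m"]
 have p: "P r' om ^ m = (\<Prod>e\<in>A. \<beta> e (om e) ^ m)" "P r om ^ m = (\<Prod>e\<in>B. \<beta> e (om e) ^ m)" for om
  using d by (simp_all add: P_eq_prod A_def B_def prod_power_distrib)
 have "(LINT om|M. P r' om ^ m * P r om ^ m) = (LINT om|M. (\<Prod>e\<in>A \<union> B. \<beta> e (om e) ^ m))"
  using dis by (simp add: p prod.union_disjoint)
 also have "... = (LINT om|M. P r' om ^ m) * (LINT om|M. P r om ^ m)"
 proof -
  have "(LINT om|M. (\<Prod>e\<in>A \<union> B. \<beta> e (om e) ^ m)) = (\<Prod>e\<in>A \<union> B. (LINT t|\<nu> e. \<beta> e t ^ m))"
   using AJ by (intro ex bdd_rv_power bdd_beta) auto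
  then show ?thesis
   using ex[OF AJ(1)] ex[OF AJ(2)] dis by (simp add: p bdd_rv_power bdd_beta prod.union_disjoint)
 qed
 finally show ?thesis using True by simp
next
 case False
 let ?\<Gamma> = "replicate m r' @ replicate m r"
 have d: "distinct r" "distinct r'" "set r \<subseteq> V" "set r' \<subseteq> V" using DD assms by auto
 have u: "used_edges ?\<Gamma> = used_edges [r', r]" "used_edges (replicate m r) = set (steps r)"
  "used_edges (replicate m r') = set (steps r')"
  using assms(3) by (auto simp: used_edges_def)
 have "(LINT om|M. P r' om ^ m * P r om ^ m) <= q ^ card (used_edges [r', r])"
  using expect_paths[of ?\<Gamma>] d unfolding u by (auto simp: prod_list_replicate abs_le_iff split: if_splits)
 moreover have "- ((LINT om|M. P r' om ^ m) * (LINT om|M. P r om ^ m)) <= q ^ card (used_edges [r', r])"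
 proof -
  have 1: "\<bar>(LINT om|M. P r om ^ m)\<bar> <= q ^ card (set (steps r))"
   using expect_paths[of "replicate m r"] d unfolding u by (auto simp: prod_list_replicate)
  have 2: "\<bar>(LINT om|M. P r' om ^ m)\<bar> <= q ^ card (set (steps r'))"
   using expect_paths[of "replicate m r'"] d unfolding u by (auto simp: prod_list_replicate)
  have "\<bar>(LINT om|M. P r' om ^ m) * (LINT om|M. P r om ^ m)\<bar> <= q ^ card (set (steps r')) * q ^ card (set (steps r))"
   unfolding abs_mult using 1 2 q_bounds by (intro mult_mono) auto
  also have "... <= q ^ card (used_edges [r', r])"
   unfolding power_add[symmetric] using q_bounds
   by (intro power_decreasing) (auto simp: used_edges_def card_Un_le)
  finally show ?thesis by linarith
 qed
 ultimately show ?thesis using False by simp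
qed

lemma U_variance:
 assumes k: "3 <= k" "k <= L" and m: "m >= 1"
 shows "(LINT om|M. (U m k om - (LINT om|M. U m k om))\<^sup>2) <= K\<^sup>2 * q"
proof -
 let ?D = "dpaths V k"
 have sub: "?D \<subseteq> D" using k by (rule dpaths_D)
 define X where "X r om = P r om ^ m" for r om
 define c where "c r = (LINT om|M. X r om)" for r
 have bX: "bdd_rv M (%om. X r om)" if "r \<in> D" for r unfolding X_def using that by (intro bdd_rv_power bdd_PP)
 note iX = PM.bdd_rv_integrable[OF bX]
 have EU: "(LINT om|M. U m k om) = b * (\<Sum>r\<in>?D. c r)"
  unfolding U_def c_def X_def[symmetric] using iX sub by (simp add: Bochner_Integration.integral_sum subset_iff)
 have "(U m k om - (LINT om|M. U m k om))\<^sup>2 = b\<^sup>2 * (\<Sum>r\<in>?D. \<Sum>r'\<in>?D. (X r' om - c r') * (X r om - c r))" for om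
 proof -
  have "U m k om - (LINT om|M. U m k om) = b * (\<Sum>r\<in>?D. X r om - c r)"
   unfolding EU by (simp add: U_def X_def sum_subtractf right_diff_distrib)
  then show ?thesis
   by (simp add: power_mult_distrib power2_eq_square sum_product mult.commute)
 qed
 then have sq: "(LINT om|M. (U m k om - (LINT om|M. U m k om))\<^sup>2) =
   b\<^sup>2 * (LINT om|M. (\<Sum>r\<in>?D. \<Sum>r'\<in>?D. (X r' om - c r') * (X r om - c r)))" by simp
 have "(LINT om|M. (\<Sum>r\<in>?D. \<Sum>r'\<in>?D. (X r' om - c r') * (X r om - c r))) =
   (\<Sum>r\<in>?D. \<Sum>r'\<in>?D. (LINT om|M. (X r' om - c r') * (X r om - c r)))"
 proof -
  have i: "integrable M (%om. (X r' om - c r') * (X r om - c r))" if "r \<in> ?D" "r' \<in> ?D" for r r'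
   using that sub by (intro PM.bdd_rv_integrable bdd_rv_mult bdd_rv_diff bX bdd_rv_const) auto
  then show ?thesis by (simp add: Bochner_Integration.integral_sum)
 qed
 also have "... <= (\<Sum>r\<in>?D. \<Sum>r'\<in>?D. (if set (steps r') \<inter> used_edges [r] \<noteq> {} then 2 * q ^ card (used_edges [r', r]) else 0))"
 proof (intro sum_mono)
  fix r r' assume g: "r \<in> ?D" "r' \<in> ?D"
  then have gD: "r \<in> D" "r' \<in> D" using sub by auto
  have i: "integrable M (%om. X r' om * X r om)" by (intro PM.bdd_rv_integrable bdd_rv_mult bX gD)
  have "(LINT om|M. (X r' om - c r') * (X r om - c r)) =
    (LINT om|M. X r' om * X r om - c r' * X r om - c r * X r' om + c r' * c r)"
   by (intro Bochner_Integration.integral_cong refl) (simp add: algebra_simps)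
  also have "... = (LINT om|M. X r' om * X r om) - c r' * c r"
   using i iX[OF gD(1)] iX[OF gD(2)] by (simp add: c_def PM.prob_space)
  also have "... <= (if set (steps r') \<inter> used_edges [r] \<noteq> {} then 2 * q ^ card (used_edges [r', r]) else 0)"
   unfolding c_def X_def by (rule covariance_le[OF gD m])
  finally show "(LINT om|M. (X r' om - c r') * (X r om - c r)) \<le>
   (if set (steps r') \<inter> used_edges [r] \<noteq> {} then 2 * q ^ card (used_edges [r', r]) else 0)" .
 qed
 also have "... <= (\<Sum>r\<in>D. \<Sum>r'\<in>D. (if set (steps r') \<inter> used_edges [r] \<noteq> {} then 2 * q ^ card (used_edges [r', r]) else 0))"
  using sub finite_D q_bounds(1)
  by (intro order.trans[OF sum_mono2[of D ?D]] sum_mono sum_mono2) (auto intro!: sum_nonneg)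
 also have "... <= (\<Sum>r\<in>D. q ^ card (used_edges [r]) * (2 * K))"
 proof (rule sum_mono)
  fix r assume g: "r \<in> D"
  have "(\<Sum>r'\<in>D. (if set (steps r') \<inter> used_edges [r] \<noteq> {} then 2 * q ^ card (used_edges [r', r]) else 0)) =
   (\<Sum>r' | r' \<in> D \<and> set (steps r') \<inter> used_edges [r] \<noteq> {}. 2 * q ^ card (used_edges [r', r]))"
   by (rule sum.mono_neutral_cong_right) (auto simp: finite_D)
  also have "... = 2 * (\<Sum>r' | r' \<in> D \<and> set (steps r') \<inter> used_edges [r] \<noteq> {}. q ^ card (used_edges [r', r]))"
   by (simp add: sum_distrib_left)
  also have "... <= 2 * (q ^ card (used_edges [r]) * K)"
   using nested_meet[of "[r]"] g by simp
  finally show "(\<Sum>r'\<in>D. (if set (steps r') \<inter> used_edges [r] \<noteq> {} then 2 * q ^ card (used_edges [r', r]) else 0)) \<le>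
   q ^ card (used_edges [r]) * (2 * K)" by simp
 qed
 also have "... <= (K * n) * (2 * K)"
  unfolding sum_distrib_right[symmetric] using K_nonneg by (intro mult_right_mono single_free) auto
 finally have "(LINT om|M. (U m k om - (LINT om|M. U m k om))\<^sup>2) <= b\<^sup>2 * ((K * n) * (2 * K))"
  unfolding sq by (rule mult_left_mono) simp
 also have "... = (b * n) * (K\<^sup>2 * q)" by (simp add: power2_eq_square mult_ac q_def)
 also have "... <= 1 * (K\<^sup>2 * q)" using q_bounds K_nonneg by (intro mult_right_mono) auto
 finally show ?thesis by simp
qed

lemma U_mean:
 assumes k: "3 <= k" "k <= L"
 shows "(LINT om|M. U 1 k om) = \<kappa> * vk k" "\<bar>(LINT om|M. U 2 k om) - vk k\<bar> <= vk k * (2 ^ L * \<eta>)"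
proof -
 let ?D = "dpaths V k"
 have sub: "?D \<subseteq> D" using k by (rule dpaths_D)
 have EU: "(LINT om|M. U m k om) = b * (\<Sum>r\<in>?D. \<Prod>e\<in>set (steps r). (LINT t|\<nu> e. \<beta> e t ^ m))" for m
 proof -
  have "(LINT om|M. U m k om) = b * (\<Sum>r\<in>?D. (LINT om|M. P r om ^ m))"
   unfolding U_def using sub
   by (simp add: Bochner_Integration.integral_sum PM.bdd_rv_integrable bdd_rv_power bdd_PP subset_iff)
  also have "(\<Sum>r\<in>?D. (LINT om|M. P r om ^ m)) = (\<Sum>r\<in>?D. \<Prod>e\<in>set (steps r). (LINT t|\<nu> e. \<beta> e t ^ m))"
  proof (rule sum.cong[OF refl])
   fix r assume "r \<in> ?D"
   then have d: "distinct r" "set r \<subseteq> V" by (auto simp: dpaths_def)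
   then show "(LINT om|M. P r om ^ m) = (\<Prod>e\<in>set (steps r). (LINT t|\<nu> e. \<beta> e t ^ m))"
    using expect_prod[of "set (steps r)" "%e t. \<beta> e t ^ m"] path_in_J[OF d]
    by (simp add: P_eq_prod prod_power_distrib bdd_rv_power bdd_beta)
  qed
  finally show ?thesis .
 qed
 have st: "card (set (steps r)) = k - 1" "\<forall>e\<in>set (steps r). e \<subseteq> V \<and> card e = 2" if "r \<in> ?D" for r
  using that distinct_card[OF distinct_steps[of r]] steps_edge[of _ r] steps_card[of r]
  by (auto simp: dpaths_def length_steps)
 have kk: "b * b ^ (k - 1) = b ^ k" using k by (cases k) auto
 have "(LINT om|M. U 1 k om) = b * (\<Sum>r\<in>?D. (\<kappa> * b) ^ (k - 1))"
  unfolding EU using st edge_moments(1) by (simp add: prod_constant[symmetric] cong: sum.cong)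
 also have "... = \<kappa> ^ (k - 1) * vk k"
  by (simp add: vk_def power_mult_distrib kk[symmetric] mult_ac)
 also have "\<kappa> ^ (k - 1) = \<kappa>" using kappa k by auto
 finally show "(LINT om|M. U 1 k om) = \<kappa> * vk k" .
 have "(LINT om|M. U 2 k om) - vk k = b * (\<Sum>r\<in>?D. (\<Prod>e\<in>set (steps r). (LINT t|\<nu> e. \<beta> e t ^ 2)) - b ^ (k - 1))"
  unfolding EU by (simp add: vk_def sum_subtractf kk[symmetric] algebra_simps)
 also have "\<bar>...\<bar> <= b * (\<Sum>r\<in>?D. b ^ (k - 1) * (2 ^ L * \<eta>))"
 proof -
  have "\<bar>(\<Prod>e\<in>set (steps r). (LINT t|\<nu> e. \<beta> e t ^ 2)) - b ^ (k - 1)\<bar> <= b ^ (k - 1) * (2 ^ L * \<eta>)" if g: "r \<in> ?D" for r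
  proof -
   have "\<bar>(\<Prod>e\<in>set (steps r). (LINT t|\<nu> e. \<beta> e t ^ 2)) - b ^ (k - 1)\<bar> <= b ^ (k - 1) * ((1 + \<eta>) ^ (k - 1) - 1)"
    using prod_near_power[of "set (steps r)" "%e. (LINT t|\<nu> e. \<beta> e t ^ 2)" b \<eta>] st[OF g] edge_moments(2) scale small by auto
   also have "(1 + \<eta>) ^ (k - 1) - 1 <= (2 ^ (k - 1) - 1) * \<eta>" using small by (intro one_plus_power_le) auto
   also have "... <= 2 ^ L * \<eta>"
   proof (rule mult_right_mono)
    have "(2::real) ^ (k - 1) <= 2 ^ L" using k by (intro power_increasing) auto
    then show "2 ^ (k - 1) - 1 <= (2::real) ^ L" by linarith
   qed (use small in auto)
   finally show ?thesis using scale by (simp add: mult_left_mono)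
  qed
  then have "\<bar>\<Sum>r\<in>?D. (\<Prod>e\<in>set (steps r). (LINT t|\<nu> e. \<beta> e t ^ 2)) - b ^ (k - 1)\<bar> <= (\<Sum>r\<in>?D. b ^ (k - 1) * (2 ^ L * \<eta>))"
   by (intro order.trans[OF sum_abs sum_mono])
  then show ?thesis
   unfolding abs_mult abs_of_nonneg[OF scale(2)] by (rule mult_left_mono[OF _ scale(2)])
 qed
 also have "... = vk k * (2 ^ L * \<eta>)" by (simp add: vk_def kk[symmetric] mult_ac)
 finally show "\<bar>(LINT om|M. U 2 k om) - vk k\<bar> <= vk k * (2 ^ L * \<eta>)" .
qed

lemma vk_le_1: "0 <= vk k" "vk k <= 1"
proof -
 have "card (dpaths V k) <= card V ^ k"
  using card_mono[OF finite_walks[OF finV] dpaths_subset_walks[of k]] card_lists_length_eq[OF finV, of k]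
  by (simp add: walks_def)
 then have "real (card (dpaths V k)) <= n ^ k" by (metis of_nat_le_iff of_nat_power)
 then have "vk k <= n ^ k * b ^ k" unfolding vk_def using scale by (intro mult_right_mono) auto
 also have "... <= 1" using scale by (simp add: power_mult_distrib[symmetric] power_le_one)
 finally show "vk k <= 1" .
qed (use scale in \<open>auto simp: vk_def\<close>)

lemma finite_pairs: "finite pairs"
 unfolding pairs_def by (rule finite_subset[of _ "V \<times> V"]) (auto simp: finV)

lemma sum_pairs_Gk:
 assumes "2 <= k"
 shows "(\<Sum>(x, y)\<in>pairs. Gk k x y om * f x y) = (\<Sum>r\<in>dpaths V k. P r om * f (last r) (hd r))"
proof -
 have "(\<Sum>(x, y)\<in>pairs. Gk k x y om * f x y) =
   (\<Sum>p\<in>pairs. \<Sum>r\<in>{r. r \<in> dpaths V k \<and> (last r, hd r) = p}. P r om * f (last r) (hd r))"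
  by (intro sum.cong refl) (auto simp: Gk_def sum_distrib_right intro!: sum.cong)
 also have "... = (\<Sum>r\<in>dpaths V k. P r om * f (last r) (hd r))"
 proof (rule sum.group)
  show "(%r. (last r, hd r)) ` dpaths V k \<subseteq> pairs"
  proof clarsimp
   fix r assume "r \<in> dpaths V k"
   with assms obtain u v w where "r = u # v # w" "distinct r" "set r \<subseteq> V"
    by (auto simp: dpaths_def numeral_2_eq_2 Suc_le_length_iff)
   then show "(last r, hd r) \<in> pairs" using last_in_set[of "v # w"] by (auto simp: pairs_def)
  qed
 qed (auto simp: finite_pairs finite_dpaths finV)
 finally show ?thesis .
qed

text \<open>The sum splits into the diagonal terms, whose mean is \<open>vc\<close> up to \<open>\<eta>\<close> and whose variance is of order
\<open>q\<close>, and the products of two different paths with common ends, which are small in mean square.\<close>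
lemma quadratic_concentration:
 "(LINT om|M. \<bar>(\<Sum>k\<in>{3..L}. 1 / (2 * real k) * (\<Sum>(x, y)\<in>pairs. b * (Gk k x y om * G x y om))) - vc\<bar>)
   <= real L * ((K + K\<^sup>2) * sqrt q + 2 ^ L * \<eta>)"
proof -
 have eq: "(\<Sum>(x, y)\<in>pairs. b * (Gk k x y om * G x y om)) = U 2 k om + Off k om" if k: "3 <= k" "k <= L" for k om
 proof -
  have "(\<Sum>(x, y)\<in>pairs. b * (Gk k x y om * G x y om)) = b * (\<Sum>(x, y)\<in>pairs. Gk k x y om * G x y om)"
   by (simp add: sum_distrib_left case_prod_unfold)
  also have "... = b * (\<Sum>r\<in>dpaths V k. P r om * G (last r) (hd r) om)"
   using k sum_pairs_Gk[of k om "%x y. G x y om"] by simp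
  also have "(\<Sum>r\<in>dpaths V k. P r om * G (last r) (hd r) om) =
   (\<Sum>r\<in>dpaths V k. P r om ^ 2 + (\<Sum>r'\<in>Dxy (last r) (hd r) - {r}. P r om * P r' om))"
  proof (rule sum.cong[OF refl])
   fix r assume "r \<in> dpaths V k"
   then have g: "r \<in> Dxy (last r) (hd r)" using dpaths_D[OF k] by (auto simp: Dxy_def)
   show "P r om * G (last r) (hd r) om = P r om ^ 2 + (\<Sum>r'\<in>Dxy (last r) (hd r) - {r}. P r om * P r' om)"
    unfolding G_def sum.remove[OF finite_D(2) g] by (simp add: power2_eq_square distrib_left sum_distrib_left)
  qed
  finally show ?thesis by (simp add: U_def Off_def sum.distrib distrib_left)
 qed
 have bnd: "(LINT om|M. \<bar>U 2 k om + Off k om - vk k\<bar>) <= (K + K\<^sup>2) * sqrt q + 2 ^ L * \<eta>" if k: "3 <= k" "k <= L" for k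
 proof -
  define c where "c = (LINT om|M. U 2 k om)"
  have b1: "bdd_rv M (%om. U 2 k om - c)" and b2: "bdd_rv M (%om. Off k om)"
   using bdd_U[OF k] bdd_Off[OF k] by auto
  have "(LINT om|M. \<bar>U 2 k om + Off k om - vk k\<bar>) <= (LINT om|M. \<bar>U 2 k om - c\<bar> + \<bar>Off k om\<bar> + \<bar>c - vk k\<bar>)"
   using bdd_U[OF k] bdd_Off[OF k]
   by (intro integral_mono PM.bdd_rv_integrable bdd_rv_add bdd_rv_abs bdd_rv_diff bdd_rv_const) auto
  also have "... = (LINT om|M. \<bar>U 2 k om - c\<bar>) + (LINT om|M. \<bar>Off k om\<bar>) + \<bar>c - vk k\<bar>"
   using PM.bdd_rv_integrable[OF bdd_rv_abs[OF b1]] PM.bdd_rv_integrable[OF bdd_rv_abs[OF b2]]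
   by (simp add: PM.prob_space)
  also have "(LINT om|M. \<bar>U 2 k om - c\<bar>) <= sqrt (K\<^sup>2 * q)"
  proof (rule order.trans[OF PM.abs_le_sqrt_second_moment[OF b1] real_sqrt_le_mono])
   show "(LINT om|M. (U 2 k om - c)\<^sup>2) <= K\<^sup>2 * q" using U_variance[OF k, of 2] by (simp add: c_def)
  qed
  also have "(LINT om|M. \<bar>Off k om\<bar>) <= sqrt (K ^ 4 * q)"
   by (rule order.trans[OF PM.abs_le_sqrt_second_moment[OF b2] real_sqrt_le_mono[OF Off_second_moment[OF k]]])
  also have "\<bar>c - vk k\<bar> <= 1 * (2 ^ L * \<eta>)"
   unfolding c_def using small vk_le_1 by (intro order.trans[OF U_mean(2)[OF k]] mult_right_mono) auto
  also have "sqrt (K ^ 4 * q) = K\<^sup>2 * sqrt q"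
   using K_nonneg by (simp add: real_sqrt_mult power4_eq_xxxx power2_eq_square real_sqrt_mult)
  also have "sqrt (K\<^sup>2 * q) = K * sqrt q" using K_nonneg by (simp add: real_sqrt_mult)
  finally show ?thesis by (simp add: algebra_simps)
 qed
 have "(LINT om|M. \<bar>(\<Sum>k\<in>{3..L}. 1 / (2 * real k) * (\<Sum>(x, y)\<in>pairs. b * (Gk k x y om * G x y om))) - vc\<bar>)
   <= (LINT om|M. (\<Sum>k\<in>{3..L}. \<bar>U 2 k om + Off k om - vk k\<bar>))"
 proof (rule integral_mono)
  fix om
  have "(\<Sum>k\<in>{3..L}. 1 / (2 * real k) * (\<Sum>(x, y)\<in>pairs. b * (Gk k x y om * G x y om))) - vc =
    (\<Sum>k\<in>{3..L}. 1 / (2 * real k) * (U 2 k om + Off k om - vk k))"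
   unfolding vc_def sum_subtractf[symmetric] by (intro sum.cong) (auto simp: eq right_diff_distrib)
  also have "\<bar>...\<bar> <= (\<Sum>k\<in>{3..L}. \<bar>1 / (2 * real k) * (U 2 k om + Off k om - vk k)\<bar>)" by (rule sum_abs)
  also have "... <= (\<Sum>k\<in>{3..L}. \<bar>U 2 k om + Off k om - vk k\<bar>)"
   unfolding abs_mult by (intro sum_mono mult_left_le_one_le) auto
  finally show "\<bar>(\<Sum>k\<in>{3..L}. 1 / (2 * real k) * (\<Sum>(x, y)\<in>pairs. b * (Gk k x y om * G x y om))) - vc\<bar>
    <= (\<Sum>k\<in>{3..L}. \<bar>U 2 k om + Off k om - vk k\<bar>)" .
 next
  show "integrable M (%om. \<Sum>k\<in>{3..L}. \<bar>U 2 k om + Off k om - vk k\<bar>)"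
   by (intro PM.bdd_rv_integrable bdd_rv_sum bdd_rv_abs bdd_rv_diff bdd_rv_add bdd_rv_const bdd_U bdd_Off) auto
  show "integrable M (%om. \<bar>(\<Sum>k\<in>{3..L}. 1 / (2 * real k) * (\<Sum>(x, y)\<in>pairs. b * (Gk k x y om * G x y om))) - vc\<bar>)"
   unfolding case_prod_unfold
   by (intro PM.bdd_rv_integrable bdd_rv_abs bdd_rv_diff bdd_rv_sum bdd_rv_mult bdd_rv_const bdd_G bdd_Gk)
 qed
 also have "... = (\<Sum>k\<in>{3..L}. (LINT om|M. \<bar>U 2 k om + Off k om - vk k\<bar>))"
  by (intro Bochner_Integration.integral_sum PM.bdd_rv_integrable bdd_rv_abs bdd_rv_diff bdd_rv_add bdd_rv_const bdd_U bdd_Off) auto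
 also have "... <= real L * ((K + K\<^sup>2) * sqrt q + 2 ^ L * \<eta>)"
  using bnd K_nonneg q_bounds(1) small by (intro sum_over_lengths) auto
 finally show ?thesis .
qed

text \<open>Under the tilted law every edge has mean \<open>b\<close>, so \<open>b\<close> times a path product has mean \<open>b ^ k\<close>; under the null law the factor
\<open>\<kappa>\<close> makes the bound trivial.\<close>
lemma linear_concentration:
 "\<kappa> * (LINT om|M. \<bar>(\<Sum>k\<in>{3..L}. 1 / (2 * real k) * (\<Sum>(x, y)\<in>pairs. b * Gk k x y om)) - vc\<bar>)
   <= real L * (K * sqrt q)"
proof (cases "\<kappa> = 1")
 case False
 then show ?thesis using kappa K_nonneg q_bounds(1) by auto
next
 case True
 have eq: "(\<Sum>(x, y)\<in>pairs. b * Gk k x y om) = U 1 k om" if k: "3 <= k" "k <= L" for k om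
  using k sum_pairs_Gk[of k om "%_ _. b"] by (simp add: U_def case_prod_unfold mult.commute sum_distrib_left)
 have bnd: "(LINT om|M. \<bar>U 1 k om - vk k\<bar>) <= K * sqrt q" if k: "3 <= k" "k <= L" for k
 proof -
  have "(LINT om|M. \<bar>U 1 k om - vk k\<bar>) <= sqrt (LINT om|M. (U 1 k om - vk k)\<^sup>2)"
   using bdd_U[OF k] by (intro PM.abs_le_sqrt_second_moment) auto
  also have "... <= sqrt (K\<^sup>2 * q)"
   using U_variance[OF k, of 1] unfolding U_mean(1)[OF k] True by (intro real_sqrt_le_mono) simp
  finally show ?thesis using K_nonneg by (simp add: real_sqrt_mult)
 qed
 have "(LINT om|M. \<bar>(\<Sum>k\<in>{3..L}. 1 / (2 * real k) * (\<Sum>(x, y)\<in>pairs. b * Gk k x y om)) - vc\<bar>)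
   <= (LINT om|M. (\<Sum>k\<in>{3..L}. \<bar>U 1 k om - vk k\<bar>))"
 proof (rule integral_mono)
  fix om
  have "(\<Sum>k\<in>{3..L}. 1 / (2 * real k) * (\<Sum>(x, y)\<in>pairs. b * Gk k x y om)) - vc =
    (\<Sum>k\<in>{3..L}. 1 / (2 * real k) * (U 1 k om - vk k))"
   unfolding vc_def sum_subtractf[symmetric] by (intro sum.cong) (auto simp: eq right_diff_distrib)
  also have "\<bar>...\<bar> <= (\<Sum>k\<in>{3..L}. \<bar>1 / (2 * real k) * (U 1 k om - vk k)\<bar>)" by (rule sum_abs)
  also have "... <= (\<Sum>k\<in>{3..L}. \<bar>U 1 k om - vk k\<bar>)"
   unfolding abs_mult by (intro sum_mono mult_left_le_one_le) auto
  finally show "\<bar>(\<Sum>k\<in>{3..L}. 1 / (2 * real k) * (\<Sum>(x, y)\<in>pairs. b * Gk k x y om)) - vc\<bar>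
    <= (\<Sum>k\<in>{3..L}. \<bar>U 1 k om - vk k\<bar>)" .
 next
  show "integrable M (%om. \<Sum>k\<in>{3..L}. \<bar>U 1 k om - vk k\<bar>)"
   by (intro PM.bdd_rv_integrable bdd_rv_sum bdd_rv_abs bdd_rv_diff bdd_rv_add bdd_rv_const bdd_U) auto
  show "integrable M (%om. \<bar>(\<Sum>k\<in>{3..L}. 1 / (2 * real k) * (\<Sum>(x, y)\<in>pairs. b * Gk k x y om)) - vc\<bar>)"
   unfolding case_prod_unfold
   by (intro PM.bdd_rv_integrable bdd_rv_abs bdd_rv_diff bdd_rv_sum bdd_rv_mult bdd_rv_const bdd_Gk)
 qed
 also have "... = (\<Sum>k\<in>{3..L}. (LINT om|M. \<bar>U 1 k om - vk k\<bar>))"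
  by (intro Bochner_Integration.integral_sum PM.bdd_rv_integrable bdd_rv_abs bdd_rv_diff bdd_rv_add bdd_rv_const bdd_U) auto
 also have "... <= real L * (K * sqrt q)"
  using bnd K_nonneg q_bounds(1) by (intro sum_over_lengths) auto
 finally show ?thesis using True by simp
qed

end

section \<open>The cycle statistic\<close>

lemma scaled_le:
 fixes A s :: real
 assumes "1 <= A" "0 <= s" "s <= 1" "i <= 3" "m <= j" "0 <= c"
 shows "c * (A ^ i * s ^ j) <= c * (A ^ 3 * s ^ m)"
 using assms by (intro mult_left_mono mult_mono power_increasing power_decreasing) auto

context edge_field
begin

text \<open>The weight \<open>1 / (2 * k)\<close> compensates the number of lists that represent the same cycle.\<close>
definition "cycsum om = (\<Sum>k\<in>{3..L}. 1 / (2 * real k) * (\<Sum>r\<in>dpaths V k. cprod (%e. \<beta> e (om e)) r))"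
definition "S om = (\<Sum>e\<in>J. \<zeta> e (om e)) + cycsum om"
definition "E1 = {e. e \<subseteq> V \<and> card e = 1}"
definition "E2 = {e. e \<subseteq> V \<and> card e = 2}"
definition "vtot = real (card E2) * a + real (card E1) * d + vc"
definition "\<psi> th = (LINT om|M. iexp (th * S om))"
definition "A = 2 * \<Lambda> * (1 + K) ^ 3"
definition "s = 1 / sqrt n"

lemma J_split: "J = E1 \<union> E2" "E1 \<inter> E2 = {}" "finite E1" "finite E2"
 using finJ by (auto simp: J_def E1_def E2_def intro: finite_subset[of _ J])

lemma csteps_card:
 assumes "r \<in> dpaths V k" "k >= 3" "e \<in> set (csteps r)"
 shows "e \<subseteq> V \<and> card e = 2"
proof -
 have d: "distinct r" "set r \<subseteq> V" "length r = k" using assms(1) by (auto simp: dpaths_def)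
 obtain u v w where g: "r = u # v # w" using d(3) assms(2)
  by (auto simp: numeral_3_eq_3 Suc_le_length_iff)
 have "closing r \<subseteq> V \<and> card (closing r) = 2"
  using d g last_in_set[of "v # w"] by (auto simp: closing_def card_insert_if)
 then show ?thesis using assms(3) d steps_edge[of e r] steps_card[of r e] by (auto simp: csteps_def)
qed

lemma cprod_update:
 "e \<notin> set (csteps r) ==> cprod (%c. \<beta> c ((om (e := t)) c)) r = cprod (%c. \<beta> c (om c)) r"
 unfolding cprod_csteps by (intro arg_cong[of _ _ prod_list] map_cong) auto

lemma P_update: "e \<notin> set (steps r) ==> P r (om (e := t)) = P r om"
 unfolding P_def pprod_def by (intro arg_cong[of _ _ prod_list] map_cong) auto

lemma edge_not_in_steps:
 assumes "r \<in> dpaths V k" "k >= 3" "hd r = y" "last r = x"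
 shows "{x, y} \<notin> set (steps r)"
 using distinct_csteps[of r] assms by (auto simp: dpaths_def csteps_def closing_def)

lemma free_Gk: "k >= 3 ==> free_of {x, y} (Gk k x y)"
 unfolding free_of_def Gk_def using edge_not_in_steps by (auto intro!: sum.cong P_update)

lemma G_eq: "G x y om = (\<Sum>k\<in>{3..L}. Gk k x y om)"
 unfolding G_def Gk_def by (rule sum_Dxy)

lemma free_G: "free_of {x, y} (G x y)"
 using free_Gk by (auto simp: free_of_def G_eq intro!: sum.cong)

text \<open>A cycle either avoids the edge or, after removing the edge, is a path between its ends. The cycle statistic is
therefore affine in the variable of the edge with slope \<open>G x y\<close>.\<close>
lemma free_cyc_edge:
 assumes "(x, y) \<in> pairs"
 shows "free_of {x, y} (%om. cycsum om - \<beta> {x, y} (om {x, y}) * G x y om)"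
proof -
 let ?e = "{x, y}"
 have "cycsum om - \<beta> ?e (om ?e) * G x y om =
  (\<Sum>k\<in>{3..L}. 1 / (2 * real k) * (\<Sum>r | r \<in> dpaths V k \<and> ?e \<notin> set (csteps r). cprod (%e. \<beta> e (om e)) r))" for om
 proof -
  let ?c = "cprod (%e. \<beta> e (om e))"
  have k: "1 / (2 * real k) * (\<Sum>r\<in>dpaths V k. ?c r) - \<beta> ?e (om ?e) * Gk k x y om =
    1 / (2 * real k) * (\<Sum>r | r \<in> dpaths V k \<and> ?e \<notin> set (csteps r). ?c r)" if k: "k \<in> {3..L}" for k
  proof -
   have "(\<Sum>r\<in>dpaths V k. ?c r) = (\<Sum>r | r \<in> dpaths V k \<and> ?e \<in> set (csteps r). ?c r) +
     (\<Sum>r | r \<in> dpaths V k \<and> ?e \<notin> set (csteps r). ?c r)"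
    using finite_dpaths[OF finV, of k]
    by (subst sum.union_disjoint[symmetric]) (auto intro!: sum.cong)
   moreover have "(\<Sum>r | r \<in> dpaths V k \<and> ?e \<in> set (csteps r). ?c r) =
     2 * real k * (\<Sum>r | r \<in> dpaths V k \<and> hd r = y \<and> last r = x. ?c r)"
    using assms k by (intro sum_cycles_through_edge finV) (auto simp: pairs_def)
   moreover have "(\<Sum>r | r \<in> dpaths V k \<and> hd r = y \<and> last r = x. ?c r) = \<beta> ?e (om ?e) * Gk k x y om"
    unfolding Gk_def sum_distrib_left by (intro sum.cong refl) (auto simp: cprod_def P_def closing_def)
   ultimately show ?thesis using k by (simp add: distrib_left)
  qed
  have "cycsum om - \<beta> ?e (om ?e) * G x y om =
    (\<Sum>k\<in>{3..L}. 1 / (2 * real k) * (\<Sum>r\<in>dpaths V k. ?c r) - \<beta> ?e (om ?e) * Gk k x y om)"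
   unfolding cycsum_def G_eq sum_distrib_left sum_subtractf ..
  also have "... = (\<Sum>k\<in>{3..L}. 1 / (2 * real k) * (\<Sum>r | r \<in> dpaths V k \<and> ?e \<notin> set (csteps r). ?c r))"
   by (rule sum.cong[OF refl k])
  finally show ?thesis .
 qed
 note eq = this
 show ?thesis
  unfolding free_of_def eq by (intro allI sum.cong refl arg_cong2[of _ _ _ _ "(*)"] cprod_update) auto
qed

lemma free_cyc_loop:
 assumes "e \<in> E1"
 shows "free_of e cycsum"
proof -
 have "e \<notin> set (csteps r)" if "r \<in> dpaths V k" "k >= 3" for r k
  using csteps_card[OF that, of e] assms by (auto simp: E1_def)
 then show ?thesis
  unfolding free_of_def cycsum_def
  by (intro allI sum.cong refl arg_cong2[of _ _ _ _ "(*)"] cprod_update) auto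
qed

lemma free_other_zeta: "free_of e (%om. \<Sum>e'\<in>J - {e}. \<zeta> e' (om e'))"
 unfolding free_of_def by (auto intro!: sum.cong)

lemma bdd_cprod: "k >= 3 ==> r \<in> dpaths V k ==> bdd_rv M (%om. cprod (%e. \<beta> e (om e)) r)"
proof -
 assume k: "k >= 3" and g: "r \<in> dpaths V k"
 have "closing r \<in> J" using csteps_card[OF g k, of "closing r"] by (auto simp: J_def csteps_def)
 then show ?thesis
  unfolding cprod_def P_def[symmetric] using g by (intro bdd_rv_mult bdd_beta_coord bdd_P_dpaths)
qed

lemma bdd_cycsum: "bdd_rv M (%om. cycsum om)"
 unfolding cycsum_def by (intro bdd_rv_sum bdd_rv_mult bdd_rv_const bdd_cprod) auto

lemma bdd_S: "bdd_rv M (%om. S om)"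
 unfolding S_def by (intro bdd_rv_add bdd_rv_sum bdd_zeta_coord bdd_cycsum)

lemma A_bounds: "1 <= A" "2 * \<Lambda> <= A" "2 * K <= A" "2 * K\<^sup>2 <= A" "2 * K ^ 3 <= A" "2 * (K + K\<^sup>2) <= A" "2 <= A"
proof -
 have k: "K ^ i <= (1 + K) ^ 3" if "i <= 3" for i
  using K_nonneg that by (intro order.trans[OF power_mono[of K "1 + K" i] power_increasing]) auto
 have A2: "2 * x <= A" if "x <= (1 + K) ^ 3" for x
 proof -
  have "2 * x <= 2 * (1 + K) ^ 3" using that by simp
  also have "... <= (2 * \<Lambda>) * (1 + K) ^ 3" using scale(7) K_nonneg by (intro mult_right_mono) auto
  finally show ?thesis by (simp add: A_def)
 qed
 show "2 * K <= A" "2 * K\<^sup>2 <= A" "2 * K ^ 3 <= A" "2 <= A" using A2[OF k[of 1]] A2[OF k[of 2]] A2[OF k[of 3]] A2[OF k[of 0]] by auto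
 then show "1 <= A" by simp
 have "K + K\<^sup>2 <= (1 + K) ^ 3" using K_nonneg by (simp add: power3_eq_cube power2_eq_square algebra_simps)
 then show "2 * (K + K\<^sup>2) <= A" by (rule A2)
 have "2 * \<Lambda> * 1 <= 2 * \<Lambda> * (1 + K) ^ 3" using scale(7) K_nonneg by (intro mult_left_mono) auto
 then show "2 * \<Lambda> <= A" by (simp add: A_def)
qed

lemma s_bounds: "0 < s" "s <= 1" "n * s\<^sup>2 = 1" "b <= s\<^sup>2" "2 * a <= A * s ^ 4" "2 * d <= A * s\<^sup>2" "sqrt q <= 2 * s"
 "q <= 2 * s\<^sup>2" "n\<^sup>2 * s ^ 4 = 1"
proof -
 have n: "n >= 2" by (rule q_bounds)
 show s0: "0 < s" using n by (simp add: s_def)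
 show "s <= 1" using n by (simp add: s_def)
 show ns: "n * s\<^sup>2 = 1" using n by (simp add: s_def power_divide)
 have n0: "0 < n" using n by simp
 have "n * b <= n * s\<^sup>2" using ns scale by simp
 then show b: "b <= s\<^sup>2" using n0 by (simp only: mult_le_cancel_left_pos)
 then show q: "q <= 2 * s\<^sup>2" by (simp add: q_def)
 have "0 <= s\<^sup>2" by simp
 then have "q <= 4 * s\<^sup>2" using q by linarith
 then have "q <= (2 * s)\<^sup>2" by (simp add: power_mult_distrib)
 then show "sqrt q <= 2 * s" using s0 by (intro real_le_lsqrt) auto
 have ns4: "n\<^sup>2 * s ^ 4 = (n * s\<^sup>2)\<^sup>2" by (simp add: power_mult_distrib flip: power_mult)
 then show ns4': "n\<^sup>2 * s ^ 4 = 1" by (simp add: ns)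
 have "n\<^sup>2 * (2 * a) <= 2 * \<Lambda>" using scale by simp
 also have "... <= A" by (rule A_bounds)
 also have "... = n\<^sup>2 * (A * s ^ 4)" using ns4' by (simp add: mult.left_commute)
 finally show "2 * a <= A * s ^ 4" using n0 by (simp only: mult_le_cancel_left_pos zero_less_power)
 have "n * (2 * d) <= 2 * \<Lambda>" using scale by simp
 also have "... <= A" by (rule A_bounds)
 also have "... = n * (A * s\<^sup>2)" using ns by (simp add: mult.left_commute)
 finally show "2 * d <= A * s\<^sup>2" using n0 by (simp only: mult_le_cancel_left_pos)
qed

lemma sqrt_A_le: "0 <= y ==> x <= A * y\<^sup>2 ==> sqrt x <= A * y"
proof -
 assume y: "0 <= y" and x: "x <= A * y\<^sup>2"
 have "A * y\<^sup>2 <= A * A * y\<^sup>2" using A_bounds(1) by (intro mult_right_mono) auto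
 with x have "x <= (A * y)\<^sup>2" by (simp add: power2_eq_square mult_ac)
 then have "sqrt x <= sqrt ((A * y)\<^sup>2)" by (rule real_sqrt_le_mono)
 then show "sqrt x <= A * y" using y A_bounds(1) by simp
qed

text \<open>All error terms are expressed by powers of \<open>s = 1 / sqrt n\<close>, with one common constant \<open>A\<close>.\<close>
lemma coordinate_moments:
 assumes e: "e \<in> E2"
 shows "(LINT t|\<nu> e. (\<zeta> e t)\<^sup>2) <= A * s ^ 4" "(LINT t|\<nu> e. \<bar>\<zeta> e t\<bar>) <= A * s\<^sup>2"
  "(LINT t|\<nu> e. (\<beta> e t)\<^sup>2) <= A * s\<^sup>2" "(LINT t|\<nu> e. \<bar>\<beta> e t\<bar>) <= A * s"
  "(LINT t|\<nu> e. \<bar>\<zeta> e t\<bar> * (\<zeta> e t)\<^sup>2) <= \<eta> * (A * s ^ 4)" "(LINT t|\<nu> e. \<bar>\<zeta> e t\<bar> * (\<beta> e t)\<^sup>2) <= \<eta> * (A * s\<^sup>2)"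
  "(LINT t|\<nu> e. \<bar>\<beta> e t\<bar> * (\<zeta> e t)\<^sup>2) <= \<epsilon> * (A * s ^ 4)" "(LINT t|\<nu> e. \<bar>\<beta> e t\<bar> * (\<beta> e t)\<^sup>2) <= \<epsilon> * (A * s\<^sup>2)"
  "\<bar>(LINT t|\<nu> e. \<zeta> e t)\<bar> <= A * s ^ 4" "\<bar>(LINT t|\<nu> e. \<beta> e t)\<bar> <= s\<^sup>2" "\<bar>(LINT t|\<nu> e. \<zeta> e t * \<beta> e t)\<bar> <= \<eta> * s\<^sup>2"
proof -
 interpret Pe: prob_space "\<nu> e" by (rule prob)
 have ee: "e \<subseteq> V" "card e = 2" using e by (auto simp: E2_def)
 note m = edge_moments[OF ee]
 note bz = bdd_zeta[of e] and bb = bdd_beta[of e]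
 have i: "integrable (\<nu> e) (%t. (\<zeta> e t)\<^sup>2)" "integrable (\<nu> e) (%t. (\<beta> e t)\<^sup>2)"
  by (intro Pe.bdd_rv_integrable bdd_rv_power bz bb)+
 have "a + \<eta> * a <= 2 * a" using small scale mult_right_mono[of \<eta> 1 a] by auto
 then show z2: "(LINT t|\<nu> e. (\<zeta> e t)\<^sup>2) <= A * s ^ 4" using m(4) s_bounds(5) by linarith
 show "(LINT t|\<nu> e. \<bar>\<zeta> e t\<bar>) <= A * s\<^sup>2"
  using z2 s_bounds(1) by (intro order.trans[OF Pe.abs_le_sqrt_second_moment[OF bz]] sqrt_A_le) (auto simp flip: power_mult)
 have "b + \<eta> * b <= 2 * b" using small scale mult_right_mono[of \<eta> 1 b] by auto
 then have "(LINT t|\<nu> e. (\<beta> e t)\<^sup>2) <= 2 * s\<^sup>2" using m(2) s_bounds(4) by linarith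
 also have "... <= A * s\<^sup>2" using A_bounds by (intro mult_right_mono) auto
 finally show b2: "(LINT t|\<nu> e. (\<beta> e t)\<^sup>2) <= A * s\<^sup>2" .
 show "(LINT t|\<nu> e. \<bar>\<beta> e t\<bar>) <= A * s"
  using b2 s_bounds(1) by (intro order.trans[OF Pe.abs_le_sqrt_second_moment[OF bb]] sqrt_A_le) auto
 have gen: "(LINT t|\<nu> e. \<bar>f t\<bar> * (g t)\<^sup>2) <= c * B"
  if "bdd_rv (\<nu> e) f" "bdd_rv (\<nu> e) g" "\<And>t. \<bar>f t\<bar> <= c" "(LINT t|\<nu> e. (g t)\<^sup>2) <= B" for f g :: "_ => real" and c B
 proof -
  have c: "0 <= c" using order.trans[OF abs_ge_zero that(3)] .
  have "(LINT t|\<nu> e. \<bar>f t\<bar> * (g t)\<^sup>2) <= (LINT t|\<nu> e. c * (g t)\<^sup>2)"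
   using that(1,2,3) by (intro integral_mono Pe.bdd_rv_integrable bdd_rv_mult bdd_rv_abs bdd_rv_power bdd_rv_const mult_right_mono) auto
  also have "... = c * (LINT t|\<nu> e. (g t)\<^sup>2)" by simp
  also have "... <= c * B" using that(4) c by (rule mult_left_mono)
  finally show ?thesis .
 qed
 show "(LINT t|\<nu> e. \<bar>\<zeta> e t\<bar> * (\<zeta> e t)\<^sup>2) <= \<eta> * (A * s ^ 4)" "(LINT t|\<nu> e. \<bar>\<zeta> e t\<bar> * (\<beta> e t)\<^sup>2) <= \<eta> * (A * s\<^sup>2)"
  "(LINT t|\<nu> e. \<bar>\<beta> e t\<bar> * (\<zeta> e t)\<^sup>2) <= \<epsilon> * (A * s ^ 4)" "(LINT t|\<nu> e. \<bar>\<beta> e t\<bar> * (\<beta> e t)\<^sup>2) <= \<epsilon> * (A * s\<^sup>2)"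
  using zeta_le(2)[OF ee(2)] beta_le z2 b2 by (auto intro!: gen bz bb)
 have "\<bar>\<kappa>\<bar> <= 1" using kappa by auto
 then have "\<bar>\<kappa> * a\<bar> <= a" "\<bar>\<kappa> * b\<bar> <= b" using scale by (auto simp: abs_mult mult_left_le_one_le)
 then show "\<bar>(LINT t|\<nu> e. \<zeta> e t)\<bar> <= A * s ^ 4" "\<bar>(LINT t|\<nu> e. \<beta> e t)\<bar> <= s\<^sup>2"
  using s_bounds(4,5) scale unfolding m(1,3) by linarith+
 show "\<bar>(LINT t|\<nu> e. \<zeta> e t * \<beta> e t)\<bar> <= \<eta> * s\<^sup>2"
  using small s_bounds(4) by (intro order.trans[OF m(5)] mult_left_mono) auto
qed

lemma path_sum_moments:
 shows "(LINT om|M. \<bar>G x y om\<bar>) <= A * s" "(LINT om|M. (G x y om)\<^sup>2) <= A * s\<^sup>2"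
  "3 <= k ==> k <= L ==> (LINT om|M. \<bar>Gk k x y om\<bar>) <= A * s"
  "3 <= k ==> k <= L ==> (LINT om|M. \<bar>Gk k x y om * G x y om\<bar>) <= A * s\<^sup>2"
  "3 <= k ==> k <= L ==> (LINT om|M. \<bar>Gk k x y om\<bar> * (G x y om)\<^sup>2) <= A * s\<^sup>2"
proof -
 have K2: "K\<^sup>2 * q <= A * s\<^sup>2"
 proof -
  have "K\<^sup>2 * q <= K\<^sup>2 * (2 * s\<^sup>2)" using s_bounds by (intro mult_left_mono) auto
  also have "... = (2 * K\<^sup>2) * s\<^sup>2" by simp
  also have "... <= A * s\<^sup>2" using A_bounds by (intro mult_right_mono) auto
  finally show ?thesis .
 qed
 have G2: "(LINT om|M. (G x y om)\<^sup>2) <= K\<^sup>2 * q" unfolding G_def by (rule second_moment[of _ x y]) simp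
 then show "(LINT om|M. (G x y om)\<^sup>2) <= A * s\<^sup>2" using K2 by simp
 then show "(LINT om|M. \<bar>G x y om\<bar>) <= A * s"
  using s_bounds(1) by (intro order.trans[OF PM.abs_le_sqrt_second_moment[OF bdd_G]] sqrt_A_le) auto
 have G4: "(LINT om|M. ((G x y om)\<^sup>2)\<^sup>2) <= K ^ 4 * q"
  using fourth_moment[of "Dxy x y" x y] by (simp add: G_def)
 assume k: "3 <= k" "k <= L"
 have sub: "{r. r \<in> dpaths V k \<and> hd r = y \<and> last r = x} \<subseteq> Dxy x y" using dpaths_D[OF k] by (auto simp: Dxy_def)
 have H2: "(LINT om|M. (Gk k x y om)\<^sup>2) <= K\<^sup>2 * q" unfolding Gk_def by (rule second_moment[OF sub])
 then show "(LINT om|M. \<bar>Gk k x y om\<bar>) <= A * s"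
  using s_bounds(1) K2 by (intro order.trans[OF PM.abs_le_sqrt_second_moment[OF bdd_Gk]] sqrt_A_le) auto
 have "(LINT om|M. \<bar>Gk k x y om * G x y om\<bar>) <= sqrt (LINT om|M. (Gk k x y om)\<^sup>2) * sqrt (LINT om|M. (G x y om)\<^sup>2)"
  by (rule PM.cauchy_schwarz_bdd[OF bdd_Gk bdd_G])
 also have "... <= sqrt (K\<^sup>2 * q) * sqrt (K\<^sup>2 * q)"
  using H2 G2 q_bounds(1) by (intro mult_mono real_sqrt_le_mono) auto
 also have "... = K\<^sup>2 * q" using q_bounds(1) by simp
 finally show "(LINT om|M. \<bar>Gk k x y om * G x y om\<bar>) <= A * s\<^sup>2" using K2 by linarith
 have "(LINT om|M. \<bar>Gk k x y om\<bar> * (G x y om)\<^sup>2) = (LINT om|M. \<bar>Gk k x y om * (G x y om)\<^sup>2\<bar>)" by (simp add: abs_mult)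
 also have "... <= sqrt (LINT om|M. (Gk k x y om)\<^sup>2) * sqrt (LINT om|M. ((G x y om)\<^sup>2)\<^sup>2)"
  by (rule PM.cauchy_schwarz_bdd[OF bdd_Gk bdd_rv_power[OF bdd_G]])
 also have "... <= sqrt (K\<^sup>2 * q) * sqrt (K ^ 4 * q)"
  using H2 G4 q_bounds(1) by (intro mult_mono real_sqrt_le_mono) auto
 also have "... = K ^ 3 * q"
 proof -
  have "sqrt (K\<^sup>2 * q) * sqrt (K ^ 4 * q) = sqrt ((K ^ 3 * q)\<^sup>2)"
   unfolding real_sqrt_mult[symmetric] by (rule arg_cong[of _ _ sqrt]) (simp add: eval_nat_numeral)
  then show ?thesis using K_nonneg q_bounds(1) by simp
 qed
 also have "... <= K ^ 3 * (2 * s\<^sup>2)" using s_bounds K_nonneg by (intro mult_left_mono) auto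
 also have "... = (2 * K ^ 3) * s\<^sup>2" by simp
 also have "... <= A * s\<^sup>2" using A_bounds by (intro mult_right_mono) auto
 finally show "(LINT om|M. \<bar>Gk k x y om\<bar> * (G x y om)\<^sup>2) <= A * s\<^sup>2" .
qed

lemma theta_bounds: "th\<^sup>2 <= 1 + th\<^sup>2" "\<bar>th\<bar> <= 1 + th\<^sup>2" for th :: real
proof -
 have "0 <= (\<bar>th\<bar> - 1)\<^sup>2" by simp
 then show "\<bar>th\<bar> <= 1 + th\<^sup>2" unfolding power2_diff using abs_ge_zero[of th] by simp
qed simp

lemma combine_theta:
 fixes th :: real
 assumes "0 <= X1" "0 <= X2" "0 <= X3" "X1 + X2 + X3 <= Y"
 shows "th\<^sup>2 * X1 + \<bar>th\<bar> * X2 + th\<^sup>2 * X3 <= (1 + th\<^sup>2) * Y"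
proof -
 have "th\<^sup>2 * X1 + \<bar>th\<bar> * X2 + th\<^sup>2 * X3 <= (1 + th\<^sup>2) * X1 + (1 + th\<^sup>2) * X2 + (1 + th\<^sup>2) * X3"
  using theta_bounds assms by (intro add_mono mult_right_mono) auto
 also have "... = (1 + th\<^sup>2) * (X1 + X2 + X3)" by (simp add: algebra_simps)
 also have "... <= (1 + th\<^sup>2) * Y" using assms by (intro mult_left_mono) auto
 finally show ?thesis .
qed

lemma cmod_integral_le:
 fixes f :: "_ => complex" and g :: "_ => real"
 assumes "bdd_rv M f" "bdd_rv M g" "\<And>om. cmod (f om) <= g om"
 shows "cmod (LINT om|M. f om) <= (LINT om|M. g om)"
proof -
 have "cmod (LINT om|M. f om) <= (LINT om|M. cmod (f om))" by (rule integral_norm_bound)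
 also have "... <= (LINT om|M. g om)"
  using assms by (intro integral_mono integrable_norm PM.bdd_rv_integrable) auto
 finally show ?thesis .
qed

end

section \<open>Expansion in a single coordinate\<close>

context edge_field
begin

lemma psi_le_1: "cmod (\<psi> th) <= 1"
 unfolding \<psi>_def
 by (rule order.trans[OF cmod_integral_le[OF bdd_rv_iexp[OF bdd_S] bdd_rv_const[of _ 1]]]) (auto simp: PM.prob_space)

lemma free_const: "free_of e (%_. c)"
 by (simp add: free_of_def)

lemma S_split_edge:
 assumes "(x, y) \<in> pairs"
 defines "S0 \<equiv> %om. (\<Sum>e'\<in>J - {{x, y}}. \<zeta> e' (om e')) + (cycsum om - \<beta> {x, y} (om {x, y}) * G x y om)"
 shows "S om = S0 om + \<zeta> {x, y} (om {x, y}) + \<beta> {x, y} (om {x, y}) * G x y om"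
  "bdd_rv M S0" "free_of {x, y} S0" "{x, y} \<in> E2" "{x, y} \<in> J"
proof -
 show e: "{x, y} \<in> E2" "{x, y} \<in> J" using assms(1) by (auto simp: pairs_def E2_def J_def)
 show "S om = S0 om + \<zeta> {x, y} (om {x, y}) + \<beta> {x, y} (om {x, y}) * G x y om"
  unfolding S_def S0_def sum.remove[OF finJ e(2)] by simp
 show "bdd_rv M S0"
  unfolding S0_def using e
  by (intro bdd_rv_add bdd_rv_diff bdd_rv_sum bdd_rv_mult bdd_zeta_coord bdd_beta_coord bdd_cycsum bdd_G) auto
 show "free_of {x, y} S0"
  using free_other_zeta[of "{x, y}"] free_cyc_edge[OF assms(1)] unfolding S0_def free_of_def by simp
qed

text \<open>The instance of \<open>stein_expansion\<close> in which \<open>Y\<close> is \<open>\<beta>\<close> of the edge and \<open>H\<close> the sum of paths closing it to a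
cycle. The first order term produces the product \<open>Gk * G\<close> of two path sums with the same ends.\<close>
lemma edge_beta_term:
 assumes xy: "(x, y) \<in> pairs" and k: "3 <= k" "k <= L"
 shows "cmod ((LINT om|M. \<beta> {x, y} (om {x, y}) * Gk k x y om * iexp (th * S om)) -
   (LINT om|M. iexp (th * S om) * (\<kappa> * (b * Gk k x y om) + \<i> * th * (b * (Gk k x y om * G x y om)))))
  <= (1 + th\<^sup>2) * (A ^ 3 * (s ^ 4 * (6 * (\<epsilon> + s)) + s ^ 3 * (2 * \<eta>)))"
proof -
 let ?e = "{x, y}"
 note sp = S_split_edge[OF xy]
 define S0 where "S0 om = (\<Sum>e'\<in>J - {?e}. \<zeta> e' (om e')) + (cycsum om - \<beta> ?e (om ?e) * G x y om)" for om
 define E where "E f = (LINT t|\<nu> ?e. f t)" for f :: "_ => real"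
 define EE where "EE f = (LINT om|M. f om)" for f :: "_ => real"
 let ?H = "Gk k x y" and ?g = "G x y" and ?z = "\<zeta> ?e" and ?u = "\<beta> ?e"
 note stein = stein_expansion[OF finJ sp(5) prob bdd_beta bdd_zeta bdd_beta
   bdd_Gk[unfolded M_def] free_Gk[OF k(1)] bdd_G[unfolded M_def] free_G
   sp(2)[folded S0_def, unfolded M_def] sp(3)[folded S0_def] sp(1)[folded S0_def], of th, folded M_def, folded E_def, folded EE_def]
 note cm = coordinate_moments[OF sp(4), folded E_def]
 note pm = path_sum_moments(1,2)[of x y, folded EE_def] path_sum_moments(3-5)[OF k, of x y, folded EE_def]
 have A: "1 <= A" "0 <= A" and s: "0 <= s" "s <= 1" using A_bounds s_bounds by auto
 have eta: "0 <= \<eta>" "\<eta> <= 1" "0 <= \<epsilon>" using small by auto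
 have nnE: "0 <= E (%t. \<bar>?z t\<bar>)" "0 <= E (%t. \<bar>?u t\<bar>)" "0 <= E (%t. \<bar>?u t\<bar> * (?z t)\<^sup>2)" "0 <= E (%t. \<bar>?u t\<bar> * (?u t)\<^sup>2)"
  "0 <= EE (%om. \<bar>?H om\<bar>)" "0 <= EE (%om. \<bar>?H om * ?g om\<bar>)" "0 <= EE (%om. \<bar>?H om\<bar> * (?g om)\<^sup>2)"
  by (auto simp: E_def EE_def)
 have uz: "\<bar>E (%t. ?u t * ?z t)\<bar> <= \<eta> * s\<^sup>2" using cm(11) by (simp add: mult.commute)
 have uu: "\<bar>E (%t. ?u t * ?u t)\<bar> <= A * s\<^sup>2" using cm(3) by (simp add: E_def power2_eq_square)
 define X1 where "X1 = E (%t. \<bar>?u t\<bar> * (?z t)\<^sup>2) * EE (%om. \<bar>?H om\<bar>) + E (%t. \<bar>?u t\<bar> * (?u t)\<^sup>2) * EE (%om. \<bar>?H om\<bar> * (?g om)\<^sup>2)"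
 define W where "W = E (%t. \<bar>?z t\<bar>) * EE (%om. \<bar>?H om\<bar>) + E (%t. \<bar>?u t\<bar>) * EE (%om. \<bar>?H om * ?g om\<bar>)"
 define W' where "W' = E (%t. \<bar>?z t\<bar>) * EE (%om. \<bar>?H om * ?g om\<bar>) + E (%t. \<bar>?u t\<bar>) * EE (%om. \<bar>?H om\<bar> * (?g om)\<^sup>2)"
 define X2 where "X2 = \<bar>E ?u\<bar> * W"
 define X3 where "X3 = \<bar>E (%t. ?u t * ?z t)\<bar> * W + \<bar>E (%t. ?u t * ?u t)\<bar> * W'"
 have X1: "X1 <= (\<epsilon> * (A * s ^ 4)) * (A * s) + (\<epsilon> * (A * s\<^sup>2)) * (A * s\<^sup>2)"
  unfolding X1_def by (intro add_mono mult_mono cm pm nnE mult_nonneg_nonneg zero_le_power zero_le_power2 A(2) s(1) eta(1,3))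
 have W: "W <= (A * s\<^sup>2) * (A * s) + (A * s) * (A * s\<^sup>2)"
  unfolding W_def by (intro add_mono mult_mono cm pm nnE mult_nonneg_nonneg zero_le_power zero_le_power2 A(2) s(1) eta(1,3))
 have W': "W' <= (A * s\<^sup>2) * (A * s\<^sup>2) + (A * s) * (A * s\<^sup>2)"
  unfolding W'_def by (intro add_mono mult_mono cm pm nnE mult_nonneg_nonneg zero_le_power zero_le_power2 A(2) s(1) eta(1,3))
 have Wn: "0 <= W" "0 <= W'" "0 <= X1" using nnE by (auto simp: W_def W'_def X1_def)
 have X2: "X2 <= s\<^sup>2 * ((A * s\<^sup>2) * (A * s) + (A * s) * (A * s\<^sup>2))"
  unfolding X2_def by (intro mult_mono cm(10) W Wn abs_ge_zero zero_le_power2)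
 have X3: "X3 <= (1 * s\<^sup>2) * ((A * s\<^sup>2) * (A * s) + (A * s) * (A * s\<^sup>2)) + (A * s\<^sup>2) * ((A * s\<^sup>2) * (A * s\<^sup>2) + (A * s) * (A * s\<^sup>2))"
 proof -
  have uz1: "\<bar>E (%t. ?u t * ?z t)\<bar> <= 1 * s\<^sup>2"
   by (rule order.trans[OF uz mult_right_mono[OF eta(2) zero_le_power2]])
  show ?thesis
   unfolding X3_def by (intro add_mono mult_mono uz1 uu W W' Wn abs_ge_zero mult_nonneg_nonneg zero_le_power2 zero_le_one A(2))
 qed
 note pw = scaled_le[OF A(1) s]
 have "X1 + X2 + X3 <= A ^ 3 * (s ^ 4 * (6 * (\<epsilon> + s)))"
 proof -
  have "X1 + X2 + X3 <= \<epsilon> * (A ^ 2 * s ^ 5) + \<epsilon> * (A ^ 2 * s ^ 4) + 2 * (A ^ 2 * s ^ 5) + 2 * (A ^ 2 * s ^ 5) + 1 * (A ^ 3 * s ^ 6) + 1 * (A ^ 3 * s ^ 5)"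
   using X1 X2 X3 by (simp add: eval_nat_numeral algebra_simps)
  also have "... <= \<epsilon> * (A ^ 3 * s ^ 4) + \<epsilon> * (A ^ 3 * s ^ 4) + 2 * (A ^ 3 * s ^ 5) + 2 * (A ^ 3 * s ^ 5) + 1 * (A ^ 3 * s ^ 5) + 1 * (A ^ 3 * s ^ 5)"
   using eta by (intro add_mono pw) auto
  also have "... = A ^ 3 * (s ^ 4 * (2 * \<epsilon> + 6 * s))" by (simp add: eval_nat_numeral algebra_simps)
  also have "... <= A ^ 3 * (s ^ 4 * (6 * (\<epsilon> + s)))" using A s eta by (intro mult_left_mono) auto
  finally show ?thesis .
 qed
 then have B: "th\<^sup>2 * X1 + \<bar>th\<bar> * X2 + th\<^sup>2 * X3 <= (1 + th\<^sup>2) * (A ^ 3 * (s ^ 4 * (6 * (\<epsilon> + s))))"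
  using Wn nnE by (intro combine_theta) (auto simp: X2_def X3_def)
 let ?I = "(LINT om|M. ?u (om ?e) * ?H om * iexp (th * S om))"
 let ?J1 = "(LINT om|M. iexp (th * S om) * (?H om * (E ?u + \<i> * th * (E (%t. ?u t * ?z t) + E (%t. ?u t * ?u t) * ?g om))))"
 let ?J2 = "(LINT om|M. iexp (th * S om) * (\<kappa> * (b * ?H om) + \<i> * th * (b * (?H om * ?g om))))"
 have I: "cmod (?I - ?J1) <= (1 + th\<^sup>2) * (A ^ 3 * (s ^ 4 * (6 * (\<epsilon> + s))))"
  using stein B unfolding X1_def X2_def X3_def W_def W'_def by (simp add: mult.assoc)
 have bI: "bdd_rv M (%om. iexp (th * S om) * (?H om * (E ?u + \<i> * th * (E (%t. ?u t * ?z t) + E (%t. ?u t * ?u t) * ?g om))))"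
  "bdd_rv M (%om. iexp (th * S om) * (\<kappa> * (b * ?H om) + \<i> * th * (b * (?H om * ?g om))))"
  by (intro bdd_rv_mult bdd_rv_add bdd_rv_iexp bdd_rv_of_real bdd_rv_const bdd_S bdd_G bdd_Gk)+
 have "cmod (?J1 - ?J2) = cmod (LINT om|M. iexp (th * S om) * (?H om * (E ?u + \<i> * th * (E (%t. ?u t * ?z t) + E (%t. ?u t * ?u t) * ?g om)))
   - iexp (th * S om) * (\<kappa> * (b * ?H om) + \<i> * th * (b * (?H om * ?g om))))"
  using bI[THEN PM.bdd_rv_integrable] by (subst Bochner_Integration.integral_diff) auto
 also have "... <= (LINT om|M. \<bar>th\<bar> * (\<eta> * s\<^sup>2 * (\<bar>?H om\<bar> + \<bar>?H om * ?g om\<bar>)))"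
 proof (rule cmod_integral_le)
  fix om
  have Eu: "E ?u = \<kappa> * b" using edge_moments(1)[of ?e] sp(4) by (simp add: E_def E2_def)
  have diff: "iexp (th * S om) * (?H om * (E ?u + \<i> * th * (E (%t. ?u t * ?z t) + E (%t. ?u t * ?u t) * ?g om)))
   - iexp (th * S om) * (\<kappa> * (b * ?H om) + \<i> * th * (b * (?H om * ?g om))) =
   iexp (th * S om) * (\<i> * (complex_of_real (th * (E (%t. ?u t * ?z t) * ?H om + (E (%t. ?u t * ?u t) - b) * (?H om * ?g om)))))"
   unfolding Eu by (simp add: algebra_simps)
  have "cmod (iexp (th * S om) * (?H om * (E ?u + \<i> * th * (E (%t. ?u t * ?z t) + E (%t. ?u t * ?u t) * ?g om)))
   - iexp (th * S om) * (\<kappa> * (b * ?H om) + \<i> * th * (b * (?H om * ?g om)))) = \<bar>th * (E (%t. ?u t * ?z t) * ?H om + (E (%t. ?u t * ?u t) - b) * (?H om * ?g om))\<bar>"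
   unfolding diff by (simp only: norm_mult norm_exp_i_times norm_of_real norm_ii mult_1)
  also have "... = \<bar>th\<bar> * \<bar>E (%t. ?u t * ?z t) * ?H om + (E (%t. ?u t * ?u t) - b) * (?H om * ?g om)\<bar>" by (rule abs_mult)
  also have "... <= \<bar>th\<bar> * (\<eta> * s\<^sup>2 * (\<bar>?H om\<bar> + \<bar>?H om * ?g om\<bar>))"
  proof (rule mult_left_mono)
   have "\<bar>E (%t. ?u t * ?u t) - b\<bar> <= \<eta> * b"
    using edge_moments(2)[of ?e] sp(4) by (simp add: E_def E2_def power2_eq_square)
   also have "... <= \<eta> * s\<^sup>2" using s_bounds(4) eta by (intro mult_left_mono) auto
   finally have u2: "\<bar>E (%t. ?u t * ?u t) - b\<bar> <= \<eta> * s\<^sup>2" .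
   have "\<bar>E (%t. ?u t * ?z t) * ?H om\<bar> <= \<eta> * s\<^sup>2 * \<bar>?H om\<bar>" "\<bar>(E (%t. ?u t * ?u t) - b) * (?H om * ?g om)\<bar> <= \<eta> * s\<^sup>2 * \<bar>?H om * ?g om\<bar>"
    using u2 uz unfolding abs_mult[of "E _"] abs_mult[of "E _ - b"] by (auto intro: mult_right_mono)
   then show "\<bar>E (%t. ?u t * ?z t) * ?H om + (E (%t. ?u t * ?u t) - b) * (?H om * ?g om)\<bar> <= \<eta> * s\<^sup>2 * (\<bar>?H om\<bar> + \<bar>?H om * ?g om\<bar>)"
    unfolding distrib_left by linarith
  qed simp
  finally show "cmod (iexp (th * S om) * (?H om * (E ?u + \<i> * th * (E (%t. ?u t * ?z t) + E (%t. ?u t * ?u t) * ?g om)))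
   - iexp (th * S om) * (\<kappa> * (b * ?H om) + \<i> * th * (b * (?H om * ?g om)))) <= \<bar>th\<bar> * (\<eta> * s\<^sup>2 * (\<bar>?H om\<bar> + \<bar>?H om * ?g om\<bar>))" .
 qed (use bI in \<open>auto intro!: bdd_rv_diff bdd_rv_mult bdd_rv_const bdd_rv_add bdd_rv_abs bdd_G bdd_Gk\<close>)
 also have "... = \<bar>th\<bar> * (\<eta> * s\<^sup>2 * (EE (%om. \<bar>?H om\<bar>) + EE (%om. \<bar>?H om * ?g om\<bar>)))"
  using PM.bdd_rv_integrable[OF bdd_rv_abs[OF bdd_Gk[of k x y]]] PM.bdd_rv_integrable[OF bdd_rv_abs[OF bdd_rv_mult[OF bdd_Gk[of k x y] bdd_G[of x y]]]]
  by (simp add: EE_def)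
 also have "... <= (1 + th\<^sup>2) * (A ^ 3 * (s ^ 3 * (2 * \<eta>)))"
 proof (rule mult_mono)
  have "\<eta> * s\<^sup>2 * (EE (%om. \<bar>?H om\<bar>) + EE (%om. \<bar>?H om * ?g om\<bar>)) <= \<eta> * s\<^sup>2 * (A * s + A * s\<^sup>2)"
   using pm eta by (intro mult_left_mono add_mono) auto
  also have "... = \<eta> * (A ^ 1 * s ^ 3) + \<eta> * (A ^ 1 * s ^ 4)" by (simp add: eval_nat_numeral algebra_simps)
  also have "... <= \<eta> * (A ^ 3 * s ^ 3) + \<eta> * (A ^ 3 * s ^ 3)" using eta by (intro add_mono pw) auto
  finally show "\<eta> * s\<^sup>2 * (EE (%om. \<bar>?H om\<bar>) + EE (%om. \<bar>?H om * ?g om\<bar>)) <= A ^ 3 * (s ^ 3 * (2 * \<eta>))" by (simp add: mult_ac)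
 qed (use theta_bounds eta nnE in auto)
 finally have "cmod (?J1 - ?J2) <= (1 + th\<^sup>2) * (A ^ 3 * (s ^ 3 * (2 * \<eta>)))" .
 moreover have "cmod (?I - ?J2) <= cmod (?I - ?J1) + cmod (?J1 - ?J2)"
  by (rule order.trans[OF _ norm_triangle_ineq]) simp
 ultimately have "cmod (?I - ?J2) <= (1 + th\<^sup>2) * (A ^ 3 * (s ^ 4 * (6 * (\<epsilon> + s)))) + (1 + th\<^sup>2) * (A ^ 3 * (s ^ 3 * (2 * \<eta>)))"
  using I by linarith
 then show ?thesis by (simp add: distrib_left)
qed

lemma edge_zeta_term:
 assumes e: "e \<in> E2"
 shows "cmod ((LINT om|M. \<zeta> e (om e) * iexp (th * S om)) - (\<kappa> + \<i> * th) * a * \<psi> th)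
  <= (1 + th\<^sup>2) * (A ^ 3 * (s ^ 4 * (5 * \<eta> + 4 * s) + s ^ 3 * \<eta>))"
proof -
 obtain x y where xye: "e = {x, y}" "x \<noteq> y" using e by (auto simp: E2_def card_2_iff)
 then have xy: "(x, y) \<in> pairs" using e by (auto simp: pairs_def E2_def)
 let ?e = "{x, y}"
 note sp = S_split_edge[OF xy]
 define S0 where "S0 om = (\<Sum>e'\<in>J - {?e}. \<zeta> e' (om e')) + (cycsum om - \<beta> ?e (om ?e) * G x y om)" for om
 define E where "E f = (LINT t|\<nu> ?e. f t)" for f :: "_ => real"
 define EE where "EE f = (LINT om|M. f om)" for f :: "_ => real"
 let ?g = "G x y" and ?z = "\<zeta> ?e" and ?u = "\<beta> ?e"
 note stein = stein_expansion[OF finJ sp(5) prob bdd_zeta bdd_zeta bdd_beta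
   bdd_rv_const[of _ 1] free_const[of _ 1] bdd_G[unfolded M_def] free_G
   sp(2)[folded S0_def, unfolded M_def] sp(3)[folded S0_def] sp(1)[folded S0_def], of th, folded M_def, folded E_def, folded EE_def]
 note cm = coordinate_moments[OF sp(4), folded E_def]
 note pm = path_sum_moments(1,2)[of x y, folded EE_def]
 have A: "1 <= A" "0 <= A" and s: "0 <= s" "s <= 1" using A_bounds s_bounds by auto
 have eta: "0 <= \<eta>" "\<eta> <= 1" "0 <= \<epsilon>" using small by auto
 have nnE: "0 <= E (%t. \<bar>?z t\<bar>)" "0 <= E (%t. \<bar>?u t\<bar>)" "0 <= E (%t. \<bar>?z t\<bar> * (?z t)\<^sup>2)" "0 <= E (%t. \<bar>?z t\<bar> * (?u t)\<^sup>2)"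
  "0 <= EE (%om. \<bar>?g om\<bar>)" "0 <= EE (%om. (?g om)\<^sup>2)"
  by (auto simp: E_def EE_def)
 have zz: "\<bar>E (%t. ?z t * ?z t)\<bar> <= A * s ^ 4" using cm(1) by (simp add: E_def power2_eq_square)
 define X1 where "X1 = E (%t. \<bar>?z t\<bar> * (?z t)\<^sup>2) + E (%t. \<bar>?z t\<bar> * (?u t)\<^sup>2) * EE (%om. (?g om)\<^sup>2)"
 define W where "W = E (%t. \<bar>?z t\<bar>) + E (%t. \<bar>?u t\<bar>) * EE (%om. \<bar>?g om\<bar>)"
 define W' where "W' = E (%t. \<bar>?z t\<bar>) * EE (%om. \<bar>?g om\<bar>) + E (%t. \<bar>?u t\<bar>) * EE (%om. (?g om)\<^sup>2)"
 define X2 where "X2 = \<bar>E ?z\<bar> * W"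
 define X3 where "X3 = \<bar>E (%t. ?z t * ?z t)\<bar> * W + \<bar>E (%t. ?z t * ?u t)\<bar> * W'"
 have X1: "X1 <= \<eta> * (A * s ^ 4) + (\<eta> * (A * s\<^sup>2)) * (A * s\<^sup>2)"
  unfolding X1_def by (intro add_mono mult_mono cm pm nnE mult_nonneg_nonneg zero_le_power zero_le_power2 A(2) s(1) eta(1,3))
 have W: "W <= A * s\<^sup>2 + (A * s) * (A * s)"
  unfolding W_def by (intro add_mono mult_mono cm pm nnE mult_nonneg_nonneg zero_le_power zero_le_power2 A(2) s(1) eta(1,3))
 have W': "W' <= (A * s\<^sup>2) * (A * s) + (A * s) * (A * s\<^sup>2)"
  unfolding W'_def by (intro add_mono mult_mono cm pm nnE mult_nonneg_nonneg zero_le_power zero_le_power2 A(2) s(1) eta(1,3))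
 have Wn: "0 <= W" "0 <= W'" "0 <= X1" using nnE by (auto simp: W_def W'_def X1_def)
 have X2: "X2 <= (A * s ^ 4) * (A * s\<^sup>2 + (A * s) * (A * s))"
  unfolding X2_def by (intro mult_mono cm(9) W Wn abs_ge_zero mult_nonneg_nonneg zero_le_power A(2) s(1))
 have X3: "X3 <= (A * s ^ 4) * (A * s\<^sup>2 + (A * s) * (A * s)) + (\<eta> * s\<^sup>2) * ((A * s\<^sup>2) * (A * s) + (A * s) * (A * s\<^sup>2))"
  unfolding X3_def by (intro add_mono mult_mono cm(11) zz W W' Wn abs_ge_zero mult_nonneg_nonneg zero_le_power zero_le_power2 A(2) s(1) eta(1))
 note pw = scaled_le[OF A(1) s]
 have "X1 + X2 + X3 <= A ^ 3 * (s ^ 4 * (4 * \<eta> + 4 * s))"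
 proof -
  have "X1 + X2 + X3 <= \<eta> * (A ^ 1 * s ^ 4) + \<eta> * (A ^ 2 * s ^ 4) + 2 * (A ^ 2 * s ^ 6) + 2 * (A ^ 3 * s ^ 6) + (2 * \<eta>) * (A ^ 2 * s ^ 5)"
  proof -
   have a: "A * (A * s ^ 6) <= A * (A * (A * s ^ 6))"
    using A s by (intro mult_left_mono) (auto simp: mult_le_cancel_right1)
   show ?thesis using X1 X2 X3 a by (simp add: eval_nat_numeral algebra_simps)
  qed
  also have "... <= \<eta> * (A ^ 3 * s ^ 4) + \<eta> * (A ^ 3 * s ^ 4) + 2 * (A ^ 3 * s ^ 5) + 2 * (A ^ 3 * s ^ 5) + (2 * \<eta>) * (A ^ 3 * s ^ 4)"
   using eta by (intro add_mono pw) auto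
  also have "... = A ^ 3 * (s ^ 4 * (4 * \<eta> + 4 * s))" by (simp add: eval_nat_numeral algebra_simps)
  finally show ?thesis .
 qed
 then have B: "th\<^sup>2 * X1 + \<bar>th\<bar> * X2 + th\<^sup>2 * X3 <= (1 + th\<^sup>2) * (A ^ 3 * (s ^ 4 * (4 * \<eta> + 4 * s)))"
  using Wn nnE by (intro combine_theta) (auto simp: X2_def X3_def)
 let ?I = "(LINT om|M. ?z (om ?e) * iexp (th * S om))"
 let ?J1 = "(LINT om|M. iexp (th * S om) * (E ?z + \<i> * th * (E (%t. ?z t * ?z t) + E (%t. ?z t * ?u t) * ?g om)))"
 let ?J2 = "(LINT om|M. iexp (th * S om) * ((\<kappa> + \<i> * th) * a))"
 have I: "cmod (?I - ?J1) <= (1 + th\<^sup>2) * (A ^ 3 * (s ^ 4 * (4 * \<eta> + 4 * s)))"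
  using stein B unfolding X1_def X2_def X3_def W_def W'_def EE_def by (simp add: mult.assoc PM.prob_space)
 have bI: "bdd_rv M (%om. iexp (th * S om) * (E ?z + \<i> * th * (E (%t. ?z t * ?z t) + E (%t. ?z t * ?u t) * ?g om)))"
  "bdd_rv M (%om. iexp (th * S om) * ((\<kappa> + \<i> * th) * a))"
  by (intro bdd_rv_mult bdd_rv_add bdd_rv_iexp bdd_rv_of_real bdd_rv_const bdd_S bdd_G bdd_Gk)+
 have "cmod (?J1 - ?J2) = cmod (LINT om|M. iexp (th * S om) * (E ?z + \<i> * th * (E (%t. ?z t * ?z t) + E (%t. ?z t * ?u t) * ?g om))
   - iexp (th * S om) * ((\<kappa> + \<i> * th) * a))"
  using bI[THEN PM.bdd_rv_integrable] by (subst Bochner_Integration.integral_diff) auto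
 also have "... <= (LINT om|M. \<bar>th\<bar> * (\<eta> * (A * s ^ 4) + \<eta> * s\<^sup>2 * \<bar>?g om\<bar>))"
 proof (rule cmod_integral_le)
  fix om
  have Ez: "E ?z = \<kappa> * a" using edge_moments(3)[of ?e] sp(4) by (simp add: E_def E2_def)
  have diff: "iexp (th * S om) * (E ?z + \<i> * th * (E (%t. ?z t * ?z t) + E (%t. ?z t * ?u t) * ?g om))
   - iexp (th * S om) * ((\<kappa> + \<i> * th) * a) =
   iexp (th * S om) * (\<i> * (complex_of_real (th * ((E (%t. ?z t * ?z t) - a) + E (%t. ?z t * ?u t) * ?g om))))"
   unfolding Ez by (simp add: algebra_simps)
  have "cmod (iexp (th * S om) * (E ?z + \<i> * th * (E (%t. ?z t * ?z t) + E (%t. ?z t * ?u t) * ?g om))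
   - iexp (th * S om) * ((\<kappa> + \<i> * th) * a)) = \<bar>th * ((E (%t. ?z t * ?z t) - a) + E (%t. ?z t * ?u t) * ?g om)\<bar>"
   unfolding diff by (simp only: norm_mult norm_exp_i_times norm_of_real norm_ii mult_1)
  also have "... = \<bar>th\<bar> * \<bar>(E (%t. ?z t * ?z t) - a) + E (%t. ?z t * ?u t) * ?g om\<bar>" by (rule abs_mult)
  also have "... <= \<bar>th\<bar> * (\<eta> * (A * s ^ 4) + \<eta> * s\<^sup>2 * \<bar>?g om\<bar>)"
  proof (rule mult_left_mono)
   have "\<bar>E (%t. ?z t * ?z t) - a\<bar> <= \<eta> * a"
    using edge_moments(4)[of ?e] sp(4) by (simp add: E_def E2_def power2_eq_square)
   also have "... <= \<eta> * (A * s ^ 4)" using s_bounds(5) eta scale(1) by (intro mult_left_mono) auto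
   finally have u2: "\<bar>E (%t. ?z t * ?z t) - a\<bar> <= \<eta> * (A * s ^ 4)" .
   have "\<bar>E (%t. ?z t * ?u t) * ?g om\<bar> <= \<eta> * s\<^sup>2 * \<bar>?g om\<bar>"
    using cm(11) unfolding abs_mult[of "E _"] by (auto intro: mult_right_mono)
   with u2 show "\<bar>(E (%t. ?z t * ?z t) - a) + E (%t. ?z t * ?u t) * ?g om\<bar> <= \<eta> * (A * s ^ 4) + \<eta> * s\<^sup>2 * \<bar>?g om\<bar>"
    by linarith
  qed simp
  finally show "cmod (iexp (th * S om) * (E ?z + \<i> * th * (E (%t. ?z t * ?z t) + E (%t. ?z t * ?u t) * ?g om))
   - iexp (th * S om) * ((\<kappa> + \<i> * th) * a)) <= \<bar>th\<bar> * (\<eta> * (A * s ^ 4) + \<eta> * s\<^sup>2 * \<bar>?g om\<bar>)" .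
 qed (use bI in \<open>auto intro!: bdd_rv_diff bdd_rv_mult bdd_rv_const bdd_rv_add bdd_rv_abs bdd_G bdd_Gk\<close>)
 also have "... = \<bar>th\<bar> * (\<eta> * (A * s ^ 4) + \<eta> * s\<^sup>2 * EE (%om. \<bar>?g om\<bar>))"
  using PM.bdd_rv_integrable[OF bdd_rv_abs[OF bdd_G[of x y]]]
  by (simp add: EE_def PM.prob_space)
 also have "... <= (1 + th\<^sup>2) * (A ^ 3 * (s ^ 4 * \<eta> + s ^ 3 * \<eta>))"
 proof (rule mult_mono)
  have "\<eta> * (A * s ^ 4) + \<eta> * s\<^sup>2 * EE (%om. \<bar>?g om\<bar>) <= \<eta> * (A * s ^ 4) + \<eta> * s\<^sup>2 * (A * s)"
   using pm eta A by (intro mult_left_mono add_mono) auto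
  also have "... = \<eta> * (A ^ 1 * s ^ 4) + \<eta> * (A ^ 1 * s ^ 3)" by (simp add: eval_nat_numeral algebra_simps)
  also have "... <= \<eta> * (A ^ 3 * s ^ 4) + \<eta> * (A ^ 3 * s ^ 3)" using eta by (intro add_mono pw) auto
  finally show "\<eta> * (A * s ^ 4) + \<eta> * s\<^sup>2 * EE (%om. \<bar>?g om\<bar>) <= A ^ 3 * (s ^ 4 * \<eta> + s ^ 3 * \<eta>)" by (simp add: algebra_simps)
 qed (use theta_bounds eta nnE A s in auto)
 finally have "cmod (?J1 - ?J2) <= (1 + th\<^sup>2) * (A ^ 3 * (s ^ 4 * \<eta> + s ^ 3 * \<eta>))" .
 moreover have "cmod (?I - ?J2) <= cmod (?I - ?J1) + cmod (?J1 - ?J2)"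
  by (rule order.trans[OF _ norm_triangle_ineq]) simp
 ultimately have "cmod (?I - ?J2) <= (1 + th\<^sup>2) * (A ^ 3 * (s ^ 4 * (4 * \<eta> + 4 * s))) + (1 + th\<^sup>2) * (A ^ 3 * (s ^ 4 * \<eta> + s ^ 3 * \<eta>))"
  using I by linarith
 also have "... = (1 + th\<^sup>2) * (A ^ 3 * (s ^ 4 * (5 * \<eta> + 4 * s) + s ^ 3 * \<eta>))" by (simp add: algebra_simps)
 finally show ?thesis by (simp add: xye \<psi>_def mult.commute)
qed

lemma loop_zeta_term:
 assumes e: "e \<in> E1"
 shows "cmod ((LINT om|M. \<zeta> e (om e) * iexp (th * S om)) - (\<kappa> + \<i> * th) * d * \<psi> th)
  <= (1 + th\<^sup>2) * (A ^ 3 * (s\<^sup>2 * (2 * (\<epsilon> + s))))"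
proof -
 have eJ: "e \<in> J" using e by (auto simp: J_def E1_def)
 have ee: "e \<subseteq> V" "card e = 1" using e by (auto simp: E1_def)
 define S0 where "S0 om = (\<Sum>e'\<in>J - {e}. \<zeta> e' (om e')) + cycsum om" for om
 have S0: "bdd_rv M S0" "free_of e S0" "\<And>om. S om = S0 om + \<zeta> e (om e) + 0 * 0"
 proof -
  show "bdd_rv M S0" unfolding S0_def using eJ by (intro bdd_rv_add bdd_rv_sum bdd_zeta_coord bdd_cycsum) auto
  show "free_of e S0" using free_other_zeta[of e] free_cyc_loop[OF e] unfolding S0_def free_of_def by simp
  show "S om = S0 om + \<zeta> e (om e) + 0 * 0" for om unfolding S_def S0_def sum.remove[OF finJ eJ] by simp
 qed
 interpret Pe: prob_space "\<nu> e" by (rule prob)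
 let ?z = "\<zeta> e"
 define E where "E f = (LINT t|\<nu> e. f t)" for f :: "_ => real"
 note stein = stein_expansion[where u = "%_. 0" and g = "%_. 0" and H = "%_. 1", OF finJ eJ prob bdd_zeta bdd_zeta bdd_rv_const
   bdd_rv_const free_const bdd_rv_const free_const S0(1)[unfolded M_def] S0(2,3), of th, folded M_def, folded E_def]
 have A: "1 <= A" "0 <= A" and s: "0 <= s" "s <= 1" using A_bounds s_bounds by auto
 have eps: "0 <= \<epsilon>" "\<epsilon> <= 1" using small by auto
 have "\<epsilon> * d <= d" using scale(3) eps by (simp add: mult_left_le_one_le)
 then have z2: "E (%t. (?z t)\<^sup>2) <= A * s\<^sup>2"
  using loop_moments(2)[OF ee] s_bounds(6) unfolding E_def by linarith
 have z1: "E (%t. \<bar>?z t\<bar>) <= A * s"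
  using z2 s(1) unfolding E_def by (intro order.trans[OF Pe.abs_le_sqrt_second_moment[OF bdd_zeta]] sqrt_A_le)
 have z3: "E (%t. \<bar>?z t\<bar> * (?z t)\<^sup>2) <= \<epsilon> * (A * s\<^sup>2)"
 proof -
  have "E (%t. \<bar>?z t\<bar> * (?z t)\<^sup>2) <= (LINT t|\<nu> e. \<epsilon> * (?z t)\<^sup>2)"
   unfolding E_def using zeta_le(1)
   by (intro integral_mono Pe.bdd_rv_integrable bdd_rv_mult bdd_rv_abs bdd_rv_power bdd_rv_const mult_right_mono bdd_zeta) auto
  also have "... = \<epsilon> * E (%t. (?z t)\<^sup>2)" by (simp add: E_def)
  also have "... <= \<epsilon> * (A * s\<^sup>2)" using z2 eps by (intro mult_left_mono)
  finally show ?thesis .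
 qed
 have zz: "\<bar>E (%t. ?z t * ?z t)\<bar> <= A * s\<^sup>2" using z2 by (simp add: E_def power2_eq_square)
 have zm: "E ?z = \<kappa> * d" using loop_moments(1)[OF ee] by (simp add: E_def)
 have "\<bar>\<kappa> * d\<bar> <= 1 * d" unfolding abs_mult using kappa scale(3) by (intro mult_mono) auto
 then have zd: "\<bar>E ?z\<bar> <= A * s\<^sup>2" using zm s_bounds(6) scale(3) by linarith
 have nn: "0 <= E (%t. \<bar>?z t\<bar>)" "0 <= E (%t. \<bar>?z t\<bar> * (?z t)\<^sup>2)" by (auto simp: E_def)
 note pw = scaled_le[OF A(1) s]
 have "E (%t. \<bar>?z t\<bar> * (?z t)\<^sup>2) + \<bar>E ?z\<bar> * E (%t. \<bar>?z t\<bar>) + \<bar>E (%t. ?z t * ?z t)\<bar> * E (%t. \<bar>?z t\<bar>)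
   <= \<epsilon> * (A * s\<^sup>2) + (A * s\<^sup>2) * (A * s) + (A * s\<^sup>2) * (A * s)"
  by (intro add_mono mult_mono z1 z3 zz zd nn abs_ge_zero mult_nonneg_nonneg zero_le_power2 A(2) s(1))
 also have "... = \<epsilon> * (A ^ 1 * s ^ 2) + 2 * (A ^ 2 * s ^ 3)" by (simp add: eval_nat_numeral algebra_simps)
 also have "... <= \<epsilon> * (A ^ 3 * s ^ 2) + 2 * (A ^ 3 * s ^ 3)" using eps by (intro add_mono pw) auto
 also have "... = A ^ 3 * (s\<^sup>2 * (\<epsilon> + 2 * s))" by (simp add: eval_nat_numeral algebra_simps)
 finally have "th\<^sup>2 * E (%t. \<bar>?z t\<bar> * (?z t)\<^sup>2) + \<bar>th\<bar> * (\<bar>E ?z\<bar> * E (%t. \<bar>?z t\<bar>)) + th\<^sup>2 * (\<bar>E (%t. ?z t * ?z t)\<bar> * E (%t. \<bar>?z t\<bar>))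
   <= (1 + th\<^sup>2) * (A ^ 3 * (s\<^sup>2 * (\<epsilon> + 2 * s)))"
  using nn by (intro combine_theta) auto
 moreover have E0: "E (%t. 0) = 0" by (simp add: E_def)
 ultimately have I: "cmod ((LINT om|M. ?z (om e) * iexp (th * S om)) - (E ?z + \<i> * th * E (%t. ?z t * ?z t)) * \<psi> th)
   <= (1 + th\<^sup>2) * (A ^ 3 * (s\<^sup>2 * (\<epsilon> + 2 * s)))"
  using stein by (simp add: PM.prob_space \<psi>_def E0 mult_ac)
 have "cmod ((E ?z + \<i> * th * E (%t. ?z t * ?z t)) * \<psi> th - (\<kappa> + \<i> * th) * d * \<psi> th) =
   cmod (\<i> * complex_of_real (th * (E (%t. ?z t * ?z t) - d)) * \<psi> th)"
  unfolding zm by (rule arg_cong[of _ _ cmod]) (simp add: algebra_simps)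
 also have "... = \<bar>th\<bar> * \<bar>E (%t. ?z t * ?z t) - d\<bar> * cmod (\<psi> th)"
  by (simp only: norm_mult norm_ii norm_of_real abs_mult mult_1)
 also have "... <= (1 + th\<^sup>2) * (A ^ 3 * (s\<^sup>2 * \<epsilon>)) * 1"
 proof (intro mult_mono psi_le_1)
  have "\<bar>E (%t. ?z t * ?z t) - d\<bar> <= \<epsilon> * d" using loop_moments(2)[OF ee] by (simp add: E_def power2_eq_square)
  also have "... <= \<epsilon> * (A ^ 1 * s\<^sup>2)" using s_bounds(6) eps scale(3) by (intro mult_left_mono) auto
  also have "... <= \<epsilon> * (A ^ 3 * s\<^sup>2)" using eps by (intro pw) auto
  finally show "\<bar>E (%t. ?z t * ?z t) - d\<bar> <= A ^ 3 * (s\<^sup>2 * \<epsilon>)" by (simp add: mult_ac)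
 qed (use theta_bounds A s eps in auto)
 finally have J: "cmod ((E ?z + \<i> * th * E (%t. ?z t * ?z t)) * \<psi> th - (\<kappa> + \<i> * th) * d * \<psi> th) <= (1 + th\<^sup>2) * (A ^ 3 * (s\<^sup>2 * \<epsilon>))" by simp
 have "cmod ((LINT om|M. ?z (om e) * iexp (th * S om)) - (\<kappa> + \<i> * th) * d * \<psi> th)
  <= cmod ((LINT om|M. ?z (om e) * iexp (th * S om)) - (E ?z + \<i> * th * E (%t. ?z t * ?z t)) * \<psi> th)
   + cmod ((E ?z + \<i> * th * E (%t. ?z t * ?z t)) * \<psi> th - (\<kappa> + \<i> * th) * d * \<psi> th)"
  by (rule order.trans[OF _ norm_triangle_ineq]) simp
 also have "... <= (1 + th\<^sup>2) * (A ^ 3 * (s\<^sup>2 * (\<epsilon> + 2 * s))) + (1 + th\<^sup>2) * (A ^ 3 * (s\<^sup>2 * \<epsilon>))" using I J by linarith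
 also have "... = (1 + th\<^sup>2) * (A ^ 3 * (s\<^sup>2 * (2 * (\<epsilon> + s))))" by (simp add: algebra_simps)
 finally show ?thesis .
qed

end

section \<open>The characteristic function of the cycle statistic\<close>

context edge_field
begin

definition "\<delta> = \<epsilon> + s + \<eta> / s"
definition "C = A ^ 3 * (20 + 10 * real L) + real L * (2 * A + 2 ^ L)"

lemma delta_bounds: "0 <= \<delta>" "\<epsilon> <= \<delta>" "s <= \<delta>" "\<eta> <= \<delta>" "\<eta> / s <= \<delta>"
proof -
 have "0 <= \<eta> / s" using small s_bounds by simp
 then show "0 <= \<delta>" "\<epsilon> <= \<delta>" "s <= \<delta>" "\<eta> <= \<delta>" "\<eta> / s <= \<delta>"
  using small s_bounds(1) unfolding \<delta>_def by linarith+
qed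

lemma card_E: "real (card E1) = n" "real (card E2) <= n\<^sup>2"
proof -
 have "card E1 = card V choose 1" unfolding E1_def using n_subsets[OF finV, of 1] by simp
 then show "real (card E1) = n" by simp
 have "card E2 = card V choose 2" unfolding E2_def by (rule n_subsets[OF finV])
 also have "... <= card V ^ 2" using V2 by (intro binomial_le_pow) auto
 finally show "real (card E2) <= n\<^sup>2" by (metis of_nat_le_iff of_nat_power)
qed

lemma card_pairs: "real (card pairs) <= n\<^sup>2"
proof -
 have "card pairs <= card (V \<times> V)" unfolding pairs_def by (intro card_mono) (auto simp: finV)
 then show ?thesis by (simp add: card_cartesian_product power2_eq_square flip: of_nat_mult)
qed

lemma cycsum_pairs: "cycsum om = (\<Sum>k\<in>{3..L}. 1 / (2 * real k) * (\<Sum>(x, y)\<in>pairs. \<beta> {x, y} (om {x, y}) * Gk k x y om))"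
 unfolding cycsum_def
proof (intro sum.cong refl arg_cong2[of _ _ _ _ "(*)"])
 fix k assume "k \<in> {3..L}"
 then have "(\<Sum>(x, y)\<in>pairs. Gk k x y om * \<beta> {x, y} (om {x, y})) = (\<Sum>r\<in>dpaths V k. P r om * \<beta> {last r, hd r} (om {last r, hd r}))"
  by (intro sum_pairs_Gk) auto
 then show "(\<Sum>r\<in>dpaths V k. cprod (%e. \<beta> e (om e)) r) = (\<Sum>(x, y)\<in>pairs. \<beta> {x, y} (om {x, y}) * Gk k x y om)"
  by (simp add: cprod_def P_def closing_def mult.commute)
qed

lemma pair_in_J: "p \<in> pairs ==> {fst p, snd p} \<in> J"
 by (auto simp: pairs_def J_def)

text \<open>Summing \<open>edge_beta_term\<close> over all pairs leaves the two sums treated in the concentration lemmas; replacing each of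
them by \<open>vc\<close> gives the factors \<open>\<kappa>\<close> and \<open>\<i> * th\<close>.\<close>
lemma cycle_part:
 "cmod ((LINT om|M. cycsum om * iexp (th * S om)) - (\<kappa> + \<i> * th) * vc * \<psi> th)
  <= (1 + th\<^sup>2) * ((A ^ 3 * (8 * real L) + real L * (2 * A + 2 ^ L)) * \<delta>)"
proof -
 let ?b = "%p om. \<beta> {fst p, snd p} (om {fst p, snd p})"
 let ?H = "%k p om. Gk k (fst p) (snd p) om"
 let ?g = "%p om. G (fst p) (snd p) om"
 define c where "c k = complex_of_real (1 / (2 * real k))" for k
 define I where "I k p = (LINT om|M. ?b p om * ?H k p om * iexp (th * S om))" for k p
 define J' where "J' k p = (LINT om|M. iexp (th * S om) * (\<kappa> * (b * ?H k p om) + \<i> * th * (b * (?H k p om * ?g p om))))" for k p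
 have bI: "bdd_rv M (%om. complex_of_real (?b p om * ?H k p om) * iexp (th * S om))" if "p \<in> pairs" for p k
  using pair_in_J[OF that] by (intro bdd_rv_mult bdd_rv_of_real bdd_rv_iexp bdd_S bdd_beta_coord bdd_Gk)
 have bJ: "bdd_rv M (%om. iexp (th * S om) * (\<kappa> * (b * ?H k p om) + \<i> * th * (b * (?H k p om * ?g p om))))" for p k
  by (intro bdd_rv_mult bdd_rv_add bdd_rv_of_real bdd_rv_const bdd_rv_iexp bdd_S bdd_G bdd_Gk)
 have 1: "(LINT om|M. cycsum om * iexp (th * S om)) = (\<Sum>k\<in>{3..L}. c k * (\<Sum>p\<in>pairs. I k p))"
 proof -
  have "(LINT om|M. cycsum om * iexp (th * S om)) =
    (LINT om|M. (\<Sum>k\<in>{3..L}. c k * (\<Sum>p\<in>pairs. complex_of_real (?b p om * ?H k p om) * iexp (th * S om))))"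
   unfolding cycsum_pairs case_prod_unfold c_def
   by (intro Bochner_Integration.integral_cong refl)
     (simp add: sum_distrib_right sum_distrib_left mult.assoc)
  also have "... = (\<Sum>k\<in>{3..L}. c k * (\<Sum>p\<in>pairs. I k p))"
   unfolding I_def using PM.bdd_rv_integrable[OF bI]
   by (subst Bochner_Integration.integral_sum) (auto simp: Bochner_Integration.integral_sum intro!: Bochner_Integration.integrable_sum integrable_mult_right)
  finally show ?thesis .
 qed
 define R1 where "R1 om = (\<Sum>k\<in>{3..L}. 1 / (2 * real k) * (\<Sum>(x, y)\<in>pairs. b * Gk k x y om))" for om
 define R2 where "R2 om = (\<Sum>k\<in>{3..L}. 1 / (2 * real k) * (\<Sum>(x, y)\<in>pairs. b * (Gk k x y om * G x y om)))" for om
 have bR: "bdd_rv M R1" "bdd_rv M R2"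
  unfolding R1_def[abs_def] R2_def[abs_def] case_prod_unfold
  by (intro bdd_rv_sum bdd_rv_mult bdd_rv_const bdd_G bdd_Gk)+
 have 2: "(\<Sum>k\<in>{3..L}. c k * (\<Sum>p\<in>pairs. J' k p)) = (LINT om|M. iexp (th * S om) * (\<kappa> * R1 om + \<i> * th * R2 om))"
 proof -
  have "(LINT om|M. iexp (th * S om) * (\<kappa> * R1 om + \<i> * th * R2 om)) =
    (LINT om|M. (\<Sum>k\<in>{3..L}. c k * (\<Sum>p\<in>pairs. iexp (th * S om) * (\<kappa> * (b * ?H k p om) + \<i> * th * (b * (?H k p om * ?g p om))))))"
  proof (intro Bochner_Integration.integral_cong refl)
   fix om
   have "complex_of_real (R1 om) = (\<Sum>k\<in>{3..L}. c k * (\<Sum>p\<in>pairs. complex_of_real (b * ?H k p om)))"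
    "complex_of_real (R2 om) = (\<Sum>k\<in>{3..L}. c k * (\<Sum>p\<in>pairs. complex_of_real (b * (?H k p om * ?g p om))))"
    by (simp_all add: R1_def R2_def c_def case_prod_unfold)
   then show "iexp (th * S om) * (\<kappa> * R1 om + \<i> * th * R2 om) =
    (\<Sum>k\<in>{3..L}. c k * (\<Sum>p\<in>pairs. iexp (th * S om) * (\<kappa> * (b * ?H k p om) + \<i> * th * (b * (?H k p om * ?g p om)))))"
    by (simp add: sum_distrib_left sum.distrib distrib_left mult_ac)
  qed
  also have "... = (\<Sum>k\<in>{3..L}. c k * (\<Sum>p\<in>pairs. J' k p))"
   unfolding J'_def using PM.bdd_rv_integrable[OF bJ]
   by (subst Bochner_Integration.integral_sum) (auto simp: Bochner_Integration.integral_sum intro!: Bochner_Integration.integrable_sum integrable_mult_right)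
  finally show ?thesis by simp
 qed
 have T: "0 <= 1 + th\<^sup>2" by simp
 have A0: "0 <= A" "0 <= A ^ 3" using A_bounds by auto
 have e1: "cmod ((\<Sum>k\<in>{3..L}. c k * (\<Sum>p\<in>pairs. I k p)) - (\<Sum>k\<in>{3..L}. c k * (\<Sum>p\<in>pairs. J' k p)))
   <= real L * ((1 + th\<^sup>2) * (A ^ 3 * (8 * \<delta>)))"
 proof -
  have "cmod ((\<Sum>k\<in>{3..L}. c k * (\<Sum>p\<in>pairs. I k p)) - (\<Sum>k\<in>{3..L}. c k * (\<Sum>p\<in>pairs. J' k p))) =
    cmod (\<Sum>k\<in>{3..L}. c k * (\<Sum>p\<in>pairs. I k p - J' k p))"
   by (simp add: sum_subtractf right_diff_distrib)
  also have "... <= (\<Sum>k\<in>{3..L}. cmod (c k * (\<Sum>p\<in>pairs. I k p - J' k p)))" by (rule norm_sum)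
  also have "... <= real L * ((1 + th\<^sup>2) * (A ^ 3 * (8 * \<delta>)))"
  proof (rule sum_over_lengths)
   fix k assume k: "3 <= k" "k <= L"
   have "cmod (c k) <= 1" using k by (simp add: c_def norm_divide norm_mult)
   then have "cmod (c k * (\<Sum>p\<in>pairs. I k p - J' k p)) <= cmod (\<Sum>p\<in>pairs. I k p - J' k p)"
    unfolding norm_mult by (simp add: mult_left_le_one_le)
   also have "... <= (\<Sum>p\<in>pairs. (1 + th\<^sup>2) * (A ^ 3 * (s ^ 4 * (6 * (\<epsilon> + s)) + s ^ 3 * (2 * \<eta>))))"
   proof (rule order.trans[OF norm_sum sum_mono])
    fix p assume "p \<in> pairs"
    then show "cmod (I k p - J' k p) <= (1 + th\<^sup>2) * (A ^ 3 * (s ^ 4 * (6 * (\<epsilon> + s)) + s ^ 3 * (2 * \<eta>)))"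
     unfolding I_def J'_def using edge_beta_term[of "fst p" "snd p" k th] k by simp
   qed
   also have "... = real (card pairs) * ((1 + th\<^sup>2) * (A ^ 3 * (s ^ 4 * (6 * (\<epsilon> + s)) + s ^ 3 * (2 * \<eta>))))" by simp
   also have "... <= n\<^sup>2 * ((1 + th\<^sup>2) * (A ^ 3 * (s ^ 4 * (6 * (\<epsilon> + s)) + s ^ 3 * (2 * \<eta>))))"
    using A0 s_bounds small by (intro mult_right_mono card_pairs mult_nonneg_nonneg add_nonneg_nonneg) auto
   also have "... = (1 + th\<^sup>2) * (A ^ 3 * (6 * (\<epsilon> + s) + 2 * (\<eta> / s)))"
   proof -
    have "n\<^sup>2 * s ^ 3 = (n\<^sup>2 * s ^ 4) / s" using s_bounds(1) by (simp add: eval_nat_numeral)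
    then have n3: "n\<^sup>2 * s ^ 3 = 1 / s" using s_bounds(9) by simp
    have "n\<^sup>2 * (s ^ 4 * (6 * (\<epsilon> + s)) + s ^ 3 * (2 * \<eta>)) = (n\<^sup>2 * s ^ 4) * (6 * (\<epsilon> + s)) + (n\<^sup>2 * s ^ 3) * (2 * \<eta>)"
     by (simp add: algebra_simps)
    also have "... = 6 * (\<epsilon> + s) + 2 * (\<eta> / s)" unfolding n3 s_bounds(9) by simp
    finally show ?thesis by (simp only: mult.left_commute[of "n\<^sup>2"])
   qed
   also have "... <= (1 + th\<^sup>2) * (A ^ 3 * (8 * \<delta>))"
   proof (intro mult_left_mono)
    define r where "r = \<eta> / s"
    have "0 <= r" using small s_bounds(1) by (simp add: r_def)
    then show "6 * (\<epsilon> + s) + 2 * (\<eta> / s) <= 8 * \<delta>"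
     unfolding \<delta>_def r_def[symmetric] using order.trans[OF small(1,2)] s_bounds(1)
     by (simp add: distrib_left)
   qed (use A0 in auto)
   finally show "cmod (c k * (\<Sum>p\<in>pairs. I k p - J' k p)) <= (1 + th\<^sup>2) * (A ^ 3 * (8 * \<delta>))" .
  qed (use A0 delta_bounds in auto)
  finally show ?thesis .
 qed
 have bE: "bdd_rv M (%om. iexp (th * S om) * (\<kappa> * R1 om + \<i> * th * R2 om))" "bdd_rv M (%om. iexp (th * S om) * ((\<kappa> + \<i> * th) * vc))"
  by (intro bdd_rv_mult bdd_rv_add bdd_rv_of_real bdd_rv_const bdd_rv_iexp bdd_S bR)+
 have e2: "cmod ((LINT om|M. iexp (th * S om) * (\<kappa> * R1 om + \<i> * th * R2 om)) - (\<kappa> + \<i> * th) * vc * \<psi> th)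
   <= (1 + th\<^sup>2) * (real L * (2 * A + 2 ^ L) * \<delta>)"
 proof -
  have "(\<kappa> + \<i> * th) * vc * \<psi> th = (LINT om|M. iexp (th * S om) * ((\<kappa> + \<i> * th) * vc))"
   by (simp add: \<psi>_def mult.commute)
  then have "cmod ((LINT om|M. iexp (th * S om) * (\<kappa> * R1 om + \<i> * th * R2 om)) - (\<kappa> + \<i> * th) * vc * \<psi> th) =
   cmod (LINT om|M. iexp (th * S om) * (\<kappa> * R1 om + \<i> * th * R2 om) - iexp (th * S om) * ((\<kappa> + \<i> * th) * vc))"
   using bE[THEN PM.bdd_rv_integrable] by (simp only: Bochner_Integration.integral_diff)
  also have "... <= (LINT om|M. \<kappa> * \<bar>R1 om - vc\<bar> + \<bar>th\<bar> * \<bar>R2 om - vc\<bar>)"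
  proof (rule cmod_integral_le)
   fix om
   have d: "iexp (th * S om) * (\<kappa> * R1 om + \<i> * th * R2 om) - iexp (th * S om) * ((\<kappa> + \<i> * th) * vc) =
     iexp (th * S om) * (complex_of_real (\<kappa> * (R1 om - vc)) + \<i> * complex_of_real (th * (R2 om - vc)))"
    by (simp add: algebra_simps)
   have "cmod (complex_of_real (\<kappa> * (R1 om - vc)) + \<i> * complex_of_real (th * (R2 om - vc))) <= \<bar>\<kappa> * (R1 om - vc)\<bar> + \<bar>th * (R2 om - vc)\<bar>"
    by (rule order.trans[OF norm_triangle_ineq]) (simp only: norm_mult norm_of_real norm_ii mult_1 order.refl)
   then show "cmod (iexp (th * S om) * (\<kappa> * R1 om + \<i> * th * R2 om) - iexp (th * S om) * ((\<kappa> + \<i> * th) * vc)) <= \<kappa> * \<bar>R1 om - vc\<bar> + \<bar>th\<bar> * \<bar>R2 om - vc\<bar>"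
    unfolding d using kappa by (simp only: norm_mult norm_exp_i_times mult_1) (auto simp: abs_mult)
  qed (use bE bR in \<open>auto intro!: bdd_rv_diff bdd_rv_add bdd_rv_mult bdd_rv_abs bdd_rv_const\<close>)
  also have "... = \<kappa> * (LINT om|M. \<bar>R1 om - vc\<bar>) + \<bar>th\<bar> * (LINT om|M. \<bar>R2 om - vc\<bar>)"
   using PM.bdd_rv_integrable[OF bdd_rv_abs[OF bdd_rv_diff[OF bR(1) bdd_rv_const]]] PM.bdd_rv_integrable[OF bdd_rv_abs[OF bdd_rv_diff[OF bR(2) bdd_rv_const]]]
   by simp
  also have "... <= real L * (K * sqrt q) + (1 + th\<^sup>2) * (real L * ((K + K\<^sup>2) * sqrt q + 2 ^ L * \<eta>))"
   by (rule add_mono[OF linear_concentration[folded R1_def] mult_mono[OF theta_bounds(2) quadratic_concentration[folded R2_def]]]) auto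
  also have "... <= (1 + th\<^sup>2) * (real L * (A * \<delta>)) + (1 + th\<^sup>2) * (real L * (A * \<delta> + 2 ^ L * \<delta>))"
  proof (intro add_mono mult_left_mono)
   have Ks: "K * sqrt q <= A * \<delta>"
   proof -
    have "K * sqrt q <= K * (2 * s)" using s_bounds K_nonneg by (intro mult_left_mono) auto
    also have "... = (2 * K) * s" by simp
    also have "... <= A * \<delta>" using A_bounds delta_bounds s_bounds A0 by (intro mult_mono) auto
    finally show ?thesis .
   qed
   have "1 * (real L * (K * sqrt q)) <= (1 + th\<^sup>2) * (real L * (A * \<delta>))"
    using Ks K_nonneg q_bounds(1) by (intro mult_mono[of 1] mult_left_mono) auto
   then show "real L * (K * sqrt q) <= (1 + th\<^sup>2) * (real L * (A * \<delta>))" by simp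
   have "(K + K\<^sup>2) * sqrt q <= (K + K\<^sup>2) * (2 * s)" using s_bounds K_nonneg by (intro mult_left_mono) auto
   also have "... = (2 * (K + K\<^sup>2)) * s" by simp
   also have "... <= A * \<delta>" using A_bounds delta_bounds s_bounds A0 by (intro mult_mono) auto
   finally show "(K + K\<^sup>2) * sqrt q <= A * \<delta>" .
   show "\<eta> <= \<delta>" by (rule delta_bounds)
  qed auto
  also have "... = (1 + th\<^sup>2) * (real L * (2 * A + 2 ^ L) * \<delta>)" by (simp add: algebra_simps)
  finally show ?thesis .
 qed
 have "cmod ((LINT om|M. cycsum om * iexp (th * S om)) - (\<kappa> + \<i> * th) * vc * \<psi> th) \<le>
   real L * ((1 + th\<^sup>2) * (A ^ 3 * (8 * \<delta>))) + (1 + th\<^sup>2) * (real L * (2 * A + 2 ^ L) * \<delta>)"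
 proof -
  have t: "cmod (x - z) <= cmod (x - y) + cmod (y - z)" for x y z
   using norm_triangle_ineq[of "x - y" "y - z"] by simp
  show ?thesis
   unfolding 1 by (rule order.trans[OF t add_mono[OF e1 e2[folded 2]]])
 qed
 also have "... = (1 + th\<^sup>2) * ((A ^ 3 * (8 * real L) + real L * (2 * A + 2 ^ L)) * \<delta>)" by (simp add: algebra_simps)
 finally show ?thesis .
qed

text \<open>For a normal variable with variance \<open>v\<close> and mean \<open>\<kappa> * v\<close> the left-hand difference would vanish. It
remains to sum the three kinds of terms: loops, edges and cycles.\<close>
lemma stein_equation:
 "cmod ((LINT om|M. S om * iexp (th * S om)) - (\<kappa> + \<i> * th) * vtot * \<psi> th) <= (1 + th\<^sup>2) * (C * \<delta>)"
proof -
 define I where "I e = (LINT om|M. \<zeta> e (om e) * iexp (th * S om))" for e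
 have bz: "bdd_rv M (%om. complex_of_real (\<zeta> e (om e)) * iexp (th * S om))" if "e \<in> J" for e
  using that by (intro bdd_rv_mult bdd_rv_of_real bdd_zeta_coord bdd_rv_iexp bdd_S)
 have bc: "bdd_rv M (%om. complex_of_real (cycsum om) * iexp (th * S om))"
  by (intro bdd_rv_mult bdd_rv_of_real bdd_cycsum bdd_rv_iexp bdd_S)
 have "(LINT om|M. S om * iexp (th * S om)) =
   (LINT om|M. (\<Sum>e\<in>J. complex_of_real (\<zeta> e (om e)) * iexp (th * S om)) + complex_of_real (cycsum om) * iexp (th * S om))"
  by (intro Bochner_Integration.integral_cong refl) (simp add: S_def sum_distrib_right distrib_right)
 also have "... = (\<Sum>e\<in>J. I e) + (LINT om|M. cycsum om * iexp (th * S om))"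
  unfolding I_def using bz[THEN PM.bdd_rv_integrable] PM.bdd_rv_integrable[OF bc]
  by (subst Bochner_Integration.integral_add) (auto simp: Bochner_Integration.integral_sum)
 finally have eq: "(LINT om|M. S om * iexp (th * S om)) = (\<Sum>e\<in>E1. I e) + (\<Sum>e\<in>E2. I e) + (LINT om|M. cycsum om * iexp (th * S om))"
  unfolding J_split(1) using J_split(2-4) by (simp add: sum.union_disjoint)
 define c1 c2 where "c1 = (\<kappa> + \<i> * th) * d * \<psi> th" and "c2 = (\<kappa> + \<i> * th) * a * \<psi> th"
 have A0: "0 <= A ^ 3" using A_bounds by auto
 have T1: "cmod ((\<Sum>e\<in>E1. I e) - (\<Sum>e\<in>E1. c1)) <= (1 + th\<^sup>2) * (A ^ 3 * (2 * (\<epsilon> + s)))"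
 proof -
  have "cmod ((\<Sum>e\<in>E1. I e) - (\<Sum>e\<in>E1. c1)) <= (\<Sum>e\<in>E1. (1 + th\<^sup>2) * (A ^ 3 * (s\<^sup>2 * (2 * (\<epsilon> + s)))))"
   unfolding sum_subtractf[symmetric] I_def c1_def using loop_zeta_term by (intro order.trans[OF norm_sum sum_mono]) auto
  also have "... = n * ((1 + th\<^sup>2) * (A ^ 3 * (s\<^sup>2 * (2 * (\<epsilon> + s)))))" by (simp add: card_E)
  also have "... = (1 + th\<^sup>2) * (A ^ 3 * ((n * s\<^sup>2) * (2 * (\<epsilon> + s))))" by (simp only: mult_ac)
  finally show ?thesis by (simp only: s_bounds(3) mult_1)
 qed
 have T2: "cmod ((\<Sum>e\<in>E2. I e) - (\<Sum>e\<in>E2. c2)) <= (1 + th\<^sup>2) * (A ^ 3 * (5 * \<eta> + 4 * s + \<eta> / s))"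
 proof -
  have "cmod ((\<Sum>e\<in>E2. I e) - (\<Sum>e\<in>E2. c2)) <= (\<Sum>e\<in>E2. (1 + th\<^sup>2) * (A ^ 3 * (s ^ 4 * (5 * \<eta> + 4 * s) + s ^ 3 * \<eta>)))"
   unfolding sum_subtractf[symmetric] I_def c2_def using edge_zeta_term by (intro order.trans[OF norm_sum sum_mono]) auto
  also have "... = real (card E2) * ((1 + th\<^sup>2) * (A ^ 3 * (s ^ 4 * (5 * \<eta> + 4 * s) + s ^ 3 * \<eta>)))" by simp
  also have "... <= n\<^sup>2 * ((1 + th\<^sup>2) * (A ^ 3 * (s ^ 4 * (5 * \<eta> + 4 * s) + s ^ 3 * \<eta>)))"
   using A0 s_bounds small by (intro mult_right_mono card_E mult_nonneg_nonneg add_nonneg_nonneg) auto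
  also have "... = (1 + th\<^sup>2) * (A ^ 3 * (5 * \<eta> + 4 * s + \<eta> / s))"
  proof -
   have "n\<^sup>2 * s ^ 3 = (n\<^sup>2 * s ^ 4) / s" using s_bounds(1) by (simp add: eval_nat_numeral)
   then have n3: "n\<^sup>2 * s ^ 3 = 1 / s" using s_bounds(9) by simp
   have "n\<^sup>2 * (s ^ 4 * (5 * \<eta> + 4 * s) + s ^ 3 * \<eta>) = (n\<^sup>2 * s ^ 4) * (5 * \<eta> + 4 * s) + (n\<^sup>2 * s ^ 3) * \<eta>"
    by (simp add: algebra_simps)
   also have "... = 5 * \<eta> + 4 * s + \<eta> / s" unfolding n3 s_bounds(9) by simp
   finally show ?thesis by (simp only: mult.left_commute[of "n\<^sup>2"])
  qed
  finally show ?thesis .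
 qed
 have v: "(\<kappa> + \<i> * th) * vtot * \<psi> th = (\<Sum>e\<in>E1. c1) + (\<Sum>e\<in>E2. c2) + (\<kappa> + \<i> * th) * vc * \<psi> th"
  by (simp add: vtot_def c1_def c2_def algebra_simps)
 have tri: "cmod ((x1 + x2 + x3) - (y1 + y2 + y3)) <= cmod (x1 - y1) + cmod (x2 - y2) + cmod (x3 - y3)" for x1 x2 x3 y1 y2 y3
 proof -
  have "(x1 + x2 + x3) - (y1 + y2 + y3) = (x1 - y1) + (x2 - y2) + (x3 - y3)" by simp
  then show ?thesis
   using norm_triangle_ineq[of "(x1 - y1) + (x2 - y2)" "x3 - y3"] norm_triangle_ineq[of "x1 - y1" "x2 - y2"] by (simp only:)
 qed
 have "cmod ((LINT om|M. S om * iexp (th * S om)) - (\<kappa> + \<i> * th) * vtot * \<psi> th) \<le>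
   (1 + th\<^sup>2) * (A ^ 3 * (2 * (\<epsilon> + s))) + (1 + th\<^sup>2) * (A ^ 3 * (5 * \<eta> + 4 * s + \<eta> / s))
   + (1 + th\<^sup>2) * ((A ^ 3 * (8 * real L) + real L * (2 * A + 2 ^ L)) * \<delta>)"
  unfolding eq v using T1 T2 cycle_part[of th] by (intro order.trans[OF tri] add_mono)
 also have "... <= (1 + th\<^sup>2) * (A ^ 3 * (4 * \<delta>)) + (1 + th\<^sup>2) * (A ^ 3 * (10 * \<delta>))
   + (1 + th\<^sup>2) * ((A ^ 3 * (8 * real L) + real L * (2 * A + 2 ^ L)) * \<delta>)"
  using delta_bounds A0 by (intro add_mono mult_left_mono) auto
 also have "... = (1 + th\<^sup>2) * ((A ^ 3 * (14 + 8 * real L) + real L * (2 * A + 2 ^ L)) * \<delta>)" by (simp add: algebra_simps)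
 also have "... <= (1 + th\<^sup>2) * (C * \<delta>)"
  unfolding C_def using delta_bounds A0 by (intro mult_left_mono mult_right_mono add_mono) auto
 finally show ?thesis .
qed

lemma psi_derivative: "(\<psi> has_vector_derivative (\<i> * (LINT om|M. S om * iexp (th * S om)))) (at th)"
proof -
 let ?D = "\<i> * (LINT om|M. S om * iexp (th * S om))"
 define B where "B = (LINT om|M. (S om)\<^sup>2)"
 have B: "0 <= B" by (simp add: B_def)
 have bnd: "cmod (\<psi> y - \<psi> th - (y - th) *\<^sub>R ?D) <= (y - th)\<^sup>2 * B" for y
 proof -
  let ?f = "%om. iexp (y * S om) - iexp (th * S om) - complex_of_real (y - th) * (\<i> * (S om * iexp (th * S om)))"
  have b: "bdd_rv M (%om. iexp (y * S om))" "bdd_rv M (%om. iexp (th * S om))" "bdd_rv M (%om. S om * iexp (th * S om))"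
   by (intro bdd_rv_iexp bdd_rv_mult bdd_rv_of_real bdd_S)+
  have eq: "\<psi> y - \<psi> th - (y - th) *\<^sub>R ?D = (LINT om|M. ?f om)"
   unfolding \<psi>_def scaleR_conv_of_real using b[THEN PM.bdd_rv_integrable] by simp
  have "cmod (LINT om|M. ?f om) <= (LINT om|M. (y - th)\<^sup>2 * (S om)\<^sup>2)"
  proof (rule cmod_integral_le)
   fix om
   have "?f om = iexp (th * S om) * (iexp ((y - th) * S om) - (1 + \<i> * complex_of_real ((y - th) * S om)))"
   proof -
    have "iexp (y * S om) = iexp (th * S om) * iexp ((y - th) * S om)"
     by (simp add: exp_add[symmetric] algebra_simps)
    then show ?thesis by (simp add: right_diff_distrib distrib_left)
   qed
   then have "cmod (?f om) = cmod (iexp ((y - th) * S om) - (1 + \<i> * complex_of_real ((y - th) * S om)))"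
    by (simp only: norm_mult norm_exp_i_times mult_1)
   also have "... <= ((y - th) * S om)\<^sup>2 / 2"
    using iexp_approx1[of "(y - th) * S om" 1] by (simp add: numeral_2_eq_2 power2_eq_square)
   also have "... <= (y - th)\<^sup>2 * (S om)\<^sup>2" by (simp add: power_mult_distrib)
   finally show "cmod (?f om) <= (y - th)\<^sup>2 * (S om)\<^sup>2" .
  qed (intro bdd_rv_diff bdd_rv_mult bdd_rv_const bdd_rv_power bdd_S b)+
  then show ?thesis unfolding eq by (simp add: B_def)
 qed
 show ?thesis
  unfolding has_vector_derivative_def has_derivative_at'
 proof (intro conjI allI impI bounded_linear_scaleR_left)
  fix e :: real assume e: "0 < e"
  show "\<exists>d>0. \<forall>y. 0 < norm (y - th) \<and> norm (y - th) < d \<longrightarrow> norm (\<psi> y - \<psi> th - (y - th) *\<^sub>R ?D) / norm (y - th) < e"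
  proof (intro exI[of _ "e / (B + 1)"] conjI allI impI)
   show "0 < e / (B + 1)" using e B by simp
   fix y assume y: "0 < norm (y - th) \<and> norm (y - th) < e / (B + 1)"
   have "norm (\<psi> y - \<psi> th - (y - th) *\<^sub>R ?D) / norm (y - th) <= ((y - th)\<^sup>2 * B) / norm (y - th)"
    using bnd[of y] y by (intro divide_right_mono) auto
   also have "... = \<bar>y - th\<bar> * B"
   proof -
    have sq: "(y - th)\<^sup>2 = \<bar>y - th\<bar> * \<bar>y - th\<bar>" by (simp add: power2_eq_square)
    have "x \<noteq> 0 ==> (x * x) * B / x = x * B" for x :: real by simp
    from this[of "\<bar>y - th\<bar>"] show ?thesis unfolding sq real_norm_def using y by (simp only: abs_eq_0 real_norm_def zero_less_abs_iff not_False_eq_True)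
   qed
   also have "... <= \<bar>y - th\<bar> * (B + 1)" by (intro mult_left_mono) auto
   also have "... < e" using y B by (simp add: pos_less_divide_eq)
   finally show "norm (\<psi> y - \<psi> th - (y - th) *\<^sub>R ?D) / norm (y - th) < e" .
  qed
 qed
qed

lemma vtot_bounds: "0 <= vtot" "vtot <= 2 * \<Lambda> + real L"
proof -
 have "0 <= vc" unfolding vc_def using vk_le_1 by (intro sum_nonneg mult_nonneg_nonneg) auto
 then show "0 <= vtot" unfolding vtot_def using scale by simp
 have "vc <= real L * 1" unfolding vc_def
 proof (rule sum_over_lengths)
  fix k assume k: "3 <= k" "k <= L"
  have "1 / (2 * real k) * vk k <= 1 * 1" using vk_le_1[of k] k by (intro mult_mono) auto
  then show "1 / (2 * real k) * vk k <= 1" by simp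
 qed simp
 moreover have "real (card E2) * a <= n\<^sup>2 * a" using card_E scale by (intro mult_right_mono) auto
 ultimately show "vtot <= 2 * \<Lambda> + real L" unfolding vtot_def card_E(1) using scale by linarith
qed

text \<open>The previous estimate is a linear differential equation for the characteristic function with a small error term.
Multiplying by the integrating factor turns it into a bound on a derivative, which is then integrated from 0.\<close>
theorem char_close:
 "cmod (\<psi> th - exp (\<i> * (\<kappa> * vtot * th) - th\<^sup>2 * vtot / 2)) <= \<bar>th\<bar> * ((1 + th\<^sup>2) * (C * \<delta>) * exp (th\<^sup>2 * vtot / 2))"
proof -
 define h where "h t = complex_of_real (t\<^sup>2 * vtot / 2) - \<i> * complex_of_real (\<kappa> * vtot * t)" for t
 define \<phi> where "\<phi> t = \<psi> t * exp (h t)" for t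
 define D where "D t = (\<i> * (LINT om|M. S om * iexp (t * S om)) - (\<i> * \<kappa> - t) * vtot * \<psi> t) * exp (h t)" for t
 have Cd: "0 <= C * \<delta>"
  using order.trans[OF norm_ge_zero stein_equation[of 0]] by simp
 have der: "(\<phi> has_vector_derivative D t) (at t)" for t
 proof -
  have "(h has_vector_derivative (t * vtot - \<i> * (\<kappa> * vtot))) (at t)"
   unfolding h_def
   by (auto intro!: derivative_eq_intros simp: has_vector_derivative_def scaleR_conv_of_real) (simp add: algebra_simps)
  then have "((%t. exp (h t)) has_vector_derivative (t * vtot - \<i> * (\<kappa> * vtot)) * exp (h t)) (at t)"
   using field_vector_diff_chain_at[of h _ t exp "exp (h t)"] DERIV_exp by (simp add: o_def)
  then have "(\<phi> has_vector_derivative (\<psi> t * ((t * vtot - \<i> * (\<kappa> * vtot)) * exp (h t)) + (\<i> * (LINT om|M. S om * iexp (t * S om))) * exp (h t))) (at t)"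
   unfolding \<phi>_def by (rule has_vector_derivative_mult[OF psi_derivative])
  moreover have "\<psi> t * ((t * vtot - \<i> * (\<kappa> * vtot)) * exp (h t)) + (\<i> * (LINT om|M. S om * iexp (t * S om))) * exp (h t) = D t"
   by (simp add: D_def algebra_simps)
  ultimately show ?thesis by simp
 qed
 have hn: "cmod (exp (h t)) = exp (t\<^sup>2 * vtot / 2)" for t by (simp add: h_def)
 have Dn: "cmod (D t) <= (1 + th\<^sup>2) * (C * \<delta>) * exp (th\<^sup>2 * vtot / 2)" if t: "\<bar>t\<bar> <= \<bar>th\<bar>" for t
 proof -
  have t2: "t\<^sup>2 <= th\<^sup>2" using t by (simp add: abs_le_square_iff)
  have "\<i> * (LINT om|M. S om * iexp (t * S om)) - (\<i> * \<kappa> - t) * vtot * \<psi> t =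
    \<i> * ((LINT om|M. S om * iexp (t * S om)) - (\<kappa> + \<i> * t) * vtot * \<psi> t)"
   by (simp add: algebra_simps)
  then have "cmod (D t) = cmod ((LINT om|M. S om * iexp (t * S om)) - (\<kappa> + \<i> * t) * vtot * \<psi> t) * exp (t\<^sup>2 * vtot / 2)"
   unfolding D_def by (simp only: norm_mult hn norm_ii mult_1)
  also have "... <= ((1 + t\<^sup>2) * (C * \<delta>)) * exp (t\<^sup>2 * vtot / 2)" by (intro mult_right_mono stein_equation) simp
  also have "... <= ((1 + th\<^sup>2) * (C * \<delta>)) * exp (th\<^sup>2 * vtot / 2)"
  proof (rule mult_mono)
   show "(1 + t\<^sup>2) * (C * \<delta>) <= (1 + th\<^sup>2) * (C * \<delta>)" using t2 by (rule mult_right_mono[OF add_left_mono Cd])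
   show "exp (t\<^sup>2 * vtot / 2) <= exp (th\<^sup>2 * vtot / 2)" using t2 vtot_bounds(1) by (simp add: mult_right_mono)
   show "0 <= (1 + th\<^sup>2) * (C * \<delta>)" by (rule mult_nonneg_nonneg[OF _ Cd]) simp
  qed simp
  finally show ?thesis .
 qed
 have "norm (\<phi> th - \<phi> 0) <= ((1 + th\<^sup>2) * (C * \<delta>) * exp (th\<^sup>2 * vtot / 2)) * norm (th - 0)"
 proof (rule differentiable_bound[where S = "{t. \<bar>t\<bar> <= \<bar>th\<bar>}" and f' = "%t y. y *\<^sub>R D t"])
  have "{t. \<bar>t\<bar> <= \<bar>th\<bar>} = {- \<bar>th\<bar>..\<bar>th\<bar>}" by auto
  then show "convex {t. \<bar>t\<bar> <= \<bar>th\<bar>}" by simp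
  fix t assume t: "t \<in> {t. \<bar>t\<bar> <= \<bar>th\<bar>}"
  show "(\<phi> has_derivative (%y. y *\<^sub>R D t)) (at t within {t. \<bar>t\<bar> <= \<bar>th\<bar>})"
   using der[of t] by (auto simp: has_vector_derivative_def intro: has_derivative_at_withinI)
  show "onorm (%y. y *\<^sub>R D t) <= (1 + th\<^sup>2) * (C * \<delta>) * exp (th\<^sup>2 * vtot / 2)"
   using Dn[of t] t Cd by (intro onorm_bound) (auto simp: mult.commute[of _ "cmod (D t)"] intro!: mult_right_mono)
 qed auto
 moreover have "\<phi> 0 = 1" by (simp add: \<phi>_def \<psi>_def h_def PM.prob_space)
 ultimately have c: "cmod (\<phi> th - 1) <= \<bar>th\<bar> * ((1 + th\<^sup>2) * (C * \<delta>) * exp (th\<^sup>2 * vtot / 2))" by (simp add: mult.commute)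
 have "\<psi> th - exp (- h th) = (\<phi> th - 1) * exp (- h th)"
  by (simp add: \<phi>_def algebra_simps exp_minus)
 then have "cmod (\<psi> th - exp (- h th)) = cmod (\<phi> th - 1) * exp (- (th\<^sup>2 * vtot / 2))"
  by (simp add: norm_mult h_def)
 also have "... <= cmod (\<phi> th - 1)" using vtot_bounds by (intro mult_right_le_one_le) auto
 finally show ?thesis using c by (simp add: h_def)
qed

end

section \<open>Gaussian integrals\<close>

lemma integral_std_normal:
 fixes f :: "real => real"
 assumes "f \<in> borel_measurable borel"
 shows "(LINT x|std_normal_distribution. f x) = (LINT x|lborel. std_normal_density x * f x)"
  "integrable std_normal_distribution f \<longleftrightarrow> integrable lborel (%x. std_normal_density x * f x)"
 using assms by (simp_all add: integral_density integrable_density)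

lemma std_normal_exp:
 "integrable std_normal_distribution (%x. exp (t * x))" (is ?A)
 "(LINT x|std_normal_distribution. exp (t * x)) = exp (t\<^sup>2 / 2)" (is ?B)
proof -
 have eq: "std_normal_density x * exp (t * x) = exp (t\<^sup>2 / 2) * normal_density t 1 x" for x
  by (simp add: normal_density_def exp_add[symmetric] power2_diff field_simps power2_eq_square)
    (simp add: exp_add[symmetric] field_simps)?
 show ?A by (subst integral_std_normal) (auto simp: eq)
 show ?B by (subst integral_std_normal) (auto simp: eq)
qed

lemma std_normal_exp_square:
 assumes c: "c < 1"
 shows "integrable std_normal_distribution (%x. exp (c * x\<^sup>2 / 2))" (is ?A)
  "(LINT x|std_normal_distribution. exp (c * x\<^sup>2 / 2)) = 1 / sqrt (1 - c)" (is ?B)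
proof -
 define \<sigma> where "\<sigma> = 1 / sqrt (1 - c)"
 have s: "\<sigma> > 0" "\<sigma>\<^sup>2 = 1 / (1 - c)" using c by (auto simp: \<sigma>_def power_divide)
 have eq: "std_normal_density x * exp (c * x\<^sup>2 / 2) = \<sigma> * normal_density 0 \<sigma> x" for x
 proof -
  have "exp (- x\<^sup>2 / 2) * exp (c * x\<^sup>2 / 2) = exp (- x\<^sup>2 / (2 * \<sigma>\<^sup>2))"
   unfolding s exp_add[symmetric] using c by (intro arg_cong[of _ _ exp]) (simp add: field_simps)
  moreover have "1 / sqrt (2 * pi) = \<sigma> * (1 / sqrt (2 * pi * \<sigma>\<^sup>2))"
   using s(1) by (simp add: real_sqrt_mult)
  ultimately show ?thesis by (simp add: normal_density_def mult.assoc)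
 qed
 show ?A using s(1) by (subst integral_std_normal) (auto simp: eq)
 show ?B using s(1) by (subst integral_std_normal) (auto simp: eq \<sigma>_def)
qed

lemma cosh_le_exp_square: "cosh x <= exp (x\<^sup>2 / 2)" for x :: real
proof -
 have f: "(2::real) ^ k * fact k <= fact (2 * k)" for k
 proof (induction k)
  case (Suc k)
  have "(2::real) ^ Suc k * fact (Suc k) = (2 * real (Suc k)) * (2 ^ k * fact k)" by simp
  also have "... <= (real (2 * k + 2) * real (2 * k + 1)) * fact (2 * k)"
   using Suc by (intro mult_mono) (auto simp: mult_le_cancel_left1)
  also have "... = fact (2 * Suc k)" by (simp add: algebra_simps)
  finally show ?case .
 qed simp
 have "(%k. x ^ (2 * k) /\<^sub>R fact (2 * k)) sums cosh x"
 proof -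
  let ?c = "%n. if even n then x ^ n /\<^sub>R fact n else 0"
  have "(%k. ?c (2 * k)) sums cosh x \<longleftrightarrow> ?c sums cosh x"
   by (rule sums_mono_reindex) (auto simp: strict_mono_def elim!: evenE)
  then show ?thesis using cosh_converges[of x] by simp
 qed
 moreover have "(%k. (x\<^sup>2 / 2) ^ k /\<^sub>R fact k) sums exp (x\<^sup>2 / 2)" by (rule exp_converges)
 ultimately show ?thesis
 proof (rule sums_le[rotated -2])
  fix k
  have "x ^ (2 * k) / fact (2 * k) <= x ^ (2 * k) / (2 ^ k * fact k)"
   using f[of k] by (intro divide_left_mono) (auto simp: power_mult)
  also have "... = (x\<^sup>2 / 2) ^ k / fact k" by (simp add: power_divide power_mult)
  finally show "x ^ (2 * k) /\<^sub>R fact (2 * k) <= (x\<^sup>2 / 2) ^ k /\<^sub>R fact k" by (simp add: field_simps)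
 qed
qed

text \<open>The quadratic term has to be kept: on the edges it produces the term \<open>- lb^2 / 4\<close> in the limit of the second moment.\<close>
lemma ln_one_plus_le_cubic: "ln (1 + x) <= x - x\<^sup>2 / 2 + x ^ 3 / 3" if "x > -1" for x :: real
proof -
 define f where "f x = x - x\<^sup>2 / 2 + x ^ 3 / 3 - ln (1 + x)" for x :: real
 have d: "(f has_real_derivative (x ^ 3 / (1 + x))) (at x)" if "x > -1" for x
 proof -
  have "(f has_real_derivative (1 - x + x\<^sup>2 - 1 / (1 + x))) (at x)"
   unfolding f_def using that by (auto intro!: derivative_eq_intros simp: power2_eq_square)
  also have "1 - x + x\<^sup>2 - 1 / (1 + x) = x ^ 3 / (1 + x)"
   using that by (simp add: field_simps power2_eq_square power3_eq_cube)
  finally show ?thesis .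
 qed
 have "f 0 <= f x"
 proof (cases "x >= 0")
  case True
  then show ?thesis
   by (intro DERIV_nonneg_imp_nondecreasing[of 0 x f]) (auto intro!: exI[of _ "_ ^ 3 / (1 + _)"] d)
 next
  case False
  then show ?thesis
   using that by (intro DERIV_nonpos_imp_nonincreasing[of x 0 f])
    (auto intro!: exI[of _ "_ ^ 3 / (1 + _)"] d divide_nonpos_pos simp: power3_eq_cube mult_nonpos_nonpos mult_nonneg_nonpos2 zero_le_mult_iff mult_le_0_iff)
 qed
 then show ?thesis by (simp add: f_def)
qed

lemma sum_sign_vectors_prod:
 fixes f :: "real => real"
 assumes "finite V"
 shows "(\<Sum>s\<in>V \<rightarrow>\<^sub>E {1, -1}. \<Prod>i\<in>V. f (s i)) = (f 1 + f (- 1)) ^ card V"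
proof -
 have "(\<Sum>s\<in>V \<rightarrow>\<^sub>E {1, -1}. \<Prod>i\<in>V. f (s i)) = (\<Prod>i\<in>V. \<Sum>t\<in>{1, -1}. f t)"
  by (rule prod_sum_PiE[symmetric]) (use assms in auto)
 then show ?thesis by simp
qed

text \<open>The square of the sum of the spins is linearized by a Gaussian integral, which turns the average over spins into a power of a
hyperbolic cosine; bounding that by \<open>exp (x^2 / 2)\<close> leaves a Gaussian integral that converges because \<open>n * b < 1\<close>.\<close>
lemma hubbard_stratonovich:
 assumes V: "finite V" and b: "0 <= b" "real (card V) * b < 1"
 shows "(\<Sum>s\<in>V \<rightarrow>\<^sub>E {1, -1}. exp (b * (\<Sum>i\<in>V. s i)\<^sup>2 / 2)) / 2 ^ card V <= 1 / sqrt (1 - real (card V) * b)"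
proof -
 let ?N = std_normal_distribution and ?S = "V \<rightarrow>\<^sub>E {1, -1 :: real}"
 have fS: "finite ?S" using V by (intro finite_PiE) auto
 have e: "exp (b * (\<Sum>i\<in>V. s i)\<^sup>2 / 2) = (LINT x|?N. exp (sqrt b * (\<Sum>i\<in>V. s i) * x))" for s
  using b by (simp add: std_normal_exp(2) power_mult_distrib)
 have "(\<Sum>s\<in>?S. exp (b * (\<Sum>i\<in>V. s i)\<^sup>2 / 2)) = (LINT x|?N. (\<Sum>s\<in>?S. exp (sqrt b * (\<Sum>i\<in>V. s i) * x)))"
  unfolding e by (rule Bochner_Integration.integral_sum[symmetric]) (rule std_normal_exp(1))
 also have "... = (LINT x|?N. 2 ^ card V * cosh (sqrt b * x) ^ card V)"
 proof (intro Bochner_Integration.integral_cong refl)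
  fix x
  have "(\<Sum>s\<in>?S. exp (sqrt b * (\<Sum>i\<in>V. s i) * x)) = (\<Sum>s\<in>?S. \<Prod>i\<in>V. exp (sqrt b * s i * x))"
   using V by (simp add: exp_sum[symmetric] sum_distrib_left sum_distrib_right)
  also have "... = (exp (sqrt b * 1 * x) + exp (sqrt b * (- 1) * x)) ^ card V"
   using V by (rule sum_sign_vectors_prod)
  also have "exp (sqrt b * 1 * x) + exp (sqrt b * (- 1) * x) = 2 * cosh (sqrt b * x)"
   by (simp add: cosh_field_def)
  finally show "(\<Sum>s\<in>?S. exp (sqrt b * (\<Sum>i\<in>V. s i) * x)) = 2 ^ card V * cosh (sqrt b * x) ^ card V"
   by (simp add: power_mult_distrib)
 qed
 also have "... = 2 ^ card V * (LINT x|?N. cosh (sqrt b * x) ^ card V)" by simp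
 finally have "(\<Sum>s\<in>?S. exp (b * (\<Sum>i\<in>V. s i)\<^sup>2 / 2)) / 2 ^ card V = (LINT x|?N. cosh (sqrt b * x) ^ card V)"
  by simp
 also have "... <= (LINT x|?N. exp ((real (card V) * b) * x\<^sup>2 / 2))"
 proof (rule integral_mono')
  show "integrable ?N (%x. exp ((real (card V) * b) * x\<^sup>2 / 2))" by (rule std_normal_exp_square(1)[OF b(2)])
  fix x
  have "cosh (sqrt b * x) ^ card V <= exp ((sqrt b * x)\<^sup>2 / 2) ^ card V"
   by (intro power_mono cosh_le_exp_square less_imp_le cosh_real_pos)
  also have "... = exp ((real (card V) * b) * x\<^sup>2 / 2)"
   using b by (simp add: exp_of_nat_mult[symmetric] power_mult_distrib)
  finally show "cosh (sqrt b * x) ^ card V <= exp ((real (card V) * b) * x\<^sup>2 / 2)" .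
 qed simp
 also have "... = 1 / sqrt (1 - real (card V) * b)" by (rule std_normal_exp_square(2)[OF b(2)])
 finally show ?thesis .
qed

text \<open>The minimum with 1 of a log-normal variable of mean 1.\<close>

text \<open>The minimum switches at \<open>\<sigma> / 2\<close>. Completing the square on the other side turns that part into a
shifted Gaussian tail, and by symmetry the two parts are equal tails at \<open>\<sigma> / 2\<close>.\<close>
lemma expectation_min_lognormal:
 assumes "0 <= \<sigma>"
 shows "(LINT x|std_normal_distribution. min 1 (exp (\<sigma> * x - \<sigma>\<^sup>2 / 2))) = erfc (\<sigma> / (2 * sqrt 2))"
proof -
 let ?p = std_normal_density
 define I where "I = (LINT x|lborel. indicator {\<sigma> / 2..} x * ?p x)"
 have ip: "integrable lborel (%x. indicator {\<sigma> / 2..} x * ?p x)" "integrable lborel (%x. indicator {..<\<sigma> / 2} x * ?p (\<sigma> + - 1 * x))"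
 proof -
  show "integrable lborel (%x. indicator {\<sigma> / 2..} x * ?p x)"
   by (rule Bochner_Integration.integrable_bound[OF integrable_normal_density[where \<mu> = 0 and \<sigma> = 1]]) (auto simp: indicator_def)
  have "integrable lborel (%x. ?p (\<sigma> + - 1 * x))"
   by (subst lborel_integrable_real_affine_iff[of "-1" ?p \<sigma>]) auto
  then show "integrable lborel (%x. indicator {..<\<sigma> / 2} x * ?p (\<sigma> + - 1 * x))"
   by (rule Bochner_Integration.integrable_bound) (auto simp: indicator_def)
 qed
 have eq: "?p x * min 1 (exp (\<sigma> * x - \<sigma>\<^sup>2 / 2)) = indicator {\<sigma> / 2..} x * ?p x + indicator {..<\<sigma> / 2} x * ?p (\<sigma> + - 1 * x)" for x
 proof (cases "x >= \<sigma> / 2")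
  case True
  then have "\<sigma> * (\<sigma> / 2) <= \<sigma> * x" using assms by (intro mult_left_mono)
  then have "exp (\<sigma> * x - \<sigma>\<^sup>2 / 2) >= 1" by (simp add: power2_eq_square)
  then show ?thesis using True by (simp add: indicator_def)
 next
  case False
  then have "\<sigma> * x <= \<sigma> * (\<sigma> / 2)" using assms by (intro mult_left_mono) auto
  then have "exp (\<sigma> * x - \<sigma>\<^sup>2 / 2) <= 1" by (simp add: power2_eq_square)
  then have "min 1 (exp (\<sigma> * x - \<sigma>\<^sup>2 / 2)) = exp (\<sigma> * x - \<sigma>\<^sup>2 / 2)" by (rule min_absorb2)
  moreover have "?p x * exp (\<sigma> * x - \<sigma>\<^sup>2 / 2) = ?p (\<sigma> + - 1 * x)"
  proof -
   have "exp (- x\<^sup>2 / 2) * exp (\<sigma> * x - \<sigma>\<^sup>2 / 2) = exp (- (\<sigma> + - 1 * x)\<^sup>2 / 2)"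
    unfolding exp_add[symmetric] by (intro arg_cong[of _ _ exp]) (simp add: power2_eq_square field_simps)
   then show ?thesis by (simp add: std_normal_density_def mult.assoc)
  qed
  ultimately show ?thesis using False by (simp add: indicator_def)
 qed
 have "(LINT x|std_normal_distribution. min 1 (exp (\<sigma> * x - \<sigma>\<^sup>2 / 2))) =
   I + (LINT x|lborel. indicator {..<\<sigma> / 2} x * ?p (\<sigma> + - 1 * x))"
  by (subst integral_std_normal(1)) (use ip in \<open>auto simp: eq I_def\<close>)
 also have "(LINT x|lborel. indicator {..<\<sigma> / 2} x * ?p (\<sigma> + - 1 * x)) = I"
 proof -
  have "(LINT x|lborel. indicator {\<sigma> / 2<..} x * ?p x) =
    \<bar>- 1\<bar> *\<^sub>R (LINT x|lborel. indicator {\<sigma> / 2<..} (\<sigma> + - 1 * x) * ?p (\<sigma> + - 1 * x))"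
   by (rule lborel_integral_real_affine) simp
  also have "... = (LINT x|lborel. indicator {..<\<sigma> / 2} x * ?p (\<sigma> + - 1 * x))"
  proof -
   have "indicator {\<sigma> / 2<..} (\<sigma> + - 1 * x) = (indicator {..<\<sigma> / 2} x :: real)" for x by (auto simp: indicator_def)
   then show ?thesis by simp
  qed
  finally have "(LINT x|lborel. indicator {..<\<sigma> / 2} x * ?p (\<sigma> + - 1 * x)) = (LINT x|lborel. indicator {\<sigma> / 2<..} x * ?p x)" ..
  also have "... = I"
   unfolding I_def
  proof (rule integral_cong_AE)
   show "AE x in lborel. indicator {\<sigma> / 2<..} x * ?p x = indicator {\<sigma> / 2..} x * ?p x"
    using AE_lborel_singleton[of "\<sigma> / 2"] by eventually_elim (auto simp: indicator_def)
  qed auto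
  finally show ?thesis .
 qed
 also have "I = 1 / sqrt pi * (LBINT t:{\<sigma> / (2 * sqrt 2)..}. exp (- t\<^sup>2))"
 proof -
  have "I = \<bar>sqrt 2\<bar> *\<^sub>R (LINT t|lborel. indicator {\<sigma> / 2..} (0 + sqrt 2 * t) * ?p (0 + sqrt 2 * t))"
   unfolding I_def by (rule lborel_integral_real_affine) simp
  also have "... = (LINT t|lborel. sqrt 2 * (indicator {\<sigma> / 2..} (0 + sqrt 2 * t) * ?p (0 + sqrt 2 * t)))" by simp
  also have "... = (LINT t|lborel. 1 / sqrt pi * (indicator {\<sigma> / (2 * sqrt 2)..} t *\<^sub>R exp (- t\<^sup>2)))"
  proof (intro Bochner_Integration.integral_cong refl)
   fix t
   have "\<sigma> / 2 <= sqrt 2 * t \<longleftrightarrow> \<sigma> / (2 * sqrt 2) <= t" by (simp add: field_simps)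
   then show "sqrt 2 * (indicator {\<sigma> / 2..} (0 + sqrt 2 * t) * ?p (0 + sqrt 2 * t)) =
     1 / sqrt pi * (indicator {\<sigma> / (2 * sqrt 2)..} t *\<^sub>R exp (- t\<^sup>2))"
    by (auto simp: indicator_def std_normal_density_def real_sqrt_mult power_mult_distrib)
  qed
  also have "... = 1 / sqrt pi * (LBINT t:{\<sigma> / (2 * sqrt 2)..}. exp (- t\<^sup>2))"
   unfolding set_lebesgue_integral_def by (rule integral_mult_right_zero)
  finally show ?thesis .
 qed
 finally show ?thesis by (simp add: erfc_def)
qed

lemma char_affine_std_normal:
 "char (distr std_normal_distribution borel (%x. m + \<sigma> * x)) th = exp (\<i> * (m * th) - th\<^sup>2 * \<sigma>\<^sup>2 / 2)"
proof -
 have "char (distr std_normal_distribution borel (%x. m + \<sigma> * x)) th = (CLINT x|std_normal_distribution. iexp (th * (m + \<sigma> * x)))"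
  unfolding char_def by (subst integral_distr) auto
 also have "... = (CLINT x|std_normal_distribution. iexp (th * m) * iexp ((th * \<sigma>) * x))"
  by (intro Bochner_Integration.integral_cong refl) (simp add: exp_add[symmetric] algebra_simps)
 also have "... = iexp (th * m) * char std_normal_distribution (th * \<sigma>)"
  unfolding char_def by (rule integral_mult_right_zero)
 also have "... = exp (\<i> * (m * th) - th\<^sup>2 * \<sigma>\<^sup>2 / 2)"
  unfolding char_std_normal_distribution
  by (simp add: exp_of_real[symmetric] exp_add[symmetric] power_mult_distrib algebra_simps del: exp_of_real)
 finally show ?thesis .
qed

section \<open>The likelihood ratio averaged over spins\<close>

lemma density_PiM:
 fixes D :: "'i => 't => ennreal"
 assumes J: "finite J" and prob: "\<And>i. prob_space (\<nu> i)"
  and D: "\<And>i. D i \<in> borel_measurable (\<nu> i)" "\<And>i. prob_space (density (\<nu> i) (D i))"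
 shows "density (PiM J \<nu>) (%om. \<Prod>i\<in>J. D i (om i)) = PiM J (%i. density (\<nu> i) (D i))"
proof -
 interpret P: product_sigma_finite \<nu>
  using prob by (simp add: product_sigma_finite_def prob_space_imp_sigma_finite)
 interpret Q: product_sigma_finite "%i. density (\<nu> i) (D i)"
  using D(2) by (simp add: product_sigma_finite_def prob_space_imp_sigma_finite)
 note D(1)[measurable]
 have m: "(%om. \<Prod>i\<in>J. D i (om i)) \<in> borel_measurable (PiM J \<nu>)"
  by (intro borel_measurable_prod_ennreal) measurable
 show ?thesis
 proof (rule Q.PiM_eqI[OF J])
  show "sets (density (PiM J \<nu>) (%om. \<Prod>i\<in>J. D i (om i))) = sets (PiM J (%i. density (\<nu> i) (D i)))"
   by (simp cong: sets_PiM_cong)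
  fix A assume A: "\<And>i. i \<in> J ==> A i \<in> sets (density (\<nu> i) (D i))"
  then have A': "\<And>i. i \<in> J ==> A i \<in> sets (\<nu> i)" by simp
  have "emeasure (density (PiM J \<nu>) (%om. \<Prod>i\<in>J. D i (om i))) (Pi\<^sub>E J A) =
   (\<integral>\<^sup>+om. (\<Prod>i\<in>J. D i (om i)) * indicator (Pi\<^sub>E J A) om \<partial>PiM J \<nu>)"
   using m A' J by (intro emeasure_density) (auto intro!: sets_PiM_I_finite)
  also have "... = (\<integral>\<^sup>+om. (\<Prod>i\<in>J. D i (om i) * indicator (A i) (om i)) \<partial>PiM J \<nu>)"
  proof (rule nn_integral_cong)
   fix om assume "om \<in> space (PiM J \<nu>)"
   then have "om \<in> extensional J" by (auto simp: space_PiM PiE_def)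
   then have "indicator (Pi\<^sub>E J A) om = (\<Prod>i\<in>J. indicator (A i) (om i) :: ennreal)"
    using J by (auto simp: indicator_def PiE_def Pi_def prod_zero_iff)
   then show "(\<Prod>i\<in>J. D i (om i)) * indicator (Pi\<^sub>E J A) om = (\<Prod>i\<in>J. D i (om i) * indicator (A i) (om i))"
    by (simp add: prod.distrib)
  qed
  also have "... = (\<Prod>i\<in>J. \<integral>\<^sup>+t. D i t * indicator (A i) t \<partial>\<nu> i)"
   using A' by (intro P.product_nn_integral_prod[OF J]) auto
  also have "... = (\<Prod>i\<in>J. emeasure (density (\<nu> i) (D i)) (A i))"
   using A' by (intro prod.cong refl emeasure_density[symmetric]) auto
  finally show "emeasure (density (PiM J \<nu>) (%om. \<Prod>i\<in>J. D i (om i))) (Pi\<^sub>E J A) = (\<Prod>i\<in>J. emeasure (density (\<nu> i) (D i)) (A i))" .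
 qed
qed

text \<open>The value 1 outside \<open>V\<close> makes this a sign for every set, so that tilting can be stated without side conditions.\<close>
definition spin_prod :: "'v set => ('v => real) => 'v set => real" where
 "spin_prod V s e = (if e \<subseteq> V then \<Prod>i\<in>e. s i else 1)"

lemma sign_cases: "s \<in> V \<rightarrow>\<^sub>E {1, -1 :: real} ==> i \<in> V ==> s i = 1 \<or> s i = - 1"
 by (auto simp: PiE_def Pi_def)

lemma sign_square: "s \<in> V \<rightarrow>\<^sub>E {1, -1 :: real} ==> i \<in> V ==> s i * s i = 1"
 using sign_cases[of s V i] by auto

lemma spin_prod_cases:
 assumes "s \<in> V \<rightarrow>\<^sub>E {1, -1 :: real}"
 shows "spin_prod V s e = 1 \<or> spin_prod V s e = - 1"
proof (cases "finite e \<and> e \<subseteq> V")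
 case True
 then have "finite e" "e \<subseteq> V" by auto
 then have "(\<Prod>i\<in>e. s i) = 1 \<or> (\<Prod>i\<in>e. s i) = - 1"
 proof (induction e)
  case (insert i e)
  then show ?case using sign_cases[OF assms, of i] by auto
 qed simp
 then show ?thesis using True by (simp add: spin_prod_def)
qed (auto simp: spin_prod_def)

lemma pprod_spin_prod:
 assumes s: "s \<in> V \<rightarrow>\<^sub>E {1, -1 :: real}" and "distinct r" "set r \<subseteq> V" "r \<noteq> []"
 shows "pprod (spin_prod V s) r = s (hd r) * s (last r)"
 using assms(2-)
proof (induction r rule: steps.induct)
 case (1 x y zs)
 have y: "s y * s y = 1" using 1 sign_square[OF s] by auto
 have e: "spin_prod V s {x, y} = s x * s y" using 1 by (simp add: spin_prod_def)
 have "pprod (spin_prod V s) (x # y # zs) = spin_prod V s {x, y} * pprod (spin_prod V s) (y # zs)"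
  by (simp add: pprod_def)
 also have "... = (s x * s y) * (s y * s (last (y # zs)))" using 1 e by simp
 also have "... = s x * (s y * s y) * s (last (y # zs))" by (simp only: mult_ac)
 finally show ?case by (simp add: y)
next
 case ("2_2" x)
 then show ?case using sign_square[OF s] by (simp add: pprod_def)
qed auto

lemma pprod_mult: "pprod (%e. g e * f e) r = pprod g r * pprod f r"
proof -
 have "prod_list (map (%e. g e * f e) l) = prod_list (map g l) * prod_list (map f l)" for l
  by (induction l) (auto simp: mult_ac)
 then show ?thesis by (simp add: pprod_def)
qed

text \<open>Every vertex of a cycle lies on exactly two of its edges, so the spins cancel. Hence the cycle statistic does not
see the spin vector and its law is controlled uniformly over all spins.\<close>
lemma cprod_spin_prod:
 assumes s: "s \<in> V \<rightarrow>\<^sub>E {1, -1 :: real}" and "r \<in> dpaths V k" "k >= 3"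
 shows "cprod (%e. spin_prod V s e * f e) r = cprod f r"
proof -
 have g: "distinct r" "set r \<subseteq> V" "length r = k" using assms(2) by (auto simp: dpaths_def)
 obtain u v w where gg: "r = u # v # w" using g(3) assms(3) by (auto simp: numeral_3_eq_3 Suc_le_length_iff)
 have ne: "last r \<noteq> hd r" "r \<noteq> []" using g gg last_in_set[of "v # w"] by auto
 have V: "hd r \<in> V" "last r \<in> V" using g ne by auto
 have "spin_prod V s (closing r) * pprod (spin_prod V s) r = (s (last r) * s (hd r)) * (s (hd r) * s (last r))"
  using ne V by (simp add: pprod_spin_prod[OF s g(1,2) ne(2)] closing_def spin_prod_def)
 also have "... = (s (hd r) * s (hd r)) * (s (last r) * s (last r))" by (simp only: mult_ac)
 finally have 1: "spin_prod V s (closing r) * pprod (spin_prod V s) r = 1"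
  using V sign_square[OF s] by simp
 have "cprod (%e. spin_prod V s e * f e) r = (spin_prod V s (closing r) * pprod (spin_prod V s) r) * cprod f r"
  unfolding cprod_def pprod_mult by (simp only: mult_ac)
 then show ?thesis by (simp add: 1)
qed

text \<open>Two-element subsets rather than ordered pairs, matching the index set of the edge variables.\<close>
lemma square_sum_eq_pairs:
 fixes f :: "'v => real"
 assumes "finite V"
 shows "(\<Sum>i\<in>V. f i)\<^sup>2 = (\<Sum>i\<in>V. (f i)\<^sup>2) + 2 * (\<Sum>e | e \<subseteq> V \<and> card e = 2. \<Prod>i\<in>e. f i)"
 using assms
proof (induction V)
 case empty
 have "{e. e \<subseteq> ({} :: 'v set) \<and> card e = 2} = {}" by auto
 then show ?case by simp
next
 case (insert v V)
 let ?P = "{e. e \<subseteq> V \<and> card e = 2}" and ?Q = "(%i. {v, i}) ` V"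
 have eq: "{e. e \<subseteq> insert v V \<and> card e = 2} = ?P \<union> ?Q"
 proof (intro set_eqI iffI)
  fix e assume "e \<in> {e. e \<subseteq> insert v V \<and> card e = 2}"
  then obtain x y where "e = {x, y}" "x \<noteq> y" "x \<in> insert v V" "y \<in> insert v V" by (auto simp: card_2_iff)
  then show "e \<in> ?P \<union> ?Q" by (auto simp: insert_commute)
 next
  fix e assume "e \<in> ?P \<union> ?Q"
  then show "e \<in> {e. e \<subseteq> insert v V \<and> card e = 2}" using insert.hyps by (auto simp: card_insert_if)
 qed
 have fin: "finite ?P" by (rule finite_subset[of _ "Pow V"]) (use insert in auto)
 have inj: "inj_on (%i. {v, i}) V" using insert.hyps by (auto simp: inj_on_def doubleton_eq_iff)
 have "(\<Sum>e\<in>?Q. \<Prod>i\<in>e. f i) = (\<Sum>i\<in>V. \<Prod>i\<in>{v, i}. f i)" by (simp add: sum.reindex[OF inj])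
 also have "... = (\<Sum>i\<in>V. f v * f i)"
 proof (intro sum.cong refl)
  fix i assume "i \<in> V"
  then have "v \<noteq> i" using insert.hyps by auto
  then show "(\<Prod>i\<in>{v, i}. f i) = f v * f i" by simp
 qed
 finally have Q: "(\<Sum>e\<in>?Q. \<Prod>i\<in>e. f i) = f v * (\<Sum>i\<in>V. f i)" by (simp add: sum_distrib_left)
 have "(\<Sum>e\<in>?P \<union> ?Q. \<Prod>i\<in>e. f i) = (\<Sum>e\<in>?P. \<Prod>i\<in>e. f i) + f v * (\<Sum>i\<in>V. f i)"
  unfolding Q[symmetric] using insert.hyps fin by (intro sum.union_disjoint) auto
 then show ?case unfolding eq using insert by (simp add: power2_eq_square algebra_simps)
qed

text \<open>The conditions under which tilting by \<open>1 + \<zeta> \<plusminus> \<beta>\<close> produces, up to relative errors of size \<open>\<eta>\<close>, the moments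
of an edge field with \<open>\<kappa> = 1\<close>. The vanishing mixed moments hold in the application because \<open>\<beta>\<close> is odd under a
symmetry of the law that leaves \<open>\<zeta>\<close> unchanged.\<close>
locale null_model =
 fixes V :: "'v set" and \<nu> :: "'v set => 't measure" and \<zeta> \<beta> :: "'v set => 't => real"
  and a b d \<epsilon> \<eta> \<Lambda> :: real and L :: nat
 assumes finV: "finite V" and V2: "card V >= 2"
  and prob: "\<And>e. prob_space (\<nu> e)"
  and meas: "\<And>e. \<zeta> e \<in> borel_measurable (\<nu> e)" "\<And>e. \<beta> e \<in> borel_measurable (\<nu> e)"
  and zeta_le: "\<And>e t. \<bar>\<zeta> e t\<bar> <= \<epsilon>" "\<And>e t. card e = 2 ==> \<bar>\<zeta> e t\<bar> <= \<eta>"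
  and beta_le: "\<And>e t. \<bar>\<beta> e t\<bar> <= \<epsilon>"
  and small: "0 <= \<eta>" "\<eta> <= \<epsilon>" "\<epsilon> <= 1 / 2"
  and scale: "0 <= a" "0 <= b" "0 <= d" "real (card V) * b < 1" "real (card V) ^ 2 * a <= \<Lambda>"
   "real (card V) * d <= \<Lambda>" "1 <= \<Lambda>"
  and means: "\<And>e. (LINT t|\<nu> e. \<zeta> e t) = 0" "\<And>e. (LINT t|\<nu> e. \<beta> e t) = 0"
  and edge_moments: "\<And>e. e \<subseteq> V ==> card e = 2 ==> (LINT t|\<nu> e. (\<beta> e t)\<^sup>2) = b"
   "\<And>e. e \<subseteq> V ==> card e = 2 ==> (LINT t|\<nu> e. (\<zeta> e t)\<^sup>2) = a"
   "\<And>e. e \<subseteq> V ==> card e = 2 ==> (LINT t|\<nu> e. \<zeta> e t * \<beta> e t) = 0"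
   "\<And>e. e \<subseteq> V ==> card e = 2 ==> (LINT t|\<nu> e. (\<zeta> e t)\<^sup>2 * \<beta> e t) = 0"
   "\<And>e. e \<subseteq> V ==> card e = 2 ==> (LINT t|\<nu> e. \<beta> e t * (\<beta> e t)\<^sup>2) = 0"
  and loop_moments: "\<And>e. e \<subseteq> V ==> card e = 1 ==> (LINT t|\<nu> e. (\<zeta> e t)\<^sup>2) = d"
   "\<And>e t. card e = 1 ==> \<beta> e t = 0"
begin

sublocale H0: edge_field V \<nu> \<zeta> \<beta> 0 a b d \<epsilon> \<eta> \<Lambda> L
proof (rule edge_field.intro)
 show "\<And>e. prob_space (\<nu> e)" by (rule prob)
qed (use finV V2 meas zeta_le beta_le small scale means edge_moments loop_moments in auto)

definition "tilt s e t = 1 + \<zeta> e t + spin_prod V s e * \<beta> e t"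
definition "signs = V \<rightarrow>\<^sub>E {1, -1 :: real}"
definition "LR om = (\<Sum>s\<in>signs. \<Prod>e\<in>H0.J. tilt s e (om e)) / 2 ^ card V"
definition "tilted s e = density (\<nu> e) (%t. ennreal (tilt s e t))"

lemma spin: "s \<in> signs ==> spin_prod V s e = 1 \<or> spin_prod V s e = - 1"
 unfolding signs_def by (rule spin_prod_cases)

lemma spin_sq: "s \<in> signs ==> spin_prod V s e * spin_prod V s e = 1"
 using spin[of s e] by auto

lemma tilt_nonneg: "s \<in> signs ==> 0 <= tilt s e t"
 using spin[of s e] small beta_le[of e t] zeta_le(1)[of e t] unfolding tilt_def by auto

lemma bdd_tilt: "bdd_rv (\<nu> e) (%t. tilt s e t)"
 unfolding tilt_def by (intro bdd_rv_add bdd_rv_mult bdd_rv_const H0.bdd_beta H0.bdd_zeta)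

lemma integral_tilt: "(LINT t|\<nu> e. tilt s e t) = 1"
proof -
 interpret Pe: prob_space "\<nu> e" by (rule prob)
 show ?thesis
  unfolding tilt_def using Pe.bdd_rv_integrable[OF H0.bdd_beta] Pe.bdd_rv_integrable[OF H0.bdd_zeta]
  by (simp add: means Pe.prob_space)
qed

lemma prob_tilted:
 assumes s: "s \<in> signs"
 shows "prob_space (tilted s e)"
proof -
 interpret Pe: prob_space "\<nu> e" by (rule prob)
 have "emeasure (density (\<nu> e) (%t. ennreal (tilt s e t))) (space (\<nu> e)) = (\<integral>\<^sup>+t. ennreal (tilt s e t) \<partial>\<nu> e)"
  using bdd_tilt[of e s] by (subst emeasure_density) (auto simp: bdd_rv_def intro!: nn_integral_cong)
 also have "... = ennreal (LINT t|\<nu> e. tilt s e t)"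
  using tilt_nonneg[OF s] by (intro nn_integral_eq_integral Pe.bdd_rv_integrable bdd_tilt) auto
 finally show ?thesis by (intro prob_spaceI) (simp add: tilted_def integral_tilt)
qed

lemma integral_tilted:
 assumes "s \<in> signs" "bdd_rv (\<nu> e) f"
 shows "(LINT t|tilted s e. f t) = ((LINT t|\<nu> e. tilt s e t * f t) :: real)"
 using assms bdd_tilt[of e s] tilt_nonneg[OF assms(1)] unfolding tilted_def
 by (subst integral_density) (auto simp: bdd_rv_def)

text \<open>A moment of the tilted law is a moment of the null law with one more factor; for example the
mean of \<open>\<beta>\<close> becomes its second moment. The vanishing third order moments and the bound \<open>\<eta>\<close> on \<open>\<zeta>\<close> give the relative errors.\<close>
lemma tilted_field:
 assumes s: "s \<in> signs"
 shows "edge_field V (tilted s) \<zeta> (%e t. spin_prod V s e * \<beta> e t) 1 a b d \<epsilon> \<eta> \<Lambda>"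
proof (rule edge_field.intro)
 fix e :: "'v set"
 interpret Pe: prob_space "\<nu> e" by (rule prob)
 let ?p = "spin_prod V s e"
 have p: "?p * ?p = 1" "?p\<^sup>2 = 1" using spin_sq[OF s] by (auto simp: power2_eq_square)
 have m: "sets (tilted s e) = sets (\<nu> e)" by (simp add: tilted_def)
 show "prob_space (tilted s e)" by (rule prob_tilted[OF s])
 show "\<zeta> e \<in> borel_measurable (tilted s e)" "(%t. ?p * \<beta> e t) \<in> borel_measurable (tilted s e)"
  using meas[of e] by (auto simp: measurable_cong_sets[OF m refl])
 note bz = H0.bdd_zeta[of e] and bb = H0.bdd_beta[of e]
 note ib = Pe.bdd_rv_integrable
 have int: "integrable (\<nu> e) (%t. \<beta> e t)" "integrable (\<nu> e) (%t. \<zeta> e t)" "integrable (\<nu> e) (%t. (\<zeta> e t)\<^sup>2)" "integrable (\<nu> e) (%t. (\<beta> e t)\<^sup>2)"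
  "integrable (\<nu> e) (%t. \<zeta> e t * \<beta> e t)" "integrable (\<nu> e) (%t. (\<zeta> e t)\<^sup>2 * \<beta> e t)" "integrable (\<nu> e) (%t. \<zeta> e t * (\<beta> e t)\<^sup>2)"
  "integrable (\<nu> e) (%t. \<beta> e t * (\<beta> e t)\<^sup>2)" "integrable (\<nu> e) (%t. \<zeta> e t * (\<zeta> e t)\<^sup>2)"
  by (intro ib bdd_rv_mult bdd_rv_power bz bb)+
 have cubic: "\<bar>(LINT t|\<nu> e. \<zeta> e t * (f t)\<^sup>2)\<bar> <= c * (LINT t|\<nu> e. (f t)\<^sup>2)"
  if f: "bdd_rv (\<nu> e) f" and c: "\<And>t. \<bar>\<zeta> e t\<bar> <= c" for f c
 proof -
  have "\<bar>(LINT t|\<nu> e. \<zeta> e t * (f t)\<^sup>2)\<bar> <= (LINT t|\<nu> e. \<bar>\<zeta> e t * (f t)\<^sup>2\<bar>)" by (rule integral_abs_bound)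
  also have "... <= (LINT t|\<nu> e. c * (f t)\<^sup>2)"
   using c f by (intro integral_mono ib bdd_rv_abs bdd_rv_mult bdd_rv_power bdd_rv_const bz) (auto simp: abs_mult mult_right_mono)
  finally show ?thesis by simp
 qed
 show "\<bar>?p * \<beta> e t\<bar> <= \<epsilon>" for t
  using spin[OF s, of e] beta_le[of e t] by auto
 have z1: "(LINT t|tilted s e. \<zeta> e t) = (LINT t|\<nu> e. (\<zeta> e t)\<^sup>2) + ?p * (LINT t|\<nu> e. \<zeta> e t * \<beta> e t)"
 proof -
  have "(LINT t|tilted s e. \<zeta> e t) = (LINT t|\<nu> e. \<zeta> e t + (\<zeta> e t)\<^sup>2 + ?p * (\<zeta> e t * \<beta> e t))"
   unfolding integral_tilted[OF s bz] tilt_def by (intro Bochner_Integration.integral_cong refl) (simp add: power2_eq_square algebra_simps)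
  also have "... = (LINT t|\<nu> e. (\<zeta> e t)\<^sup>2) + ?p * (LINT t|\<nu> e. \<zeta> e t * \<beta> e t)" using int by (simp add: means)
  finally show ?thesis .
 qed
 have z2: "(LINT t|tilted s e. (\<zeta> e t)\<^sup>2) = (LINT t|\<nu> e. (\<zeta> e t)\<^sup>2) + (LINT t|\<nu> e. \<zeta> e t * (\<zeta> e t)\<^sup>2) + ?p * (LINT t|\<nu> e. (\<zeta> e t)\<^sup>2 * \<beta> e t)"
 proof -
  have "(LINT t|tilted s e. (\<zeta> e t)\<^sup>2) = (LINT t|\<nu> e. (\<zeta> e t)\<^sup>2 + \<zeta> e t * (\<zeta> e t)\<^sup>2 + ?p * ((\<zeta> e t)\<^sup>2 * \<beta> e t))"
   unfolding integral_tilted[OF s bdd_rv_power[OF bz]] tilt_def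
   by (intro Bochner_Integration.integral_cong refl) (simp add: algebra_simps)
  then show ?thesis using int by simp
 qed
 { assume e: "e \<subseteq> V" "card e = 2"
  note em = edge_moments[OF e]
  show "(LINT t|tilted s e. ?p * \<beta> e t) = 1 * b"
  proof -
   have "(LINT t|tilted s e. ?p * \<beta> e t) = (LINT t|\<nu> e. ?p * \<beta> e t + ?p * (\<zeta> e t * \<beta> e t) + (\<beta> e t)\<^sup>2)"
    unfolding integral_tilted[OF s bdd_rv_mult[OF bdd_rv_const bb]] tilt_def
   proof (intro Bochner_Integration.integral_cong refl)
    fix t
    have "(1 + \<zeta> e t + ?p * \<beta> e t) * (?p * \<beta> e t) = ?p * \<beta> e t + ?p * (\<zeta> e t * \<beta> e t) + (?p * ?p) * (\<beta> e t)\<^sup>2"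
     by (simp add: power2_eq_square algebra_simps)
    then show "(1 + \<zeta> e t + ?p * \<beta> e t) * (?p * \<beta> e t) = ?p * \<beta> e t + ?p * (\<zeta> e t * \<beta> e t) + (\<beta> e t)\<^sup>2" by (simp add: p)
   qed
   also have "... = b" using int by (simp add: means em)
   finally show ?thesis by simp
  qed
  show "\<bar>(LINT t|tilted s e. (?p * \<beta> e t)\<^sup>2) - b\<bar> <= \<eta> * b"
  proof -
   have "(LINT t|tilted s e. (?p * \<beta> e t)\<^sup>2) = (LINT t|tilted s e. (\<beta> e t)\<^sup>2)"
    by (simp add: power_mult_distrib p)
   also have "... = (LINT t|\<nu> e. (\<beta> e t)\<^sup>2 + \<zeta> e t * (\<beta> e t)\<^sup>2 + ?p * (\<beta> e t * (\<beta> e t)\<^sup>2))"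
    unfolding integral_tilted[OF s bdd_rv_power[OF bb]] tilt_def
    by (intro Bochner_Integration.integral_cong refl) (simp add: algebra_simps)
   also have "... = b + (LINT t|\<nu> e. \<zeta> e t * (\<beta> e t)\<^sup>2)" using int by (simp add: em)
   finally show ?thesis using cubic[OF bb zeta_le(2)[OF e(2)]] by (simp add: em)
  qed
  show "(LINT t|tilted s e. \<zeta> e t) = 1 * a" by (simp add: z1 em)
  show "\<bar>(LINT t|tilted s e. (\<zeta> e t)\<^sup>2) - a\<bar> <= \<eta> * a"
   using cubic[OF bz zeta_le(2)[OF e(2)]] by (simp add: z2 em)
  show "\<bar>(LINT t|tilted s e. \<zeta> e t * (?p * \<beta> e t))\<bar> <= \<eta> * b"
  proof -
   have "(LINT t|tilted s e. \<zeta> e t * (?p * \<beta> e t)) = (LINT t|\<nu> e. ?p * (\<zeta> e t * \<beta> e t) + ?p * ((\<zeta> e t)\<^sup>2 * \<beta> e t) + \<zeta> e t * (\<beta> e t)\<^sup>2)"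
    unfolding integral_tilted[OF s bdd_rv_mult[OF bz bdd_rv_mult[OF bdd_rv_const bb]]] tilt_def
   proof (intro Bochner_Integration.integral_cong refl)
    fix t
    have "(1 + \<zeta> e t + ?p * \<beta> e t) * (\<zeta> e t * (?p * \<beta> e t)) =
      ?p * (\<zeta> e t * \<beta> e t) + ?p * ((\<zeta> e t)\<^sup>2 * \<beta> e t) + (?p * ?p) * (\<zeta> e t * (\<beta> e t)\<^sup>2)"
     by (simp add: power2_eq_square algebra_simps)
    then show "(1 + \<zeta> e t + ?p * \<beta> e t) * (\<zeta> e t * (?p * \<beta> e t)) =
      ?p * (\<zeta> e t * \<beta> e t) + ?p * ((\<zeta> e t)\<^sup>2 * \<beta> e t) + \<zeta> e t * (\<beta> e t)\<^sup>2" by (simp add: p)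
   qed
   also have "... = (LINT t|\<nu> e. \<zeta> e t * (\<beta> e t)\<^sup>2)" using int by (simp add: em)
   finally show ?thesis using cubic[OF bb zeta_le(2)[OF e(2)]] by (simp add: em)
  qed
 }
 { assume e: "e \<subseteq> V" "card e = 1"
  note lm = loop_moments(1)[OF e] loop_moments(2)[OF e(2)]
  show "(LINT t|tilted s e. \<zeta> e t) = 1 * d" by (simp add: z1 lm)
  show "\<bar>(LINT t|tilted s e. (\<zeta> e t)\<^sup>2) - d\<bar> <= \<epsilon> * d"
   using cubic[OF bz zeta_le(1)] by (simp add: z2 lm)
 }
qed (use finV V2 zeta_le small scale in auto)

lemma bdd_tilt_prod: "bdd_rv H0.M (%om. \<Prod>e\<in>H0.J. tilt s e (om e))"
 unfolding H0.M_def by (intro bdd_rv_prod bdd_rv_coord bdd_tilt)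

lemma finite_signs: "finite signs" "card signs = 2 ^ card V"
 unfolding signs_def using finV by (auto intro!: finite_PiE simp: card_PiE numeral_2_eq_2)

lemma bdd_LR: "bdd_rv H0.M LR"
proof -
 have "bdd_rv H0.M (%om. (1 / 2 ^ card V) * (\<Sum>s\<in>signs. \<Prod>e\<in>H0.J. tilt s e (om e)))"
  by (intro bdd_rv_mult bdd_rv_const bdd_rv_sum bdd_tilt_prod)
 then show ?thesis by (simp add: LR_def[abs_def])
qed

lemma LR_nonneg: "0 <= LR om"
 unfolding LR_def by (intro divide_nonneg_nonneg sum_nonneg prod_nonneg tilt_nonneg) auto

lemma expect_tilted:
 fixes f :: "_ => complex"
 assumes s: "s \<in> signs" and f: "bdd_rv H0.M f"
 shows "(LINT om|PiM H0.J (tilted s). f om) = (LINT om|H0.M. (\<Prod>e\<in>H0.J. tilt s e (om e)) *\<^sub>R f om)"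
proof -
 have "PiM H0.J (tilted s) = density H0.M (%om. \<Prod>e\<in>H0.J. ennreal (tilt s e (om e)))"
  unfolding tilted_def[abs_def] H0.M_def
  using prob_tilted[OF s] by (intro density_PiM[symmetric] H0.finJ prob measurable_compose[OF bdd_rv_measurable[OF bdd_tilt] measurable_ennreal]) (auto simp: tilted_def)
 also have "... = density H0.M (%om. ennreal (\<Prod>e\<in>H0.J. tilt s e (om e)))"
  using tilt_nonneg[OF s] by (simp add: prod_ennreal)
 finally show ?thesis
  using f bdd_tilt_prod[of s] tilt_nonneg[OF s]
  by (simp only:) (subst integral_density, auto simp: bdd_rv_def intro!: prod_nonneg)
qed

text \<open>The measure with density \<open>LR\<close> is the average over spins of the tilted product laws. For each of them \<open>S\<close> is also
the statistic of the field with signs, so \<open>char_close\<close> applies with the same bound.\<close>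
lemma LR_char_close:
 "cmod ((LINT om|H0.M. LR om *\<^sub>R iexp (th * H0.S om)) - exp (\<i> * (H0.vtot * th) - th\<^sup>2 * H0.vtot / 2))
  <= \<bar>th\<bar> * ((1 + th\<^sup>2) * (H0.C * H0.\<delta>) * exp (th\<^sup>2 * H0.vtot / 2))" (is "_ <= ?B")
proof -
 let ?t = "exp (\<i> * (H0.vtot * th) - th\<^sup>2 * H0.vtot / 2)"
 define c where "c s = (LINT om|PiM H0.J (tilted s). iexp (th * H0.S om))" for s
 have bS: "bdd_rv H0.M (%om. iexp (th * H0.S om))" by (intro bdd_rv_iexp H0.bdd_S)
 have close: "cmod (c s - ?t) <= ?B" if s: "s \<in> signs" for s
 proof -
  interpret T: edge_field V "tilted s" \<zeta> "%e t. spin_prod V s e * \<beta> e t" 1 a b d \<epsilon> \<eta> \<Lambda> L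
   by (rule tilted_field[OF s])
  have "T.cycsum om = H0.cycsum om" for om
   unfolding T.cycsum_def H0.cycsum_def
   using cprod_spin_prod[OF s[unfolded signs_def], where f = "%e. \<beta> e (om e)"] by (auto intro!: sum.cong)
  then have S: "T.S om = H0.S om" for om by (simp add: T.S_def H0.S_def)
  show ?thesis using T.char_close[of th] by (simp add: c_def T.\<psi>_def T.M_def S)
 qed
 have "(LINT om|H0.M. LR om *\<^sub>R iexp (th * H0.S om)) =
   (LINT om|H0.M. (\<Sum>s\<in>signs. (1 / 2 ^ card V) *\<^sub>R ((\<Prod>e\<in>H0.J. tilt s e (om e)) *\<^sub>R iexp (th * H0.S om))))"
  by (intro Bochner_Integration.integral_cong refl) (simp add: LR_def sum_divide_distrib scaleR_sum_left)
 also have "... = (\<Sum>s\<in>signs. (1 / 2 ^ card V) *\<^sub>R c s)"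
 proof -
  have "integrable H0.M (%om. (\<Prod>e\<in>H0.J. tilt s e (om e)) *\<^sub>R iexp (th * H0.S om))" for s
   unfolding scaleR_conv_of_real by (intro H0.PM.bdd_rv_integrable bdd_rv_mult bdd_rv_of_real bdd_tilt_prod bS)
  then show ?thesis
   unfolding c_def using expect_tilted[OF _ bS]
   by (subst Bochner_Integration.integral_sum) (simp_all only: integral_scaleR_right integrable_scaleR_right cong: sum.cong)
 qed
 finally have e0: "(LINT om|H0.M. LR om *\<^sub>R iexp (th * H0.S om)) = (\<Sum>s\<in>signs. (1 / 2 ^ card V) *\<^sub>R c s)" .
 have e: "(LINT om|H0.M. LR om *\<^sub>R iexp (th * H0.S om)) - ?t = (\<Sum>s\<in>signs. (1 / 2 ^ card V) *\<^sub>R (c s - ?t))"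
 proof -
  have "(\<Sum>s\<in>signs. (1 / 2 ^ card V) *\<^sub>R ?t) = ?t"
   unfolding sum_constant_scaleR by (simp add: finite_signs)
  then show ?thesis by (simp only: e0 scaleR_diff_right sum_subtractf)
 qed
 have "cmod (\<Sum>s\<in>signs. (1 / 2 ^ card V) *\<^sub>R (c s - ?t)) <= (\<Sum>s\<in>signs. (1 / 2 ^ card V) * ?B)"
  using close by (intro order.trans[OF norm_sum sum_mono]) (simp add: divide_right_mono)
 then show ?thesis unfolding e by (simp add: finite_signs)
qed

lemma integral_tilt_mult:
 assumes "s \<in> signs" "s' \<in> signs"
 shows "e \<in> H0.E2 ==> (LINT t|\<nu> e. tilt s e t * tilt s' e t) = 1 + a + (\<Prod>i\<in>e. s i * s' i) * b"
  and "e \<in> H0.E1 ==> (LINT t|\<nu> e. tilt s e t * tilt s' e t) = 1 + d"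
proof -
 interpret Pe: prob_space "\<nu> e" by (rule prob)
 let ?p = "spin_prod V s e" and ?q = "spin_prod V s' e"
 have int: "integrable (\<nu> e) (%t. \<beta> e t)" "integrable (\<nu> e) (%t. \<zeta> e t)" "integrable (\<nu> e) (%t. (\<zeta> e t)\<^sup>2)"
  "integrable (\<nu> e) (%t. (\<beta> e t)\<^sup>2)" "integrable (\<nu> e) (%t. \<zeta> e t * \<beta> e t)"
  by (intro Pe.bdd_rv_integrable bdd_rv_mult bdd_rv_power H0.bdd_zeta H0.bdd_beta)+
 have "(LINT t|\<nu> e. tilt s e t * tilt s' e t) = (LINT t|\<nu> e. 1 + (\<zeta> e t)\<^sup>2 + (?p * ?q) * (\<beta> e t)\<^sup>2 + 2 * \<zeta> e t + (?p + ?q) * \<beta> e t + (?p + ?q) * (\<zeta> e t * \<beta> e t))"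
  unfolding tilt_def by (intro Bochner_Integration.integral_cong refl) (simp add: power2_eq_square algebra_simps)
 also have "... = 1 + (LINT t|\<nu> e. (\<zeta> e t)\<^sup>2) + (?p * ?q) * (LINT t|\<nu> e. (\<beta> e t)\<^sup>2) + (?p + ?q) * (LINT t|\<nu> e. \<zeta> e t * \<beta> e t)"
  using int by (simp add: means Pe.prob_space)
 finally have eq: "(LINT t|\<nu> e. tilt s e t * tilt s' e t) = ..." .
 { assume "e \<in> H0.E2"
  then have e: "e \<subseteq> V" "card e = 2" by (auto simp: H0.E2_def)
  then show "(LINT t|\<nu> e. tilt s e t * tilt s' e t) = 1 + a + (\<Prod>i\<in>e. s i * s' i) * b"
   unfolding eq edge_moments(1-3)[OF e] by (simp add: spin_prod_def prod.distrib) }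
 { assume "e \<in> H0.E1"
  then have e: "e \<subseteq> V" "card e = 1" by (auto simp: H0.E1_def)
  then show "(LINT t|\<nu> e. tilt s e t * tilt s' e t) = 1 + d"
   unfolding eq loop_moments(1)[OF e] loop_moments(2)[OF e(2)] by simp }
qed

text \<open>By independence the expectation is a product of factors \<open>1 + a \<plusminus> b\<close> over the edges and \<open>1 + d\<close> over the loops. The
first order terms \<open>\<plusminus> b\<close> sum up to the square of the overlap of the two spin vectors.\<close>
lemma overlap_bound:
 assumes s: "s \<in> signs" and s': "s' \<in> signs" and ab: "a + b <= 1 / 2"
 shows "(LINT om|H0.M. (\<Prod>e\<in>H0.J. tilt s e (om e)) * (\<Prod>e\<in>H0.J. tilt s' e (om e))) \<le>
  (1 + d) ^ card V * exp (real (card H0.E2) * (a - b\<^sup>2 / 2 + a * b + (a + b) ^ 3) - real (card V) * b / 2)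
   * exp (b * (\<Sum>i\<in>V. s i * s' i)\<^sup>2 / 2)"
proof -
 let ?t = "%i. s i * s' i"
 define g where "g e = (LINT t|\<nu> e. tilt s e t * tilt s' e t)" for e
 have "(LINT om|H0.M. (\<Prod>e\<in>H0.J. tilt s e (om e)) * (\<Prod>e\<in>H0.J. tilt s' e (om e))) =
   (LINT om|H0.M. (\<Prod>e\<in>H0.J. tilt s e (om e) * tilt s' e (om e)))" by (simp add: prod.distrib)
 also have "... = (\<Prod>e\<in>H0.J. g e)"
  unfolding g_def by (rule H0.expect_prod) (auto intro!: bdd_rv_mult bdd_tilt)
 also have "... = (\<Prod>e\<in>H0.E1. g e) * (\<Prod>e\<in>H0.E2. g e)"
  using H0.J_split by (simp add: prod.union_disjoint)
 finally have I: "(LINT om|H0.M. (\<Prod>e\<in>H0.J. tilt s e (om e)) * (\<Prod>e\<in>H0.J. tilt s' e (om e))) = ..." .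
 have E1: "(\<Prod>e\<in>H0.E1. g e) = (1 + d) ^ card V"
  using H0.card_E(1) integral_tilt_mult(2)[OF s s'] by (simp add: g_def)
 let ?c = "a - b\<^sup>2 / 2 + a * b + (a + b) ^ 3"
 have tt: "(?t i)\<^sup>2 = 1" if "i \<in> V" for i
  using sign_cases[OF s[unfolded signs_def] that] sign_cases[OF s'[unfolded signs_def] that] by auto
 have "(\<Prod>e\<in>H0.E2. g e) <= (\<Prod>e\<in>H0.E2. exp (?c + b * (\<Prod>i\<in>e. ?t i)))"
 proof (rule prod_mono)
  fix e assume e: "e \<in> H0.E2"
  let ?p = "\<Prod>i\<in>e. ?t i"
  have "?p = spin_prod V s e * spin_prod V s' e" using e by (simp add: H0.E2_def spin_prod_def prod.distrib)
  then have p: "?p = 1 \<or> ?p = - 1" using spin[OF s, of e] spin[OF s', of e] by auto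
  let ?x = "a + ?p * b"
  have ge: "g e = 1 + ?x" unfolding g_def using integral_tilt_mult(1)[OF s s' e] by simp
  have x: "\<bar>?x\<bar> <= a + b" using p scale by auto
  have "?x ^ 3 <= (a + b) ^ 3"
   using x by (intro power_mono_odd) auto
  moreover have "0 <= (a + b) ^ 3" using scale by simp
  ultimately have x3: "?x ^ 3 / 3 <= (a + b) ^ 3" by linarith
  have x2: "?x\<^sup>2 / 2 >= b\<^sup>2 / 2 - a * b"
  proof -
   have "?x\<^sup>2 = a\<^sup>2 + 2 * (?p * (a * b)) + b\<^sup>2" using p by (auto simp: power2_eq_square algebra_simps)
   moreover have "- (a * b) <= ?p * (a * b)" using p scale by auto
   ultimately show ?thesis using zero_le_power2[of a] by linarith
  qed
  have pos: "?x > - 1" using x ab by linarith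
  have "ln (1 + ?x) <= ?x - ?x\<^sup>2 / 2 + ?x ^ 3 / 3" by (rule ln_one_plus_le_cubic[OF pos])
  also have "... <= ?c + b * ?p" using x2 x3 by (simp add: mult.commute)
  finally have "exp (ln (1 + ?x)) <= exp (?c + b * ?p)" by simp
  then show "0 <= g e \<and> g e <= exp (?c + b * ?p)" using pos by (simp add: ge)
 qed
 also have "... = exp (\<Sum>e\<in>H0.E2. ?c + b * (\<Prod>i\<in>e. ?t i))" using H0.J_split by (simp add: exp_sum)
 also have "(\<Sum>e\<in>H0.E2. ?c + b * (\<Prod>i\<in>e. ?t i)) = real (card H0.E2) * ?c + b * (\<Sum>e\<in>H0.E2. \<Prod>i\<in>e. ?t i)"
  unfolding sum.distrib[of "%e. ?c"] sum_distrib_left[symmetric] by (simp only: sum_constant)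
 also have "(\<Sum>e\<in>H0.E2. \<Prod>i\<in>e. ?t i) = ((\<Sum>i\<in>V. ?t i)\<^sup>2 - real (card V)) / 2"
  using square_sum_eq_pairs[OF finV, of ?t] by (simp add: tt H0.E2_def)
 finally have "(\<Prod>e\<in>H0.E2. g e) <= exp (real (card H0.E2) * ?c + b * (((\<Sum>i\<in>V. ?t i)\<^sup>2 - real (card V)) / 2))" .
 also have "real (card H0.E2) * ?c + b * (((\<Sum>i\<in>V. ?t i)\<^sup>2 - real (card V)) / 2) =
   (real (card H0.E2) * ?c - real (card V) * b / 2) + b * (\<Sum>i\<in>V. ?t i)\<^sup>2 / 2"
  by (simp add: right_diff_distrib diff_divide_distrib)
 finally show ?thesis unfolding I E1 exp_add using scale
  by (simp only: mult.assoc) (intro mult_left_mono, auto)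
qed

text \<open>For a fixed first spin vector, the pointwise product with the second one runs over all spin vectors, which reduces
the double average to a single one.\<close>
lemma LR_second_moment:
 assumes ab: "a + b <= 1 / 2"
 shows "(LINT om|H0.M. (LR om)\<^sup>2) \<le>
  (1 + d) ^ card V * exp (real (card H0.E2) * (a - b\<^sup>2 / 2 + a * b + (a + b) ^ 3) - real (card V) * b / 2)
   / sqrt (1 - real (card V) * b)"
proof -
 define c where "c = (1 + d) ^ card V * exp (real (card H0.E2) * (a - b\<^sup>2 / 2 + a * b + (a + b) ^ 3) - real (card V) * b / 2)"
 have c0: "0 <= c" using scale by (simp add: c_def)
 let ?P = "%s om. \<Prod>e\<in>H0.J. tilt s e (om e)" and ?n = "(2::real) ^ card V"
 let ?h = "%s :: 'v => real. exp (b * (\<Sum>i\<in>V. s i)\<^sup>2 / 2)"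
 have n0: "?n > 0" by simp
 have sq: "(LR om)\<^sup>2 = (\<Sum>s\<in>signs. \<Sum>s'\<in>signs. ?P s om * ?P s' om) / (?n * ?n)" for om
  by (simp add: LR_def power2_eq_square sum_product)
 have ii: "integrable H0.M (%om. ?P s om * ?P s' om)" for s s'
  by (intro H0.PM.bdd_rv_integrable bdd_rv_mult bdd_tilt_prod)
 have "(LINT om|H0.M. (LR om)\<^sup>2) = (\<Sum>s\<in>signs. \<Sum>s'\<in>signs. (LINT om|H0.M. ?P s om * ?P s' om)) / (?n * ?n)"
  unfolding sq using ii by simp
 also have "... <= (\<Sum>s\<in>signs. \<Sum>s'\<in>signs. c * ?h (%i. s i * s' i)) / (?n * ?n)"
  unfolding c_def using overlap_bound[OF _ _ ab] by (intro divide_right_mono sum_mono) auto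
 also have "(\<Sum>s\<in>signs. \<Sum>s'\<in>signs. c * ?h (%i. s i * s' i)) = (\<Sum>s\<in>signs. \<Sum>s'\<in>signs. c * ?h s')"
 proof (rule sum.cong[OF refl])
  fix s assume s: "s \<in> signs"
  let ?m = "%s'. \<lambda>i\<in>V. s i * s' i"
  have mem: "?m s' \<in> signs" if "s' \<in> signs" for s'
   unfolding signs_def
  proof (rule restrict_PiE_iff[THEN iffD2], rule ballI)
   fix i assume "i \<in> V"
   then show "s i * s' i \<in> {1, - 1}"
    using sign_cases[OF s[unfolded signs_def], of i] sign_cases[OF that[unfolded signs_def], of i] by auto
  qed
  have inv: "?m (?m s') = s'" if "s' \<in> signs" for s'
  proof
   fix i
   show "?m (?m s') i = s' i"
    using that sign_square[OF s[unfolded signs_def], of i]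
    by (cases "i \<in> V") (auto simp: signs_def PiE_def extensional_def mult.assoc[symmetric])
  qed
  show "(\<Sum>s'\<in>signs. c * ?h (%i. s i * s' i)) = (\<Sum>s'\<in>signs. c * ?h s')"
   by (rule sum.reindex_bij_witness[of _ ?m ?m]) (simp_all only: mem inv, simp)
 qed
 also have "(\<Sum>s\<in>signs. \<Sum>s'\<in>signs. c * ?h s') / (?n * ?n) = c * ((\<Sum>s'\<in>signs. ?h s') / ?n)"
  by (simp add: finite_signs sum_distrib_left[symmetric])
 also have "... <= c * (1 / sqrt (1 - real (card V) * b))"
  using hubbard_stratonovich[OF finV] scale c0 unfolding signs_def by (intro mult_left_mono) auto
 finally show ?thesis by (simp add: c_def)
qed

end

section \<open>The limiting risk\<close>

text \<open>Levy continuity, for a statistic whose underlying probability space changes with the index.\<close>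
lemma expectation_limit:
 fixes M :: "nat => 'a measure" and S :: "nat => 'a => real" and f :: "real => real"
 assumes M: "\<And>N. prob_space (M N)" and S: "\<And>N. S N \<in> borel_measurable (M N)"
  and char: "\<And>th. (%N. (LINT om|M N. iexp (th * S N om))) \<longlonglongrightarrow> exp (\<i> * (m * th) - th\<^sup>2 * \<sigma>\<^sup>2 / 2)"
  and f: "continuous_on UNIV f" "\<And>x. \<bar>f x\<bar> <= B"
 shows "(%N. (LINT om|M N. f (S N om))) \<longlonglongrightarrow> (LINT x|std_normal_distribution. f (m + \<sigma> * x))"
proof -
 let ?D = "%N. distr (M N) borel (S N)" and ?G = "distr std_normal_distribution borel (%x. m + \<sigma> * x)"
 have D: "real_distribution (?D N)" for N
 proof -
  interpret prob_space "M N" by (rule M)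
  show ?thesis using S by (rule real_distribution_distr)
 qed
 interpret N: prob_space std_normal_distribution by (rule prob_space_normal_density) simp
 have G: "real_distribution ?G" by (rule N.real_distribution_distr) simp
 have "weak_conv_m ?D ?G"
 proof (rule levy_continuity[OF D G])
  fix th
  have "char (?D N) th = (LINT om|M N. iexp (th * S N om))" for N
   unfolding char_def using S by (subst integral_distr) auto
  then show "(%N. char (?D N) th) \<longlonglongrightarrow> char ?G th"
   using char[of th] by (simp only: char_affine_std_normal)
 qed
 then have "(%N. integral\<^sup>L (?D N) f) \<longlonglongrightarrow> integral\<^sup>L ?G f"
  using f by (intro weak_conv_imp_integral_bdd_continuous_conv[OF D G]) (auto simp: continuous_on_eq_continuous_at)
 moreover have fm: "f \<in> borel_measurable borel" using f(1) by (rule borel_measurable_continuous_onI)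
 have "integral\<^sup>L (?D N) f = (LINT om|M N. f (S N om))" for N
  using S fm by (rule integral_distr)
 moreover have "integral\<^sup>L ?G f = (LINT x|std_normal_distribution. f (m + \<sigma> * x))"
  using fm by (intro integral_distr) auto
 ultimately show ?thesis by simp
qed

text \<open>The map \<open>min 1\<close> is a contraction, and the first absolute moment is at most the root of the second moment.\<close>
lemma (in prob_space) expectation_min_diff_le:
 fixes X Y :: "'a => real"
 assumes X: "bdd_rv M X" and Y: "bdd_rv M Y"
 shows "\<bar>(LINT om|M. min 1 (X om)) - (LINT om|M. min 1 (Y om))\<bar>
  <= sqrt ((LINT om|M. (X om)\<^sup>2) - 2 * (LINT om|M. X om * Y om) + (LINT om|M. (Y om)\<^sup>2))"
proof -
 have bmin: "bdd_rv M (%om. min 1 (Z om))" if "bdd_rv M Z" for Z :: "'a => real"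
 proof -
  have "(%om. min 1 (Z om)) = (%om. (1 + Z om - \<bar>1 - Z om\<bar>) * (1 / 2))" by (auto simp: min_def)
  then show ?thesis using that by (simp only:) (intro bdd_rv_mult bdd_rv_diff bdd_rv_add bdd_rv_abs bdd_rv_const)
 qed
 define Z where "Z om = \<bar>X om - Y om\<bar>" for om
 have bZ: "bdd_rv M Z" unfolding Z_def by (intro bdd_rv_abs bdd_rv_diff X Y)
 note ii = bdd_rv_integrable
 have "\<bar>(LINT om|M. min 1 (X om)) - (LINT om|M. min 1 (Y om))\<bar> = \<bar>(LINT om|M. min 1 (X om) - min 1 (Y om))\<bar>"
  using ii[OF bmin[OF X]] ii[OF bmin[OF Y]] by simp
 also have "... <= (LINT om|M. \<bar>min 1 (X om) - min 1 (Y om)\<bar>)" by (rule integral_abs_bound)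
 also have "... <= (LINT om|M. Z om)"
  unfolding Z_def by (intro integral_mono ii bdd_rv_abs bdd_rv_diff bmin X Y) (auto simp: min_def)
 also have "... <= sqrt (LINT om|M. (Z om)\<^sup>2)"
 proof (rule real_le_rsqrt)
  have "0 <= variance Z" by (rule variance_positive)
  also have "variance Z = (LINT om|M. (Z om)\<^sup>2) - (LINT om|M. Z om)\<^sup>2"
   by (rule variance_eq) (auto intro!: ii bdd_rv_power bZ)
  finally show "(LINT om|M. Z om)\<^sup>2 <= (LINT om|M. (Z om)\<^sup>2)" by simp
 qed
 also have "(LINT om|M. (Z om)\<^sup>2) = (LINT om|M. (X om)\<^sup>2 - 2 * (X om * Y om) + (Y om)\<^sup>2)"
  by (simp add: Z_def power2_eq_square algebra_simps)
 also have "... = (LINT om|M. (X om)\<^sup>2) - 2 * (LINT om|M. X om * Y om) + (LINT om|M. (Y om)\<^sup>2)"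
  using ii[OF bdd_rv_power[OF X]] ii[OF bdd_rv_power[OF Y]] ii[OF bdd_rv_mult[OF X Y]] by simp
 finally show ?thesis .
qed

lemma bdd_rv_compose:
 assumes "bdd_rv M S" "continuous_on UNIV f" "\<And>x. \<bar>f x :: real\<bar> <= B"
 shows "bdd_rv M (%om. f (S om :: real))"
proof (rule bdd_rvI)
 show "(%om. f (S om)) \<in> borel_measurable M"
  by (rule measurable_compose[OF bdd_rv_measurable[OF assms(1)] borel_measurable_continuous_onI[OF assms(2)]])
 show "norm (f (S om)) <= B" for om using assms(3) by simp
qed

text \<open>Capping makes the exponential a bounded continuous function, as weak convergence
requires; the cap \<open>K\<close> is removed afterwards.\<close>
lemma lognormal_truncation_limits:
 assumes v: "0 <= v"
 shows "(%K::nat. (LINT x|std_normal_distribution. min (exp (v / 2 + sqrt v * x)) (real K))) \<longlonglongrightarrow> exp v"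
  and "(LINT x|std_normal_distribution. (min (exp (sqrt v * x - v / 2)) (real K))\<^sup>2) <= exp v"
proof -
 let ?N = std_normal_distribution
 have e: "exp (v / 2 + sqrt v * x) = exp (v / 2) * exp (sqrt v * x)" for x by (simp add: exp_add)
 have i1: "integrable ?N (%x. exp (v / 2 + sqrt v * x))" unfolding e using std_normal_exp(1)[of "sqrt v"] by simp
 have v1: "(LINT x|?N. exp (v / 2 + sqrt v * x)) = exp v"
 proof -
  have "(LINT x|?N. exp (v / 2 + sqrt v * x)) = exp (v / 2) * exp (v / 2)"
   unfolding e using v by (simp add: std_normal_exp(2))
  then show ?thesis by (simp add: exp_add[symmetric])
 qed
 have "(%K::nat. (LINT x|?N. min (exp (v / 2 + sqrt v * x)) (real K))) \<longlonglongrightarrow> (LINT x|?N. exp (v / 2 + sqrt v * x))"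
 proof (rule integral_dominated_convergence[OF _ _ i1])
  show "AE x in ?N. (%K::nat. min (exp (v / 2 + sqrt v * x)) (real K)) \<longlonglongrightarrow> exp (v / 2 + sqrt v * x)"
  proof (rule AE_I2)
   fix x
   obtain k :: nat where k: "exp (v / 2 + sqrt v * x) <= real k" using real_arch_simple by blast
   have "eventually (%K. min (exp (v / 2 + sqrt v * x)) (real K) = exp (v / 2 + sqrt v * x)) sequentially"
    using eventually_ge_at_top[of k] by eventually_elim (use k in \<open>auto simp: min_def\<close>)
   then show "(%K::nat. min (exp (v / 2 + sqrt v * x)) (real K)) \<longlonglongrightarrow> exp (v / 2 + sqrt v * x)"
    by (rule tendsto_eventually)
  qed
 qed (auto simp: min_def)
 then show "(%K::nat. (LINT x|?N. min (exp (v / 2 + sqrt v * x)) (real K))) \<longlonglongrightarrow> exp v" by (simp only: v1)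
 have e2: "(exp (sqrt v * x - v / 2))\<^sup>2 = exp (- v) * exp ((2 * sqrt v) * x)" for x
  by (simp add: exp_add[symmetric] power2_eq_square)
 have i2: "integrable ?N (%x. (exp (sqrt v * x - v / 2))\<^sup>2)" unfolding e2 using std_normal_exp(1)[of "2 * sqrt v"] by simp
 have "(LINT x|?N. (min (exp (sqrt v * x - v / 2)) (real K))\<^sup>2) <= (LINT x|?N. (exp (sqrt v * x - v / 2))\<^sup>2)"
  by (intro integral_mono' i2 power_mono) auto
 also have "... = exp v"
 proof -
  have "(LINT x|?N. (exp (sqrt v * x - v / 2))\<^sup>2) = exp (- v) * exp (2 * v)"
   unfolding e2 using v by (simp add: std_normal_exp(2) power_mult_distrib del: mult_exp_exp)
  then show ?thesis by (simp add: exp_add[symmetric])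
 qed
 finally show "(LINT x|?N. (min (exp (sqrt v * x - v / 2)) (real K))\<^sup>2) <= exp v" .
qed

lemma continuous_lognormal_min:
 assumes "v \<longlonglongrightarrow> V" "\<And>L. 0 <= v L"
 shows "(%L. (LINT x|std_normal_distribution. min 1 (exp (sqrt (v L) * x - v L / 2))))
  \<longlonglongrightarrow> (LINT x|std_normal_distribution. min 1 (exp (sqrt V * x - V / 2)))"
proof (rule integral_dominated_convergence[where w = "%_. 1"])
 interpret N: prob_space std_normal_distribution by (rule prob_space_normal_density) simp
 show "integrable std_normal_distribution (%_. 1 :: real)" by simp
 show "AE x in std_normal_distribution. (%L. min 1 (exp (sqrt (v L) * x - v L / 2))) \<longlonglongrightarrow> min 1 (exp (sqrt V * x - V / 2))"
  using assms(1) by (intro AE_I2 tendsto_intros) auto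
qed auto

lemma null_modelI_fields:
 assumes "null_model V \<nu> \<zeta> \<beta> a b d \<epsilon> \<eta> \<Lambda>"
 shows "edge_field V \<nu> \<zeta> \<beta> 0 a b d \<epsilon> \<eta> \<Lambda>"
proof -
 interpret null_model V \<nu> \<zeta> \<beta> a b d \<epsilon> \<eta> \<Lambda> by fact
 show ?thesis by (rule H0.edge_field_axioms)
qed

text \<open>The parameters \<open>la\<close>, \<open>lb\<close>, \<open>ld\<close> are the limits of \<open>n^2 * a\<close>, \<open>n * b\<close>, \<open>n * d\<close>.\<close>
locale null_sequence =
 fixes V :: "nat => 'v set" and \<nu> :: "nat => 'v set => 't measure" and \<zeta> \<beta> :: "nat => 'v set => 't => real"
  and a b d \<epsilon> \<eta> :: "nat => real" and \<Lambda> la lb ld :: real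
 assumes model: "\<And>N. null_model (V N) (\<nu> N) (\<zeta> N) (\<beta> N) (a N) (b N) (d N) (\<epsilon> N) (\<eta> N) \<Lambda>"
  and size: "filterlim (%N. real (card (V N))) at_top sequentially"
  and eps: "\<epsilon> \<longlonglongrightarrow> 0" "(%N. sqrt (real (card (V N))) * \<eta> N) \<longlonglongrightarrow> 0"
  and lims: "(%N. real (card (V N)) * b N) \<longlonglongrightarrow> lb" "lb < 1"
   "(%N. (real (card (V N)))\<^sup>2 * a N) \<longlonglongrightarrow> la" "(%N. real (card (V N)) * d N) \<longlonglongrightarrow> ld"
begin

abbreviation "n N \<equiv> real (card (V N))"
definition "LRN N = null_model.LR (V N) (\<zeta> N) (\<beta> N)"
definition "MN N = edge_field.M (V N) (\<nu> N)"
definition "SN L N = edge_field.S (V N) (\<zeta> N) (\<beta> N) L"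
definition "vN L N = edge_field.vtot (V N) (a N) (b N) (d N) L"
definition "vlim L = la / 2 + ld + (\<Sum>k\<in>{3..L}. lb ^ k / (2 * real k))"
definition "Vlim = la / 2 + ld - ln (1 - lb) / 2 - lb / 2 - lb\<^sup>2 / 4"

lemma limit_nonneg: "0 <= la" "0 <= lb" "0 <= ld"
proof -
 have nn: "0 <= a N" "0 <= b N" "0 <= d N" for N
  using null_model.scale(1-3)[OF model[of N]] by auto
 show "0 <= la" using lims(3) by (rule LIMSEQ_le_const) (auto simp: nn)
 show "0 <= lb" using lims(1) by (rule LIMSEQ_le_const) (auto simp: nn)
 show "0 <= ld" using lims(4) by (rule LIMSEQ_le_const) (auto simp: nn)
qed

lemma vlim_nonneg: "0 <= vlim L"
 unfolding vlim_def using limit_nonneg by (auto intro!: add_nonneg_nonneg sum_nonneg)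

lemma inv_size: "(%N. 1 / n N) \<longlonglongrightarrow> 0"
 using tendsto_inverse_0_at_top[OF size] by (simp add: inverse_eq_divide)

lemma n_ge2: "n N >= 2"
 using null_model.V2[OF model[of N]] by simp

lemma edge_count_limit: "(%N. real (card (edge_field.E2 (V N))) / (n N)\<^sup>2) \<longlonglongrightarrow> 1 / 2"
proof -
 have "real (card (edge_field.E2 (V N))) / (n N)\<^sup>2 = 1 / 2 - (1 / n N) / 2" for N
 proof -
  interpret E: edge_field "V N" "\<nu> N" "\<zeta> N" "\<beta> N" 0 "a N" "b N" "d N" "\<epsilon> N" "\<eta> N" \<Lambda>
   by (rule null_modelI_fields[OF model])
  have "card E.E2 = card (V N) choose 2" unfolding E.E2_def by (rule n_subsets[OF E.finV])
  then have "real (card E.E2) = n N * (n N - 1) / 2"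
   using E.V2 by (simp add: choose_two real_of_nat_div of_nat_diff)
  then show ?thesis using n_ge2[of N] by (simp add: field_simps power2_eq_square)
 qed
 moreover have "(%N. 1 / 2 - (1 / n N) / 2) \<longlonglongrightarrow> 1 / 2 - 0 / 2" by (intro tendsto_intros inv_size) auto
 ultimately show ?thesis by simp
qed

text \<open>For fixed \<open>k\<close> almost all walks of length \<open>k\<close> are simple paths.\<close>
lemma cycle_weight_limit: "(%N. real (card (dpaths (V N) k)) * b N ^ k) \<longlonglongrightarrow> lb ^ k"
proof (rule tendsto_sandwich)
 have nk: "eventually (%N. n N > real k) sequentially" using size unfolding filterlim_at_top_dense by blast
 show "eventually (%N. ((1 - real k * (1 / n N)) * (n N * b N)) ^ k <= real (card (dpaths (V N) k)) * b N ^ k) sequentially"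
  using nk
 proof eventually_elim
  case (elim N)
  have fin: "finite (V N)" and b: "0 <= b N" using null_model.finV[OF model[of N]] null_model.scale(2)[OF model[of N]] by auto
  have "real (card (dpaths (V N) k)) = (\<Prod>j\<in>{card (V N) - k + 1 .. card (V N)}. real j)"
   unfolding dpaths_def using elim by (subst card_lists_distinct_length_eq[OF fin]) auto
  also have "... >= (\<Prod>j\<in>{card (V N) - k + 1 .. card (V N)}. n N - real k)"
   using elim by (intro prod_mono) auto
  also have "(\<Prod>j\<in>{card (V N) - k + 1 .. card (V N)}. n N - real k) = (n N - real k) ^ k"
   using elim by simp
  also have "n N - real k = (1 - real k * (1 / n N)) * n N" using n_ge2[of N] by (simp add: field_simps)
  finally have "((1 - real k * (1 / n N)) * n N) ^ k * b N ^ k <= real (card (dpaths (V N) k)) * b N ^ k"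
   using b by (intro mult_right_mono) auto
  then show ?case by (simp only: power_mult_distrib mult.assoc)
 qed
 show "eventually (%N. real (card (dpaths (V N) k)) * b N ^ k <= (n N * b N) ^ k) sequentially"
 proof (rule always_eventually, rule allI)
  fix N
  have fin: "finite (V N)" and b: "0 <= b N" using null_model.finV[OF model[of N]] null_model.scale(2)[OF model[of N]] by auto
  have "card (dpaths (V N) k) <= card {xs. set xs \<subseteq> V N \<and> length xs = k}"
   by (intro card_mono finite_lists_length_eq fin) (auto simp: dpaths_def)
  then have "card (dpaths (V N) k) <= card (V N) ^ k" by (simp only: card_lists_length_eq[OF fin])
  then have "real (card (dpaths (V N) k)) <= n N ^ k" by (metis of_nat_le_iff of_nat_power)
  then show "real (card (dpaths (V N) k)) * b N ^ k <= (n N * b N) ^ k"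
   unfolding power_mult_distrib using b by (intro mult_right_mono) auto
 qed
 have "(%N. ((1 - real k * (1 / n N)) * (n N * b N)) ^ k) \<longlonglongrightarrow> ((1 - real k * 0) * lb) ^ k"
  by (intro tendsto_intros inv_size lims)
 then show "(%N. ((1 - real k * (1 / n N)) * (n N * b N)) ^ k) \<longlonglongrightarrow> lb ^ k" by simp
 show "(%N. (n N * b N) ^ k) \<longlonglongrightarrow> lb ^ k" by (intro tendsto_intros lims)
qed

lemma vN_limit: "vN L \<longlonglongrightarrow> vlim L"
proof -
 have eq: "vN L N = (real (card (edge_field.E2 (V N))) / (n N)\<^sup>2) * ((n N)\<^sup>2 * a N) + n N * d N
   + (\<Sum>k\<in>{3..L}. 1 / (2 * real k) * (real (card (dpaths (V N) k)) * b N ^ k))" for N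
 proof -
  interpret E: edge_field "V N" "\<nu> N" "\<zeta> N" "\<beta> N" 0 "a N" "b N" "d N" "\<epsilon> N" "\<eta> N" \<Lambda> L
   by (rule null_modelI_fields[OF model])
  show ?thesis unfolding vN_def E.vtot_def E.vc_def E.vk_def E.card_E using n_ge2[of N] by simp
 qed
 have "(%N. (real (card (edge_field.E2 (V N))) / (n N)\<^sup>2) * ((n N)\<^sup>2 * a N) + n N * d N
   + (\<Sum>k\<in>{3..L}. 1 / (2 * real k) * (real (card (dpaths (V N) k)) * b N ^ k)))
   \<longlonglongrightarrow> 1 / 2 * la + ld + (\<Sum>k\<in>{3..L}. 1 / (2 * real k) * lb ^ k)"
  by (intro tendsto_add tendsto_mult edge_count_limit lims tendsto_sum cycle_weight_limit tendsto_const)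
 then show ?thesis unfolding eq[abs_def] vlim_def by simp
qed

text \<open>The cycle terms are the logarithmic series of \<open>- ln (1 - lb) / 2\<close> without its first two terms.\<close>
lemma vlim_Vlim: "vlim \<longlonglongrightarrow> Vlim"
proof -
 have "(%n. - ((- (- lb)) ^ n) / of_nat n) sums ln (1 + (- lb))"
  using limit_nonneg lims(2) by (intro ln_series') auto
 then have "(%L. \<Sum>k<L. - (lb ^ k / real k)) \<longlonglongrightarrow> ln (1 - lb)" by (simp add: sums_def)
 then have *: "(%L. \<Sum>k<Suc L. - (lb ^ k / real k)) \<longlonglongrightarrow> ln (1 - lb)" by (rule LIMSEQ_Suc)
 have "(%L. la / 2 + ld + (- (\<Sum>k<Suc L. - (lb ^ k / real k)) - lb - lb\<^sup>2 / 2) / 2)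
   \<longlonglongrightarrow> la / 2 + ld + (- ln (1 - lb) - lb - lb\<^sup>2 / 2) / 2"
  by (intro tendsto_intros *) auto
 moreover have "eventually (%L. la / 2 + ld + (- (\<Sum>k<Suc L. - (lb ^ k / real k)) - lb - lb\<^sup>2 / 2) / 2 = vlim L) sequentially"
  using eventually_ge_at_top[of 2]
 proof eventually_elim
  case (elim L)
  have "{..<Suc L} = {0, 1, 2} \<union> {3..L}" using elim by auto
  then have "(\<Sum>k<Suc L. - (lb ^ k / real k)) = (\<Sum>k\<in>{0, 1, 2}. - (lb ^ k / real k)) + (\<Sum>k\<in>{3..L}. - (lb ^ k / real k))"
   by (simp add: sum.union_disjoint)
  also have "... = - lb - lb\<^sup>2 / 2 - 2 * (\<Sum>k\<in>{3..L}. lb ^ k / (2 * real k))"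
   by (simp add: sum_negf sum_distrib_left)
  finally show ?case by (simp add: vlim_def)
 qed
 ultimately have "vlim \<longlonglongrightarrow> la / 2 + ld + (- ln (1 - lb) - lb - lb\<^sup>2 / 2) / 2"
  by (rule Lim_transform_eventually)
 also have "la / 2 + ld + (- ln (1 - lb) - lb - lb\<^sup>2 / 2) / 2 = Vlim" by (simp add: Vlim_def field_simps)
 finally show ?thesis .
qed

lemma error_limit:
 fixes f :: "nat => complex"
 assumes close: "\<And>N. cmod (f N - exp (\<i> * (\<kappa> * vN L N * th) - th\<^sup>2 * vN L N / 2))
   <= \<bar>th\<bar> * ((1 + th\<^sup>2) * (edge_field.C \<Lambda> L * edge_field.\<delta> (V N) (\<epsilon> N) (\<eta> N)) * exp (th\<^sup>2 * vN L N / 2))"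
 shows "f \<longlonglongrightarrow> exp (\<i> * (\<kappa> * vlim L * th) - th\<^sup>2 * (sqrt (vlim L))\<^sup>2 / 2)"
proof -
 let ?\<delta> = "%N. edge_field.\<delta> (V N) (\<epsilon> N) (\<eta> N)"
 let ?e = "%N. exp (\<i> * (\<kappa> * vN L N * th) - th\<^sup>2 * vN L N / 2)"
 have "?\<delta> N = \<epsilon> N + 1 / sqrt (n N) + sqrt (n N) * \<eta> N" for N
 proof -
  interpret E: edge_field "V N" "\<nu> N" "\<zeta> N" "\<beta> N" 0 "a N" "b N" "d N" "\<epsilon> N" "\<eta> N" \<Lambda> L
   by (rule null_modelI_fields[OF model])
  show ?thesis by (simp add: E.\<delta>_def E.s_def)
 qed
 moreover have "(%N. \<epsilon> N + 1 / sqrt (n N) + sqrt (n N) * \<eta> N) \<longlonglongrightarrow> 0 + 0 + 0"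
 proof (intro tendsto_add eps)
  show "(%N. 1 / sqrt (n N)) \<longlonglongrightarrow> 0" using tendsto_real_sqrt[OF inv_size] by (simp add: real_sqrt_divide)
 qed
 ultimately have \<delta>: "?\<delta> \<longlonglongrightarrow> 0" by simp
 have "(%N. \<bar>th\<bar> * ((1 + th\<^sup>2) * (edge_field.C \<Lambda> L * ?\<delta> N) * exp (th\<^sup>2 * vN L N / 2)))
   \<longlonglongrightarrow> \<bar>th\<bar> * ((1 + th\<^sup>2) * (edge_field.C \<Lambda> L * 0) * exp (th\<^sup>2 * vlim L / 2))"
  by (intro tendsto_intros \<delta> vN_limit) auto
 then have lim: "(%N. \<bar>th\<bar> * ((1 + th\<^sup>2) * (edge_field.C \<Lambda> L * ?\<delta> N) * exp (th\<^sup>2 * vN L N / 2))) \<longlonglongrightarrow> 0" by simp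
 have "(%N. f N - ?e N) \<longlonglongrightarrow> 0"
  by (rule Lim_null_comparison[OF _ lim]) (rule always_eventually, rule allI, rule close)
 moreover have "?e \<longlonglongrightarrow> exp (\<i> * (\<kappa> * vlim L * th) - th\<^sup>2 * vlim L / 2)"
  by (intro tendsto_intros vN_limit) auto
 ultimately have "(%N. f N - ?e N + ?e N) \<longlonglongrightarrow> 0 + exp (\<i> * (\<kappa> * vlim L * th) - th\<^sup>2 * vlim L / 2)"
  by (rule tendsto_add)
 then show ?thesis using vlim_nonneg by simp
qed

lemma basics:
 "prob_space (MN N)" "bdd_rv (MN N) (SN L N)" "bdd_rv (MN N) (LRN N)" "0 <= LRN N om"
proof -
 interpret E: null_model "V N" "\<nu> N" "\<zeta> N" "\<beta> N" "a N" "b N" "d N" "\<epsilon> N" "\<eta> N" \<Lambda> L by (rule model)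
 show "prob_space (MN N)" unfolding MN_def by (rule E.H0.PM.prob_space_axioms)
 show "bdd_rv (MN N) (SN L N)" unfolding MN_def SN_def by (rule E.H0.bdd_S)
 show "bdd_rv (MN N) (LRN N)" "0 <= LRN N om" unfolding MN_def LRN_def by (rule E.bdd_LR E.LR_nonneg)+
qed

lemma null_limit:
 assumes "continuous_on UNIV f" "\<And>x. \<bar>f x :: real\<bar> <= B"
 shows "(%N. (LINT om|MN N. f (SN L N om))) \<longlonglongrightarrow> (LINT x|std_normal_distribution. f (sqrt (vlim L) * x))"
proof -
 have "(%N. (LINT om|MN N. iexp (th * SN L N om))) \<longlonglongrightarrow> exp (\<i> * (0 * vlim L * th) - th\<^sup>2 * (sqrt (vlim L))\<^sup>2 / 2)" for th
 proof (rule error_limit)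
  fix N
  interpret E: null_model "V N" "\<nu> N" "\<zeta> N" "\<beta> N" "a N" "b N" "d N" "\<epsilon> N" "\<eta> N" \<Lambda> L by (rule model)
  show "cmod ((LINT om|MN N. iexp (th * SN L N om)) - exp (\<i> * (0 * vN L N * th) - th\<^sup>2 * vN L N / 2))
   <= \<bar>th\<bar> * ((1 + th\<^sup>2) * (E.H0.C * E.H0.\<delta>) * exp (th\<^sup>2 * vN L N / 2))"
   using E.H0.char_close[of th] by (simp only: E.H0.\<psi>_def MN_def SN_def vN_def)
 qed
 then show ?thesis
  using expectation_limit[of MN "SN L" 0 "sqrt (vlim L)" f B] basics assms
  by (simp add: bdd_rv_measurable)
qed

lemma alternative_limit:
 assumes "continuous_on UNIV f" "\<And>x. \<bar>f x :: real\<bar> <= B"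
 shows "(%N. (LINT om|MN N. LRN N om * f (SN L N om))) \<longlonglongrightarrow> (LINT x|std_normal_distribution. f (vlim L + sqrt (vlim L) * x))"
proof -
 let ?Q = "%N. density (MN N) (%om. ennreal (LRN N om))"
 have dens: "(LINT om|?Q N. g om) = (LINT om|MN N. LRN N om *\<^sub>R g om)"
  if "g \<in> borel_measurable (MN N)" for g :: "_ => 'z::{banach, second_countable_topology}" and N
  using that basics by (intro integral_density) (auto simp: bdd_rv_measurable)
 have close: "cmod ((LINT om|MN N. LRN N om *\<^sub>R iexp (th * SN L N om)) - exp (\<i> * (1 * vN L N * th) - th\<^sup>2 * vN L N / 2))
   <= \<bar>th\<bar> * ((1 + th\<^sup>2) * (edge_field.C \<Lambda> L * edge_field.\<delta> (V N) (\<epsilon> N) (\<eta> N)) * exp (th\<^sup>2 * vN L N / 2))" for N th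
 proof -
  interpret E: null_model "V N" "\<nu> N" "\<zeta> N" "\<beta> N" "a N" "b N" "d N" "\<epsilon> N" "\<eta> N" \<Lambda> L by (rule model)
  show ?thesis using E.LR_char_close[of th] by (simp only: MN_def SN_def vN_def LRN_def mult_1_left of_real_1)
 qed
 have Q: "prob_space (?Q N)" for N
 proof (rule prob_spaceI)
  interpret P: prob_space "MN N" by (rule basics)
  have "(LINT om|MN N. complex_of_real (LRN N om)) = 1" using close[of N 0] by (simp add: scaleR_conv_of_real)
  then have one: "(LINT om|MN N. LRN N om) = 1" by (simp add: of_real_eq_1_iff)
  have "emeasure (?Q N) (space (?Q N)) = (\<integral>\<^sup>+om. ennreal (LRN N om) \<partial>MN N)"
   using basics by (subst emeasure_density) (auto simp: bdd_rv_measurable intro!: nn_integral_cong)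
  also have "... = ennreal (LINT om|MN N. LRN N om)"
   using basics by (intro nn_integral_eq_integral P.bdd_rv_integrable) auto
  finally show "emeasure (?Q N) (space (?Q N)) = 1" by (simp add: one)
 qed
 have m: "SN L N \<in> borel_measurable (MN N)" for N using basics by (auto simp: bdd_rv_measurable)
 have fm: "f \<in> borel_measurable borel" using assms(1) by (rule borel_measurable_continuous_onI)
 have "(%N. (LINT om|?Q N. iexp (th * SN L N om))) \<longlonglongrightarrow> exp (\<i> * (vlim L * th) - th\<^sup>2 * (sqrt (vlim L))\<^sup>2 / 2)" for th
 proof -
  have "(LINT om|?Q N. iexp (th * SN L N om)) = (LINT om|MN N. LRN N om *\<^sub>R iexp (th * SN L N om))" for N
   using m by (intro dens) auto
  then show ?thesis using error_limit[OF close] by simp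
 qed
 then have "(%N. (LINT om|?Q N. f (SN L N om))) \<longlonglongrightarrow> (LINT x|std_normal_distribution. f (vlim L + sqrt (vlim L) * x))"
  using m by (intro expectation_limit[OF Q _ _ assms]) auto
 moreover have "(LINT om|?Q N. f (SN L N om)) = (LINT om|MN N. LRN N om * f (SN L N om))" for N
  using measurable_compose[OF m fm] by (subst dens) auto
 ultimately show ?thesis by simp
qed

text \<open>The limit is the exponential of the full variance, including the contribution of cycles of all lengths.\<close>
lemma second_moment_limit:
 obtains B where "B \<longlonglongrightarrow> exp Vlim" "eventually (%N. (LINT om|MN N. (LRN N om)\<^sup>2) <= B N) sequentially"
proof
 let ?e = "%N. real (card (edge_field.E2 (V N))) / (n N)\<^sup>2"
 let ?a = "%N. (n N)\<^sup>2 * a N" and ?b = "%N. n N * b N" and ?d = "%N. n N * d N" and ?i = "%N. 1 / n N"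
 define B where "B N = exp (?d N) * exp (?e N * (?a N - (?b N)\<^sup>2 / 2 + ?a N * ?b N * ?i N + (?a N * ?i N + ?b N) ^ 3 * ?i N) - ?b N / 2)
   / sqrt (1 - ?b N)" for N
 have "B \<longlonglongrightarrow> exp ld * exp (1 / 2 * (la - lb\<^sup>2 / 2 + la * lb * 0 + (la * 0 + lb) ^ 3 * 0) - lb / 2) / sqrt (1 - lb)"
  unfolding B_def using lims(2) by (intro tendsto_intros lims edge_count_limit inv_size) auto
 also have "exp ld * exp (1 / 2 * (la - lb\<^sup>2 / 2 + la * lb * 0 + (la * 0 + lb) ^ 3 * 0) - lb / 2) / sqrt (1 - lb) = exp Vlim"
 proof -
  have "exp (ln (1 - lb) / 2) = sqrt (1 - lb)" using lims(2) by (simp add: ln_sqrt[symmetric])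
  moreover have "Vlim = (la / 2 + ld - lb / 2 - lb\<^sup>2 / 4) - ln (1 - lb) / 2" by (simp add: Vlim_def)
  ultimately have V: "exp Vlim = exp (la / 2 + ld - lb / 2 - lb\<^sup>2 / 4) / sqrt (1 - lb)" by (simp only: exp_diff)
  have "ld + (1 / 2 * (la - lb\<^sup>2 / 2 + la * lb * 0 + (la * 0 + lb) ^ 3 * 0) - lb / 2) = la / 2 + ld - lb / 2 - lb\<^sup>2 / 4"
   by (simp add: field_simps)
  then show ?thesis unfolding V exp_add[symmetric] by (simp only:)
 qed
 finally show "B \<longlonglongrightarrow> exp Vlim" .
 have "(%N. ?a N * ?i N * ?i N + ?b N * ?i N) \<longlonglongrightarrow> la * 0 * 0 + lb * 0" by (intro tendsto_intros lims inv_size)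
 then have "eventually (%N. ?a N * ?i N * ?i N + ?b N * ?i N < 1 / 2) sequentially"
  by (rule order_tendstoD) simp
 then show "eventually (%N. (LINT om|MN N. (LRN N om)\<^sup>2) <= B N) sequentially"
 proof eventually_elim
  case (elim N)
  interpret E: null_model "V N" "\<nu> N" "\<zeta> N" "\<beta> N" "a N" "b N" "d N" "\<epsilon> N" "\<eta> N" \<Lambda> 0 by (rule model)
  have n0: "n N > 0" using n_ge2[of N] by simp
  have "a N + b N <= 1 / 2" using elim n0 by (simp add: power2_eq_square)
  then have "(LINT om|MN N. (LRN N om)\<^sup>2) <= (1 + d N) ^ card (V N) * exp (real (card E.H0.E2) * (a N - (b N)\<^sup>2 / 2 + a N * b N + (a N + b N) ^ 3) - n N * b N / 2)
   / sqrt (1 - n N * b N)" unfolding LRN_def MN_def by (rule E.LR_second_moment)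
  also have "... <= exp (d N) ^ card (V N) * exp (real (card E.H0.E2) * (a N - (b N)\<^sup>2 / 2 + a N * b N + (a N + b N) ^ 3) - n N * b N / 2)
   / sqrt (1 - n N * b N)"
   using E.scale exp_ge_add_one_self[of "d N"] by (intro divide_right_mono mult_right_mono power_mono) auto
  also have "exp (d N) ^ card (V N) = exp (?d N)" by (simp add: exp_of_nat_mult)
  also have "real (card E.H0.E2) * (a N - (b N)\<^sup>2 / 2 + a N * b N + (a N + b N) ^ 3) =
    ?e N * (?a N - (?b N)\<^sup>2 / 2 + ?a N * ?b N * ?i N + (?a N * ?i N + ?b N) ^ 3 * ?i N)"
  proof -
   have i: "n N * ?i N = 1" using n0 by simp
   have 1: "?a N * ?b N * ?i N = (n N)\<^sup>2 * (a N * b N)" using n0 by simp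
   have "?a N * ?i N + ?b N = n N * (a N + b N)" using n0 by (simp add: power2_eq_square algebra_simps)
   then have 2: "(?a N * ?i N + ?b N) ^ 3 * ?i N = (n N)\<^sup>2 * (a N + b N) ^ 3"
    using n0 by (simp add: power_mult_distrib power2_eq_square power3_eq_cube)
   show ?thesis unfolding 1 2 using n0 by (simp add: power_mult_distrib field_simps)
  qed
  finally show ?case by (simp only: B_def)
 qed
qed

text \<open>Comparison of the likelihood ratio with the capped exponential of the cycle statistic in mean square; the three
expectations in the expanded square converge separately.\<close>
lemma risk_close:
 assumes e: "0 < e"
 shows "eventually (%N. \<bar>(LINT om|MN N. min 1 (LRN N om)) - (LINT x|std_normal_distribution. min 1 (exp (sqrt (vlim L) * x - vlim L / 2)))\<bar>
  <= sqrt (exp Vlim - exp (vlim L) + e) + e) sequentially"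
proof -
 let ?v = "vlim L" and ?N = std_normal_distribution
 obtain B where B: "B \<longlonglongrightarrow> exp Vlim" "eventually (%N. (LINT om|MN N. (LRN N om)\<^sup>2) <= B N) sequentially"
  by (rule second_moment_limit)
 have "eventually (%K::nat. (LINT x|?N. min (exp (?v / 2 + sqrt ?v * x)) (real K)) > exp ?v - e / 4) sequentially"
  using e by (intro order_tendstoD(1)[OF lognormal_truncation_limits(1)[OF vlim_nonneg]]) auto
 then have "eventually (%K::nat. (LINT x|?N. min (exp (?v / 2 + sqrt ?v * x)) (real K)) > exp ?v - e / 4 \<and> K >= 1) sequentially"
  using eventually_ge_at_top[of 1] by (rule eventually_conj)
 then obtain K :: nat where K: "(LINT x|?N. min (exp (?v / 2 + sqrt ?v * x)) (real K)) > exp ?v - e / 4" "K >= 1"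
  by (auto simp: eventually_sequentially)
 define \<phi> where "\<phi> x = min (exp (x - ?v / 2)) (real K)" for x
 have \<phi>: "continuous_on UNIV \<phi>" "\<bar>\<phi> x\<bar> <= real K" for x
  unfolding \<phi>_def by (auto intro!: continuous_intros)
 have \<phi>2: "continuous_on UNIV (%x. (\<phi> x)\<^sup>2)" "\<bar>(\<phi> x)\<^sup>2\<bar> <= (real K)\<^sup>2" for x
  using \<phi> by (auto intro!: continuous_intros abs_le_square_iff[THEN iffD1] simp: power2_abs)
 have \<phi>m: "continuous_on UNIV (%x. min 1 (\<phi> x))" "\<bar>min 1 (\<phi> x)\<bar> <= 1" for x
  using \<phi>(1) by (auto intro!: continuous_intros simp: \<phi>_def)
 have m1: "min 1 (\<phi> x) = min 1 (exp (x - ?v / 2))" for x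
 proof -
  have "min 1 (real K) = 1" using K(2) by simp
  then show ?thesis unfolding \<phi>_def by (metis min.assoc min.commute)
 qed
 have l1: "(%N. (LINT om|MN N. (\<phi> (SN L N om))\<^sup>2)) \<longlonglongrightarrow> (LINT x|?N. (\<phi> (sqrt ?v * x))\<^sup>2)" by (rule null_limit[OF \<phi>2])
 have l2: "(%N. (LINT om|MN N. LRN N om * \<phi> (SN L N om))) \<longlonglongrightarrow> (LINT x|?N. \<phi> (?v + sqrt ?v * x))" by (rule alternative_limit[OF \<phi>])
 have l3: "(%N. (LINT om|MN N. min 1 (\<phi> (SN L N om)))) \<longlonglongrightarrow> (LINT x|?N. min 1 (\<phi> (sqrt ?v * x)))" by (rule null_limit[OF \<phi>m])
 let ?D = "%N. B N - 2 * (LINT om|MN N. LRN N om * \<phi> (SN L N om)) + (LINT om|MN N. (\<phi> (SN L N om))\<^sup>2)"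
 have D: "?D \<longlonglongrightarrow> exp Vlim - 2 * (LINT x|?N. \<phi> (?v + sqrt ?v * x)) + (LINT x|?N. (\<phi> (sqrt ?v * x))\<^sup>2)"
  by (intro tendsto_intros B l1 l2)
 have s: "?v + sqrt ?v * x - ?v / 2 = ?v / 2 + sqrt ?v * x" for x by simp
 have k1: "(LINT x|?N. \<phi> (?v + sqrt ?v * x)) > exp ?v - e / 4" using K(1) by (simp only: \<phi>_def s)
 have k2: "(LINT x|?N. (\<phi> (sqrt ?v * x))\<^sup>2) <= exp ?v"
  using lognormal_truncation_limits(2)[OF vlim_nonneg] by (simp only: \<phi>_def)
 have "exp Vlim - 2 * (LINT x|?N. \<phi> (?v + sqrt ?v * x)) + (LINT x|?N. (\<phi> (sqrt ?v * x))\<^sup>2) < exp Vlim - exp ?v + e"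
  using k1 k2 e by linarith
 then have ev1: "eventually (%N. ?D N < exp Vlim - exp ?v + e) sequentially" using D by (rule order_tendstoD(2)[rotated])
 have ev2: "eventually (%N. dist (LINT om|MN N. min 1 (\<phi> (SN L N om))) (LINT x|?N. min 1 (\<phi> (sqrt ?v * x))) < e) sequentially"
  using l3 e by (rule tendstoD)
 show ?thesis using B(2) ev1 ev2
 proof eventually_elim
  case (elim N)
  interpret P: prob_space "MN N" by (rule basics)
  have "\<bar>(LINT om|MN N. min 1 (LRN N om)) - (LINT om|MN N. min 1 (\<phi> (SN L N om)))\<bar> \<le>
   sqrt ((LINT om|MN N. (LRN N om)\<^sup>2) - 2 * (LINT om|MN N. LRN N om * \<phi> (SN L N om)) + (LINT om|MN N. (\<phi> (SN L N om))\<^sup>2))"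
   by (intro P.expectation_min_diff_le basics bdd_rv_compose[OF _ \<phi>])
  also have "... <= sqrt (exp Vlim - exp ?v + e)" using elim(1,2) by (intro real_sqrt_le_mono) linarith
  finally show ?case using elim(3) unfolding dist_real_def m1 by linarith
 qed
qed

theorem risk_limit: "(%N. (LINT om|MN N. min 1 (LRN N om))) \<longlonglongrightarrow> erfc (sqrt Vlim / (2 * sqrt 2))"
proof -
 let ?g = "%v. (LINT x|std_normal_distribution. min 1 (exp (sqrt v * x - v / 2)))"
 have V0: "0 <= Vlim" using vlim_Vlim by (rule LIMSEQ_le_const) (auto simp: vlim_nonneg)
 have g: "(%L. ?g (vlim L)) \<longlonglongrightarrow> ?g Vlim" by (rule continuous_lognormal_min[OF vlim_Vlim vlim_nonneg])
 have "(%N. (LINT om|MN N. min 1 (LRN N om))) \<longlonglongrightarrow> ?g Vlim"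
 proof (rule tendstoI)
  fix r :: real assume r: "0 < r"
  (* e is chosen such that sqrt (2 * e) and e are both at most r / 4 *)
  define e where "e = min (r / 4) ((r / 4)\<^sup>2 / 2)"
  have e: "0 < e" "e <= r / 4" "2 * e <= (r / 4)\<^sup>2" using r by (auto simp: e_def)
  have "(%L. exp Vlim - exp (vlim L)) \<longlonglongrightarrow> exp Vlim - exp Vlim" by (intro tendsto_intros vlim_Vlim)
  then have "eventually (%L. exp Vlim - exp (vlim L) < e) sequentially" using e by (intro order_tendstoD(2)) auto
  moreover have "eventually (%L. dist (?g (vlim L)) (?g Vlim) < r / 4) sequentially" using g r by (intro tendstoD) auto
  ultimately have "eventually (%L. exp Vlim - exp (vlim L) < e \<and> dist (?g (vlim L)) (?g Vlim) < r / 4) sequentially"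
   by (rule eventually_conj)
  then obtain L where L: "exp Vlim - exp (vlim L) < e" "dist (?g (vlim L)) (?g Vlim) < r / 4"
   by (auto simp: eventually_sequentially)
  have "sqrt (exp Vlim - exp (vlim L) + e) <= sqrt ((r / 4)\<^sup>2)" using L(1) e by (intro real_sqrt_le_mono) linarith
  then have s: "sqrt (exp Vlim - exp (vlim L) + e) <= r / 4" using r by simp
  show "eventually (%N. dist (LINT om|MN N. min 1 (LRN N om)) (?g Vlim) < r) sequentially"
   using risk_close[OF e(1), of L]
  proof eventually_elim
   case (elim N)
   then show ?case using s L(2) e(2) r unfolding dist_real_def by linarith
  qed
 qed
 moreover have "?g Vlim = erfc (sqrt Vlim / (2 * sqrt 2))"
  using expectation_min_lognormal[of "sqrt Vlim"] V0 by simp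
 ultimately show ?thesis by simp
qed

end

section \<open>Truncated likelihood ratio of a single entry\<close>

locale noise_density =
 fixes p :: "real => real" and \<omega> :: real
 assumes adm: "admissible_density p"
  and prob: "prob_space (density lborel p)"
  and moments: "\<And>m::nat. integrable (density lborel p) (%z. \<bar>z\<bar> ^ m)"
  and omega: "\<omega> > 0"
begin

abbreviation "\<mu> \<equiv> density lborel p"
abbreviation "p1 \<equiv> deriv p"
abbreviation "p2 \<equiv> (deriv ^^ 2) p"

sublocale P: prob_space \<mu> by (rule prob)

lemma p_pos: "p x > 0" and p_even: "p (- x) = p x"
 using adm by (auto simp: admissible_density_def)

lemma p_deriv: "(p has_real_derivative p1 x) (at x)" "(p1 has_real_derivative p2 x) (at x)" "isCont p2 x"
proof -
 have d: "((deriv ^^ n) p has_real_derivative (deriv ^^ Suc n) p x) (at x)" for n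
  using adm by (auto simp: admissible_density_def DERIV_deriv_iff_field_differentiable)
 show "(p has_real_derivative p1 x) (at x)" using d[of 0] by simp
 show "(p1 has_real_derivative p2 x) (at x)" using d[of 1] by (simp add: numeral_2_eq_2)
 show "isCont p2 x" using d[of 2] by (rule DERIV_isCont)
qed

lemma p_cont: "continuous_on UNIV p" "continuous_on UNIV p1" "continuous_on UNIV p2"
 using DERIV_isCont[OF p_deriv(1)] DERIV_isCont[OF p_deriv(2)] p_deriv(3) by (auto simp: continuous_on_eq_continuous_at)

lemma p_meas [measurable]: "p \<in> borel_measurable borel" "p1 \<in> borel_measurable borel" "p2 \<in> borel_measurable borel"
 using p_cont by (auto intro: borel_measurable_continuous_onI)

lemma integral_mu:
 assumes "f \<in> borel_measurable borel"
 shows "(LINT z|\<mu>. f z) = (LINT z|lborel. p z * f z)" "integrable \<mu> f \<longleftrightarrow> integrable lborel (%z. p z * f z)"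
 using assms p_pos less_imp_le[OF p_pos] by (auto simp: integral_density integrable_density)

lemma integral_shift:
 assumes "f \<in> borel_measurable borel"
 shows "(LINT z|lborel. p (z - c) * f z) = (LINT z|\<mu>. f (z + c))"
proof -
 have "(LINT z|lborel. p (z - c) * f z) = \<bar>1\<bar> *\<^sub>R (LINT z|lborel. p (c + 1 * z - c) * f (c + 1 * z))"
  by (rule lborel_integral_real_affine) simp
 then show ?thesis using assms by (subst integral_mu) (auto simp: add.commute)
qed

lemma mu_even: "distr \<mu> borel uminus = \<mu>"
proof -
 have "density lborel p = density (distr lborel borel uminus) p" by (simp add: lborel_distr_uminus)
 also have "... = distr (density lborel (%x. p (- x))) borel uminus"
  by (rule density_distr) auto
 finally show ?thesis by (simp add: p_even)
qed

text \<open>Polynomial bounds with a common constant and a common natural exponent for the first two derivatives.\<close>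
lemma log_derivative_bound:
 obtains D R where "1 <= D" "1 <= R" "\<And>x. \<bar>p1 x\<bar> <= D * (1 + \<bar>x\<bar>) ^ R * p x" "\<And>x. \<bar>p2 x\<bar> <= D * (1 + \<bar>x\<bar>) ^ R * p x"
proof -
 have "\<exists>D R. \<forall>x. \<bar>(deriv ^^ s) p x\<bar> <= D * (1 + \<bar>x\<bar>) ^ R * p x \<and> 1 <= D \<and> 1 <= R" if "s >= 1" for s
 proof -
  obtain C r where C: "C > 0" "r > 0" "\<And>x. \<bar>(deriv ^^ s) p x / p x\<bar> <= C * (1 + \<bar>x\<bar> powr r)"
   using adm \<open>s >= 1\<close> unfolding admissible_density_def by blast
  define R where "R = Suc (nat \<lceil>r\<rceil>)"
  have "\<bar>(deriv ^^ s) p x\<bar> <= max 1 (2 * C) * (1 + \<bar>x\<bar>) ^ R * p x" for x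
  proof -
   have "\<bar>x\<bar> powr r <= (1 + \<bar>x\<bar>) powr r" using C(2) by (intro powr_mono2) auto
   also have "... <= (1 + \<bar>x\<bar>) powr (real R)" by (intro powr_mono) (auto simp: R_def, linarith)
   also have "... = (1 + \<bar>x\<bar>) ^ R" by (rule powr_realpow) auto
   finally have 1: "\<bar>x\<bar> powr r <= (1 + \<bar>x\<bar>) ^ R" .
   have 2: "1 <= (1 + \<bar>x\<bar>) ^ R" by (rule one_le_power) simp
   have "\<bar>(deriv ^^ s) p x\<bar> / p x = \<bar>(deriv ^^ s) p x / p x\<bar>" using p_pos[of x] by simp
   also have "... <= C * (1 + \<bar>x\<bar> powr r)" by (rule C(3))
   also have "... <= C * (2 * (1 + \<bar>x\<bar>) ^ R)" using 1 2 C(1) by (intro mult_left_mono) linarith+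
   also have "... <= max 1 (2 * C) * (1 + \<bar>x\<bar>) ^ R" using 2 mult_right_mono[of "2 * C" "max 1 (2 * C)" "(1 + \<bar>x\<bar>) ^ R"] by simp
   finally show ?thesis using p_pos[of x] by (simp add: pos_divide_le_eq)
  qed
  then show ?thesis by (intro exI[of _ "max 1 (2 * C)"] exI[of _ R]) (auto simp: R_def)
 qed
 from this[of 1] this[of 2] obtain D R D' R' where
  1: "\<And>x. \<bar>p1 x\<bar> <= D * (1 + \<bar>x\<bar>) ^ R * p x" "1 <= D" "1 <= R" and
  2: "\<And>x. \<bar>p2 x\<bar> <= D' * (1 + \<bar>x\<bar>) ^ R' * p x" "1 <= D'" "1 <= R'" by auto
 show thesis
 proof (rule that[of "max D D'" "max R R'"])
  have mono: "E * (1 + \<bar>x\<bar>) ^ S * p x <= max D D' * (1 + \<bar>x\<bar>) ^ (max R R') * p x"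
   if "E = D \<and> S = R \<or> E = D' \<and> S = R'" for E S x
   using that 1 2 p_pos[of x] by (intro mult_right_mono mult_mono power_increasing) auto
  show "\<bar>p1 x\<bar> <= max D D' * (1 + \<bar>x\<bar>) ^ (max R R') * p x" "\<bar>p2 x\<bar> <= max D D' * (1 + \<bar>x\<bar>) ^ (max R R') * p x" for x
   using order.trans[OF 1(1) mono[of D R]] order.trans[OF 2(1) mono[of D' R']] by auto
 qed (use 1 2 in auto)
qed

definition "Ah h z = (p (z - h) + p (z + h)) / (2 * p z)"
definition "Bh h z = (p (z - h) - p (z + h)) / (2 * p z)"

lemma Ah_Bh:
 "Ah h (- z) = Ah h z" "Bh h (- z) = - Bh h z" "0 < Ah h z"
 "\<sigma> = 1 \<or> \<sigma> = - 1 ==> Ah h z + \<sigma> * Bh h z = p (z - \<sigma> * h) / p z"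
proof -
 have 1: "p (- z - h) = p (z + h)" "p (- z + h) = p (z - h)" using p_even[of "z + h"] p_even[of "z - h"] by simp_all
 show "Ah h (- z) = Ah h z" "Bh h (- z) = - Bh h z" unfolding Ah_def Bh_def 1 p_even
  by (simp_all only: add.commute minus_divide_left minus_diff_eq)
 show "0 < Ah h z" unfolding Ah_def using p_pos by (intro divide_pos_pos add_pos_pos) auto
 show "\<sigma> = 1 \<or> \<sigma> = - 1 ==> Ah h z + \<sigma> * Bh h z = p (z - \<sigma> * h) / p z"
  unfolding Ah_def Bh_def using p_pos[of z] by (auto simp: field_simps)
qed

lemma measurable_Ah_Bh [measurable]: "Ah h \<in> borel_measurable borel" "Bh h \<in> borel_measurable borel"
 unfolding Ah_def[abs_def] Bh_def[abs_def] by measurable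

text \<open>To first order \<open>Bh\<close> is \<open>- h * p' / p\<close>, the score of a translation, and its second moment is governed by the Fisher information.\<close>
lemma Bh_mean_value:
 assumes "0 < h"
 obtains x where "\<bar>x - z\<bar> < h" "Bh h z = - h * (p1 x / p z)"
proof -
 obtain x where x: "z - h < x" "x < z + h" "p (z + h) - p (z - h) = ((z + h) - (z - h)) * p1 x"
  using MVT2[of "z - h" "z + h" p p1] assms p_deriv(1) by auto
 then have "p (z - h) - p (z + h) = - h * p1 x * 2" by (simp add: algebra_simps)
 then show thesis using x p_pos[of z] by (intro that[of x]) (auto simp: Bh_def)
qed

text \<open>The first order terms cancel by symmetry, so \<open>Ah - 1\<close> is of order \<open>h^2\<close> with leading coefficient \<open>p'' / (2 * p)\<close>. This
explains how \<open>G\<close> enters.\<close>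
lemma Ah_taylor:
 assumes "0 < h"
 obtains t where "0 < t" "t < h" "Ah h z - 1 = h\<^sup>2 / 4 * (p2 (z + t) / p z + p2 (z - t) / p z)"
proof -
 define g where "g n t = (if n = 0 then p (z + t) + p (z - t) - 2 * p z else if n = 1 then p1 (z + t) - p1 (z - t) else p2 (z + t) + p2 (z - t))"
  for n :: nat and t
 have d: "\<forall>m t. m < 2 \<and> 0 <= t \<and> t <= h \<longrightarrow> DERIV (g m) t :> g (Suc m) t"
 proof (intro allI impI)
  fix m :: nat and t :: real assume "m < 2 \<and> 0 <= t \<and> t <= h"
  then have "m = 0 \<or> m = 1" by auto
  moreover have q: "((%t. f (z + t)) has_real_derivative f' (z + t)) (at t)" "((%t. f (z - t)) has_real_derivative - f' (z - t)) (at t)"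
   if "\<And>x. (f has_real_derivative f' x) (at x)" for f f'
  proof -
   have "((%t. z + t) has_real_derivative 1) (at t)" "((%t. z - t) has_real_derivative - 1) (at t)"
    by (auto intro!: derivative_eq_intros)
   from DERIV_chain2[OF that this(1)] DERIV_chain2[OF that this(2)]
   show "((%t. f (z + t)) has_real_derivative f' (z + t)) (at t)" "((%t. f (z - t)) has_real_derivative - f' (z - t)) (at t)" by simp_all
  qed
  ultimately show "DERIV (g m) t :> g (Suc m) t"
   unfolding g_def by (auto intro!: derivative_eq_intros q[OF p_deriv(1)] q[OF p_deriv(2)])
 qed
 obtain t where t: "0 < t" "t < h" "g 0 h = (\<Sum>m<2. g m 0 / fact m * h ^ m) + g 2 t / fact 2 * h ^ 2"
  using Maclaurin[OF assms, of 2 g "g 0"] d by auto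
 have "g 0 0 = 0" "g 1 0 = 0" by (auto simp: g_def)
 then have "g 0 h = h\<^sup>2 / 2 * (p2 (z + t) + p2 (z - t))"
  using t(3) by (simp add: numeral_2_eq_2 g_def)
 moreover have "Ah h z - 1 = g 0 h / (2 * p z)" using p_pos[of z] by (simp add: Ah_def g_def field_simps)
 ultimately show thesis using t p_pos[of z] by (intro that[of t]) (auto simp: field_simps)
qed

end

locale noise_density_bound = noise_density +
 fixes D :: real and R :: nat
 assumes D: "1 <= D" and R: "1 <= R"
  and p1_le: "\<And>x. \<bar>deriv p x\<bar> <= D * (1 + \<bar>x\<bar>) ^ R * p x"
  and p2_le: "\<And>x. \<bar>(deriv ^^ 2) p x\<bar> <= D * (1 + \<bar>x\<bar>) ^ R * p x"
begin

definition "q z = D * (2 + \<bar>z\<bar>) ^ R"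

lemma q_ge1: "1 <= q z" and q_mono: "\<bar>z\<bar> <= \<bar>w\<bar> ==> q z <= q w"
proof -
 have "1 <= (2 + \<bar>z\<bar>) ^ R" by (rule one_le_power) simp
 then show "1 <= q z" unfolding q_def using D mult_mono[of 1 D 1 "(2 + \<bar>z\<bar>) ^ R"] by simp
 show "\<bar>z\<bar> <= \<bar>w\<bar> ==> q z <= q w" unfolding q_def using D by (intro mult_left_mono power_mono) auto
qed

lemma derivs_le:
 assumes "\<bar>x - z\<bar> <= 1"
 shows "\<bar>p1 x\<bar> <= q z * p x" "\<bar>p2 x\<bar> <= q z * p x"
proof -
 have "D * (1 + \<bar>x\<bar>) ^ R * p x <= q z * p x"
  unfolding q_def using D assms p_pos[of x] by (intro mult_right_mono mult_left_mono power_mono) auto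
 then show "\<bar>p1 x\<bar> <= q z * p x" "\<bar>p2 x\<bar> <= q z * p x" using p1_le[of x] p2_le[of x] by linarith+
qed

text \<open>On the scale \<open>h\<close> the logarithm of the density varies by at most 1, because its derivative is bounded by \<open>q z\<close>.\<close>
lemma ratio_le:
 assumes h: "\<bar>x - z\<bar> <= h" "h <= 1" "h * q z <= 1"
 shows "p x <= 3 * p z"
proof -
 have d: "((%x. ln (p x)) has_real_derivative p1 u / p u) (at u)" for u
  using p_pos[of u] by (auto intro!: derivative_eq_intros p_deriv(1) simp: field_simps)
 have "\<exists>u. \<bar>u - z\<bar> <= \<bar>x - z\<bar> \<and> ln (p x) - ln (p z) = (x - z) * (p1 u / p u)"
 proof -
  consider "x = z" | "z < x" | "x < z" by linarith
  then show ?thesis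
  proof cases
   case 2
   then obtain u where "z < u" "u < x" "ln (p x) - ln (p z) = (x - z) * (p1 u / p u)"
    using MVT2[of z x "%x. ln (p x)" "%u. p1 u / p u"] d by auto
   then show ?thesis by (intro exI[of _ u]) auto
  next
   case 3
   then obtain u where "x < u" "u < z" "ln (p z) - ln (p x) = (z - x) * (p1 u / p u)"
    using MVT2[of x z "%x. ln (p x)" "%u. p1 u / p u"] d by auto
   moreover from this have "ln (p x) - ln (p z) = (x - z) * (p1 u / p u)" by (simp only: left_diff_distrib)
   ultimately show ?thesis by (intro exI[of _ u]) auto
  qed auto
 qed
 then obtain u where u: "\<bar>u - z\<bar> <= \<bar>x - z\<bar>" "ln (p x) - ln (p z) = (x - z) * (p1 u / p u)" by blast
 have "\<bar>p1 u\<bar> <= q z * p u" using u h by (intro derivs_le) auto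
 then have "\<bar>p1 u / p u\<bar> <= q z" using p_pos[of u] by (simp add: pos_divide_le_eq)
 then have "\<bar>x - z\<bar> * \<bar>p1 u / p u\<bar> <= h * q z" using h by (intro mult_mono) auto
 moreover have "ln (p x) - ln (p z) <= \<bar>x - z\<bar> * \<bar>p1 u / p u\<bar>" unfolding u(2) abs_mult[symmetric] by (rule abs_ge_self)
 ultimately have "ln (p x) - ln (p z) <= 1" using h(3) by (meson order.trans)
 then have "exp (ln (p x)) <= exp (1 + ln (p z))" by simp
 also have "... = exp 1 * p z" using p_pos[of z] by (simp add: exp_add)
 also have "... <= 3 * p z" using exp_le p_pos[of z] by (intro mult_right_mono) auto
 finally show ?thesis using p_pos[of x] by simp
qed

lemma Bh_le:
 assumes h: "0 < h" "h <= 1" "h * q z <= 1"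
 shows "\<bar>Bh h z\<bar> <= 3 * h * q z"
proof -
 obtain x where x: "\<bar>x - z\<bar> < h" "Bh h z = - h * (p1 x / p z)" by (rule Bh_mean_value[OF h(1)])
 have "\<bar>p1 x\<bar> <= q z * p x" using x h by (intro derivs_le) auto
 also have "... <= q z * (3 * p z)" using x h q_ge1[of z] by (intro mult_left_mono ratio_le) auto
 finally have "\<bar>p1 x\<bar> / p z <= 3 * q z" using p_pos[of z] by (simp add: pos_divide_le_eq)
 then have "h * (\<bar>p1 x\<bar> / p z) <= h * (3 * q z)" using h by (intro mult_left_mono) auto
 then show ?thesis using x(2) h(1) p_pos[of z] by (simp add: abs_mult)
qed

lemma Ah_le:
 assumes h: "0 < h" "h <= 1" "h * q z <= 1"
 shows "\<bar>Ah h z - 1\<bar> <= 3 * h\<^sup>2 * q z"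
proof -
 obtain t where t: "0 < t" "t < h" "Ah h z - 1 = h\<^sup>2 / 4 * (p2 (z + t) / p z + p2 (z - t) / p z)" by (rule Ah_taylor[OF h(1)])
 have b: "\<bar>p2 x / p z\<bar> <= 3 * q z" if "\<bar>x - z\<bar> <= h" for x
 proof -
  have "\<bar>p2 x\<bar> <= q z * p x" using that h by (intro derivs_le) auto
  also have "... <= q z * (3 * p z)" using that h q_ge1[of z] by (intro mult_left_mono ratio_le) auto
  finally show ?thesis using p_pos[of z] by (simp add: pos_divide_le_eq)
 qed
 have b1: "\<bar>p2 (z + t) / p z\<bar> <= 3 * q z" and b2: "\<bar>p2 (z - t) / p z\<bar> <= 3 * q z" using t(1,2) by (intro b, simp)+
 have "\<bar>Ah h z - 1\<bar> = h\<^sup>2 / 4 * \<bar>p2 (z + t) / p z + p2 (z - t) / p z\<bar>" unfolding t(3) by (simp add: abs_mult)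
 also have "... <= h\<^sup>2 / 4 * (6 * q z)" using b1 b2 by (intro mult_left_mono) (linarith, simp)
 also have "... <= 3 * h\<^sup>2 * q z" using q_ge1[of z] by (simp add: mult_right_mono)
 finally show ?thesis .
qed

lemma integrable_q_square: "integrable \<mu> (%z. (q z)\<^sup>2)"
proof (rule Bochner_Integration.integrable_bound)
 show "integrable \<mu> (%z. D\<^sup>2 * (4 ^ (R * 2) + 2 ^ (R * 2) * \<bar>z\<bar> ^ (R * 2)))"
  by (intro integrable_mult_right Bochner_Integration.integrable_add moments P.integrable_const)
 show "(%z. (q z)\<^sup>2) \<in> borel_measurable \<mu>" unfolding q_def by simp
 have "(q z)\<^sup>2 <= D\<^sup>2 * (4 ^ (R * 2) + 2 ^ (R * 2) * \<bar>z\<bar> ^ (R * 2))" for z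
 proof -
  have "(2 + \<bar>z\<bar>) ^ (R * 2) <= (max 4 (2 * \<bar>z\<bar>)) ^ (R * 2)" by (intro power_mono) auto
  also have "... <= 4 ^ (R * 2) + (2 * \<bar>z\<bar>) ^ (R * 2)" by (auto simp: max_def)
  finally show ?thesis unfolding q_def power_mult_distrib power_mult[symmetric] by (intro mult_left_mono) auto
 qed
 then show "AE z in \<mu>. norm ((q z)\<^sup>2) <= norm (D\<^sup>2 * (4 ^ (R * 2) + 2 ^ (R * 2) * \<bar>z\<bar> ^ (R * 2)))"
  by (intro AE_I2) simp
qed

definition "hN N = sqrt (\<omega> / real N)"
text \<open>The truncation level grows like a small power of \<open>N\<close>, chosen so that the polynomial bound \<open>q\<close> is at most of
order \<open>N powr (1 / 16)\<close> on the truncated range.\<close>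
definition "K N = real N powr (1 / (16 * real R))"
definition "tail N = P.prob {z. \<bar>z\<bar> > K N - 1}"
definition "mN N = P.prob {- K N .. K N}"
definition "cN N = (LINT z|\<mu>. indicator {- K N .. K N} z * Ah (hN N) z)"
text \<open>The truncated factors. The quotient \<open>mN / cN\<close> restores the normalization, so that \<open>AN\<close> has mean 1 exactly and the
truncated likelihood ratio is again a probability density.\<close>
definition "AN N z = (if \<bar>z\<bar> <= K N then mN N / cN N * Ah (hN N) z else 1)"
definition "BN N z = (if \<bar>z\<bar> <= K N then mN N / cN N * Bh (hN N) z else 0)"
definition "C0 = D * 3 ^ R"

lemma measurable_ABN [measurable]: "AN N \<in> borel_measurable borel" "BN N \<in> borel_measurable borel"
 unfolding AN_def[abs_def] BN_def[abs_def] by measurable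

lemma ABN_even: "AN N (- z) = AN N z" "BN N (- z) = - BN N z"
 by (simp_all add: AN_def BN_def Ah_Bh)

lemma powr_limit: "c > 0 ==> (%N. real N powr (- c)) \<longlonglongrightarrow> 0"
 using tendsto_neg_powr[OF _ filterlim_real_sequentially, of "- c"] by simp

lemma K_powers:
 assumes "N >= 1"
 shows "1 <= K N" "K N ^ R = real N powr (1 / 16)" "K N ^ (48 * R) = real N ^ 3"
  "\<bar>z\<bar> <= K N ==> q z <= C0 * real N powr (1 / 16)"
proof -
 have N: "real N > 0" using assms by simp
 have pw: "K N ^ j = real N powr (real j / (16 * real R))" for j
  using N by (simp add: K_def powr_realpow[symmetric] powr_powr)
 show K1: "1 <= K N" unfolding K_def using assms by (intro ge_one_powr_ge_zero) auto
 show KR: "K N ^ R = real N powr (1 / 16)" unfolding pw using R by simp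
 have "K N ^ (48 * R) = real N powr (real 3)" unfolding pw using R by simp
 then show "K N ^ (48 * R) = real N ^ 3" by (simp only: powr_realpow[OF N])
 assume "\<bar>z\<bar> <= K N"
 then have "q z <= D * (3 * K N) ^ R" unfolding q_def using D K1 by (intro mult_left_mono power_mono) auto
 then show "q z <= C0 * real N powr (1 / 16)" by (simp add: C0_def power_mult_distrib KR mult.assoc)
qed

text \<open>Markov's inequality for the moment of order \<open>48 * R\<close>, which is large enough because \<open>K\<close> to this power is \<open>N^3\<close>.\<close>
lemma tail_limit: "(%N. (real N)\<^sup>2 * tail N) \<longlonglongrightarrow> 0"
proof -
 let ?m = "48 * R"
 define E where "E = (LINT z|\<mu>. \<bar>z\<bar> ^ ?m)"
 have "filterlim K at_top sequentially"
  unfolding K_def using R by (intro filterlim_compose[OF real_powr_at_top filterlim_real_sequentially]) auto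
 then have "eventually (%N. K N >= 2) sequentially" by (simp add: filterlim_at_top)
 then have ev: "eventually (%N. norm ((real N)\<^sup>2 * tail N) <= 2 ^ ?m * E * real N powr (- 1)) sequentially"
  using eventually_ge_at_top[of 1]
 proof eventually_elim
  case (elim N)
  have N: "real N > 0" using elim by simp
  have "tail N <= P.prob {z \<in> space \<mu>. \<bar>z\<bar> ^ ?m >= (K N / 2) ^ ?m}"
   unfolding tail_def using elim by (intro P.finite_measure_mono) (auto intro!: power_mono)
  also have "... <= E / (K N / 2) ^ ?m"
   unfolding E_def using elim by (intro integral_Markov_inequality_measure[where A = "{}"] moments) auto
  also have "... = 2 ^ ?m * E / real N ^ 3" using K_powers(3) elim by (simp add: power_divide)
  finally have "(real N)\<^sup>2 * tail N <= (real N)\<^sup>2 * (2 ^ ?m * E / real N ^ 3)" by (intro mult_left_mono) auto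
  also have "... = 2 ^ ?m * E * real N powr (- 1)" using N by (simp add: powr_minus field_simps power2_eq_square power3_eq_cube)
  finally show ?case by (simp add: tail_def)
 qed
 have "(%N. 2 ^ ?m * E * real N powr (- 1)) \<longlonglongrightarrow> 2 ^ ?m * E * 0" by (intro tendsto_intros powr_limit) simp
 then have "(%N. 2 ^ ?m * E * real N powr (- 1)) \<longlonglongrightarrow> 0" by simp
 then show ?thesis by (rule Lim_null_comparison[OF ev])
qed

text \<open>The translates of the truncation interval by at most 1 contain the interval shortened by 1 at both ends.\<close>
lemma mc_bounds:
 assumes N: "N >= 1" and h: "hN N <= 1"
 shows "1 - tail N <= mN N" "mN N <= 1" "1 - tail N <= cN N" "cN N <= 1"
proof -
 let ?S = "{- K N .. K N}" and ?h = "hN N" and ?C = "{z. \<bar>z\<bar> <= K N - 1}"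
 have h0: "0 <= ?h" using less_imp_le[OF omega] by (simp add: hN_def)
 have "P.prob ?C = 1 - tail N"
 proof -
  have "tail N = P.prob (space \<mu> - ?C)" unfolding tail_def by (intro arg_cong[of _ _ P.prob]) auto
  also have "... = 1 - P.prob ?C" by (rule P.prob_compl) simp
  finally show ?thesis by simp
 qed
 then have sub: "1 - tail N <= P.prob T" if "?C \<subseteq> T" "T \<in> sets borel" for T
  using that P.finite_measure_mono[of ?C T] by simp
 show "1 - tail N <= mN N" unfolding mN_def by (intro sub) auto
 show "mN N <= 1" unfolding mN_def by simp
 have ind: "(LINT z|\<mu>. indicator ?S (z + e)) = P.prob {z. z + e \<in> ?S}" for e
 proof -
  have "(LINT z|\<mu>. indicator ?S (z + e)) = ((LINT z|\<mu>. indicator {z. z + e \<in> ?S} z) :: real)"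
   by (intro Bochner_Integration.integral_cong) (auto simp: indicator_def)
  then show ?thesis by simp
 qed
 have shift: "(LINT z|lborel. p (z - e) * indicator ?S z) = P.prob {z. z + e \<in> ?S}" for e
  by (simp add: integral_shift ind)
 have int: "integrable lborel (%z. p (z - e) * indicator ?S z)" for e
 proof -
  have "integrable lborel (%z. indicator ?S z *\<^sub>R p (z - e))"
   by (rule borel_integrable_atLeastAtMost'[unfolded set_integrable_def]) (intro continuous_on_compose2[OF p_cont(1)] continuous_intros, auto)
  then show ?thesis by (simp add: mult.commute)
 qed
 have "cN N = (LINT z|lborel. p z * (indicator ?S z * Ah ?h z))" unfolding cN_def by (rule integral_mu) simp
 also have "... = (LINT z|lborel. (p (z - ?h) * indicator ?S z + p (z - (- ?h)) * indicator ?S z) / 2)"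
 proof (intro Bochner_Integration.integral_cong refl)
  fix z show "p z * (indicator ?S z * Ah ?h z) = (p (z - ?h) * indicator ?S z + p (z - (- ?h)) * indicator ?S z) / 2"
   using p_pos[of z] by (simp add: Ah_def field_simps)
 qed
 also have "... = (P.prob {z. z + ?h \<in> ?S} + P.prob {z. z + (- ?h) \<in> ?S}) / 2"
  by (simp only: integral_divide_zero Bochner_Integration.integral_add[OF int int] shift)
 finally have c: "cN N = ..." .
 have "1 - tail N <= P.prob {z. z + ?h \<in> ?S}" "1 - tail N <= P.prob {z. z + (- ?h) \<in> ?S}"
  using h h0 by (auto intro!: sub)
 moreover have avg: "u <= (v + w) / 2" if "u <= v" "u <= w" for u v w :: real using that by simp
 ultimately show "1 - tail N <= cN N" unfolding c by (intro avg)
 have avg': "(v + w) / 2 <= u" if "v <= u" "w <= u" for u v w :: real using that by simp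
 show "cN N <= 1" unfolding c by (intro avg' P.prob_le_1)
qed

definition "good N \<longleftrightarrow> N >= 1 \<and> hN N <= 1 \<and> hN N * (C0 * real N powr (1 / 16)) <= 1 \<and> (real N)\<^sup>2 * tail N <= 1 / 2"

lemma powr_minus_half: "real N powr (- (1 / 2)) = inverse (sqrt (real N))"
 unfolding powr_minus by (rule arg_cong[of _ _ inverse]) (rule powr_half_sqrt, simp)

lemma hN_powr:
 assumes "N >= 1"
 shows "hN N = sqrt \<omega> * real N powr (- (1 / 2))" "(hN N)\<^sup>2 = \<omega> / real N"
proof -
 have "hN N = sqrt \<omega> / sqrt (real N)" unfolding hN_def by (rule real_sqrt_divide)
 then show "hN N = sqrt \<omega> * real N powr (- (1 / 2))"
  unfolding powr_minus_half by (simp only: divide_inverse)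
 have "0 <= \<omega>" using omega by linarith
 then have "0 <= \<omega> / real N" by (rule divide_nonneg_nonneg) simp
 then show "(hN N)\<^sup>2 = \<omega> / real N" unfolding hN_def by (rule real_sqrt_pow2)
qed

lemma eventually_good: "eventually good sequentially"
proof -
 have 1: "(%N. sqrt \<omega> * real N powr (- (1 / 2))) \<longlonglongrightarrow> 0" "(%N. sqrt \<omega> * C0 * real N powr (- (7 / 16))) \<longlonglongrightarrow> 0"
  using tendsto_mult[OF tendsto_const powr_limit[of "1 / 2"], of "sqrt \<omega>"]
   tendsto_mult[OF tendsto_const powr_limit[of "7 / 16"], of "sqrt \<omega> * C0"] by auto
 have "eventually (%N. sqrt \<omega> * real N powr (- (1 / 2)) < 1) sequentially"
  "eventually (%N. sqrt \<omega> * C0 * real N powr (- (7 / 16)) < 1) sequentially"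
  "eventually (%N. (real N)\<^sup>2 * tail N < 1 / 2) sequentially"
  using order_tendstoD(2)[OF 1(1), of 1] order_tendstoD(2)[OF 1(2), of 1] order_tendstoD(2)[OF tail_limit, of "1 / 2"] by auto
 then show ?thesis using eventually_ge_at_top[of 1]
 proof eventually_elim
  case (elim N)
  have "hN N * (C0 * real N powr (1 / 16)) = sqrt \<omega> * C0 * (real N powr (- (1 / 2)) * real N powr (1 / 16))"
   using elim by (simp add: hN_powr)
  also have "... = sqrt \<omega> * C0 * real N powr (- (7 / 16))" by (subst powr_add[symmetric]) simp
  finally have "hN N * (C0 * real N powr (1 / 16)) < 1" using elim(2) by (simp only:)
  moreover have "hN N < 1" using elim by (simp add: hN_powr)
  ultimately show ?case using elim(3,4) by (simp add: good_def)
 qed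
qed

lemma good_facts:
 assumes "good N"
 shows "N >= 1" "0 < hN N" "hN N <= 1" "tail N <= 1 / 2" "0 <= tail N" "0 < mN N" "0 < cN N"
  "mN N / cN N <= 2" "\<bar>mN N / cN N - 1\<bar> <= 2 * tail N" "\<bar>z\<bar> <= K N ==> hN N * q z <= 1"
proof -
 show N: "N >= 1" and h: "hN N <= 1" using assms by (auto simp: good_def)
 show h0: "0 < hN N" using N omega by (simp add: hN_def)
 have "1 * tail N <= (real N)\<^sup>2 * tail N" using N by (intro mult_right_mono) (auto simp: tail_def)
 then show t: "tail N <= 1 / 2" using assms by (simp add: good_def)
 show t0: "0 <= tail N" by (simp add: tail_def)
 note mc = mc_bounds[OF N h]
 show m: "0 < mN N" and c: "0 < cN N" using mc t by linarith+
 have "mN N <= 2 * cN N" using mc t by linarith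
 then show "mN N / cN N <= 2" using c by (simp add: pos_divide_le_eq)
 have "\<bar>mN N / cN N - 1\<bar> = \<bar>mN N - cN N\<bar> / cN N" using c by (simp add: field_simps)
 also have "... <= tail N / (1 / 2)" using mc t t0 by (intro frac_le) auto
 finally show "\<bar>mN N / cN N - 1\<bar> <= 2 * tail N" by simp
 assume "\<bar>z\<bar> <= K N"
 then have "hN N * q z <= hN N * (C0 * real N powr (1 / 16))" using K_powers(4)[OF N] h0 by (intro mult_left_mono) auto
 then show "hN N * q z <= 1" using assms by (simp add: good_def)
qed

lemma BN_le: "good N ==> \<bar>BN N z\<bar> <= 6 * hN N * q z"
proof (cases "\<bar>z\<bar> <= K N")
 case True
 assume g: "good N"
 note gf = good_facts[OF g]
 have "\<bar>BN N z\<bar> = mN N / cN N * \<bar>Bh (hN N) z\<bar>" using True gf by (simp add: BN_def abs_mult)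
 also have "... <= 2 * (3 * hN N * q z)" using gf True by (intro mult_mono Bh_le) auto
 finally show ?thesis by simp
next
 case False
 assume g: "good N"
 show ?thesis using False good_facts[OF g] q_ge1[of z] by (simp add: BN_def)
qed

lemma AN_le: "good N ==> \<bar>AN N z - 1\<bar> <= 6 * (hN N)\<^sup>2 * q z + 2 * tail N"
proof (cases "\<bar>z\<bar> <= K N")
 case True
 assume g: "good N"
 note gf = good_facts[OF g]
 let ?r = "mN N / cN N"
 have "AN N z - 1 = ?r * (Ah (hN N) z - 1) + (?r - 1)" using True by (simp add: AN_def right_diff_distrib)
 then have "\<bar>AN N z - 1\<bar> <= ?r * \<bar>Ah (hN N) z - 1\<bar> + \<bar>?r - 1\<bar>"
  using gf abs_triangle_ineq[of "?r * (Ah (hN N) z - 1)" "?r - 1"] by (simp add: abs_mult)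
 moreover have "?r * \<bar>Ah (hN N) z - 1\<bar> <= 2 * (3 * (hN N)\<^sup>2 * q z)" using gf True by (intro mult_mono Ah_le) auto
 ultimately show ?thesis using gf(9) by linarith
next
 case False
 assume g: "good N"
 show ?thesis using False good_facts[OF g] q_ge1[of z] by (simp add: AN_def)
qed

text \<open>The factor \<open>mN / cN\<close> enters the product over all entries \<open>N^2\<close> times; the tail is small enough to
absorb this.\<close>
lemma ratio_limit: "(%N. mN N / cN N) \<longlonglongrightarrow> 1" "(%N. real N * (mN N / cN N - 1)) \<longlonglongrightarrow> 0"
 "(%N. (mN N / cN N) ^ (N\<^sup>2)) \<longlonglongrightarrow> 1"
proof -
 have t0: "(%N. 2 * ((real N)\<^sup>2 * tail N)) \<longlonglongrightarrow> 0" using tendsto_mult[OF tendsto_const tail_limit, of 2] by simp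
 have N2: "real N <= (real N)\<^sup>2" "1 <= (real N)\<^sup>2" if "N >= 1" for N
  using that self_le_power[of "real N" 2] one_le_power[of "real N" 2] by auto
 have "eventually (%N. norm (real N * (mN N / cN N - 1)) <= 2 * ((real N)\<^sup>2 * tail N)) sequentially"
  using eventually_good
 proof eventually_elim
  case (elim N)
  have "real N * \<bar>mN N / cN N - 1\<bar> <= (real N)\<^sup>2 * (2 * tail N)"
   using good_facts[OF elim] N2 by (intro mult_mono) auto
  then show ?case by (simp add: abs_mult)
 qed
 then show 2: "(%N. real N * (mN N / cN N - 1)) \<longlonglongrightarrow> 0" using t0 by (rule Lim_null_comparison)
 have "eventually (%N. norm (mN N / cN N - 1) <= 2 * ((real N)\<^sup>2 * tail N)) sequentially"
  using eventually_good
 proof eventually_elim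
  case (elim N)
  have "1 * \<bar>mN N / cN N - 1\<bar> <= (real N)\<^sup>2 * (2 * tail N)"
   using good_facts[OF elim] N2 by (intro mult_mono) auto
  then show ?case by simp
 qed
 then have "(%N. mN N / cN N - 1) \<longlonglongrightarrow> 0" using t0 by (rule Lim_null_comparison)
 then show "(%N. mN N / cN N) \<longlonglongrightarrow> 1" by (rule LIM_zero_cancel)
 show "(%N. (mN N / cN N) ^ (N\<^sup>2)) \<longlonglongrightarrow> 1"
 proof (rule tendsto_sandwich)
  have bern: "1 - (real N)\<^sup>2 * tail N <= (1 - tail N) ^ (N\<^sup>2)" if "good N" for N
   using Bernoulli_inequality[of "- tail N" "N\<^sup>2"] good_facts[OF that] by simp
  show "eventually (%N. 1 - (real N)\<^sup>2 * tail N <= (mN N / cN N) ^ (N\<^sup>2)) sequentially" using eventually_good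
  proof eventually_elim
   case (elim N)
   note gf = good_facts[OF elim] note mc = mc_bounds[OF gf(1,3)]
   have "1 - tail N <= mN N / 1" using mc by simp
   also have "... <= mN N / cN N" using mc gf by (intro divide_left_mono) auto
   finally have "(1 - tail N) ^ (N\<^sup>2) <= (mN N / cN N) ^ (N\<^sup>2)" using gf by (intro power_mono) auto
   then show ?case using bern[OF elim] by linarith
  qed
  show "eventually (%N. (mN N / cN N) ^ (N\<^sup>2) <= 1 / (1 - (real N)\<^sup>2 * tail N)) sequentially" using eventually_good
  proof eventually_elim
   case (elim N)
   note gf = good_facts[OF elim] note mc = mc_bounds[OF gf(1,3)]
   have "mN N / cN N <= 1 / (1 - tail N)" using mc gf by (intro frac_le) auto
   then have "(mN N / cN N) ^ (N\<^sup>2) <= (1 / (1 - tail N)) ^ (N\<^sup>2)" using gf by (intro power_mono) auto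
   also have "... = 1 / (1 - tail N) ^ (N\<^sup>2)" by (simp add: power_divide)
   also have "... <= 1 / (1 - (real N)\<^sup>2 * tail N)"
    using bern[OF elim] elim by (intro divide_left_mono) (auto simp: good_def)
   finally show ?case .
  qed
  have "(%N. 1 - (real N)\<^sup>2 * tail N) \<longlonglongrightarrow> 1 - 0" by (intro tendsto_intros tail_limit)
  then show "(%N. 1 - (real N)\<^sup>2 * tail N) \<longlonglongrightarrow> 1" by simp
  have "(%N. 1 / (1 - (real N)\<^sup>2 * tail N)) \<longlonglongrightarrow> 1 / (1 - 0)" by (intro tendsto_intros tail_limit) auto
  then show "(%N. 1 / (1 - (real N)\<^sup>2 * tail N)) \<longlonglongrightarrow> 1" by simp
 qed
qed

definition "e1 N = 6 * ((hN N)\<^sup>2 * (C0 * real N powr (1 / 16))) + 2 * tail N"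
definition "e2 N = 6 * (hN N * (C0 * real N powr (1 / 16)))"

lemma AN_BN_small:
 assumes "good N"
 shows "\<bar>AN N z - 1\<bar> <= e1 N" "\<bar>BN N z\<bar> <= e2 N" "0 <= e1 N" "0 <= e2 N"
proof -
 note gf = good_facts[OF assms]
 have C0: "0 <= C0" unfolding C0_def using D by simp
 show e: "0 <= e1 N" "0 <= e2 N" unfolding e1_def e2_def using C0 gf by auto
 show "\<bar>AN N z - 1\<bar> <= e1 N"
 proof (cases "\<bar>z\<bar> <= K N")
  case True
  have "(hN N)\<^sup>2 * q z <= (hN N)\<^sup>2 * (C0 * real N powr (1 / 16))" using K_powers(4)[OF gf(1) True] by (rule mult_left_mono) simp
  then show ?thesis using AN_le[OF assms, of z] unfolding e1_def mult.assoc by linarith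
 qed (use e in \<open>simp add: AN_def\<close>)
 show "\<bar>BN N z\<bar> <= e2 N"
 proof (cases "\<bar>z\<bar> <= K N")
  case True
  have "hN N * q z <= hN N * (C0 * real N powr (1 / 16))" using K_powers(4)[OF gf(1) True] gf by (intro mult_left_mono) auto
  then show ?thesis using BN_le[OF assms, of z] unfolding e2_def mult.assoc by linarith
 qed (use e in \<open>simp add: BN_def\<close>)
qed

lemma e1_e2_limits: "(%N. sqrt (real N) * e1 N) \<longlonglongrightarrow> 0" "(%N. sqrt (real N) * (e2 N)\<^sup>2) \<longlonglongrightarrow> 0"
 "e1 \<longlonglongrightarrow> 0" "e2 \<longlonglongrightarrow> 0"
proof -
 have pw: "sqrt (real N) * (hN N)\<^sup>2 = \<omega> * real N powr (- (1 / 2))" if "N >= 1" for N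
 proof -
  have "sqrt (real N) * (\<omega> / real N) = \<omega> * (sqrt (real N) / real N)" by simp
  also have "sqrt (real N) / real N = real N powr (- (1 / 2))"
  proof -
   define r where "r = sqrt (real N)"
   have "r > 0" "real N = r * r" using that by (auto simp: r_def)
   then have "r / real N = inverse r" by (simp add: field_simps)
   then show ?thesis by (simp only: r_def powr_minus_half)
  qed
  finally show ?thesis using that by (simp only: hN_powr(2))
 qed
 have tl: "(%N. sqrt (real N) * tail N) \<longlonglongrightarrow> 0"
 proof (rule Lim_null_comparison[OF _ tail_limit], rule eventually_mono[OF eventually_ge_at_top[of 1]])
  fix N :: nat assume N: "1 <= N"
  have "sqrt (real N) <= sqrt ((real N)\<^sup>2 * (real N)\<^sup>2)"
  proof (rule real_sqrt_le_mono)
   have "real N ^ 1 <= real N ^ 4" using N by (intro power_increasing) auto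
   then show "real N <= (real N)\<^sup>2 * (real N)\<^sup>2" by (simp add: power_add[symmetric])
  qed
  moreover have "sqrt ((real N)\<^sup>2 * (real N)\<^sup>2) = (real N)\<^sup>2"
   by (rule real_sqrt_unique) (simp_all only: power2_eq_square[of "(real N)\<^sup>2"] zero_le_power2)
  ultimately have "sqrt (real N) <= (real N)\<^sup>2" by (simp only:)
  then show "norm (sqrt (real N) * tail N) <= (real N)\<^sup>2 * tail N"
   by (simp add: tail_def abs_mult mult_right_mono)
 qed
 have ev: "eventually (%N. 6 * \<omega> * C0 * real N powr (- (7 / 16)) + 2 * (sqrt (real N) * tail N) = sqrt (real N) * e1 N) sequentially"
  using eventually_ge_at_top[of 1]
 proof eventually_elim
  case (elim N)
  have "sqrt (real N) * e1 N = 6 * ((sqrt (real N) * (hN N)\<^sup>2) * (C0 * real N powr (1 / 16))) + 2 * (sqrt (real N) * tail N)"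
   by (simp add: e1_def algebra_simps)
  also have "... = 6 * \<omega> * C0 * (real N powr (- (1 / 2)) * real N powr (1 / 16)) + 2 * (sqrt (real N) * tail N)"
   unfolding pw[OF elim] by simp
  also have "real N powr (- (1 / 2)) * real N powr (1 / 16) = real N powr (- (7 / 16))" by (subst powr_add[symmetric]) simp
  finally show ?case by simp
 qed
 have "(%N. 6 * \<omega> * C0 * real N powr (- (7 / 16)) + 2 * (sqrt (real N) * tail N)) \<longlonglongrightarrow> 6 * \<omega> * C0 * 0 + 2 * 0"
  by (intro tendsto_intros powr_limit tl) simp
 then show l1: "(%N. sqrt (real N) * e1 N) \<longlonglongrightarrow> 0" using Lim_transform_eventually[OF _ ev] by simp
 have ev: "eventually (%N. 36 * \<omega> * C0\<^sup>2 * real N powr (- (3 / 8)) = sqrt (real N) * (e2 N)\<^sup>2) sequentially"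
  using eventually_ge_at_top[of 1]
 proof eventually_elim
  case (elim N)
  have "sqrt (real N) * (e2 N)\<^sup>2 = 36 * ((sqrt (real N) * (hN N)\<^sup>2) * (C0\<^sup>2 * (real N powr (1 / 16) * real N powr (1 / 16))))"
   by (simp add: e2_def power_mult_distrib power2_eq_square)
  also have "... = 36 * \<omega> * C0\<^sup>2 * (real N powr (- (1 / 2)) * (real N powr (1 / 16) * real N powr (1 / 16)))"
   unfolding pw[OF elim] by simp
  also have "real N powr (- (1 / 2)) * (real N powr (1 / 16) * real N powr (1 / 16)) = real N powr (- (3 / 8))"
   by (simp only: powr_add[symmetric]) simp
  finally show ?case by simp
 qed
 have "(%N. 36 * \<omega> * C0\<^sup>2 * real N powr (- (3 / 8))) \<longlonglongrightarrow> 36 * \<omega> * C0\<^sup>2 * 0"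
  by (intro tendsto_intros powr_limit) simp
 then show l2: "(%N. sqrt (real N) * (e2 N)\<^sup>2) \<longlonglongrightarrow> 0" using Lim_transform_eventually[OF _ ev] by simp
 have one: "1 <= sqrt (real N)" if "good N" for N using good_facts(1)[OF that] by simp
 show "e1 \<longlonglongrightarrow> 0"
 proof (rule Lim_null_comparison[OF _ l1], rule eventually_mono[OF eventually_good])
  fix N assume g: "good N"
  show "norm (e1 N) <= sqrt (real N) * e1 N" using one[OF g] AN_BN_small[OF g] mult_right_mono[of 1 "sqrt (real N)" "e1 N"] by simp
 qed
 have "(%N. (e2 N)\<^sup>2) \<longlonglongrightarrow> 0"
 proof (rule Lim_null_comparison[OF _ l2], rule eventually_mono[OF eventually_good])
  fix N assume g: "good N"
  show "norm ((e2 N)\<^sup>2) <= sqrt (real N) * (e2 N)\<^sup>2" using one[OF g] mult_right_mono[of 1 "sqrt (real N)" "(e2 N)\<^sup>2"] by simp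
 qed
 then show "e2 \<longlonglongrightarrow> 0" by simp
qed

lemma integral_AN: "good N ==> (LINT z|\<mu>. AN N z) = 1"
proof -
 assume g: "good N"
 note gf = good_facts[OF g]
 let ?S = "{- K N .. K N}"
 have eq: "AN N z = mN N / cN N * (indicator ?S z * Ah (hN N) z) + (1 - indicator ?S z)" for z
  by (auto simp: AN_def indicator_def)
 have i1: "integrable \<mu> (%z. indicator ?S z * Ah (hN N) z)"
 proof (rule P.integrable_const_bound[where B = "1 + 3 * (C0 * real N powr (1 / 16))"])
  have "\<bar>Ah (hN N) z\<bar> <= 1 + 3 * (C0 * real N powr (1 / 16))" if z: "z \<in> ?S" for z
  proof -
   have z': "\<bar>z\<bar> <= K N" using z by auto
   have "3 * (hN N)\<^sup>2 * q z <= 3 * 1 * q z" using gf q_ge1[of z] power_le_one[of "hN N" 2] by (intro mult_right_mono mult_left_mono) auto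
   then show ?thesis using Ah_le[OF gf(2,3) gf(10)[OF z']] K_powers(4)[OF gf(1) z'] Ah_Bh(3)[of "hN N" z] by linarith
  qed
  moreover have "0 <= 1 + 3 * (C0 * real N powr (1 / 16))" using D by (simp add: C0_def)
  ultimately show "AE z in \<mu>. norm (indicator ?S z * Ah (hN N) z) <= 1 + 3 * (C0 * real N powr (1 / 16))"
   by (intro AE_I2) (auto simp: indicator_def)
 qed simp
 have "(LINT z|\<mu>. AN N z) = mN N / cN N * cN N + (1 - mN N)"
 proof -
  have i2: "integrable \<mu> (indicat_real ?S)" by (rule P.integrable_const_bound[where B = 1]) auto
  have "(LINT z|\<mu>. indicat_real ?S z) = mN N" by (simp add: mN_def)
  moreover have "P.prob UNIV = 1" using P.prob_space by simp
  ultimately show ?thesis unfolding eq using i1 i2 by (simp add: cN_def)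
 qed
 then show ?thesis using gf by simp
qed

lemma K_eventually: "eventually (%N. \<bar>z\<bar> <= K N) sequentially"
proof -
 have "filterlim K at_top sequentially"
  unfolding K_def using R by (intro filterlim_compose[OF real_powr_at_top filterlim_real_sequentially]) auto
 then show ?thesis by (simp add: filterlim_at_top)
qed

lemma hN_limit: "hN \<longlonglongrightarrow> 0"
proof -
 have "(%N. sqrt \<omega> * real N powr (- (1 / 2))) \<longlonglongrightarrow> sqrt \<omega> * 0" by (intro tendsto_intros powr_limit) simp
 moreover have "eventually (%N. sqrt \<omega> * real N powr (- (1 / 2)) = hN N) sequentially"
  by (rule eventually_mono[OF eventually_ge_at_top[of 1]]) (simp add: hN_powr)
 ultimately show ?thesis using Lim_transform_eventually by fastforce
qed

lemma BN_pointwise: "(%N. real N * (BN N z)\<^sup>2) \<longlonglongrightarrow> \<omega> * (p1 z / p z)\<^sup>2"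
proof -
 have "\<forall>N. \<exists>x. good N \<longrightarrow> \<bar>x - z\<bar> < hN N \<and> Bh (hN N) z = - hN N * (p1 x / p z)"
  using Bh_mean_value[OF good_facts(2)] by metis
 then obtain X where X: "\<And>N. good N ==> \<bar>X N - z\<bar> < hN N \<and> Bh (hN N) z = - hN N * (p1 (X N) / p z)" by metis
 have "(%N. X N - z) \<longlonglongrightarrow> 0"
  by (rule Lim_null_comparison[OF _ hN_limit], rule eventually_mono[OF eventually_good]) (use X in \<open>auto simp: less_imp_le\<close>)
 then have "X \<longlonglongrightarrow> z" by (rule LIM_zero_cancel)
 then have p1X: "(%N. p1 (X N)) \<longlonglongrightarrow> p1 z" by (rule isCont_tendsto_compose[OF DERIV_isCont[OF p_deriv(2)]])
 have "(%N. (mN N / cN N)\<^sup>2 * (\<omega> * (p1 (X N) / p z)\<^sup>2)) \<longlonglongrightarrow> 1\<^sup>2 * (\<omega> * (p1 z / p z)\<^sup>2)"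
  using p_pos[of z] by (intro tendsto_intros ratio_limit p1X) auto
 moreover have "eventually (%N. (mN N / cN N)\<^sup>2 * (\<omega> * (p1 (X N) / p z)\<^sup>2) = real N * (BN N z)\<^sup>2) sequentially"
  using eventually_good K_eventually[of z]
 proof eventually_elim
  case (elim N)
  have N: "N >= 1" using good_facts(1)[OF elim(1)] .
  have "real N * (BN N z)\<^sup>2 = (mN N / cN N)\<^sup>2 * ((real N * (hN N)\<^sup>2) * (p1 (X N) / p z)\<^sup>2)"
   using elim X[OF elim(1)] by (simp add: BN_def power_mult_distrib power_divide)
  also have "real N * (hN N)\<^sup>2 = \<omega>" using N by (simp add: hN_powr(2))
  finally show ?case by simp
 qed
 ultimately show ?thesis using Lim_transform_eventually by fastforce
qed

lemma AN_pointwise: "(%N. (real N)\<^sup>2 * (AN N z - 1)\<^sup>2) \<longlonglongrightarrow> (\<omega> / 2 * (p2 z / p z))\<^sup>2"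
proof -
 have "\<forall>N. \<exists>t. good N \<longrightarrow> 0 < t \<and> t < hN N \<and> Ah (hN N) z - 1 = (hN N)\<^sup>2 / 4 * (p2 (z + t) / p z + p2 (z - t) / p z)"
  using Ah_taylor[OF good_facts(2)] by metis
 then obtain T where T: "\<And>N. good N ==> 0 < T N \<and> T N < hN N \<and> Ah (hN N) z - 1 = (hN N)\<^sup>2 / 4 * (p2 (z + T N) / p z + p2 (z - T N) / p z)" by metis
 have T0: "T \<longlonglongrightarrow> 0"
  by (rule Lim_null_comparison[OF _ hN_limit], rule eventually_mono[OF eventually_good]) (use T in \<open>auto simp: less_imp_le\<close>)
 have "(%N. z + T N) \<longlonglongrightarrow> z + 0" "(%N. z - T N) \<longlonglongrightarrow> z - 0" by (intro tendsto_intros T0)+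
 then have p2T: "(%N. p2 (z + T N)) \<longlonglongrightarrow> p2 z" "(%N. p2 (z - T N)) \<longlonglongrightarrow> p2 z"
  using isCont_tendsto_compose[OF p_deriv(3)] by auto
 have "(%N. (mN N / cN N * (\<omega> / 4 * (p2 (z + T N) / p z + p2 (z - T N) / p z)) + real N * (mN N / cN N - 1))\<^sup>2)
   \<longlonglongrightarrow> (1 * (\<omega> / 4 * (p2 z / p z + p2 z / p z)) + 0)\<^sup>2"
  using p_pos[of z] by (intro tendsto_intros ratio_limit p2T) auto
 moreover have "1 * (\<omega> / 4 * (p2 z / p z + p2 z / p z)) + 0 = \<omega> / 2 * (p2 z / p z)" by simp
 moreover have "eventually (%N. (mN N / cN N * (\<omega> / 4 * (p2 (z + T N) / p z + p2 (z - T N) / p z)) + real N * (mN N / cN N - 1))\<^sup>2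
   = (real N)\<^sup>2 * (AN N z - 1)\<^sup>2) sequentially"
  using eventually_good K_eventually[of z]
 proof eventually_elim
  case (elim N)
  have N: "N >= 1" using good_facts(1)[OF elim(1)] .
  have "AN N z - 1 = mN N / cN N * (Ah (hN N) z - 1) + (mN N / cN N - 1)" using elim by (simp add: AN_def right_diff_distrib)
  also have "... = mN N / cN N * ((hN N)\<^sup>2 / 4 * (p2 (z + T N) / p z + p2 (z - T N) / p z)) + (mN N / cN N - 1)"
   using conjunct2[OF conjunct2[OF T[OF elim(1)]]] by (simp only:)
  finally have "real N * (AN N z - 1) = mN N / cN N * ((real N * (hN N)\<^sup>2) / 4 * (p2 (z + T N) / p z + p2 (z - T N) / p z)) + real N * (mN N / cN N - 1)"
   by (simp only: distrib_left) (simp add: mult_ac)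
  also have "real N * (hN N)\<^sup>2 = \<omega>" using N by (simp add: hN_powr(2))
  finally show ?case by (simp only: power_mult_distrib[symmetric])
 qed
 ultimately show ?thesis using Lim_transform_eventually by fastforce
qed

lemma dominated_moment_limit:
 fixes f :: "nat => real => real"
 assumes m: "\<And>N. f N \<in> borel_measurable borel" "g \<in> borel_measurable borel"
  and lim: "\<And>z. (%N. f N z) \<longlonglongrightarrow> g z"
  and bd: "\<And>N z. good N ==> \<bar>f N z\<bar> <= c * (q z)\<^sup>2"
 shows "(%N. (LINT z|\<mu>. f N z)) \<longlonglongrightarrow> (LINT z|\<mu>. g z)"
proof -
 obtain N0 where N0: "\<And>N. N >= N0 ==> good N" using eventually_good by (auto simp: eventually_sequentially)
 have "(%N. (LINT z|\<mu>. f (N + N0) z)) \<longlonglongrightarrow> (LINT z|\<mu>. g z)"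
 proof (rule integral_dominated_convergence[where w = "%z. c * (q z)\<^sup>2"])
  show "integrable \<mu> (%z. c * (q z)\<^sup>2)" using integrable_q_square by simp
  show "AE z in \<mu>. (%N. f (N + N0) z) \<longlonglongrightarrow> g z" using LIMSEQ_ignore_initial_segment[OF lim] by (intro AE_I2)
  show "AE z in \<mu>. norm (f (N + N0) z) <= c * (q z)\<^sup>2" for N using bd N0 by (intro AE_I2) simp
 qed (use m in auto)
 then show ?thesis by (rule LIMSEQ_offset)
qed

text \<open>Dominated convergence with the square of the polynomial \<open>q\<close> as the dominating function; it is integrable since all moments of the noise are finite.\<close>
theorem truncated_moments:
 "(%N. real N * (LINT z|\<mu>. (BN N z)\<^sup>2)) \<longlonglongrightarrow> \<omega> * (LINT t|lborel. (deriv p t)\<^sup>2 / p t)"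
 "(%N. (real N)\<^sup>2 * (LINT z|\<mu>. (AN N z - 1)\<^sup>2)) \<longlonglongrightarrow> \<omega>\<^sup>2 / 4 * (LINT t|lborel. ((deriv ^^ 2) p t)\<^sup>2 / p t)"
proof -
 have Nh: "real N * (hN N)\<^sup>2 = \<omega>" if "good N" for N using good_facts(1)[OF that] by (simp add: hN_powr(2))
 have "(%N. (LINT z|\<mu>. real N * (BN N z)\<^sup>2)) \<longlonglongrightarrow> (LINT z|\<mu>. \<omega> * (p1 z / p z)\<^sup>2)"
 proof (rule dominated_moment_limit[OF _ _ BN_pointwise, where c = "36 * \<omega>"])
  fix N z assume g: "good N"
  have "(BN N z)\<^sup>2 <= (6 * hN N * q z)\<^sup>2" using BN_le[OF g, of z] by (metis abs_ge_zero power2_abs power_mono)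
  then have "real N * (BN N z)\<^sup>2 <= real N * (6 * hN N * q z)\<^sup>2" by (intro mult_left_mono) auto
  also have "... = 36 * (real N * (hN N)\<^sup>2) * (q z)\<^sup>2" by (simp add: power_mult_distrib)
  finally show "\<bar>real N * (BN N z)\<^sup>2\<bar> <= 36 * \<omega> * (q z)\<^sup>2" unfolding Nh[OF g] by simp
 qed auto
 moreover have "(LINT z|\<mu>. \<omega> * (p1 z / p z)\<^sup>2) = \<omega> * (LINT z|lborel. p z * (p1 z / p z)\<^sup>2)"
  by (simp add: integral_mu(1))
 moreover have "p z * (p1 z / p z)\<^sup>2 = (p1 z)\<^sup>2 / p z" for z using p_pos[of z] by (simp add: power2_eq_square)
 ultimately show "(%N. real N * (LINT z|\<mu>. (BN N z)\<^sup>2)) \<longlonglongrightarrow> \<omega> * (LINT t|lborel. (deriv p t)\<^sup>2 / p t)"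
  by (simp only: integral_mult_right_zero)
 have "(%N. (LINT z|\<mu>. (real N)\<^sup>2 * (AN N z - 1)\<^sup>2)) \<longlonglongrightarrow> (LINT z|\<mu>. (\<omega> / 2 * (p2 z / p z))\<^sup>2)"
 proof (rule dominated_moment_limit[OF _ _ AN_pointwise, where c = "(6 * \<omega> + 1)\<^sup>2"])
  fix N z assume g: "good N"
  note gf = good_facts[OF g]
  have "real N * \<bar>AN N z - 1\<bar> <= real N * (6 * (hN N)\<^sup>2 * q z + 2 * tail N)" using AN_le[OF g] by (intro mult_left_mono) auto
  also have "... = 6 * (real N * (hN N)\<^sup>2) * q z + 2 * (real N * tail N)" by (simp add: algebra_simps)
  also have "real N * tail N <= (real N)\<^sup>2 * tail N" using gf self_le_power[of "real N" 2] by (intro mult_right_mono) auto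
  also have "... <= 1 / 2" using g by (simp add: good_def)
  finally have "real N * \<bar>AN N z - 1\<bar> <= (6 * \<omega> + 1) * q z" unfolding Nh[OF g] using q_ge1[of z] by (simp add: algebra_simps)
  then have "(real N * \<bar>AN N z - 1\<bar>)\<^sup>2 <= ((6 * \<omega> + 1) * q z)\<^sup>2" by (intro power_mono) auto
  then show "\<bar>(real N)\<^sup>2 * (AN N z - 1)\<^sup>2\<bar> <= (6 * \<omega> + 1)\<^sup>2 * (q z)\<^sup>2" by (simp add: power_mult_distrib)
 qed auto
 moreover have "(LINT z|\<mu>. (\<omega> / 2 * (p2 z / p z))\<^sup>2) = (LINT z|lborel. \<omega>\<^sup>2 / 4 * (p z * (p2 z / p z)\<^sup>2))"
  by (subst integral_mu(1)) (simp, intro Bochner_Integration.integral_cong refl, simp add: power_mult_distrib power_divide)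
 moreover have "p z * (p2 z / p z)\<^sup>2 = (p2 z)\<^sup>2 / p z" for z using p_pos[of z] by (simp add: power2_eq_square)
 ultimately show "(%N. (real N)\<^sup>2 * (LINT z|\<mu>. (AN N z - 1)\<^sup>2)) \<longlonglongrightarrow> \<omega>\<^sup>2 / 4 * (LINT t|lborel. ((deriv ^^ 2) p t)\<^sup>2 / p t)"
  by (simp only: integral_mult_right_zero)
qed

end

section \<open>From the noise matrix to independent pairs\<close>

text \<open>A pair of opposite entries of the matrix becomes one factor attached to an edge, a diagonal entry one attached to a loop.\<close>
lemma prod_square_by_pairs:
 fixes f :: "nat => nat => 'a::comm_monoid_mult"
 assumes "finite V"
 shows "(\<Prod>i\<in>V. \<Prod>j\<in>V. f i j) =
  (\<Prod>e | e \<subseteq> V \<and> (card e = 1 \<or> card e = 2). if card e = 2 then f (Min e) (Max e) * f (Max e) (Min e) else f (Min e) (Min e))"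
proof -
 let ?D = "{(i, j). i \<in> V \<and> j \<in> V \<and> i = j}" and ?L = "{(i, j). i \<in> V \<and> j \<in> V \<and> i < j}" and ?G = "{(i, j). i \<in> V \<and> j \<in> V \<and> j < i}"
 let ?E1 = "{e. e \<subseteq> V \<and> card e = 1}" and ?E2 = "{e. e \<subseteq> V \<and> card e = 2}"
 have fin: "finite ?D" "finite ?L" "finite ?G" by (rule finite_subset[of _ "V \<times> V"]; use assms in auto)+
 have finE: "finite ?E1" "finite ?E2" by (rule finite_subset[of _ "Pow V"]; use assms in auto)+
 have two: "Min e < Max e" "e = {Min e, Max e}" if "card e = 2" for e :: "nat set"
 proof -
  obtain x y where "e = {x, y}" "x \<noteq> y" using \<open>card e = 2\<close> by (auto simp: card_2_iff)
  then show "Min e < Max e" "e = {Min e, Max e}" by (cases "x < y"; simp add: min_def max_def insert_commute)+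
 qed
 have mm: "Min {i, j} = i" "Max {i, j} = j" "Min {j, i} = i" "Max {j, i} = j" "card {i, j} = 2" "card {j, i} = 2" if "i < j" for i j :: nat
  using that by (simp_all add: min_def max_def)
 have inV: "Min e \<in> V" "Max e \<in> V" if "e \<in> ?E2" for e
 proof -
  have "{Min e, Max e} \<subseteq> V" using that two(2)[of e] by simp
  then show "Min e \<in> V" "Max e \<in> V" by simp_all
 qed
 let ?g = "%e. if card e = 2 then f (Min e) (Max e) * f (Max e) (Min e) else f (Min e) (Min e)"
 have D: "(\<Prod>(i, j)\<in>?D. f i j) = (\<Prod>e\<in>?E1. ?g e)"
  by (rule prod.reindex_bij_witness[of _ "%e. (Min e, Min e)" "%(i, j). {i}"]) (auto simp: card_1_singleton_iff)
 have L: "(\<Prod>(i, j)\<in>?L. f i j) = (\<Prod>e\<in>?E2. f (Min e) (Max e))"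
 proof (rule prod.reindex_bij_witness[of _ "%e. (Min e, Max e)" "%(i, j). {i, j}"])
  fix e assume e: "e \<in> ?E2"
  then show "(%(i, j). {i, j}) (Min e, Max e) = e" "(Min e, Max e) \<in> ?L" using two[of e] inV[OF e] by simp_all
 qed (auto simp: mm)
 have G: "(\<Prod>(i, j)\<in>?G. f i j) = (\<Prod>e\<in>?E2. f (Max e) (Min e))"
 proof (rule prod.reindex_bij_witness[of _ "%e. (Max e, Min e)" "%(i, j). {i, j}"])
  fix e assume e: "e \<in> ?E2"
  then show "(%(i, j). {i, j}) (Max e, Min e) = e" "(Max e, Min e) \<in> ?G" using two[of e] inV[OF e] by (simp_all add: insert_commute)
 qed (auto simp: mm)
 have LG: "(\<Prod>e\<in>?E2. f (Min e) (Max e)) * (\<Prod>e\<in>?E2. f (Max e) (Min e)) = (\<Prod>e\<in>?E2. ?g e)"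
  unfolding prod.distrib[symmetric] by (rule prod.cong) auto
 have V: "V \<times> V = ?D \<union> (?L \<union> ?G)" by auto
 have "(\<Prod>i\<in>V. \<Prod>j\<in>V. f i j) = (\<Prod>(i, j)\<in>V \<times> V. f i j)" by (rule prod.cartesian_product)
 then have 1: "(\<Prod>i\<in>V. \<Prod>j\<in>V. f i j) = (\<Prod>(i, j)\<in>?D \<union> (?L \<union> ?G). f i j)" by (simp only: V)
 have 2: "(\<Prod>(i, j)\<in>?D \<union> (?L \<union> ?G). f i j) = (\<Prod>(i, j)\<in>?D. f i j) * (\<Prod>(i, j)\<in>?L \<union> ?G. f i j)"
  using fin by (intro prod.union_disjoint) auto
 have 3: "(\<Prod>(i, j)\<in>?L \<union> ?G. f i j) = (\<Prod>(i, j)\<in>?L. f i j) * (\<Prod>(i, j)\<in>?G. f i j)"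
  using fin by (intro prod.union_disjoint) auto
 have 4: "(\<Prod>e\<in>?E1 \<union> ?E2. ?g e) = (\<Prod>e\<in>?E1. ?g e) * (\<Prod>e\<in>?E2. ?g e)"
  using finE by (intro prod.union_disjoint) auto
 have 5: "{e. e \<subseteq> V \<and> (card e = 1 \<or> card e = 2)} = ?E1 \<union> ?E2" by auto
 show ?thesis unfolding 5 4 1 2 3 D L G LG ..
qed

text \<open>Multiplying a nonnegative number by \<open>c\<close> changes its minimum with 1 by a factor between 1 and \<open>c\<close>.\<close>
lemma min_abs_diff_le:
 fixes x y c :: real
 assumes "0 <= x" "0 <= c" "y = c * x"
 shows "\<bar>min 1 x - min 1 y\<bar> <= \<bar>c - 1\<bar>"
proof (cases "c >= 1")
 case True
 have "x <= y" using assms True mult_right_mono[of 1 c x] by simp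
 then have "min 1 x <= min 1 y" by (intro min.mono) auto
 moreover have "min 1 y <= c * min 1 x"
 proof (cases "x <= 1")
  case False
  have "min 1 y <= 1" by simp
  also have "1 <= c * min 1 x" using True False by simp
  finally show ?thesis .
 qed (use assms in simp)
 moreover have "(c - 1) * min 1 x <= c - 1" using True mult_left_mono[of "min 1 x" 1 "c - 1"] by simp
 moreover have "c * min 1 x = (c - 1) * min 1 x + min 1 x" by (simp add: left_diff_distrib)
 moreover have "\<bar>u - v\<bar> <= \<bar>c - 1\<bar>" if "u <= v" "v <= k" "w <= c - 1" "k = w + u" for u v w k
  using that True by linarith
 ultimately show ?thesis by blast
next
 case False
 have "y <= x" using assms False mult_right_mono[of c 1 x] by simp
 then have "min 1 y <= min 1 x" by (intro min.mono) auto
 moreover have "c * min 1 x <= min 1 y"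
 proof (rule min.boundedI)
  have "c * min 1 x <= 1 * 1" using False assms by (intro mult_mono) auto
  then show "c * min 1 x <= 1" by simp
  show "c * min 1 x <= y" unfolding assms(3) using assms(2) by (intro mult_left_mono) auto
 qed
 moreover have "(1 - c) * min 1 x <= 1 - c" using False mult_left_mono[of "min 1 x" 1 "1 - c"] by simp
 moreover have "c * min 1 x = min 1 x - (1 - c) * min 1 x" by (simp add: left_diff_distrib)
 moreover have "\<bar>u - v\<bar> <= \<bar>c - 1\<bar>" if "v <= u" "k <= v" "w <= 1 - c" "k = u - w" for u v w k
  using that False by linarith
 ultimately show ?thesis by blast
qed

context noise_density
begin

text \<open>The law of the pair of entries on an edge. On a loop both components are the same diagonal entry.\<close>
definition pair_law :: "nat set => (real \<times> real) measure" where
 "pair_law e = (if card e = 2 then \<mu> \<Otimes>\<^sub>M \<mu> else distr \<mu> (borel \<Otimes>\<^sub>M borel) (%z. (z, z)))"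
definition "matrix_of V t = (\<lambda>(i, j)\<in>V \<times> V. if i <= j then fst (t {i, j}) else snd (t {i, j}))" for V :: "nat set" and t :: "nat set => real \<times> real"
definition "noise_matrix V = PiM (V \<times> V) (%_. \<mu>)" for V :: "nat set"
abbreviation "blocks V \<equiv> {e. e \<subseteq> V \<and> (card e = 1 \<or> card e = 2)}" for V :: "nat set"

lemma sets_pair_law [measurable_cong]: "sets (pair_law e) = sets (borel \<Otimes>\<^sub>M borel)"
 by (simp add: pair_law_def cong: sets_pair_measure_cong)

lemma space_pair_law [simp]: "space (pair_law e) = UNIV"
 using sets_eq_imp_space_eq[OF sets_pair_law] by (simp add: space_pair_measure)

lemma prob_pair_law: "prob_space (pair_law e)"
proof -
 interpret PP: pair_prob_space \<mu> \<mu> ..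
 show ?thesis unfolding pair_law_def by (auto intro!: PP.prob_space_axioms P.prob_space_distr)
qed

lemma pair_law_times:
 assumes "A \<in> sets borel" "B \<in> sets borel"
 shows "emeasure (pair_law e) (A \<times> B) = (if card e = 2 then emeasure \<mu> A * emeasure \<mu> B else emeasure \<mu> (A \<inter> B))"
proof -
 have "(%z. (z, z)) -` (A \<times> B) \<inter> space \<mu> = A \<inter> B" by auto
 then show ?thesis using assms unfolding pair_law_def
  by (auto simp: P.emeasure_pair_measure_Times emeasure_distr)
qed

lemma measurable_matrix_of:
 assumes "finite V"
 shows "matrix_of V \<in> measurable (PiM (blocks V) pair_law) (noise_matrix V)"
 unfolding matrix_of_def[abs_def] noise_matrix_def
proof (rule measurable_restrict)
 fix ij assume ij: "ij \<in> V \<times> V"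
 obtain i j where e: "ij = (i, j)" by force
 have "{i, j} \<in> blocks V" using ij e by (cases "i = j") auto
 then have "(%t. t {i, j}) \<in> measurable (PiM (blocks V) pair_law) (pair_law {i, j})" by (rule measurable_component_singleton)
 then have m: "(%t. t {i, j}) \<in> measurable (PiM (blocks V) pair_law) (borel \<Otimes>\<^sub>M borel)"
  by (simp add: measurable_cong_sets[OF refl sets_pair_law])
 have "(%t. fst (t {i, j})) \<in> borel_measurable (PiM (blocks V) pair_law)" "(%t. snd (t {i, j})) \<in> borel_measurable (PiM (blocks V) pair_law)"
  using measurable_compose[OF m measurable_fst] measurable_compose[OF m measurable_snd] by auto
 then show "(%t. case ij of (i, j) => if i <= j then fst (t {i, j}) else snd (t {i, j})) \<in> measurable (PiM (blocks V) pair_law) \<mu>"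
  unfolding e by (cases "i <= j") (auto simp: measurable_def)
qed

text \<open>The preimage of a box of matrices is a box of pairs, so both laws agree on boxes.\<close>
lemma distr_matrix_of:
 assumes "finite V"
 shows "distr (PiM (blocks V) pair_law) (noise_matrix V) (matrix_of V) = noise_matrix V"
proof -
 interpret Q: product_sigma_finite "%_ :: nat \<times> nat. \<mu>"
  by (simp add: product_sigma_finite_def P.sigma_finite_measure_axioms)
 interpret PJ: product_sigma_finite pair_law
  using prob_pair_law by (simp add: product_sigma_finite_def prob_space_imp_sigma_finite)
 have finJ: "finite (blocks V)" by (rule finite_subset[of _ "Pow V"]) (use assms in auto)
 note mm = measurable_matrix_of[OF assms]
 show ?thesis unfolding noise_matrix_def
 proof (rule Q.PiM_eqI)
  show "finite (V \<times> V)" using assms by simp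
  fix A :: "nat \<times> nat => real set" assume "\<And>ij. ij \<in> V \<times> V ==> A ij \<in> sets \<mu>"
  then have A: "A ij \<in> sets borel" if "ij \<in> V \<times> V" for ij using that by simp
  define C where "C e = (if card e = 2 then A (Min e, Max e) \<times> A (Max e, Min e) else A (Min e, Min e) \<times> UNIV)" for e
  have C: "C e \<in> sets (pair_law e)" if e: "e \<in> blocks V" for e
  proof -
   have "finite e" "e \<noteq> {}" using e by (auto intro: card_ge_0_finite)
   then have "Min e \<in> V" "Max e \<in> V" using e Min_in Max_in by blast+
   then show ?thesis unfolding C_def sets_pair_law using A by auto
  qed
  have pre: "matrix_of V -` (Pi\<^sub>E (V \<times> V) A) \<inter> space (PiM (blocks V) pair_law) = Pi\<^sub>E (blocks V) C"
  proof (intro set_eqI iffI)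
   fix t assume "t \<in> matrix_of V -` (Pi\<^sub>E (V \<times> V) A) \<inter> space (PiM (blocks V) pair_law)"
   then have t: "matrix_of V t \<in> Pi\<^sub>E (V \<times> V) A" "t \<in> extensional (blocks V)" by (auto simp: space_PiM PiE_def)
   have "t e \<in> C e" if e: "e \<in> blocks V" for e
   proof (cases "card e = 2")
    case True
    then obtain x y where "e = {x, y}" "x \<noteq> y" by (auto simp: card_2_iff)
    then obtain i j where ij: "e = {i, j}" "i < j" by (metis insert_commute linorder_neqE_nat)
    then have "i \<in> V" "j \<in> V" using e by auto
    then have "matrix_of V t (i, j) \<in> A (i, j)" "matrix_of V t (j, i) \<in> A (j, i)" using t(1) by (auto simp: PiE_def Pi_def)
    then show ?thesis using ij \<open>i \<in> V\<close> \<open>j \<in> V\<close> True by (cases "t e") (auto simp: C_def matrix_of_def insert_commute)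
   next
    case False
    then obtain i where i: "e = {i}" using e by (auto simp: card_1_singleton_iff)
    then have "i \<in> V" using e by auto
    then have "matrix_of V t (i, i) \<in> A (i, i)" using t(1) by (auto simp: PiE_def Pi_def)
    then show ?thesis using i \<open>i \<in> V\<close> False by (cases "t e") (auto simp: C_def matrix_of_def)
   qed
   then show "t \<in> Pi\<^sub>E (blocks V) C" using t(2) by (auto simp: PiE_def)
  next
   fix t assume t: "t \<in> Pi\<^sub>E (blocks V) C"
   have "matrix_of V t ij \<in> A ij" if mem: "ij \<in> V \<times> V" for ij
   proof -
    obtain i j where ij: "ij = (i, j)" "i \<in> V" "j \<in> V" using mem by blast
    then have b: "{i, j} \<in> blocks V" by (cases "i = j") auto
    have m: "t {i, j} \<in> C {i, j}" by (rule PiE_mem[OF t b])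
    consider "i = j" | "i < j" | "j < i" by linarith
    then show ?thesis
    proof cases
     case 2 then show ?thesis using m ij by (cases "t {i, j}") (auto simp: C_def matrix_of_def)
    next
     case 3 then show ?thesis using m ij by (cases "t {i, j}") (auto simp: C_def matrix_of_def)
    qed (use m ij in \<open>cases "t {i, j}", auto simp: C_def matrix_of_def\<close>)
   qed
   then have "matrix_of V t \<in> Pi\<^sub>E (V \<times> V) A" by (intro PiE_I) (blast, simp add: matrix_of_def)
   moreover have "t \<in> space (PiM (blocks V) pair_law)" using t by (simp add: space_PiM PiE_def)
   ultimately show "t \<in> matrix_of V -` (Pi\<^sub>E (V \<times> V) A) \<inter> space (PiM (blocks V) pair_law)" by simp
  qed
  have "Pi\<^sub>E (V \<times> V) A \<in> sets (PiM (V \<times> V) (%_. \<mu>))" using A assms by (intro sets_PiM_I_finite) auto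
  then have "emeasure (distr (PiM (blocks V) pair_law) (PiM (V \<times> V) (%_. \<mu>)) (matrix_of V)) (Pi\<^sub>E (V \<times> V) A) = emeasure (PiM (blocks V) pair_law) (Pi\<^sub>E (blocks V) C)"
   using mm unfolding noise_matrix_def pre[symmetric] by (intro emeasure_distr) auto
  also have "... = (\<Prod>e\<in>blocks V. emeasure (pair_law e) (C e))" using C by (rule PJ.emeasure_PiM[OF finJ])
  also have "... = (\<Prod>e\<in>blocks V. if card e = 2 then emeasure \<mu> (A (Min e, Max e)) * emeasure \<mu> (A (Max e, Min e)) else emeasure \<mu> (A (Min e, Min e)))"
  proof (intro prod.cong refl)
   fix e assume e: "e \<in> blocks V"
   have "finite e" "e \<noteq> {}" using e by (auto intro: card_ge_0_finite)
   then have "Min e \<in> V" "Max e \<in> V" using e Min_in Max_in by blast+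
   then show "emeasure (pair_law e) (C e) = (if card e = 2 then emeasure \<mu> (A (Min e, Max e)) * emeasure \<mu> (A (Max e, Min e)) else emeasure \<mu> (A (Min e, Min e)))"
    unfolding C_def using A by (simp add: pair_law_times)
  qed
  also have "... = (\<Prod>i\<in>V. \<Prod>j\<in>V. emeasure \<mu> (A (i, j)))" by (rule prod_square_by_pairs[OF assms, symmetric])
  also have "... = (\<Prod>ij\<in>V \<times> V. emeasure \<mu> (A ij))" by (simp add: prod.cartesian_product)
  finally show "emeasure (distr (PiM (blocks V) pair_law) (PiM (V \<times> V) (%_. \<mu>)) (matrix_of V)) (Pi\<^sub>E (V \<times> V) A) = (\<Prod>ij\<in>V \<times> V. emeasure \<mu> (A ij))" .
 qed simp
qed

lemma integral_mu_odd:
 assumes "f \<in> borel_measurable borel" "\<And>z. f (- z) = - f z"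
 shows "(LINT z|\<mu>. f z) = (0::real)"
proof -
 have "(LINT z|\<mu>. f z) = (LINT z|distr \<mu> borel uminus. f z)" by (simp only: mu_even)
 also have "... = (LINT z|\<mu>. f (- z))" using assms(1) by (intro integral_distr) auto
 also have "... = - (LINT z|\<mu>. f z)" by (simp add: assms(2))
 finally show ?thesis by simp
qed

lemma integral_pair_law:
 fixes f g :: "real => real"
 assumes f: "bdd_rv \<mu> f" and g: "bdd_rv \<mu> g"
 shows "card e = 2 ==> (LINT t|pair_law e. f (fst t) * g (snd t)) = (LINT z|\<mu>. f z) * (LINT z|\<mu>. g z)"
  "card e = 2 ==> integrable (pair_law e) (%t. f (fst t) * g (snd t))"
  "card e \<noteq> 2 ==> (LINT t|pair_law e. f (fst t)) = (LINT z|\<mu>. f z)"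
proof -
 interpret PP: pair_prob_space \<mu> \<mu> ..
 have m: "f \<in> borel_measurable \<mu>" "g \<in> borel_measurable \<mu>" using bdd_rv_measurable[OF f] bdd_rv_measurable[OF g] .
 have "bdd_rv (\<mu> \<Otimes>\<^sub>M \<mu>) (%t. f (fst t))" "bdd_rv (\<mu> \<Otimes>\<^sub>M \<mu>) (%t. g (snd t))"
  using f g measurable_compose[OF measurable_fst m(1)] measurable_compose[OF measurable_snd m(2)] by (auto simp: bdd_rv_def)
 then have int: "integrable (\<mu> \<Otimes>\<^sub>M \<mu>) (%t. f (fst t) * g (snd t))" by (intro PP.bdd_rv_integrable bdd_rv_mult)
 { assume c: "card e = 2"
  show "integrable (pair_law e) (%t. f (fst t) * g (snd t))" using int c by (simp add: pair_law_def)
  have "(LINT t|(\<mu> \<Otimes>\<^sub>M \<mu>). f (fst t) * g (snd t)) = (LINT x|\<mu>. (LINT y|\<mu>. f x * g y))"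
   using PP.integral_fst'[OF int] by simp
  then show "(LINT t|pair_law e. f (fst t) * g (snd t)) = (LINT z|\<mu>. f z) * (LINT z|\<mu>. g z)"
   using c by (simp add: pair_law_def) }
 assume ne: "card e \<noteq> 2"
 have mf: "(%t. f (fst t)) \<in> borel_measurable (borel \<Otimes>\<^sub>M borel)" using measurable_compose[OF measurable_fst, of f] m by simp
 have "(%z. (z, z)) \<in> measurable \<mu> (borel \<Otimes>\<^sub>M borel)" by (intro measurable_Pair) auto
 from integral_distr[OF this mf] show "(LINT t|pair_law e. f (fst t)) = (LINT z|\<mu>. f z)"
  unfolding pair_law_def if_not_P[OF ne] by (simp only: fst_conv)
qed

text \<open>Changing the sign of both entries preserves the law.\<close>
lemma integral_pair_law_odd:
 fixes f :: "real \<times> real => real"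
 assumes c: "card e = 2" and f: "bdd_rv (pair_law e) f" and odd: "\<And>x y. f (- x, - y) = - f (x, y)"
 shows "(LINT t|pair_law e. f t) = 0"
proof -
 interpret PP: pair_prob_space \<mu> \<mu> ..
 have f': "bdd_rv (\<mu> \<Otimes>\<^sub>M \<mu>) f" using f c by (simp add: pair_law_def)
 have m: "f \<in> borel_measurable (borel \<Otimes>\<^sub>M borel)"
  using bdd_rv_measurable[OF f] by (simp add: measurable_cong_sets[OF sets_pair_law refl])
 note [measurable] = m
 have flip: "(LINT z|\<mu>. g z) = (LINT z|\<mu>. g (- z))" if "g \<in> borel_measurable borel" for g :: "real => real"
 proof -
  have "(LINT z|\<mu>. g z) = (LINT z|distr \<mu> borel uminus. g z)" by (simp only: mu_even)
  also have "... = (LINT z|\<mu>. g (- z))" using that by (intro integral_distr) auto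
  finally show ?thesis .
 qed
 have mi: "(%x. (LINT y|\<mu>. f (x, y))) \<in> borel_measurable borel"
 proof -
  have "(%(x, y). f (x, y)) \<in> borel_measurable (borel \<Otimes>\<^sub>M \<mu>)"
   using m by (simp add: measurable_cong_sets[OF sets_pair_measure_cong[OF refl sets_density] refl])
  then show ?thesis by (rule P.borel_measurable_lebesgue_integral)
 qed
 have "(LINT t|pair_law e. f t) = (LINT x|\<mu>. (LINT y|\<mu>. f (x, y)))"
  using PP.integral_fst'[OF PP.bdd_rv_integrable[OF f']] c by (simp add: pair_law_def)
 moreover have 2: "(LINT x|\<mu>. (LINT y|\<mu>. f (x, y))) = (LINT x|\<mu>. (LINT y|\<mu>. f (- x, y)))" by (rule flip[OF mi])
 have inner: "(LINT y|\<mu>. f (- x, y)) = - (LINT y|\<mu>. f (x, y))" for x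
 proof -
  have "(%y. f (- x, y)) \<in> borel_measurable borel" by measurable
  then have "(LINT y|\<mu>. f (- x, y)) = (LINT y|\<mu>. f (- x, - y))" by (rule flip)
  then show ?thesis by (simp add: odd)
 qed
 have "(LINT x|\<mu>. (LINT y|\<mu>. f (- x, y))) = - (LINT x|\<mu>. (LINT y|\<mu>. f (x, y)))"
  unfolding inner by (rule integral_minus)
 ultimately show ?thesis using 2 by linarith
qed

end

context noise_density_bound
begin

definition "zetaN N e t = (if card e = 2 then AN N (fst t) * AN N (snd t) + BN N (fst t) * BN N (snd t) - 1
 else if card e = 1 then AN N (fst t) + BN N (fst t) - 1 else 0)" for e :: "nat set" and t :: "real \<times> real"
definition "betaN N e t = (if card e = 2 then AN N (fst t) * BN N (snd t) + BN N (fst t) * AN N (snd t) else 0)"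
 for e :: "nat set" and t :: "real \<times> real"
definition "a2 N = (LINT z|\<mu>. (AN N z - 1)\<^sup>2)"
definition "b2 N = (LINT z|\<mu>. (BN N z)\<^sup>2)"
definition "aN N = 2 * a2 N + (a2 N)\<^sup>2 + (b2 N)\<^sup>2"
definition "bN N = 2 * (1 + a2 N) * b2 N"
definition "dN N = a2 N + b2 N"
definition "etaN N = 3 * e1 N + (e2 N)\<^sup>2"
definition "epsN N = 3 * e1 N + 4 * e2 N + (e2 N)\<^sup>2"

definition "usable N \<longleftrightarrow> good N \<and> e1 N <= 1 \<and> epsN N <= 1 / 2 \<and> N >= 2 \<and> real N * bN N < 1"

lemma bdd_AN: "good N ==> bdd_rv \<mu> (AN N)" and bdd_BN: "good N ==> bdd_rv \<mu> (BN N)"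
proof -
 assume g: "good N"
 show "bdd_rv \<mu> (AN N)"
 proof (rule bdd_rvI)
  show "norm (AN N z) <= 1 + e1 N" for z using AN_BN_small(1)[OF g, of z] by (simp add: abs_le_iff)
 qed simp
 show "bdd_rv \<mu> (BN N)" by (rule bdd_rvI[of _ _ "e2 N"]) (use AN_BN_small(2)[OF g] in auto)
qed

lemma entry_moments:
 assumes g: "good N"
 shows "(LINT z|\<mu>. BN N z) = 0" "(LINT z|\<mu>. AN N z * BN N z) = 0" "(LINT z|\<mu>. (AN N z)\<^sup>2) = 1 + a2 N"
  "(LINT z|\<mu>. AN N z + BN N z - 1) = 0" "(LINT z|\<mu>. (AN N z + BN N z - 1)\<^sup>2) = dN N"
proof -
 show B: "(LINT z|\<mu>. BN N z) = 0" by (rule integral_mu_odd) (auto simp: ABN_even)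
 show AB: "(LINT z|\<mu>. AN N z * BN N z) = 0" by (rule integral_mu_odd) (auto simp: ABN_even)
 note bA = bdd_AN[OF g] and bB = bdd_BN[OF g]
 have int: "integrable \<mu> (AN N)" "integrable \<mu> (BN N)" "integrable \<mu> (%z. (AN N z)\<^sup>2)" "integrable \<mu> (%z. (BN N z)\<^sup>2)"
  "integrable \<mu> (%z. AN N z * BN N z)"
  by (intro P.bdd_rv_integrable bdd_rv_mult bdd_rv_power bA bB)+
 have one: "P.prob UNIV = 1" using P.prob_space by simp
 have "a2 N = (LINT z|\<mu>. (AN N z)\<^sup>2 - 2 * AN N z + 1)"
  unfolding a2_def by (intro Bochner_Integration.integral_cong refl) (simp add: power2_eq_square algebra_simps)
 also have "... = (LINT z|\<mu>. (AN N z)\<^sup>2) - 2 + 1" using int one by (simp add: integral_AN[OF g])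
 finally show A2: "(LINT z|\<mu>. (AN N z)\<^sup>2) = 1 + a2 N" by simp
 show "(LINT z|\<mu>. AN N z + BN N z - 1) = 0" using int one B by (simp add: integral_AN[OF g])
 have "(LINT z|\<mu>. (AN N z + BN N z - 1)\<^sup>2) = (LINT z|\<mu>. (AN N z)\<^sup>2 + (BN N z)\<^sup>2 + 1 + 2 * (AN N z * BN N z) - 2 * AN N z - 2 * BN N z)"
  by (intro Bochner_Integration.integral_cong refl) (simp add: power2_eq_square algebra_simps)
 also have "... = (1 + a2 N) + b2 N + 1 - 2" using int one B AB A2 by (simp add: integral_AN[OF g] b2_def)
 finally show "(LINT z|\<mu>. (AN N z + BN N z - 1)\<^sup>2) = dN N" by (simp add: dN_def)
qed

lemma measurable_zetaN_betaN:
 "zetaN N e \<in> borel_measurable (pair_law e')" "betaN N e \<in> borel_measurable (pair_law e')"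
proof -
 have "zetaN N e \<in> borel_measurable (borel \<Otimes>\<^sub>M borel)" "betaN N e \<in> borel_measurable (borel \<Otimes>\<^sub>M borel)"
  unfolding zetaN_def[abs_def] betaN_def[abs_def] by measurable
 then show "zetaN N e \<in> borel_measurable (pair_law e')" "betaN N e \<in> borel_measurable (pair_law e')"
  by (simp_all add: measurable_cong_sets[OF sets_pair_law refl])
qed

lemma zetaN_betaN_le:
 assumes "good N" "e1 N <= 1"
 shows "\<bar>zetaN N e t\<bar> <= epsN N" "card e = 2 ==> \<bar>zetaN N e t\<bar> <= etaN N" "\<bar>betaN N e t\<bar> <= epsN N"
proof -
 note small = AN_BN_small[OF assms(1)]
 let ?x = "AN N (fst t) - 1" and ?y = "AN N (snd t) - 1" and ?u = "BN N (fst t)" and ?v = "BN N (snd t)"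
 have "\<bar>?x * ?y\<bar> <= e1 N * 1" unfolding abs_mult using small assms by (intro mult_mono order.trans[OF small(1) assms(2)]) auto
 moreover have "\<bar>?u * ?v\<bar> <= (e2 N)\<^sup>2" unfolding abs_mult power2_eq_square using small by (intro mult_mono) auto
 moreover have "AN N (fst t) * AN N (snd t) + BN N (fst t) * BN N (snd t) - 1 = ?x * ?y + ?x + ?y + ?u * ?v" by (simp add: algebra_simps)
 ultimately have e: "\<bar>AN N (fst t) * AN N (snd t) + BN N (fst t) * BN N (snd t) - 1\<bar> <= etaN N"
  using small(1)[of "fst t"] small(1)[of "snd t"] unfolding etaN_def by linarith
 then show "card e = 2 ==> \<bar>zetaN N e t\<bar> <= etaN N" by (simp add: zetaN_def)
 have "0 <= (e2 N)\<^sup>2" by simp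
 then have nn: "etaN N <= epsN N" "e1 N + e2 N <= epsN N" "4 * e2 N <= epsN N" "0 <= epsN N"
  unfolding etaN_def epsN_def using small(3,4) by linarith+
 have "\<bar>AN N (fst t) + BN N (fst t) - 1\<bar> <= epsN N" using small(1)[of "fst t"] small(2)[of "fst t"] nn by linarith
 then show "\<bar>zetaN N e t\<bar> <= epsN N" unfolding zetaN_def using e nn by auto
 have A2: "\<bar>AN N z\<bar> <= 2" for z using small(1)[of z] assms(2) by linarith
 have "\<bar>AN N (fst t) * ?v\<bar> <= 2 * e2 N" "\<bar>?u * AN N (snd t)\<bar> <= e2 N * 2"
  unfolding abs_mult using small A2 by (intro mult_mono; auto)+
 then have "\<bar>AN N (fst t) * ?v + ?u * AN N (snd t)\<bar> <= epsN N" using nn by linarith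
 then show "\<bar>betaN N e t\<bar> <= epsN N" unfolding betaN_def using nn by auto
qed

lemma bdd_zetaN: "good N ==> e1 N <= 1 ==> bdd_rv (pair_law e') (zetaN N e)"
 and bdd_betaN: "good N ==> e1 N <= 1 ==> bdd_rv (pair_law e') (betaN N e)"
 using measurable_zetaN_betaN zetaN_betaN_le by (auto intro!: bdd_rvI[of _ _ "epsN N"])

text \<open>Expanding the squares into products of functions of one entry each; those containing an odd function of one entry vanish.\<close>
lemma pair_moments:
 assumes g: "good N" and c: "card e = 2"
 shows "(LINT t|pair_law e. zetaN N e t) = 0" "(LINT t|pair_law e. (betaN N e t)\<^sup>2) = bN N"
  "(LINT t|pair_law e. (zetaN N e t)\<^sup>2) = aN N"
proof -
 interpret PL: prob_space "pair_law e" by (rule prob_pair_law)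
 define T where "T f h t = f (fst t) * h (snd t)" for f h :: "real => real" and t :: "real \<times> real"
 have T: "integrable (pair_law e) (T f h)" "(LINT t|pair_law e. T f h t) = (LINT z|\<mu>. f z) * (LINT z|\<mu>. h z)"
  if "bdd_rv \<mu> f" "bdd_rv \<mu> h" for f h
  using integral_pair_law[OF that] c unfolding T_def[abs_def] by auto
 let ?A = "AN N" and ?B = "BN N" and ?A2 = "%z. (AN N z)\<^sup>2" and ?B2 = "%z. (BN N z)\<^sup>2" and ?AB = "%z. AN N z * BN N z"
 note bA = bdd_AN[OF g] and bB = bdd_BN[OF g]
 note bA2 = bdd_rv_power[OF bA, of 2] and bB2 = bdd_rv_power[OF bB, of 2] and bAB = bdd_rv_mult[OF bA bB]
 note em = entry_moments[OF g]
 note TAA = T[OF bA bA] and TBB = T[OF bB bB] and TAA2 = T[OF bA2 bA2] and TBB2 = T[OF bB2 bB2] and TAB = T[OF bAB bAB]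
  and TAB2 = T[OF bA2 bB2] and TBA2 = T[OF bB2 bA2]
 have one: "PL.prob UNIV = 1" using PL.prob_space by simp
 have b2: "(LINT z|\<mu>. (BN N z)\<^sup>2) = b2 N" by (simp add: b2_def)
 have "(LINT t|pair_law e. zetaN N e t) = (LINT t|pair_law e. T ?A ?A t + T ?B ?B t - 1)"
  by (simp add: zetaN_def c T_def)
 also have "... = 0" using TAA TBB one by (simp add: em integral_AN[OF g])
 finally show "(LINT t|pair_law e. zetaN N e t) = 0" .
 have "(LINT t|pair_law e. (betaN N e t)\<^sup>2) = (LINT t|pair_law e. T ?A2 ?B2 t + T ?B2 ?A2 t + 2 * T ?AB ?AB t)"
  by (intro Bochner_Integration.integral_cong refl) (simp add: betaN_def c T_def power2_eq_square algebra_simps)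
 also have "... = (1 + a2 N) * b2 N + b2 N * (1 + a2 N)" using TAB2 TBA2 TAB by (simp add: em b2)
 finally show "(LINT t|pair_law e. (betaN N e t)\<^sup>2) = bN N" by (simp add: bN_def)
 have "(LINT t|pair_law e. (zetaN N e t)\<^sup>2) = (LINT t|pair_law e. T ?A2 ?A2 t + T ?B2 ?B2 t + 1 + 2 * T ?AB ?AB t - 2 * T ?A ?A t - 2 * T ?B ?B t)"
  by (intro Bochner_Integration.integral_cong refl) (simp add: zetaN_def c T_def power2_eq_square algebra_simps)
 also have "... = (1 + a2 N) * (1 + a2 N) + b2 N * b2 N + 1 - 2" using TAA2 TBB2 TAB TAA TBB one by (simp add: em b2 integral_AN[OF g])
 finally show "(LINT t|pair_law e. (zetaN N e t)\<^sup>2) = aN N" by (simp add: aN_def power2_eq_square algebra_simps)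
qed

lemma null_model_truncated:
 assumes u: "usable N" and \<Lambda>: "(real N)\<^sup>2 * aN N <= \<Lambda>" "real N * dN N <= \<Lambda>" "1 <= \<Lambda>"
 shows "null_model {1..N} pair_law (zetaN N) (betaN N) (aN N) (bN N) (dN N) (epsN N) (etaN N) \<Lambda>"
proof -
 have g: "good N" and e1: "e1 N <= 1" and eps: "epsN N <= 1 / 2" and N2: "N >= 2" and b1: "real N * bN N < 1"
  using u by (auto simp: usable_def)
 note le = zetaN_betaN_le[OF g e1] and small = AN_BN_small(3,4)[OF g]
 note bz = bdd_zetaN[OF g e1] and bb = bdd_betaN[OF g e1]
 have a2: "0 <= a2 N" "0 <= b2 N" by (auto simp: a2_def b2_def)
 have odd: "zetaN N e (- x, - y) = zetaN N e (x, y)" "betaN N e (- x, - y) = - betaN N e (x, y)" if "card e = 2" for e x y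
  using that by (simp_all add: zetaN_def betaN_def ABN_even)
 show ?thesis
 proof (rule null_model.intro)
  fix e :: "nat set"
  show "(LINT t|pair_law e. zetaN N e t) = 0"
  proof -
   consider "card e = 2" | "card e = 1" | "card e \<noteq> 1" "card e \<noteq> 2" by blast
   then show ?thesis
   proof cases
    case 1 then show ?thesis by (rule pair_moments(1)[OF g])
   next
    case 3 then show ?thesis by (simp add: zetaN_def)
   next
    case 2
    have "bdd_rv \<mu> (%z. AN N z + BN N z - 1)" by (intro bdd_rv_diff bdd_rv_add bdd_rv_const bdd_AN[OF g] bdd_BN[OF g])
    then show ?thesis using integral_pair_law(3)[of "%z. AN N z + BN N z - 1" "%_. 0" e] 2 entry_moments(4)[OF g]
     by (simp add: zetaN_def bdd_rv_const)
   qed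
  qed
  show "(LINT t|pair_law e. betaN N e t) = 0"
  proof (cases "card e = 2")
   case True show ?thesis by (rule integral_pair_law_odd[OF True bb odd(2)[OF True]])
  qed (simp add: betaN_def)
  { assume e: "e \<subseteq> {1..N}" "card e = 2"
   show "(LINT t|pair_law e. (betaN N e t)\<^sup>2) = bN N" "(LINT t|pair_law e. (zetaN N e t)\<^sup>2) = aN N"
    using e by (auto intro: pair_moments[OF g])
   show "(LINT t|pair_law e. zetaN N e t * betaN N e t) = 0" "(LINT t|pair_law e. (zetaN N e t)\<^sup>2 * betaN N e t) = 0"
    "(LINT t|pair_law e. betaN N e t * (betaN N e t)\<^sup>2) = 0"
    by (rule integral_pair_law_odd[OF e(2)]; (intro bdd_rv_mult bdd_rv_power bz bb)?; simp add: odd[OF e(2)])+ }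
  { assume e: "e \<subseteq> {1..N}" "card e = 1"
   have "bdd_rv \<mu> (%z. (AN N z + BN N z - 1)\<^sup>2)" by (intro bdd_rv_power bdd_rv_diff bdd_rv_add bdd_rv_const bdd_AN[OF g] bdd_BN[OF g])
   then show "(LINT t|pair_law e. (zetaN N e t)\<^sup>2) = dN N"
    using integral_pair_law(3)[of "%z. (AN N z + BN N z - 1)\<^sup>2" "%_. 0" e] e entry_moments(5)[OF g]
    by (simp add: zetaN_def bdd_rv_const) }
  show "card e = 1 ==> betaN N e t = 0" for t by (simp add: betaN_def)
  show "zetaN N e \<in> borel_measurable (pair_law e)" "betaN N e \<in> borel_measurable (pair_law e)" by (rule measurable_zetaN_betaN)+
  show "prob_space (pair_law e)" by (rule prob_pair_law)
  show "\<bar>zetaN N e t\<bar> <= epsN N" "card e = 2 ==> \<bar>zetaN N e t\<bar> <= etaN N" "\<bar>betaN N e t\<bar> <= epsN N" for t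
   using le by auto
 qed (use N2 eps b1 \<Lambda> small a2 in \<open>auto simp: etaN_def epsN_def aN_def bN_def dN_def\<close>)
qed

definition "Lbar N z = (\<Sum>s\<in>{1..N} \<rightarrow>\<^sub>E {1, -1}. \<Prod>i\<in>{1..N}. \<Prod>j\<in>{1..N}. AN N (z (i, j)) + s i * s j * BN N (z (i, j))) / 2 ^ N"
 for z :: "nat \<times> nat => real"
definition "Lfull N z = (\<Sum>s\<in>{1..N} \<rightarrow>\<^sub>E {1, -1}. \<Prod>i\<in>{1..N}. \<Prod>j\<in>{1..N}. p (z (i, j) - s i * s j * hN N) / p (z (i, j))) / 2 ^ N"
 for z :: "nat \<times> nat => real"

lemma measurable_Lbar: "Lbar N \<in> borel_measurable (noise_matrix {1..N})" "Lfull N \<in> borel_measurable (noise_matrix {1..N})"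
proof -
 have c: "(%z. z (i, j)) \<in> borel_measurable (noise_matrix {1..N})" if "i \<in> {1..N}" "j \<in> {1..N}" for i j
  using that measurable_component_singleton[of "(i, j)" "{1..N} \<times> {1..N}" "%_. \<mu>"] unfolding noise_matrix_def by simp
 have AB: "(%z. AN N (z (i, j))) \<in> borel_measurable (noise_matrix {1..N})" "(%z. BN N (z (i, j))) \<in> borel_measurable (noise_matrix {1..N})"
  "(%z. p (z (i, j) - w)) \<in> borel_measurable (noise_matrix {1..N})" "(%z. p (z (i, j))) \<in> borel_measurable (noise_matrix {1..N})"
  if "i \<in> {1..N}" "j \<in> {1..N}" for i j w
  using measurable_compose[OF c[OF that] measurable_ABN(1)] measurable_compose[OF c[OF that] measurable_ABN(2)]
   measurable_compose[OF borel_measurable_diff[OF c[OF that] borel_measurable_const] p_meas(1)] measurable_compose[OF c[OF that] p_meas(1)] by auto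
 show "Lbar N \<in> borel_measurable (noise_matrix {1..N})" unfolding Lbar_def[abs_def]
  by (intro borel_measurable_divide borel_measurable_sum borel_measurable_prod borel_measurable_add borel_measurable_times borel_measurable_const AB)
 show "Lfull N \<in> borel_measurable (noise_matrix {1..N})" unfolding Lfull_def[abs_def]
  by (intro borel_measurable_divide borel_measurable_sum borel_measurable_prod borel_measurable_const AB)
qed

lemma Lfull_nonneg: "0 <= Lfull N z"
 unfolding Lfull_def using less_imp_le[OF p_pos] by (intro divide_nonneg_nonneg sum_nonneg prod_nonneg) auto

text \<open>On an edge \<open>(A + s * B) * (A' + s * B')\<close> with \<open>s^2 = 1\<close> is \<open>1 + \<zeta> + s * \<beta>\<close>; on a loop the spins cancel.\<close>
lemma LR_eq_Lbar:
 assumes "null_model {1..N} pair_law (zetaN N) (betaN N) a b d \<epsilon> \<eta> \<Lambda>"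
 shows "null_model.LR {1..N} (zetaN N) (betaN N) t = Lbar N (matrix_of {1..N} t)"
proof -
 interpret E: null_model "{1..N}" pair_law "zetaN N" "betaN N" a b d \<epsilon> \<eta> \<Lambda> 0 by fact
 have "(\<Prod>e\<in>E.H0.J. E.tilt s e (t e)) = (\<Prod>i\<in>{1..N}. \<Prod>j\<in>{1..N}. AN N (matrix_of {1..N} t (i, j)) + s i * s j * BN N (matrix_of {1..N} t (i, j)))"
  if s: "s \<in> {1..N} \<rightarrow>\<^sub>E {1, -1}" for s
 proof -
  let ?f = "%i j. AN N (matrix_of {1..N} t (i, j)) + s i * s j * BN N (matrix_of {1..N} t (i, j))"
  have "E.tilt s e (t e) = (if card e = 2 then ?f (Min e) (Max e) * ?f (Max e) (Min e) else ?f (Min e) (Min e))"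
   if e: "e \<in> E.H0.J" for e
  proof (cases "card e = 2")
   case True
   then obtain x y where "e = {x, y}" "x \<noteq> y" by (auto simp: card_2_iff)
   then obtain i j where ij: "e = {i, j}" "i < j" by (metis insert_commute linorder_neqE_nat)
   have V3: "e \<subseteq> {1..N}" using e unfolding E.H0.J_def by blast
   then have V: "i \<in> {1..N}" "j \<in> {1..N}" "e \<subseteq> {1..N}" unfolding ij(1) by blast+
   have mm: "Min e = i" "Max e = j" using ij by (simp_all add: min_def max_def)
   have m: "matrix_of {1..N} t (i, j) = fst (t e)" "matrix_of {1..N} t (j, i) = snd (t e)"
    using V ij by (auto simp: matrix_of_def insert_commute)
   have sp: "spin_prod {1..N} s e = s i * s j" using V(3) ij by (simp add: spin_prod_def)
   have sq: "(s i * s j) * (s i * s j) = 1" using sign_square[OF s V(1)] sign_square[OF s V(2)] by (simp add: mult_ac)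
   let ?a = "AN N (fst (t e))" and ?a' = "AN N (snd (t e))" and ?b = "BN N (fst (t e))" and ?b' = "BN N (snd (t e))" and ?s = "s i * s j"
   have "(?a + ?s * ?b) * (?a' + ?s * ?b') = ?a * ?a' + (?s * ?s) * (?b * ?b') + ?s * (?a * ?b' + ?b * ?a')" by (simp add: algebra_simps)
   then have "(?a + ?s * ?b) * (?a' + ?s * ?b') = ?a * ?a' + ?b * ?b' + ?s * (?a * ?b' + ?b * ?a')" by (simp only: sq mult_1_left)
   then show ?thesis using True unfolding mm m E.tilt_def sp zetaN_def betaN_def by (simp add: mult.commute[of "s j"])
  next
   case False
   then have "card e = 1" using e unfolding E.H0.J_def by blast
   then obtain i where i: "e = {i}" by (auto simp: card_1_singleton_iff)
   then have V: "i \<in> {1..N}" using e unfolding E.H0.J_def by blast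
   then have "matrix_of {1..N} t (i, i) = fst (t e)" using i by (simp add: matrix_of_def)
   then show ?thesis unfolding E.tilt_def zetaN_def betaN_def using i sign_square[OF s V] by simp
  qed
  then show ?thesis unfolding prod_square_by_pairs[OF finite_atLeastAtMost] E.H0.J_def by (intro prod.cong refl) auto
 qed
 then show ?thesis unfolding E.LR_def Lbar_def E.signs_def by simp
qed

lemma Lbar_law:
 "(LINT z|noise_matrix {1..N}. min 1 (Lbar N z)) = (LINT t|PiM (blocks {1..N}) pair_law. min 1 (Lbar N (matrix_of {1..N} t)))"
proof -
 have m: "(%z. min 1 (Lbar N z)) \<in> borel_measurable (noise_matrix {1..N})" by (intro borel_measurable_min borel_measurable_const measurable_Lbar)
 show ?thesis using integral_distr[OF measurable_matrix_of[of "{1..N}"] m] by (simp only: distr_matrix_of finite_atLeastAtMost)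
qed

text \<open>If no entry exceeds the truncation level, the two likelihood ratios differ by a constant factor
close to 1; otherwise their contributions differ by at most 1.\<close>
lemma truncation_error:
 assumes u: "usable N"
 shows "\<bar>(LINT z|noise_matrix {1..N}. min 1 (Lfull N z)) - (LINT z|noise_matrix {1..N}. min 1 (Lbar N z))\<bar>
  <= \<bar>(mN N / cN N) ^ (N\<^sup>2) - 1\<bar> + (real N)\<^sup>2 * tail N"
proof -
 let ?V = "{1..N}" and ?r = "mN N / cN N" and ?Q = "noise_matrix {1..N}"
 have g: "good N" and eps: "epsN N <= 1 / 2" using u by (auto simp: usable_def)
 interpret PP: product_prob_space "%_ :: nat \<times> nat. \<mu>" "?V \<times> ?V" ..
 interpret Q: prob_space ?Q unfolding noise_matrix_def by (rule prob_space_PiM) (rule prob)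
 define B where "B z = (\<Sum>ij\<in>?V \<times> ?V. indicator {y. \<bar>y\<bar> > K N} (z ij) :: real)" for z
 note small = AN_BN_small[OF g]
 have Lb: "0 <= Lbar N z" for z
 proof -
  have "0 <= AN N y + s i * s j * BN N y" if s: "s \<in> ?V \<rightarrow>\<^sub>E {1, -1}" and ij: "i \<in> ?V" "j \<in> ?V" for s i j y
  proof -
   have "0 <= (e2 N)\<^sup>2" by simp
   then have "e1 N + e2 N <= 1" using eps small(3,4) unfolding epsN_def by linarith
   moreover have "s i * s j * BN N y = BN N y \<or> s i * s j * BN N y = - BN N y"
    using sign_cases[OF s ij(1)] sign_cases[OF s ij(2)] by auto
   ultimately show ?thesis using small(1,2)[of y] by (auto simp: abs_le_iff)
  qed
  then show ?thesis unfolding Lbar_def by (intro divide_nonneg_nonneg sum_nonneg prod_nonneg) auto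
 qed
 have pw: "\<bar>min 1 (Lfull N z) - min 1 (Lbar N z)\<bar> <= \<bar>?r ^ (N\<^sup>2) - 1\<bar> + B z" for z
 proof (cases "\<forall>ij\<in>?V \<times> ?V. \<bar>z ij\<bar> <= K N")
  case True
  have "(\<Prod>i\<in>?V. \<Prod>j\<in>?V. AN N (z (i, j)) + s i * s j * BN N (z (i, j))) = ?r ^ (N\<^sup>2) * (\<Prod>i\<in>?V. \<Prod>j\<in>?V. p (z (i, j) - s i * s j * hN N) / p (z (i, j)))"
   if s: "s \<in> ?V \<rightarrow>\<^sub>E {1, -1}" for s
  proof -
   have "(\<Prod>i\<in>?V. \<Prod>j\<in>?V. AN N (z (i, j)) + s i * s j * BN N (z (i, j))) = (\<Prod>i\<in>?V. \<Prod>j\<in>?V. ?r * (p (z (i, j) - s i * s j * hN N) / p (z (i, j))))"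
   proof (intro prod.cong refl)
    fix i j assume ij: "i \<in> ?V" "j \<in> ?V"
    have "\<bar>z (i, j)\<bar> <= K N" using True ij by blast
    moreover have sg: "s i * s j = 1 \<or> s i * s j = - 1" using sign_cases[OF s ij(1)] sign_cases[OF s ij(2)] by auto
    ultimately have "AN N (z (i, j)) + s i * s j * BN N (z (i, j)) = ?r * (Ah (hN N) (z (i, j)) + s i * s j * Bh (hN N) (z (i, j)))"
     by (simp add: AN_def BN_def algebra_simps)
    then show "AN N (z (i, j)) + s i * s j * BN N (z (i, j)) = ?r * (p (z (i, j) - s i * s j * hN N) / p (z (i, j)))"
     by (simp only: Ah_Bh(4)[OF sg])
   qed
   then show ?thesis by (simp only: prod.distrib prod_constant card_atLeastAtMost diff_Suc_1 power_mult[symmetric] power2_eq_square)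
  qed
  then have "Lbar N z = ?r ^ (N\<^sup>2) * Lfull N z" unfolding Lbar_def Lfull_def by (simp add: sum_distrib_left)
  then have "\<bar>min 1 (Lfull N z) - min 1 (Lbar N z)\<bar> <= \<bar>?r ^ (N\<^sup>2) - 1\<bar>"
   using good_facts(6,7)[OF g] by (intro min_abs_diff_le Lfull_nonneg) auto
  moreover have "0 <= B z" unfolding B_def by (intro sum_nonneg) auto
  ultimately show ?thesis by linarith
 next
  case False
  then obtain ij where ij: "ij \<in> ?V \<times> ?V" "\<bar>z ij\<bar> > K N" by (auto simp: not_le)
  have "(1::real) = indicator {y. \<bar>y\<bar> > K N} (z ij)" using ij by simp
  also have "... <= B z" unfolding B_def using ij by (intro member_le_sum) auto
  finally have "1 <= B z" .
  moreover have "\<bar>min 1 (Lfull N z) - min 1 (Lbar N z)\<bar> <= 1" using Lfull_nonneg[of N z] Lb[of z] by (auto simp: min_def abs_le_iff)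
  ultimately show ?thesis using abs_ge_zero[of "?r ^ (N\<^sup>2) - 1"] by linarith
 qed
 have comp: "(LINT z|?Q. indicator {y. \<bar>y\<bar> > K N} (z ij)) <= tail N" "integrable ?Q (%z. indicator {y. \<bar>y\<bar> > K N} (z ij) :: real)"
  if ij: "ij \<in> ?V \<times> ?V" for ij
 proof -
  have m: "(%z. z ij) \<in> measurable ?Q \<mu>" unfolding noise_matrix_def using ij by (rule measurable_component_singleton)
  have mi: "indicator {y. \<bar>y\<bar> > K N} \<in> borel_measurable \<mu>" by simp
  have "(LINT z|?Q. indicator {y. \<bar>y\<bar> > K N} (z ij)) = ((LINT y|distr ?Q \<mu> (%z. z ij). indicator {y. \<bar>y\<bar> > K N} y) :: real)"
   by (rule integral_distr[OF m mi, symmetric])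
  also have "distr ?Q \<mu> (%z. z ij) = \<mu>" unfolding noise_matrix_def using ij by (rule PP.PiM_component)
  also have "((LINT y|\<mu>. indicator {y. \<bar>y\<bar> > K N} y) :: real) = P.prob {y. \<bar>y\<bar> > K N}" by simp
  also have "... <= tail N" unfolding tail_def by (intro P.finite_measure_mono) auto
  finally show "(LINT z|?Q. indicator {y. \<bar>y\<bar> > K N} (z ij)) <= tail N" .
  show "integrable ?Q (%z. indicator {y. \<bar>y\<bar> > K N} (z ij) :: real)"
   using measurable_compose[OF m mi] by (intro Q.integrable_const_bound[where B = 1]) (auto simp: indicator_def)
 qed
 have int: "integrable ?Q (%z. min 1 (f z))" if "f \<in> borel_measurable ?Q" "\<And>z. 0 <= f z" for f :: "_ => real"
  using that by (intro Q.integrable_const_bound[where B = 1]) auto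
 note i1 = int[OF measurable_Lbar(2) Lfull_nonneg] and i2 = int[OF measurable_Lbar(1) Lb]
 have iB: "integrable ?Q B" unfolding B_def using comp(2) by (intro Bochner_Integration.integrable_sum)
 have "\<bar>(LINT z|?Q. min 1 (Lfull N z)) - (LINT z|?Q. min 1 (Lbar N z))\<bar> = \<bar>(LINT z|?Q. min 1 (Lfull N z) - min 1 (Lbar N z))\<bar>"
  using i1 i2 by simp
 also have "... <= (LINT z|?Q. \<bar>min 1 (Lfull N z) - min 1 (Lbar N z)\<bar>)" by (rule integral_abs_bound)
 also have "... <= (LINT z|?Q. \<bar>?r ^ (N\<^sup>2) - 1\<bar> + B z)"
  using i1 i2 iB pw by (intro integral_mono integrable_abs Bochner_Integration.integrable_diff Bochner_Integration.integrable_add Q.integrable_const)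
 also have "... = \<bar>?r ^ (N\<^sup>2) - 1\<bar> + (LINT z|?Q. B z)" 
  unfolding Bochner_Integration.integral_add[OF Q.integrable_const iB] lebesgue_integral_const Q.prob_space by simp
 also have "(LINT z|?Q. B z) = (\<Sum>ij\<in>?V \<times> ?V. (LINT z|?Q. indicator {y. \<bar>y\<bar> > K N} (z ij)))"
  unfolding B_def using comp(2) by (rule Bochner_Integration.integral_sum)
 also have "... <= (\<Sum>ij\<in>?V \<times> ?V. tail N)" by (intro sum_mono comp)
 also have "... = (real N)\<^sup>2 * tail N" by (simp add: card_cartesian_product power2_eq_square)
 finally show ?thesis by simp
qed

end

section \<open>The error of the test\<close>

context noise_density_bound
begin

text \<open>With \<open>lb = 2 * \<omega> * F\<close>, \<open>la = \<omega>^2 * (G / 2 + F^2)\<close> and \<open>ld = \<omega> * F\<close>, the terms linear in \<open>F\<close> cancel in the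
limiting variance and leave \<open>2 * \<rho>\<close>.\<close>
theorem model_risk_limit:
 assumes F: "F = (LINT t|lborel. (deriv p t)\<^sup>2 / p t)" and G: "G = (LINT t|lborel. ((deriv ^^ 2) p t)\<^sup>2 / p t)"
  and FG: "2 * \<omega> * F < 1" and \<rho>: "\<rho> = - (1 / 4) * (ln (1 - 2 * \<omega> * F) + \<omega>\<^sup>2 / 2 * (2 * F\<^sup>2 - G))"
 shows "(%N. (LINT z|noise_matrix {1..N}. min 1 (Lfull N z))) \<longlonglongrightarrow> erfc (sqrt \<rho> / 2)"
proof -
 have bl: "(%N. real N * b2 N) \<longlonglongrightarrow> \<omega> * F" using truncated_moments(1) by (simp only: b2_def F)
 have al: "(%N. (real N)\<^sup>2 * a2 N) \<longlonglongrightarrow> \<omega>\<^sup>2 / 4 * G" using truncated_moments(2) by (simp only: a2_def G)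
 have inv: "(%N. 1 / real N) \<longlonglongrightarrow> 0" by (rule lim_1_over_n)
 have Na: "(%N. (real N)\<^sup>2 * a2 N * (1 / real N)) \<longlonglongrightarrow> \<omega>\<^sup>2 / 4 * G * 0" by (intro tendsto_mult al inv)
 have Na': "(real N)\<^sup>2 * a2 N * (1 / real N) = real N * a2 N" for N by (simp add: power2_eq_square)
 have a0: "a2 \<longlonglongrightarrow> 0"
 proof (rule Lim_null_comparison)
  have "a2 N <= (real N)\<^sup>2 * a2 N * (1 / real N)" if "N >= 1" for N
   unfolding Na' using that mult_right_mono[of 1 "real N" "a2 N"] by (simp add: a2_def)
  then show "eventually (%N. norm (a2 N) <= (real N)\<^sup>2 * a2 N * (1 / real N)) sequentially"
   using eventually_ge_at_top[of 1] by (intro eventually_mono[OF eventually_ge_at_top[of 1]]) (simp add: a2_def)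
  show "(%N. (real N)\<^sup>2 * a2 N * (1 / real N)) \<longlonglongrightarrow> 0" using Na by simp
 qed
 define la lb ld where "la = \<omega>\<^sup>2 / 2 * G + (\<omega> * F)\<^sup>2" and "lb = 2 * (\<omega> * F)" and "ld = \<omega> * F"
 have lb: "(%N. real N * bN N) \<longlonglongrightarrow> lb"
 proof -
  have "(%N. 2 * (1 + a2 N) * (real N * b2 N)) \<longlonglongrightarrow> 2 * (1 + 0) * (\<omega> * F)" by (intro tendsto_intros bl a0)
  then show ?thesis by (simp add: bN_def lb_def mult_ac)
 qed
 have la: "(%N. (real N)\<^sup>2 * aN N) \<longlonglongrightarrow> la"
 proof -
  have "(%N. 2 * ((real N)\<^sup>2 * a2 N) + ((real N)\<^sup>2 * a2 N) * a2 N + (real N * b2 N)\<^sup>2) \<longlonglongrightarrow> 2 * (\<omega>\<^sup>2 / 4 * G) + (\<omega>\<^sup>2 / 4 * G) * 0 + (\<omega> * F)\<^sup>2"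
   by (intro tendsto_intros bl al a0)
  moreover have "2 * ((real N)\<^sup>2 * a2 N) + ((real N)\<^sup>2 * a2 N) * a2 N + (real N * b2 N)\<^sup>2 = (real N)\<^sup>2 * aN N" for N
   by (simp add: aN_def power2_eq_square algebra_simps)
  ultimately show ?thesis by (simp add: la_def mult.commute)
 qed
 have ld: "(%N. real N * dN N) \<longlonglongrightarrow> ld"
 proof -
  have "(%N. (real N)\<^sup>2 * a2 N * (1 / real N) + real N * b2 N) \<longlonglongrightarrow> \<omega>\<^sup>2 / 4 * G * 0 + \<omega> * F" by (intro tendsto_add Na bl)
  then show ?thesis unfolding Na' by (simp add: dN_def ld_def algebra_simps)
 qed
 have lb1: "lb < 1" using FG by (simp add: lb_def)
 have eps: "epsN \<longlonglongrightarrow> 0"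
 proof -
  have "(%N. 3 * e1 N + 4 * e2 N + (e2 N)\<^sup>2) \<longlonglongrightarrow> 3 * 0 + 4 * 0 + 0\<^sup>2" by (intro tendsto_intros e1_e2_limits)
  then show ?thesis by (simp add: epsN_def[abs_def])
 qed
 have eta: "(%N. sqrt (real N) * etaN N) \<longlonglongrightarrow> 0"
 proof -
  have "(%N. 3 * (sqrt (real N) * e1 N) + sqrt (real N) * (e2 N)\<^sup>2) \<longlonglongrightarrow> 3 * 0 + 0" by (intro tendsto_intros e1_e2_limits)
  then show ?thesis by (simp add: etaN_def algebra_simps)
 qed
 define \<Lambda> where "\<Lambda> = max 1 (max (la + 1) (ld + 1))"
 have ev1: "eventually (%N. e1 N < 1) sequentially" using e1_e2_limits(3) by (rule order_tendstoD) simp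
 have ev2: "eventually (%N. epsN N < 1 / 2) sequentially" using eps by (rule order_tendstoD) simp
 have ev3: "eventually (%N. real N * bN N < 1) sequentially" using lb lb1 by (rule order_tendstoD)
 have ev4: "eventually (%N. (real N)\<^sup>2 * aN N < la + 1) sequentially" using la by (rule order_tendstoD) simp
 have ev5: "eventually (%N. real N * dN N < ld + 1) sequentially" using ld by (rule order_tendstoD) simp
 have "eventually (%N. usable N \<and> (real N)\<^sup>2 * aN N <= \<Lambda> \<and> real N * dN N <= \<Lambda>) sequentially"
  using eventually_good ev1 ev2 ev3 ev4 ev5 eventually_ge_at_top[of 2]
 proof eventually_elim
  case (elim N)
  then show ?case by (auto simp: usable_def \<Lambda>_def)
 qed
 then obtain N0 where N0: "\<And>N. N >= N0 ==> usable N \<and> (real N)\<^sup>2 * aN N <= \<Lambda> \<and> real N * dN N <= \<Lambda>"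
  by (auto simp: eventually_sequentially)
 have model: "null_model {1..N + N0} pair_law (zetaN (N + N0)) (betaN (N + N0)) (aN (N + N0)) (bN (N + N0)) (dN (N + N0)) (epsN (N + N0)) (etaN (N + N0)) \<Lambda>" for N
  using N0[of "N + N0"] by (intro null_model_truncated) (auto simp: \<Lambda>_def)
 have cardV: "real (card {1..N + N0}) = real (N + N0)" for N by simp
 interpret S: null_sequence "%N. {1..N + N0}" "%N. pair_law" "%N. zetaN (N + N0)" "%N. betaN (N + N0)"
  "%N. aN (N + N0)" "%N. bN (N + N0)" "%N. dN (N + N0)" "%N. epsN (N + N0)" "%N. etaN (N + N0)" \<Lambda> la lb ld
 proof (rule null_sequence.intro)
  show "filterlim (%N. real (card {1..N + N0})) at_top sequentially"
   unfolding cardV by (rule filterlim_compose[OF filterlim_real_sequentially filterlim_add_const_nat_at_top])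
  show "(%N. sqrt (real (card {1..N + N0})) * etaN (N + N0)) \<longlonglongrightarrow> 0" "(%N. real (card {1..N + N0}) * bN (N + N0)) \<longlonglongrightarrow> lb"
   "(%N. (real (card {1..N + N0}))\<^sup>2 * aN (N + N0)) \<longlonglongrightarrow> la" "(%N. real (card {1..N + N0}) * dN (N + N0)) \<longlonglongrightarrow> ld"
   "(%N. epsN (N + N0)) \<longlonglongrightarrow> 0"
   unfolding cardV using LIMSEQ_ignore_initial_segment[OF eta, of N0] LIMSEQ_ignore_initial_segment[OF lb, of N0]
    LIMSEQ_ignore_initial_segment[OF la, of N0] LIMSEQ_ignore_initial_segment[OF ld, of N0] LIMSEQ_ignore_initial_segment[OF eps, of N0] by auto
 qed (rule model lb1)+
 have eq: "(LINT t|S.MN N. min 1 (S.LRN N t)) = (LINT z|noise_matrix {1..N + N0}. min 1 (Lbar (N + N0) z))" for N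
 proof -
  interpret E: null_model "{1..N + N0}" pair_law "zetaN (N + N0)" "betaN (N + N0)" "aN (N + N0)" "bN (N + N0)" "dN (N + N0)" "epsN (N + N0)" "etaN (N + N0)" \<Lambda> 0
   by (rule model)
  show ?thesis unfolding Lbar_law S.LRN_def S.MN_def LR_eq_Lbar[OF model] E.H0.M_def E.H0.J_def ..
 qed
 have V: "S.Vlim = 2 * \<rho>"
  unfolding S.Vlim_def unfolding \<rho> la_def lb_def ld_def by (simp add: power_mult_distrib mult.assoc) (simp add: field_simps)
 have "sqrt S.Vlim / (2 * sqrt 2) = sqrt \<rho> / 2" unfolding V by (simp add: real_sqrt_mult)
 then have "(%N. (LINT z|noise_matrix {1..N + N0}. min 1 (Lbar (N + N0) z))) \<longlonglongrightarrow> erfc (sqrt \<rho> / 2)"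
  using S.risk_limit by (simp only: eq)
 then have L: "(%N. (LINT z|noise_matrix {1..N}. min 1 (Lbar N z))) \<longlonglongrightarrow> erfc (sqrt \<rho> / 2)"
  by (rule LIMSEQ_offset[where f = "%N. (LINT z|noise_matrix {1..N}. min 1 (Lbar N z))"])
 have "(%N. \<bar>(mN N / cN N) ^ (N\<^sup>2) - 1\<bar> + (real N)\<^sup>2 * tail N) \<longlonglongrightarrow> \<bar>1 - 1\<bar> + 0"
  by (intro tendsto_intros ratio_limit(3) tail_limit)
 then have e0: "(%N. \<bar>(mN N / cN N) ^ (N\<^sup>2) - 1\<bar> + (real N)\<^sup>2 * tail N) \<longlonglongrightarrow> 0" by simp
 have "(%N. (LINT z|noise_matrix {1..N}. min 1 (Lfull N z)) - (LINT z|noise_matrix {1..N}. min 1 (Lbar N z))) \<longlonglongrightarrow> 0"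
  by (rule Lim_null_comparison[OF _ e0], rule eventually_mono[OF eventually_ge_at_top[of N0]]) (use truncation_error N0 in \<open>simp only: real_norm_def\<close>)
 from tendsto_add[OF this L] show ?thesis by simp
qed

lemma shift_density:
 "density \<mu> (%z. ennreal (p (z - c) / p z)) = distr \<mu> borel ((+) c)" "prob_space (density \<mu> (%z. ennreal (p (z - c) / p z)))"
proof -
 have "density \<mu> (%z. ennreal (p (z - c) / p z)) = density lborel (%z. ennreal (p z) * ennreal (p (z - c) / p z))"
  by (rule density_density_eq) auto
 also have "(%z. ennreal (p z) * ennreal (p (z - c) / p z)) = (%z. ennreal (p (z - c)))"
 proof
  fix z
  have "0 <= p z" "0 <= p (z - c) / p z" "p z * (p (z - c) / p z) = p (z - c)" using p_pos[of z] p_pos[of "z - c"] by auto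
  then show "ennreal (p z) * ennreal (p (z - c) / p z) = ennreal (p (z - c))" by (simp only: ennreal_mult[symmetric])
 qed
 finally have 1: "density \<mu> (%z. ennreal (p (z - c) / p z)) = density lborel (%z. ennreal (p (z - c)))" .
 have "density (distr lborel borel ((+) c)) (%z. ennreal (p (z - c))) = distr (density lborel (%x. ennreal (p (c + x - c)))) borel ((+) c)"
  by (rule density_distr) auto
 then have 2: "density lborel (%z. ennreal (p (z - c))) = distr \<mu> borel ((+) c)" by (simp add: lborel_distr_plus)
 show eq: "density \<mu> (%z. ennreal (p (z - c) / p z)) = distr \<mu> borel ((+) c)" by (simp only: 1 2)
 show "prob_space (density \<mu> (%z. ennreal (p (z - c) / p z)))" unfolding eq by (intro P.prob_space_distr) simp
qed

definition "shift_ratio N c z = (\<Prod>ij\<in>{1..N} \<times> {1..N}. p (z ij - c ij) / p (z ij))" for c z :: "nat \<times> nat => real"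

text \<open>Adding a deterministic matrix to the noise multiplies its density by a product of ratios of one-dimensional densities.\<close>
lemma shifted_noise_prob:
 fixes X :: "nat => nat => 'a => real"
 assumes M: "prob_space M" and N: "N >= 1"
  and ind: "prob_space.indep_vars M (%_. borel) (%(i, j). X i j) ({1..N} \<times> {1..N})"
  and dens: "\<And>i j. i \<in> {1..N} ==> j \<in> {1..N} ==> distributed M lborel (%w. sqrt (real N) * X i j w) (%t. ennreal (p t))"
  and A: "A \<in> sets (PiM ({1..N} \<times> {1..N}) (%_. borel))"
 shows "measure M {w \<in> space M. (\<lambda>ij\<in>{1..N} \<times> {1..N}. sqrt (real N) * X (fst ij) (snd ij) w + c ij) \<in> A}
   = (LINT z|noise_matrix {1..N}. shift_ratio N c z * indicator A z)" (is ?eq)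
  and "integrable (noise_matrix {1..N}) (%z. shift_ratio N c z * indicator A z)" (is ?int)
proof -
 interpret M: prob_space M by (rule M)
 define V where "V = {1..N}"
 let ?I = "V \<times> V"
 let ?Q = "noise_matrix V" and ?R = "shift_ratio N c"
 let ?D = "%ij z. ennreal (p (z - c ij) / p z)"
 define Z where "Z ij w = sqrt (real N) * X (fst ij) (snd ij) w + c ij" for ij w
 have X: "X i j \<in> borel_measurable M" if "i \<in> V" "j \<in> V" for i j
  using ind that unfolding M.indep_vars_def V_def by auto
 have ind': "M.indep_vars (%_. borel) Z ?I"
 proof -
  have "M.indep_vars (%_. borel) (%ij w. sqrt (real N) * (case ij of (i, j) => X i j) w + c ij) ?I"
   unfolding V_def by (rule M.indep_vars_compose2[OF ind]) auto
  then show ?thesis by (simp add: Z_def[abs_def] case_prod_beta)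
 qed
 have Zm: "Z ij \<in> borel_measurable M" if "ij \<in> ?I" for ij
  using X that unfolding Z_def[abs_def] by auto
 have law1: "distr M borel (Z ij) = density \<mu> (?D ij)" if ij: "ij \<in> ?I" for ij
 proof -
  have m: "(%w. sqrt (real N) * X (fst ij) (snd ij) w) \<in> borel_measurable M" using X ij by auto
  have d: "distr M lborel (%w. sqrt (real N) * X (fst ij) (snd ij) w) = \<mu>"
   using distributed_distr_eq_density[OF dens[of "fst ij" "snd ij"]] ij by (auto simp: V_def)
  have "distr M borel (%w. sqrt (real N) * X (fst ij) (snd ij) w) = \<mu>"
   unfolding d[symmetric] by (rule distr_cong) auto
  then have "distr \<mu> borel ((+) (c ij)) = distr (distr M borel (%w. sqrt (real N) * X (fst ij) (snd ij) w)) borel ((+) (c ij))" by simp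
  also have "... = distr M borel ((+) (c ij) \<circ> (%w. sqrt (real N) * X (fst ij) (snd ij) w))"
   using m by (intro distr_distr) auto
  also have "(+) (c ij) \<circ> (%w. sqrt (real N) * X (fst ij) (snd ij) w) = Z ij" by (auto simp: Z_def)
  finally show ?thesis by (simp only: shift_density(1))
 qed
 have ne: "?I \<noteq> {}" using N by (auto simp: V_def)
 have finI: "finite ?I" by (simp add: V_def)
 have "distr M (PiM ?I (%_. borel)) (%w. \<lambda>ij\<in>?I. Z ij w) = PiM ?I (%ij. distr M borel (Z ij))"
  using M.indep_vars_iff_distr_eq_PiM'[OF ne, of Z "%_. borel"] Zm ind' by blast
 also have "... = PiM ?I (%ij. density \<mu> (?D ij))" using law1 by (intro PiM_cong) auto
 also have "... = density (PiM ?I (%_. \<mu>)) (%z. \<Prod>ij\<in>?I. ?D ij (z ij))"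
  by (rule density_PiM[symmetric, OF finI prob]) (use shift_density(2) in auto)
 also have "(%z. \<Prod>ij\<in>?I. ?D ij (z ij)) = (%z. ennreal (?R z))"
  unfolding shift_ratio_def V_def using less_imp_le[OF p_pos] by (intro ext prod_ennreal) (auto intro: divide_nonneg_nonneg)
 finally have law: "distr M (PiM ?I (%_. borel)) (%w. \<lambda>ij\<in>?I. Z ij w) = density ?Q (%z. ennreal (?R z))"
  by (simp only: noise_matrix_def)
 have sQ: "sets ?Q = sets (PiM ?I (%_. borel))" unfolding noise_matrix_def by (intro sets_PiM_cong) auto
 have Zv: "(%w. \<lambda>ij\<in>?I. Z ij w) \<in> measurable M (PiM ?I (%_. borel))" by (rule measurable_restrict[OF Zm])
 have AQ: "A \<in> sets ?Q" using A unfolding sQ by (simp only: V_def)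
 have R0: "0 <= ?R z" for z unfolding shift_ratio_def using less_imp_le[OF p_pos] by (intro prod_nonneg) (auto intro: divide_nonneg_nonneg)
 have Rm: "?R \<in> borel_measurable ?Q" unfolding shift_ratio_def[abs_def]
 proof (rule borel_measurable_prod)
  fix ij assume "ij \<in> {1..N} \<times> {1..N}"
  then have "(%z. z ij) \<in> measurable ?Q \<mu>" unfolding noise_matrix_def V_def by (rule measurable_component_singleton)
  then have [measurable]: "(%z. z ij) \<in> borel_measurable ?Q" by simp
  show "(%z. p (z ij - c ij) / p (z ij)) \<in> borel_measurable ?Q" by measurable
 qed
 interpret D: prob_space "density ?Q (%z. ennreal (?R z))"
  unfolding law[symmetric] by (rule M.prob_space_distr[OF Zv])
 have im: "(indicator A :: _ => real) \<in> borel_measurable ?Q" using AQ by (rule borel_measurable_indicator)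
 have "integrable (density ?Q (%z. ennreal (?R z))) (indicator A :: _ => real)"
  using AQ by (intro D.integrable_const_bound[where B = 1]) auto
 then show ?int using integrable_density[OF im Rm] R0 by (simp add: V_def)
 have "(%w. \<lambda>ij\<in>?I. Z ij w) -` A \<inter> space M = {w \<in> space M. (\<lambda>ij\<in>?I. Z ij w) \<in> A}" by auto
 then have "measure M {w \<in> space M. (\<lambda>ij\<in>?I. Z ij w) \<in> A} = measure (distr M (PiM ?I (%_. borel)) (%w. \<lambda>ij\<in>?I. Z ij w)) A"
  using Zv A by (simp add: measure_distr V_def)
 also have "... = (LINT z|density ?Q (%z. ennreal (?R z)). indicator A z)" unfolding law using AQ by simp
 also have "... = (LINT z|?Q. ?R z * indicator A z)" using integral_density[OF im Rm] R0 by simp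
 finally show ?eq by (simp only: Z_def V_def)
qed

lemma likelihood_ratio_eq_Lfull:
 assumes N: "N >= 1"
 shows "likelihood_ratio p N \<omega> Y = Lfull N (\<lambda>ij\<in>{1..N} \<times> {1..N}. sqrt (real N) * Y (fst ij) (snd ij))"
proof -
 define r where "r = sqrt (real N)"
 have r: "r > 0" using N by (simp add: r_def)
 have h: "sqrt (\<omega> * real N) = sqrt \<omega> * r" "hN N = sqrt \<omega> / r" by (simp_all add: r_def hN_def real_sqrt_mult real_sqrt_divide)
 let ?V = "{1..N}"
 let ?z = "\<lambda>ij\<in>?V \<times> ?V. r * Y (fst ij) (snd ij)"
 have "(\<Sum>x\<in>?V \<rightarrow>\<^sub>E {1 / r, - 1 / r}. \<Prod>i\<in>?V. \<Prod>j\<in>?V. p (r * Y i j - sqrt (\<omega> * real N) * x i * x j) / p (r * Y i j))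
   = (\<Sum>s\<in>?V \<rightarrow>\<^sub>E {1, -1}. \<Prod>i\<in>?V. \<Prod>j\<in>?V. p (?z (i, j) - s i * s j * hN N) / p (?z (i, j)))"
 proof (rule sum.reindex_bij_witness[of _ "%s. \<lambda>i\<in>?V. s i / r" "%x. \<lambda>i\<in>?V. r * x i"])
  fix x assume x: "x \<in> ?V \<rightarrow>\<^sub>E {1 / r, - 1 / r}"
  show "(\<lambda>i\<in>?V. (\<lambda>i\<in>?V. r * x i) i / r) = x"
  proof
   fix i show "(\<lambda>i\<in>?V. (\<lambda>i\<in>?V. r * x i) i / r) i = x i"
    using x r by (cases "i \<in> ?V") (auto simp: PiE_def extensional_def)
  qed
  show "(\<lambda>i\<in>?V. r * x i) \<in> ?V \<rightarrow>\<^sub>E {1, -1}"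
  proof (rule restrict_PiE_iff[THEN iffD2], rule ballI)
   fix i assume "i \<in> ?V"
   then have "x i = 1 / r \<or> x i = - 1 / r" using x by (auto simp: PiE_def Pi_def)
   then show "r * x i \<in> {1, - 1}" using r by auto
  qed
  show "(\<Prod>i\<in>?V. \<Prod>j\<in>?V. p (?z (i, j) - (\<lambda>i\<in>?V. r * x i) i * (\<lambda>i\<in>?V. r * x i) j * hN N) / p (?z (i, j))) =
   (\<Prod>i\<in>?V. \<Prod>j\<in>?V. p (r * Y i j - sqrt (\<omega> * real N) * x i * x j) / p (r * Y i j))"
  proof (intro prod.cong refl)
   fix i j assume ij: "i \<in> ?V" "j \<in> ?V"
   have "r * x i * (r * x j) * hN N = sqrt (\<omega> * real N) * x i * x j" unfolding h using r by (simp add: field_simps)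
   then have "(\<lambda>i\<in>?V. r * x i) i * (\<lambda>i\<in>?V. r * x i) j * hN N = sqrt (\<omega> * real N) * x i * x j" using ij by (simp only: restrict_apply' )
   moreover have "?z (i, j) = r * Y i j" using ij by simp
   ultimately show "p (?z (i, j) - (\<lambda>i\<in>?V. r * x i) i * (\<lambda>i\<in>?V. r * x i) j * hN N) / p (?z (i, j)) =
    p (r * Y i j - sqrt (\<omega> * real N) * x i * x j) / p (r * Y i j)" by (simp only:)
  qed
 next
  fix s assume s: "s \<in> ?V \<rightarrow>\<^sub>E {1, -1 :: real}"
  show "(\<lambda>i\<in>?V. r * (\<lambda>i\<in>?V. s i / r) i) = s"
  proof
   fix i show "(\<lambda>i\<in>?V. r * (\<lambda>i\<in>?V. s i / r) i) i = s i"
    using s r by (cases "i \<in> ?V") (auto simp: PiE_def extensional_def)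
  qed
  show "(\<lambda>i\<in>?V. s i / r) \<in> ?V \<rightarrow>\<^sub>E {1 / r, - 1 / r}"
  proof (rule restrict_PiE_iff[THEN iffD2], rule ballI)
   fix i assume "i \<in> ?V"
   then show "s i / r \<in> {1 / r, - 1 / r}" using sign_cases[OF s, of i] by auto
  qed
 qed
 then show ?thesis unfolding likelihood_ratio_def Lfull_def r_def[symmetric] by (simp only: times_divide_eq_left mult_1_left)
qed

text \<open>Conditioning on the spike, the error under the alternative is the null expectation of the likelihood ratio restricted to the acceptance
region. Adding the null probability of the rejection region, where the ratio exceeds 1, gives the minimum.\<close>
lemma lr_test_error_eq:
 fixes M :: "nat => 'a measure"
 assumes N: "N >= 1" and iid: "iid_matrices p M X" and rad: "rademacher_spikes M x" and spn: "spike_indep_noise M X x"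
 shows "lr_test_error p M X x \<omega> N = (LINT z|noise_matrix {1..N}. min 1 (Lfull N z))"
proof -
 define V where "V = {1..N}"
 let ?I = "V \<times> V"
 define r where "r = sqrt (real N)"
 have r: "r > 0" using N by (simp add: r_def)
 have NV: "N \<in> {1..}" using N by simp
 have MN: "prob_space (M N)" and ind: "prob_space.indep_vars (M N) (%_. borel) (%(i, j). X N i j) ({1..N} \<times> {1..N})"
  and dens: "\<And>i j. i \<in> {1..N} ==> j \<in> {1..N} ==> distributed (M N) lborel (%w. sqrt (real N) * X N i j w) (%t. ennreal (p t))"
  using iid N unfolding iid_matrices_def by blast+
 interpret M: prob_space "M N" by (rule MN)
 have indx: "M.indep_vars (%_. borel) (x N) V"
  and half: "\<And>i. i \<in> V ==> M.prob {w \<in> space (M N). r * x N i w = 1} = 1 / 2"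
   "\<And>i. i \<in> V ==> M.prob {w \<in> space (M N). r * x N i w = - 1} = 1 / 2"
  using rad N unfolding rademacher_spikes_def V_def r_def by blast+
 have xm: "x N i \<in> borel_measurable (M N)" if "i \<in> V" for i using indx that unfolding M.indep_vars_def by auto
 have Xm: "X N i j \<in> borel_measurable (M N)" if "i \<in> V" "j \<in> V" for i j
  using ind that unfolding M.indep_vars_def V_def by auto
 let ?Q = "noise_matrix V" and ?Pb = "PiM ?I (%_. borel) :: (nat \<times> nat => real) measure"
 have sQ: "sets ?Q = sets ?Pb" unfolding noise_matrix_def by (intro sets_PiM_cong) auto
 have spQ: "space ?Q = space ?Pb" by (rule sets_eq_imp_space_eq[OF sQ])
 have Lm: "Lfull N \<in> borel_measurable ?Pb" using measurable_Lbar(2)[of N] unfolding V_def[symmetric] measurable_cong_sets[OF sQ refl] .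
 define E1 where "E1 = {z \<in> space ?Pb. Lfull N z > 1}"
 define E0 where "E0 = {z \<in> space ?Pb. \<not> Lfull N z > 1}"
 have E: "E1 \<in> sets ?Pb" "E0 \<in> sets ?Pb" using Lm unfolding E1_def E0_def by measurable
 define T where "T c w = (\<lambda>ij\<in>?I. r * X N (fst ij) (snd ij) w + c ij)" for c w
 have Tsp: "T c w \<in> space ?Pb" for c w by (simp add: T_def space_PiM)
 have sp: "A \<in> sets ?Pb ==> M.prob {w \<in> space (M N). T c w \<in> A} = (LINT z|?Q. shift_ratio N c z * indicator A z)"
  "A \<in> sets ?Pb ==> integrable ?Q (%z. shift_ratio N c z * indicator A z)" for A c
  unfolding T_def V_def r_def by (rule shifted_noise_prob[OF MN N ind dens]; assumption)+
 define c where "c s ij = s (fst ij) * s (snd ij) * hN N" for s :: "nat => real" and ij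
 let ?S = "V \<rightarrow>\<^sub>E {1, -1 :: real}"
 have finS: "finite ?S" by (intro finite_PiE) (auto simp: V_def)
 let ?Y = "%l w. data_matrix l (%i j. X N i j w) (%i. x N i w)"
 define Z where "Z l w = (\<lambda>ij\<in>?I. r * ?Y l w (fst ij) (snd ij))" for l w
 have lr: "likelihood_ratio p N \<omega> (?Y l w) = Lfull N (Z l w)" for l w
  unfolding likelihood_ratio_eq_Lfull[OF N] Z_def V_def r_def ..
 have Zsp: "Z l w \<in> space ?Pb" for l w by (simp add: Z_def space_PiM)
 have Zm: "Z l \<in> measurable (M N) ?Pb" for l
  unfolding Z_def[abs_def] data_matrix_def
  by (intro measurable_restrict borel_measurable_times borel_measurable_add borel_measurable_const xm Xm) auto
 have "{w \<in> space (M N). likelihood_ratio p N \<omega> (?Y 0 w) > 1} = {w \<in> space (M N). T (%_. 0) w \<in> E1}"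
 proof -
  have "Z 0 w = T (%_. 0) w" for w by (simp add: Z_def T_def data_matrix_def)
  then show ?thesis unfolding lr E1_def using Tsp by simp
 qed
 then have part0: "M.prob {w \<in> space (M N). likelihood_ratio p N \<omega> (?Y 0 w) > 1} = (LINT z|?Q. indicator E1 z)"
  using sp(1)[OF E(1), of "%_. 0"] p_pos by (simp add: shift_ratio_def less_imp_neq[OF p_pos, symmetric])
 have i1: "integrable ?Q (indicator E1 :: _ => real)"
  using sp(2)[OF E(1), of "%_. 0"] by (simp add: shift_ratio_def less_imp_neq[OF p_pos, symmetric])
 define As where "As s = {w \<in> space (M N). \<forall>i\<in>V. r * x N i w = s i}" for s
 define Bs where "Bs s = {w \<in> space (M N). T (c s) w \<in> E0}" for s
 define Bad where "Bad = {w \<in> space (M N). \<not> likelihood_ratio p N \<omega> (?Y \<omega> w) > 1}"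
 have AsE: "As s = (%w. \<lambda>i\<in>V. x N i w) -` (Pi\<^sub>E V (%i. {s i / r})) \<inter> space (M N)" for s
  unfolding As_def using r by (auto simp: PiE_def Pi_def field_simps)
 have As_vim: "As s \<in> sets (vimage_algebra (space (M N)) (%w. \<lambda>i\<in>V. x N i w) (PiM V (%_. borel)))" for s
  unfolding AsE by (rule in_vimage_algebra, rule sets_PiM_I_finite) (auto simp: V_def)
 have Bs_vim: "Bs s \<in> sets (vimage_algebra (space (M N)) (%w. \<lambda>(i, j)\<in>?I. X N i j w) ?Pb)" for s
 proof -
  let ?m = "%y. \<lambda>ij\<in>?I. r * y ij + c s ij"
  have "?m \<in> measurable ?Pb ?Pb"
   by (intro measurable_restrict borel_measurable_add borel_measurable_times borel_measurable_const measurable_component_singleton)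
  then have "?m -` E0 \<inter> space ?Pb \<in> sets ?Pb" using E(2) by (rule measurable_sets)
  moreover have "Bs s = (%w. \<lambda>(i, j)\<in>?I. X N i j w) -` (?m -` E0 \<inter> space ?Pb) \<inter> space (M N)"
  proof -
   have "?m (\<lambda>(i, j)\<in>?I. X N i j w) = T (c s) w" for w by (auto simp: T_def fun_eq_iff)
   moreover have "(\<lambda>(i, j)\<in>?I. X N i j w) \<in> space ?Pb" for w by (simp add: space_PiM)
   ultimately show ?thesis by (auto simp: Bs_def)
  qed
  ultimately show ?thesis by (simp only: in_vimage_algebra)
 qed
 have indep: "M.indep_set (sets (vimage_algebra (space (M N)) (%w. \<lambda>(i, j)\<in>?I. X N i j w) ?Pb))
   (sets (vimage_algebra (space (M N)) (%w. \<lambda>i\<in>V. x N i w) (PiM V (%_. borel))))"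
  using spn N unfolding spike_indep_noise_def V_def by blast
 have As_ev: "As s \<in> M.events" for s using M.indep_setD_ev2[OF indep] As_vim by blast
 have Bs_ev: "Bs s \<in> M.events" for s using M.indep_setD_ev1[OF indep] Bs_vim by blast
 have As_prob: "M.prob (As s) = 1 / 2 ^ N" if s: "s \<in> ?S" for s
 proof -
  have ne: "V \<noteq> {}" using N by (auto simp: V_def)
  have "As s = (\<Inter>i\<in>V. x N i -` {s i / r} \<inter> space (M N))" unfolding As_def using r ne by (auto simp: field_simps)
  then have "M.prob (As s) = (\<Prod>i\<in>V. M.prob (x N i -` {s i / r} \<inter> space (M N)))"
   using M.indep_varsD[OF indx ne, of "%i. {s i / r}"] by (simp add: V_def)
  also have "... = (\<Prod>i\<in>V. 1 / 2)"
  proof (rule prod.cong[OF refl])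
   fix i assume i: "i \<in> V"
   have "x N i -` {s i / r} \<inter> space (M N) = {w \<in> space (M N). r * x N i w = s i}" using r by (auto simp: field_simps)
   then show "M.prob (x N i -` {s i / r} \<inter> space (M N)) = 1 / 2" using sign_cases[OF s i] half[OF i] by auto
  qed
  finally show ?thesis by (simp add: V_def power_divide)
 qed
 have disj: "disjoint_family_on As ?S"
 proof -
  have "s = s'" if "s \<in> ?S" "s' \<in> ?S" "w \<in> As s" "w \<in> As s'" for s s' w
  proof (rule PiE_ext[OF that(1,2)])
   fix i assume "i \<in> V" then show "s i = s' i" using that(3,4) unfolding As_def by auto
  qed
  then show ?thesis unfolding disjoint_family_on_def by blast
 qed
 have cardS: "card ?S = 2 ^ N" by (simp add: card_PiE V_def numeral_2_eq_2)
 have "M.prob (\<Union>s\<in>?S. As s) = (\<Sum>s\<in>?S. M.prob (As s))"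
  using As_ev disj by (intro M.finite_measure_finite_Union finS) auto
 also have "... = 1" using As_prob by (simp add: cardS)
 finally have U1: "M.prob (\<Union>s\<in>?S. As s) = 1" .
 have U_ev: "(\<Union>s\<in>?S. As s) \<in> M.events" using As_ev finS by auto
 have Bad_eq: "Bad = Z \<omega> -` E0 \<inter> space (M N)" unfolding Bad_def lr E0_def using Zsp by auto
 have Bad_ev: "Bad \<in> M.events" unfolding Bad_eq using Zm E(2) by (rule measurable_sets)
 have AB: "As s \<inter> Bad = Bs s \<inter> As s" for s
 proof -
  have "Z \<omega> w = T (c s) w" if "w \<in> As s" for w
  proof (rule ext)
   fix ij
   show "Z \<omega> w ij = T (c s) w ij"
   proof (cases "ij \<in> ?I")
    case True
    then have s: "s (fst ij) = r * x N (fst ij) w" "s (snd ij) = r * x N (snd ij) w" using that by (auto simp: As_def)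
    have h: "hN N = sqrt \<omega> / r" by (simp add: r_def hN_def real_sqrt_divide)
    have "c s ij = r * (sqrt \<omega> * (x N (fst ij) w * x N (snd ij) w))" unfolding c_def s h using r by (simp add: field_simps)
    then show ?thesis using True by (simp add: Z_def T_def data_matrix_def distrib_left)
   qed (simp add: Z_def T_def)
  qed
  then show ?thesis unfolding Bad_eq Bs_def by (auto simp: As_def)
 qed
 have "AE w in M N. w \<in> (\<Union>s\<in>?S. As s)" using U1 M.prob_eq_1[OF U_ev] by simp
 then have AE_iff: "AE w in M N. w \<in> Bad \<longleftrightarrow> w \<in> (\<Union>s\<in>?S. As s \<inter> Bad)" by (auto elim!: eventually_mono)
 have "(\<Union>s\<in>?S. As s \<inter> Bad) \<in> M.events" by (intro sets.finite_UN finS sets.Int As_ev Bad_ev)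
 with AE_iff Bad_ev have "M.prob Bad = M.prob (\<Union>s\<in>?S. As s \<inter> Bad)" by (rule M.finite_measure_eq_AE)
 also have "... = (\<Sum>s\<in>?S. M.prob (As s \<inter> Bad))"
  using As_ev Bad_ev disj by (intro M.finite_measure_finite_Union finS) (auto simp: disjoint_family_on_def)
 also have "... = (\<Sum>s\<in>?S. (1 / 2 ^ N) * (LINT z|?Q. shift_ratio N (c s) z * indicator E0 z))"
 proof (rule sum.cong[OF refl])
  fix s assume s: "s \<in> ?S"
  have "M.prob (As s \<inter> Bad) = M.prob (Bs s) * M.prob (As s)" unfolding AB by (rule M.indep_setD[OF indep Bs_vim As_vim])
  then show "M.prob (As s \<inter> Bad) = (1 / 2 ^ N) * (LINT z|?Q. shift_ratio N (c s) z * indicator E0 z)"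
   unfolding As_prob[OF s] Bs_def sp(1)[OF E(2)] by simp
 qed
 also have "... = (LINT z|?Q. (\<Sum>s\<in>?S. (1 / 2 ^ N) * (shift_ratio N (c s) z * indicator E0 z)))"
  using sp(2)[OF E(2)] by simp
 also have "... = (LINT z|?Q. Lfull N z * indicator E0 z)"
 proof (intro Bochner_Integration.integral_cong refl)
  fix z
  have "Lfull N z = (\<Sum>s\<in>?S. shift_ratio N (c s) z) / 2 ^ N"
   unfolding Lfull_def shift_ratio_def c_def V_def by (simp add: prod.cartesian_product case_prod_beta)
  then show "(\<Sum>s\<in>?S. (1 / 2 ^ N) * (shift_ratio N (c s) z * indicator E0 z)) = Lfull N z * indicator E0 z"
   by (simp add: sum_distrib_right sum_divide_distrib)
 qed
 finally have part1: "M.prob Bad = (LINT z|?Q. Lfull N z * indicator E0 z)" .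
 have i0: "integrable ?Q (%z. Lfull N z * indicator E0 z)"
 proof -
  have "integrable ?Q (%z. \<Sum>s\<in>?S. (1 / 2 ^ N) * (shift_ratio N (c s) z * indicator E0 z))"
   using sp(2)[OF E(2)] by (intro Bochner_Integration.integrable_sum integrable_mult_right)
  moreover have "(\<Sum>s\<in>?S. (1 / 2 ^ N) * (shift_ratio N (c s) z * indicator E0 z)) = Lfull N z * indicator E0 z" for z
   unfolding Lfull_def shift_ratio_def c_def V_def
   by (simp add: prod.cartesian_product case_prod_beta sum_distrib_right sum_divide_distrib)
  ultimately show ?thesis by simp
 qed
 have "lr_test_error p M X x \<omega> N = (LINT z|?Q. indicator E1 z) + (LINT z|?Q. Lfull N z * indicator E0 z)"
  unfolding lr_test_error_def Let_def part0 part1[unfolded Bad_def] ..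
 also have "... = (LINT z|?Q. indicator E1 z + Lfull N z * indicator E0 z)" using i1 i0 by simp
 also have "... = (LINT z|?Q. min 1 (Lfull N z))"
  by (intro Bochner_Integration.integral_cong refl) (auto simp: spQ E1_def E0_def min_def indicator_def)
 finally show ?thesis by (simp only: V_def)
qed

end

text \<open>The case \<open>N = 1\<close> of the hypotheses on the matrices already contains all moments of the density.\<close>
lemma iid_matrices_noise_density:
 assumes adm: "admissible_density p" and iid: "iid_matrices p M X" and om: "\<omega> > 0"
 shows "noise_density p \<omega>"
proof -
 have M1: "prob_space (M 1)" and d: "distributed (M 1) lborel (%w. sqrt (real 1) * X 1 1 1 w) (%t. ennreal (p t))"
  using iid[unfolded iid_matrices_def, THEN conjunct1, rule_format, of 1] by auto
 interpret M: prob_space "M 1" by (rule M1)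
 have m: "X 1 1 1 \<in> borel_measurable (M 1)" and law: "distr (M 1) lborel (X 1 1 1) = density lborel p"
  using distributed_distr_eq_density[OF d] distributed_measurable[OF d] by auto
 have prob: "prob_space (density lborel p)" unfolding law[symmetric] using m by (intro M.prob_space_distr) simp
 have mom: "integrable (density lborel p) (%z. \<bar>z\<bar> ^ k)" for k :: nat
 proof (cases "k = 0")
  case True
  interpret prob_space "density lborel p" by (rule prob)
  show ?thesis using True by simp
 next
  case False
  then have "real k > 0" by simp
  then obtain C where C: "\<forall>N\<ge>1. \<forall>i\<in>{1..N}. \<forall>j\<in>{1..N}. integrable (M N) (%w. \<bar>X N i j w\<bar> powr real k) \<and>
    real N powr (real k / 2) * prob_space.expectation (M N) (%w. \<bar>X N i j w\<bar> powr real k) <= C"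
   using iid unfolding iid_matrices_def by blast
  have "integrable (M 1) (%w. \<bar>X 1 1 1 w\<bar> powr real k)"
   using C[rule_format, of 1 1 1] by simp
  moreover have "\<bar>y\<bar> powr real k = \<bar>y\<bar> ^ k" for y :: real
   using False by (cases "y = 0") (auto simp: powr_realpow)
  ultimately have "integrable (M 1) (%w. \<bar>X 1 1 1 w\<bar> ^ k)" by simp
  then show ?thesis unfolding law[symmetric] using m by (subst integrable_distr_eq) auto
 qed
 show ?thesis by (rule noise_density.intro[OF adm prob mom om])
qed

theorem corollary2p9:
  fixes p :: "real \<Rightarrow> real"
    and M :: "nat \<Rightarrow> 'a measure"
    and X :: "nat \<Rightarrow> nat \<Rightarrow> nat \<Rightarrow> 'a \<Rightarrow> real"
    and x :: "nat \<Rightarrow> nat \<Rightarrow> 'a \<Rightarrow> real"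
    and F G \<omega> \<rho> :: real
  assumes "admissible_density p"
    and "iid_matrices p M X"
    and "rademacher_spikes M x"
    and "spike_indep_noise M X x"
    and "F = (LBINT t. (deriv p t)\<^sup>2 / p t)"
    and "G = (LBINT t. ((deriv ^^ 2) p t)\<^sup>2 / p t)"
    and "\<omega> > 0"
    and "2 * \<omega> * F < 1"
    and "\<rho> = - (1 / 4) * (ln (1 - 2 * \<omega> * F) + \<omega>\<^sup>2 / 2 * (2 * F\<^sup>2 - G))"
  shows "(\<lambda>N. lr_test_error p M X x \<omega> N) \<longlonglongrightarrow> erfc (sqrt \<rho> / 2)"
proof -
 interpret nd: noise_density p \<omega> by (rule iid_matrices_noise_density[OF assms(1,2,7)])
 obtain D R where DR: "1 <= D" "1 <= R" "\<And>y. \<bar>deriv p y\<bar> <= D * (1 + \<bar>y\<bar>) ^ R * p y" "\<And>y. \<bar>(deriv ^^ 2) p y\<bar> <= D * (1 + \<bar>y\<bar>) ^ R * p y"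
  by (rule nd.log_derivative_bound) blast
 interpret nb: noise_density_bound p \<omega> D R
  by (intro noise_density_bound.intro nd.noise_density_axioms noise_density_bound_axioms.intro) (rule DR)+
 have "eventually (%N. (LINT z|nd.noise_matrix {1..N}. min 1 (nb.Lfull N z)) = lr_test_error p M X x \<omega> N) sequentially"
  using eventually_ge_at_top[of 1] by eventually_elim (rule nb.lr_test_error_eq[OF _ assms(2-4), symmetric])
 then show ?thesis using nb.model_risk_limit[OF assms(5,6,8,9)] by (rule Lim_transform_eventually[rotated])
qed

end
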